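(* Let $K$ be a field of characteristic $0$ and let $p,q,m\ge 1$ be integers. Then the invariant ring $K[\mathrm{Mat}_{p,q}^m]^{\mathrm{SL}_p\times\mathrm{SL}_q}$ is generated as a $K$-algebra by invariants of degree $\le (pq\,\mathrm{lcm}(p,q))^2$.
   Context: $\mathrm{Mat}_{p,q}$ is the space of $p\times q$ matrices over $K$. The group $\mathrm{SL}_p\times\mathrm{SL}_q$ acts on $\mathrm{Mat}_{p,q}^m$ by $(A,B)\cdot(X_1,\dots,X_m)=(AX_1B^{-1},\dots,AX_mB^{-1})$, and $K[\mathrm{Mat}_{p,q}^m]^{\mathrm{SL}_p\times\mathrm{SL}_q}$ is the ring of invariant polynomial functions, graded by polynomial degree. *)

theory Defs
  imports "HOL-Analysis.Analysis"
begin

text \<open>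
  The space of \<open>m\<close>-tuples of \<open>p \<times> q\<close> matrices over \<open>'k\<close> is the type
  \<open>'k ^ 'q ^ 'p ^ 'm\<close> with \<open>p = CARD('p)\<close>, \<open>q = CARD('q)\<close>, \<open>m = CARD('m)\<close>; the entry \<open>(i, j)\<close>
  of the \<open>l\<close>-th matrix of \<open>X\<close> is \<open>X $ l $ i $ j\<close>.
\<close>

definition special_linear :: "('k::comm_ring_1 ^ 'n ^ 'n) set" where
  "special_linear = {A. det A = 1}"

definition left_right_action ::
  "'k::field ^ 'p ^ 'p \<Rightarrow> 'k ^ 'q ^ 'q \<Rightarrow> 'k ^ 'q ^ 'p ^ 'm \<Rightarrow> 'k ^ 'q ^ 'p ^ 'm" where
  "left_right_action A B X = (\<chi> l. A ** (X $ l) ** matrix_inv B)"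

definition monomial_fun ::
  "('m \<times> 'p \<times> 'q \<Rightarrow> nat) \<Rightarrow> 'k::field ^ 'q::finite ^ 'p::finite ^ 'm::finite \<Rightarrow> 'k" where
  "monomial_fun e X = (\<Prod>(l, i, j)\<in>UNIV. (X $ l $ i $ j) ^ e (l, i, j))"

definition poly_fun_le ::
  "nat \<Rightarrow> ('k::field ^ 'q::finite ^ 'p::finite ^ 'm::finite \<Rightarrow> 'k) \<Rightarrow> bool" where
  "poly_fun_le d f \<longleftrightarrow>
    (\<exists>E c. finite E \<and> (\<forall>e\<in>E. sum e UNIV \<le> d) \<and> f = (\<lambda>X. \<Sum>e\<in>E. c e * monomial_fun e X))"

definition poly_fun :: "('k::field ^ 'q::finite ^ 'p::finite ^ 'm::finite \<Rightarrow> 'k) \<Rightarrow> bool" where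
  "poly_fun f \<longleftrightarrow> (\<exists>d. poly_fun_le d f)"

text \<open>
  Over an infinite field a polynomial function comes from a unique polynomial, and the following
  is the total degree of that polynomial, except that the zero function gets degree 0. It is
  meaningful only for polynomial functions.
\<close>

definition poly_fun_degree :: "('k::field ^ 'q::finite ^ 'p::finite ^ 'm::finite \<Rightarrow> 'k) \<Rightarrow> nat" where
  "poly_fun_degree f = (LEAST d. poly_fun_le d f)"

definition invariant_ring :: "('k::field ^ 'q::finite ^ 'p::finite ^ 'm::finite \<Rightarrow> 'k) set" where
  "invariant_ring = {f. poly_fun f \<and>
    (\<forall>A\<in>special_linear. \<forall>B\<in>special_linear. \<forall>X. f (left_right_action A B X) = f X)}"

text \<open>
  Closure under scalar multiples and negation follows from the constants and products.
\<close>

definition fun_subalgebra :: "('x \<Rightarrow> 'k::field) set \<Rightarrow> bool" where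
  "fun_subalgebra R \<longleftrightarrow>
    (\<forall>c. (\<lambda>x. c) \<in> R) \<and>
    (\<forall>f\<in>R. \<forall>g\<in>R. (\<lambda>x. f x + g x) \<in> R) \<and>
    (\<forall>f\<in>R. \<forall>g\<in>R. (\<lambda>x. f x * g x) \<in> R)"

definition generated_algebra :: "('x \<Rightarrow> 'k::field) set \<Rightarrow> ('x \<Rightarrow> 'k) set" where
  "generated_algebra G = fun_subalgebra hull G"

end

theory Submission
  imports Defs "HOL-Library.Poly_Mapping" "HOL-Library.Function_Algebras"
    "HOL-Computational_Algebra.Computational_Algebra" "HOL-Number_Theory.Cong"
    "Jordan_Normal_Form.Char_Poly"
begin

no_notation Matrix.vec_index (infixl "$" 100)

text \<open>
  Rational coefficients suffice, since an invariant over a field of characteristic zero is a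
  combination of rational invariants, and by Weyl's polarization theorem one may take
  \<open>pq\<close> matrices, so that there are \<open>n = (pq)\<^sup>2\<close> variables. Let \<open>L = lcm p q\<close>.

  The invariants of degree \<open>L\<^sup>2\<close> cut out the null cone. If an invariant does not vanish at \<open>X\<close>, pairing
  its semi-invariance with powers of the determinant produces a nonsingular blow-up \<open>\<Sum>l. X l \<otimes> T l\<close> with
  \<open>k \<ge> L\<close> blocks of size \<open>L\<close>. Removing a block row and a suitable block column leaves a blow-up whose rank
  exceeds \<open>(L - 1)(k - 1)\<close>; since the maximal rank of blow-ups with \<open>k - 1\<close> blocks is a multiple of
  \<open>k - 1\<close>, there is again a nonsingular one. At \<open>k = L\<close> its determinant is an invariant of degree \<open>L\<^sup>2\<close>.

  By the Nullstellensatz and Noether normalization there are \<open>n\<close> invariants of degree \<open>L\<^sup>2\<close> whose ideal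
  contains all invariants of large degree. Reduction modulo large primes shows that it contains all
  invariants of degree at least \<open>n L\<^sup>2\<close>. By the Reynolds operator these are polynomials in invariants of
  smaller degree, so \<open>n L\<^sup>2 = (pq lcm p q)\<^sup>2\<close> bounds the degrees of generators.
\<close>

section \<open>Polynomials in finitely many variables\<close>

hide_const (open) Polynomial.degree Poly_Mapping.degree

text \<open>The Reynolds operator is not an average over a group. The apolar form is positive
  definite on rational polynomials, and the adjoint of a linear substitution is the substitution by
  the transposed matrix; for a set of matrices closed under transposition, orthogonal projection
  therefore makes cofactors invariant. The same form yields Weyl's theorem and the functional that
  separates an invariant from an ideal.

  The threshold n d for n parameters of degree d is obtained in the style of the Briancon-Skoda
  theorem, in place of the Cohen-Macaulay property and Hilbert series: a monomial in the parameters
  of degree at least n d p has some exponent at least p.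

  The block size must be a common multiple of p and q for block operations to act on the matrices
  \<open>T l\<close> alone. Passing from k + 1 to k blocks leaves rank at least L k - (L - 1), and
  this exceeds (L - 1) k exactly when k is at least L. So the descent ends at k = L, which is the
  origin of the degree \<open>L * L\<close>.\<close>

abbreviation lookup where "lookup \<equiv> Poly_Mapping.lookup"
abbreviation keys where "keys \<equiv> Poly_Mapping.keys"
abbreviation single where "single \<equiv> Poly_Mapping.single"

type_synonym ('v, 'a) mp = "('v \<Rightarrow> nat) \<Rightarrow>\<^sub>0 'a"

lemma zero_fun_fold [simp]: "(\<lambda>_. 0 :: nat) = 0"
  by (simp add: fun_eq_iff)

section \<open>Evaluation and substitution homomorphisms\<close>

definition mon :: "('v::finite \<Rightarrow> 'a::comm_monoid_mult) \<Rightarrow> ('v \<Rightarrow> nat) \<Rightarrow> 'a" where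
  "mon s e = (\<Prod>v\<in>UNIV. s v ^ e v)"

lemma mon_add: "mon s (e + e') = mon s e * mon s e'"
  by (simp add: mon_def power_add prod.distrib)

lemma mon_0 [simp]: "mon s 0 = 1"
  by (simp add: mon_def)

lemma mon_unit: "mon s (\<lambda>w. if w = v then 1 else 0) = s v"
proof -
  have "mon s (\<lambda>w. if w = v then 1 else 0) = (\<Prod>w\<in>UNIV. if w = v then s v else 1)"
    unfolding mon_def by (rule prod.cong) auto
  then show ?thesis by simp
qed

text \<open>\<open>h\<close> moves the coefficients and \<open>s\<close> the variables, so that
  evaluation, extension of scalars and substitution of polynomials are one map with one proof of
  multiplicativity.\<close>

definition evh :: "('a::comm_ring_1 \<Rightarrow> 'b::comm_ring_1) \<Rightarrow> ('v::finite \<Rightarrow> 'b) \<Rightarrow> ('v, 'a) mp \<Rightarrow> 'b" where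
  "evh h s p = (\<Sum>e\<in>keys p. h (lookup p e) * mon s e)"

abbreviation cst :: "'a::comm_ring_1 \<Rightarrow> ('v, 'a) mp" where
  "cst c \<equiv> single 0 c"

definition Xv :: "'v \<Rightarrow> ('v, 'a::comm_ring_1) mp" where
  "Xv v = single (\<lambda>w. if w = v then 1 else 0) 1"

abbreviation ev :: "('v::finite \<Rightarrow> 'a::comm_ring_1) \<Rightarrow> ('v, 'a) mp \<Rightarrow> 'a" where
  "ev X p \<equiv> evh (\<lambda>c. c) X p"

abbreviation evq :: "('v::finite \<Rightarrow> 'a::field_char_0) \<Rightarrow> ('v, rat) mp \<Rightarrow> 'a" where
  "evq X p \<equiv> evh of_rat X p"

lemma evh_superset:
  assumes "h 0 = 0" "finite S" "keys p \<subseteq> S"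
  shows "evh h s p = (\<Sum>e\<in>S. h (lookup p e) * mon s e)"
  unfolding evh_def
  by (rule sum.mono_neutral_left) (use assms in \<open>auto simp: in_keys_iff\<close>)

lemma evh_single: "h 0 = 0 \<Longrightarrow> evh h s (single e c) = h c * mon s e"
  by (subst evh_superset[of _ "{e}"]) auto

lemma mp_expand: "p = (\<Sum>e\<in>keys p. single e (lookup p e))"
proof (rule poly_mapping_eqI)
  fix k
  have "lookup (\<Sum>e\<in>keys p. single e (lookup p e)) k
      = (\<Sum>e\<in>keys p. if e = k then lookup p k else 0)"
    unfolding lookup_sum by (rule sum.cong) (auto simp: lookup_single)
  then show "lookup p k = lookup (\<Sum>e\<in>keys p. single e (lookup p e)) k"
    by (simp add: in_keys_iff)
qed

lemma mp_induct [case_names zero add]: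
  fixes p :: "('v, 'a::comm_ring_1) mp"
  assumes "P 0" and "\<And>e c q. P q \<Longrightarrow> P (single e c + q)"
  shows "P p"
proof -
  have "P (\<Sum>e\<in>S. single e (lookup p e))" if "finite S" for S
    using that by induction (auto intro: assms)
  from this[of "keys p"] show ?thesis
    using mp_expand[of p] by simp
qed

lemma evh_hom:
  assumes "comm_ring_hom h"
  shows "comm_ring_hom (evh h s)"
proof -
  interpret comm_ring_hom h by fact
  have add: "evh h s (p + q) = evh h s p + evh h s q" for p q
  proof -
    let ?S = "keys p \<union> keys q"
    have "keys (p + q) \<subseteq> ?S" by (rule Poly_Mapping.keys_add)
    then show ?thesis
      using evh_superset[of h ?S "p + q" s] evh_superset[of h ?S p s] evh_superset[of h ?S q s]
      by (simp add: lookup_add hom_add sum.distrib ring_distribs)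
  qed
  have s1: "evh h s (single e c * q) = evh h s (single e c) * evh h s q" for e c q
  proof (induction q rule: mp_induct)
    case zero
    show ?case by (simp add: evh_def)
  next
    case (add e' c' q)
    then show ?case
      by (simp add: ring_distribs \<open>\<And>q p. evh h s (p + q) = evh h s p + evh h s q\<close> mult_single evh_single mon_add hom_mult)
  qed
  have mult: "evh h s (p * q) = evh h s p * evh h s q" for p q
  proof (induction p rule: mp_induct)
    case zero
    show ?case by (simp add: evh_def)
  next
    case (add e' c' p)
    then show ?case
      by (simp add: ring_distribs \<open>\<And>q p. evh h s (p + q) = evh h s p + evh h s q\<close> s1)
  qed
  have "evh h s 0 = 0" by (simp add: evh_def)
  moreover have "evh h s 1 = 1"
    using evh_single[of h s 0 1] by simp
  ultimately show ?thesis
    by unfold_locales (auto simp: add mult)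
qed

lemma id_hom': "comm_ring_hom (\<lambda>c::'a::comm_ring_1. c)"
  by unfold_locales auto

lemma cst_hom: "comm_ring_hom (cst :: 'a::comm_ring_1 \<Rightarrow> ('v, 'a) mp)"
  by unfold_locales (auto simp: single_add mult_single)

lemma of_rat_hom': "comm_ring_hom (of_rat :: rat \<Rightarrow> 'a::field_char_0)"
  by unfold_locales (auto simp: of_rat_add of_rat_mult)

lemma comm_ring_hom_0: "comm_ring_hom h \<Longrightarrow> h 0 = 0"
proof -
  assume "comm_ring_hom h"
  then interpret comm_ring_hom h .
  show "h 0 = 0" by simp
qed

lemma evh_cst: "comm_ring_hom h \<Longrightarrow> evh h s (cst c) = h c"
  by (simp add: evh_single comm_ring_hom_0)

lemma evh_Xv:
  assumes "comm_ring_hom h"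
  shows "evh h s (Xv v) = s v"
proof -
  interpret comm_ring_hom h by fact
  show ?thesis by (simp add: Xv_def evh_single mon_unit)
qed

lemma hom_mon:
  assumes "comm_ring_hom g"
  shows "g (mon s e) = mon (\<lambda>v. g (s v)) e"
proof -
  interpret comm_ring_hom g by fact
  show ?thesis unfolding mon_def by (simp add: hom_prod hom_power)
qed

lemma hom_evh:
  assumes "comm_ring_hom g"
  shows "g (evh h s p) = evh (\<lambda>c. g (h c)) (\<lambda>v. g (s v)) p"
proof -
  interpret comm_ring_hom g by fact
  show ?thesis unfolding evh_def by (simp add: hom_sum hom_mult hom_mon assms)
qed

interpretation evid: comm_ring_hom "evh (\<lambda>c. c) s" for s :: "'v::finite \<Rightarrow> 'a::comm_ring_1"
  by (rule evh_hom[OF id_hom'])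

interpretation evc: comm_ring_hom "evh cst s" for s :: "'v::finite \<Rightarrow> ('w, 'a::comm_ring_1) mp"
  by (rule evh_hom[OF cst_hom])

interpretation evr: comm_ring_hom "evh of_rat s" for s :: "'v::finite \<Rightarrow> 'a::field_char_0"
  by (rule evh_hom[OF of_rat_hom'])

lemmas evh_cst_simps [simp] = evh_cst[OF id_hom'] evh_cst[OF cst_hom] evh_cst[OF of_rat_hom']
lemmas evh_Xv_simps [simp] = evh_Xv[OF id_hom'] evh_Xv[OF cst_hom] evh_Xv[OF of_rat_hom']

lemma single_eq_mon: "single e (c::'a::comm_ring_1) = cst c * mon Xv (e :: 'v::finite \<Rightarrow> nat)"
proof -
  have *: "Xv v ^ n = (single (\<lambda>w. if w = v then n else 0) 1 :: ('v, 'a) mp)" for v n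
  proof (induction n)
    case 0
    then show ?case by (simp add: zero_fun_def[symmetric])
  next
    case (Suc n)
    have "(\<lambda>w. if w = v then 1 else 0) + (\<lambda>w. if w = v then n else 0) = (\<lambda>w. if w = v then Suc n else 0)"
      by (auto simp: fun_eq_iff)
    then show ?case using Suc by (simp add: Xv_def mult_single)
  qed
  have "(\<Prod>v\<in>S. Xv v ^ e v) = (single (\<lambda>w. if w \<in> S then e w else 0) 1 :: ('v, 'a) mp)" if "finite S" for S
    using that
  proof induction
    case empty
    then show ?case by (simp add: zero_fun_def[symmetric])
  next
    case (insert x S)
    have "(\<lambda>w. if w = x then e x else 0) + (\<lambda>w. if w \<in> S then e w else 0)
      = (\<lambda>w. if w \<in> insert x S then e w else 0)"
      using insert by (auto simp: fun_eq_iff)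
    then show ?case using insert by (simp add: * mult_single)
  qed
  from this[of UNIV] show ?thesis by (simp add: mon_def mult_single)
qed

lemma mp_eq_evh: "evh cst Xv p = p"
  using mp_expand[of p] by (simp add: evh_def single_eq_mon[symmetric])

section \<open>A monomial order from unique factorization\<close>

lemma prime_labels: "\<exists>f :: 'v::finite \<Rightarrow> nat. inj f \<and> (\<forall>v. prime (f v))"
proof -
  obtain B where B: "finite B" "card B = CARD('v)" "B \<subseteq> {p::nat. prime p}"
    using infinite_arbitrarily_large[OF primes_infinite] by blast
  then obtain f where "bij_betw f (UNIV::'v set) B"
    using finite_same_card_bij[of "UNIV::'v set" B] by auto
  with B show ?thesis unfolding bij_betw_def by (intro exI[of _ f]) auto
qed

definition plab :: "'v::finite \<Rightarrow> nat" where
  "plab = (SOME f. inj f \<and> (\<forall>v. prime (f v)))"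

lemma plab: "inj (plab :: 'v::finite \<Rightarrow> nat)" "prime (plab (v::'v))"
  using someI_ex[OF prime_labels[where 'v='v]] by (auto simp: plab_def)

text \<open>Each variable is replaced by its own prime. Unique factorization makes the weight
  injective, and it is multiplicative, so comparing weights is a monomial order that is well-founded
  because its values are natural numbers.\<close>

definition wt :: "('v::finite \<Rightarrow> nat) \<Rightarrow> nat" where
  "wt e = mon plab e"

lemma wt_add: "wt (e + e') = wt e * wt e'"
  by (simp add: wt_def mon_add)

lemma wt_pos: "wt e > 0"
  unfolding wt_def mon_def using plab(2)[where 'v='a] by (intro prod_pos) (simp add: prime_gt_0_nat)

lemma multiplicity_wt:
  fixes e :: "'v::finite \<Rightarrow> nat"
  shows "multiplicity (plab v) (wt e) = e v"
proof -
  have "wt e = (\<Prod>p\<in>range (plab :: 'v \<Rightarrow> nat). p ^ e (the_inv plab p))"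
    unfolding wt_def mon_def by (subst prod.reindex[OF plab(1)]) (simp add: the_inv_f_f[OF plab(1)])
  moreover have "\<And>x. x \<in> range (plab :: 'v \<Rightarrow> nat) \<Longrightarrow> prime x" using plab(2) by auto
  ultimately show ?thesis
    using multiplicity_prod_prime_powers[of "range (plab :: 'v \<Rightarrow> nat)" "plab v" "\<lambda>p. e (the_inv plab p)"] 
    by (auto simp: plab the_inv_f_f[OF plab(1)])
qed

lemma inj_wt: "wt e = wt e' \<longleftrightarrow> e = e'"
  using multiplicity_wt by (metis ext)

text \<open>Vandermonde argument: the powers of the distinct weights separate the monomials.\<close>

lemma mp_nonzero_point:
  fixes p :: "('v::finite, 'a::{idom, ring_char_0}) mp"
  assumes "p \<noteq> 0"
  shows "\<exists>x :: 'v \<Rightarrow> nat. ev (\<lambda>v. of_nat (x v)) p \<noteq> 0"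
proof (rule ccontr)
  assume neg: "\<not> ?thesis"
  from assms obtain e0 where e0: "e0 \<in> keys p" by (metis keys_eq_empty ex_in_conv)
  have z: "(\<Sum>e\<in>keys p. lookup p e * of_nat (wt e) ^ k) = 0" for k
  proof -
    have "ev (\<lambda>v. of_nat (plab v ^ k)) p = (\<Sum>e\<in>keys p. lookup p e * of_nat (wt e) ^ k)"
      unfolding evh_def
    proof (rule sum.cong[OF refl])
      fix e :: "'v \<Rightarrow> nat"
      have "mon (\<lambda>v. of_nat (plab v ^ k) :: 'a) e = of_nat (wt e) ^ k"
        by (simp add: mon_def wt_def prod_power_distrib power_mult[symmetric] mult.commute)
      then show "lookup p e * mon (\<lambda>v. of_nat (plab v ^ k)) e = lookup p e * of_nat (wt e) ^ k"
        by simp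
    qed
    moreover have "ev (\<lambda>v. of_nat (plab v ^ k)) p = 0"
      using neg[unfolded not_ex not_not, THEN spec, of "\<lambda>v. plab v ^ k"] by simp
    ultimately show ?thesis by simp
  qed
  have pz: "(\<Sum>e\<in>keys p. lookup p e * poly f (of_nat (wt e))) = 0" for f :: "'a poly"
  proof -
    have "(\<Sum>e\<in>keys p. lookup p e * poly f (of_nat (wt e)))
      = (\<Sum>e\<in>keys p. \<Sum>i\<le>Polynomial.degree f. lookup p e * (coeff f i * of_nat (wt e) ^ i))"
      by (simp add: poly_altdef sum_distrib_left)
    also have "\<dots> = (\<Sum>i\<le>Polynomial.degree f. coeff f i * (\<Sum>e\<in>keys p. lookup p e * of_nat (wt e) ^ i))"
      by (subst sum.swap) (simp add: sum_distrib_left mult_ac)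
    finally show ?thesis by (simp add: z)
  qed
  define f where "f = (\<Prod>e\<in>keys p - {e0}. [:- of_nat (wt e), 1:] :: 'a poly)"
  have f0: "poly f (of_nat (wt e)) = 0" if "e \<in> keys p - {e0}" for e
    unfolding f_def poly_prod using that by (auto intro!: prod_zero)
  have f1: "poly f (of_nat (wt e0)) \<noteq> 0"
    unfolding f_def poly_prod by (auto simp: inj_wt)
  have "(\<Sum>e\<in>keys p. lookup p e * poly f (of_nat (wt e))) = lookup p e0 * poly f (of_nat (wt e0))"
    using e0 f0 by (subst sum.remove[OF _ e0]) auto
  with pz[of f] f1 e0 show False by (auto simp: in_keys_iff)
qed

lemma mp_lead:
  fixes p :: "('v::finite, 'a::zero) mp"
  assumes "p \<noteq> 0"
  obtains e where "e \<in> keys p" "\<And>e'. e' \<in> keys p \<Longrightarrow> wt e' \<le> wt e"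
proof -
  have "keys p \<noteq> {}" using assms by (simp add: poly_mapping_eq_iff fun_eq_iff in_keys_iff set_eq_iff)
  then have "Max (wt ` keys p) \<in> wt ` keys p" by (intro Max_in) auto
  then obtain e where "e \<in> keys p" "Max (wt ` keys p) = wt e" by auto
  with that show ?thesis by (metis Max_ge finite_imageI finite_keys imageI)
qed

lemma lookup_single_mult: 
  "lookup (single e c * q) k = (\<Sum>e'\<in>keys q. if e + e' = k then c * lookup q e' else 0)"
proof -
  have "single e c * q = (\<Sum>e'\<in>keys q. single (e + e') (c * lookup q e'))"
    by (subst mp_expand[of q]) (simp add: sum_distrib_left mult_single)
  then show ?thesis by (simp add: lookup_sum lookup_single when_def)
qed

lemma lookup_mult': 
  "lookup (p * q) k = (\<Sum>e\<in>keys p. \<Sum>e'\<in>keys q. if e + e' = k then lookup p e * lookup q e' else 0)"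
proof -
  have "p * q = (\<Sum>e\<in>keys p. single e (lookup p e) * q)"
    by (subst mp_expand[of p]) (simp add: sum_distrib_right)
  then show ?thesis by (simp add: lookup_sum lookup_single_mult)
qed

lemma lookup_single_mult_shift:
  fixes q :: "('v, 'a::comm_ring_1) mp"
  shows "lookup (single e c * q) (e + k) = c * lookup q k"
proof -
  have "lookup (single e c * q) (e + k) = (\<Sum>e'\<in>keys q. if e' = k then c * lookup q e' else 0)"
    by (simp add: lookup_single_mult)
  also have "\<dots> = c * lookup q k" by (simp add: in_keys_iff)
  finally show ?thesis .
qed

lemma mp_lead_mult:
  fixes p q :: "('v::finite, 'a::comm_ring_1) mp"
  assumes e: "e \<in> keys p" "\<And>e'. e' \<in> keys p \<Longrightarrow> wt e' \<le> wt e"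
    and f: "f \<in> keys q" "\<And>e'. e' \<in> keys q \<Longrightarrow> wt e' \<le> wt f"
  shows "lookup (p * q) (e + f) = lookup p e * lookup q f"
proof -
  have *: "e1 = e \<and> e2 = f" if "e1 \<in> keys p" "e2 \<in> keys q" "e1 + e2 = e + f" for e1 e2
  proof -
    have "wt e1 * wt e2 = wt e * wt f" using that(3) by (metis wt_add)
    moreover have "wt e1 \<le> wt e" "wt e2 \<le> wt f" using that e f by auto
    ultimately have "wt e1 = wt e"
      by (metis mult_le_mono1 mult_le_mono2 le_antisym mult_right_cancel wt_pos less_irrefl_nat)
    then have "e1 = e" by (simp add: inj_wt)
    with that(3) show ?thesis by auto
  qed
  have "lookup (p * q) (e + f) = (\<Sum>e1\<in>keys p. \<Sum>e2\<in>keys q. if e1 = e \<and> e2 = f then lookup p e1 * lookup q e2 else 0)"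
    unfolding lookup_mult' by (intro sum.cong refl) (use * in auto)
  also have "\<dots> = (\<Sum>e1\<in>keys p. if e1 = e then lookup p e1 * lookup q f else 0)"
    using f by (intro sum.cong refl) (auto simp: sum.delta)
  also have "\<dots> = lookup p e * lookup q f" using e by (simp add: sum.delta)
  finally show ?thesis .
qed

lemma mp_mult_nonzero:
  fixes p q :: "('v::finite, 'a::idom) mp"
  assumes "p \<noteq> 0" "q \<noteq> 0"
  shows "p * q \<noteq> 0"
proof -
  obtain e where e: "e \<in> keys p" "\<And>e'. e' \<in> keys p \<Longrightarrow> wt e' \<le> wt e" using mp_lead[OF assms(1)] by blast
  obtain f where f: "f \<in> keys q" "\<And>e'. e' \<in> keys q \<Longrightarrow> wt e' \<le> wt f" using mp_lead[OF assms(2)] by blast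
  have "lookup (p * q) (e + f) \<noteq> 0"
    using mp_lead_mult[OF e f] e f by (simp add: in_keys_iff)
  then show ?thesis by auto
qed

lemma mp_power_nonzero: "(p :: ('v::finite, 'a::idom) mp) \<noteq> 0 \<Longrightarrow> p ^ n \<noteq> 0"
proof (induction n)
  case 0
  have "lookup (1 :: ('v, 'a) mp) 0 \<noteq> 0" by simp
  then show ?case by (metis lookup_zero power_0)
qed (simp add: mp_mult_nonzero)

text \<open>Natural points lie in every field of characteristic 0. This is what lets identities
  known over the rationals be carried to larger fields.\<close>

lemma mp_eqI:
  fixes p q :: "('v::finite, 'a::{idom, ring_char_0}) mp"
  assumes "\<And>x :: 'v \<Rightarrow> nat. ev (\<lambda>v. of_nat (x v)) p = ev (\<lambda>v. of_nat (x v)) q"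
  shows "p = q"
  using mp_nonzero_point[of "p - q"] assms by (auto simp: evid.hom_minus)

lemma evq_of_rat: "evq (\<lambda>v. of_rat (x v)) p = of_rat (ev x p)"
  by (rule hom_evh[OF of_rat_hom', symmetric])

section \<open>Grading and linear substitution\<close>

definition esz :: "('v::finite \<Rightarrow> nat) \<Rightarrow> nat" where "esz e = sum e UNIV"

lemma esz_add [simp]: "esz (e + e') = esz e + esz e'" by (simp add: esz_def sum.distrib)
lemma esz_0 [simp]: "esz 0 = 0" by (simp add: esz_def)

lemma le_esz: "e v \<le> esz (e :: 'v::finite \<Rightarrow> nat)"
  unfolding esz_def by (rule member_le_sum) auto

lemma finite_esz: "finite {e :: 'v::finite \<Rightarrow> nat. esz e \<le> N}"
proof (rule finite_subset)
  show "{e. esz e \<le> N} \<subseteq> {e :: 'v \<Rightarrow> nat. \<forall>v. e v \<in> {..N}}"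
    using le_esz le_trans by blast
  show "finite {e :: 'v \<Rightarrow> nat. \<forall>v. e v \<in> {..N}}"
    using finite_PiE[of "UNIV :: 'v set" "\<lambda>_. {..N}"] by (simp add: PiE_UNIV_domain Pi_def)
qed

definition hmg :: "nat \<Rightarrow> ('v::finite, 'a::comm_ring_1) mp \<Rightarrow> bool" where
  "hmg N p \<longleftrightarrow> (\<forall>e\<in>keys p. esz e = N)"

lemma hmg_0 [simp]: "hmg N 0" by (simp add: hmg_def)

lemma hmg_add: "hmg N p \<Longrightarrow> hmg N q \<Longrightarrow> hmg N (p + q)"
  using Poly_Mapping.keys_add[of p q] by (auto simp: hmg_def)

lemma hmg_sum: "(\<And>i. i \<in> I \<Longrightarrow> hmg N (f i)) \<Longrightarrow> hmg N (sum f I)"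
  by (induction I rule: infinite_finite_induct) (auto intro: hmg_add)

lemma hmg_uminus: "hmg N (p :: ('v::finite, 'a::comm_ring_1) mp) \<Longrightarrow> hmg N (- p)"
  by (simp add: hmg_def in_keys_iff)

lemma hmg_diff: "hmg N (p :: ('v::finite, 'a::comm_ring_1) mp) \<Longrightarrow> hmg N q \<Longrightarrow> hmg N (p - q)"
  using hmg_add[of N p "- q"] hmg_uminus[of N q] by simp

lemma hmg_mult: "hmg N p \<Longrightarrow> hmg M q \<Longrightarrow> hmg (N + M) (p * q)"
  using keys_mult[of p q] by (fastforce simp: hmg_def)

lemma hmg_single: "esz e = N \<Longrightarrow> hmg N (single e c)"
  by (simp add: hmg_def)

lemma hmg_cst: "hmg 0 (cst c)" by (simp add: hmg_single)

lemma hmg_1: "hmg 0 (1 :: ('v::finite, 'a::comm_ring_1) mp)" using hmg_cst[of 1] by simp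

lemma hmg_Xv: "hmg 1 (Xv v)" unfolding Xv_def by (rule hmg_single) (simp add: esz_def)

lemma hmg_cst_mult: "hmg N p \<Longrightarrow> hmg N (cst c * p)" using hmg_mult[OF hmg_cst, of N p c] by simp

lemma hmg_power: "hmg N p \<Longrightarrow> hmg (n * N) (p ^ n)"
  by (induction n) (auto simp: hmg_1 intro: hmg_mult)

lemma hmg_prod: "(\<And>i. i \<in> I \<Longrightarrow> hmg (d i) (f i)) \<Longrightarrow> hmg (sum d I) (prod f I)"
  by (induction I rule: infinite_finite_induct) (auto simp: hmg_1 intro: hmg_mult)

definition hcomp :: "nat \<Rightarrow> ('v::finite, 'a::comm_ring_1) mp \<Rightarrow> ('v, 'a) mp" where
  "hcomp N p = (\<Sum>e\<in>{e\<in>keys p. esz e = N}. single e (lookup p e))"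

lemma lookup_hcomp: "lookup (hcomp N p) e = (if esz e = N then lookup p e else 0)"
proof -
  have "lookup (hcomp N p) e = (\<Sum>e'\<in>{e\<in>keys p. esz e = N}. if e' = e then lookup p e else 0)"
    unfolding hcomp_def lookup_sum by (rule sum.cong) (auto simp: lookup_single)
  then show ?thesis by (auto simp: sum.delta in_keys_iff)
qed

lemma hmg_hcomp [simp]: "hmg N (hcomp N p)"
  by (auto simp: hmg_def in_keys_iff lookup_hcomp split: if_splits)

lemma hcomp_add: "hcomp N (p + q) = hcomp N p + hcomp N q"
  by (rule poly_mapping_eqI) (simp add: lookup_hcomp lookup_add)

lemma hcomp_0 [simp]: "hcomp N 0 = 0"
  by (rule poly_mapping_eqI) (simp add: lookup_hcomp)

lemma hcomp_sum: "hcomp N (sum f I) = (\<Sum>i\<in>I. hcomp N (f i))"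
  by (induction I rule: infinite_finite_induct) (auto simp: hcomp_add)

lemma hcomp_hmg: "hmg M p \<Longrightarrow> hcomp N p = (if N = M then p else 0)"
  by (rule poly_mapping_eqI) (auto simp: lookup_hcomp hmg_def in_keys_iff)

text \<open>Only an upper bound of the degree is ever needed; the sum spares the case distinction of
  a maximum over no exponents.\<close>

definition mxd :: "('v::finite, 'a::comm_ring_1) mp \<Rightarrow> nat" where
  "mxd p = (\<Sum>e\<in>keys p. esz e)"

lemma esz_le_mxd: "e \<in> keys p \<Longrightarrow> esz e \<le> mxd p"
  unfolding mxd_def by (rule member_le_sum) auto

lemma hcomp_decomp:
  assumes "mxd p \<le> D"
  shows "p = (\<Sum>N\<le>D. hcomp N p)"
proof (rule poly_mapping_eqI)
  fix k
  have "lookup (\<Sum>N\<le>D. hcomp N p) k = (\<Sum>N\<le>D. if N = esz k then lookup p k else 0)"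
    unfolding lookup_sum by (intro sum.cong refl) (simp add: lookup_hcomp)
  also have "\<dots> = (if esz k \<le> D then lookup p k else 0)"
    by (simp add: sum.delta)
  also have "\<dots> = lookup p k"
    using esz_le_mxd[of k p] assms by (cases "k \<in> keys p") (auto simp: in_keys_iff)
  finally show "lookup p k = lookup (\<Sum>N\<le>D. hcomp N p) k" ..
qed

lemma hcomp_mult_hmg:
  assumes "hmg d q"
  shows "hcomp (N + d) (p * q) = hcomp N p * q"
proof -
  let ?D = "mxd p + N"
  have "hcomp (N + d) (p * q) = (\<Sum>k\<le>?D. hcomp (N + d) (hcomp k p * q))"
    using arg_cong[OF hcomp_decomp[of p ?D], of "\<lambda>p. hcomp (N + d) (p * q)"]
    by (simp add: sum_distrib_right hcomp_sum)
  also have "\<dots> = (\<Sum>k\<le>?D. if k = N then hcomp N p * q else 0)"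
    by (intro sum.cong refl) (simp add: hcomp_hmg[OF hmg_mult[OF hmg_hcomp assms]])
  finally show ?thesis by (simp add: sum.delta)
qed

lemma hmg_evh:
  assumes "hmg N p" "comm_ring_hom h"
  shows "evh h (\<lambda>v. t * s v) p = t ^ N * evh h s p"
  unfolding evh_def sum_distrib_left
proof (intro sum.cong refl)
  fix e assume "e \<in> keys p"
  then have "mon (\<lambda>v. t * s v) e = t ^ N * mon s e"
    using assms(1) by (simp add: mon_def hmg_def esz_def power_mult_distrib prod.distrib power_sum[symmetric])
  then show "h (lookup p e) * mon (\<lambda>v. t * s v) e = t ^ N * (h (lookup p e) * mon s e)"
    by (simp add: mult_ac)
qed

text \<open>Pullback along the linear map with matrix \<open>L\<close>. Source and target may have
  different variables, as polarization needs.\<close>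

definition lsub :: "('v::finite \<Rightarrow> 'w::finite \<Rightarrow> 'a::comm_ring_1) \<Rightarrow> ('v, 'a) mp \<Rightarrow> ('w, 'a) mp" where
  "lsub L = evh cst (\<lambda>v. \<Sum>w\<in>UNIV. cst (L v w) * Xv w)"

lemma ev_lsub: "ev X (lsub L p) = ev (\<lambda>v. \<Sum>w\<in>UNIV. L v w * X w) p"
  unfolding lsub_def by (subst hom_evh[OF evid.comm_ring_hom_axioms]) (simp add: evid.hom_sum evid.hom_mult)

interpretation ls: comm_ring_hom "lsub L" for L :: "'v::finite \<Rightarrow> 'w::finite \<Rightarrow> 'a::comm_ring_1"
  unfolding lsub_def by (rule evc.comm_ring_hom_axioms)

lemma lsub_cst [simp]: "lsub L (cst c) = cst c"
  by (simp add: lsub_def)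

lemma lsub_Xv: "lsub L (Xv v) = (\<Sum>w\<in>UNIV. cst (L v w) * Xv w)"
  by (simp add: lsub_def)

lemma hmg_mon: "(\<And>v. hmg 1 (s v)) \<Longrightarrow> hmg (esz e) (mon s e :: ('w::finite, 'a::comm_ring_1) mp)"
  unfolding mon_def esz_def using hmg_prod[of UNIV e "\<lambda>v. s v ^ e v"] hmg_power[of 1 "s v" "e v" for v] by simp

lemma hmg_lsub: "hmg N p \<Longrightarrow> hmg N (lsub L p)"
  unfolding lsub_def evh_def
proof (intro hmg_sum hmg_cst_mult)
  fix e assume "hmg N p" "e \<in> keys p"
  then have "esz e = N" by (auto simp: hmg_def)
  then show "hmg N (mon (\<lambda>v. \<Sum>w\<in>UNIV. cst (L v w) * Xv w) e)"
    using hmg_mon[of "\<lambda>v. \<Sum>w\<in>UNIV. cst (L v w) * Xv w" e]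
    by (simp add: hmg_sum hmg_cst_mult hmg_Xv[simplified])
qed

section \<open>The apolar form, invariants and Weyl's theorem\<close>

lemma lookup_cst_mult [simp]: "lookup (cst c * p) e = c * lookup (p :: ('v::finite, 'a::comm_ring_1) mp) e"
  using lookup_single_mult_shift[of 0 c p e] by simp

lemma cst_sum: "cst (sum f I) = (\<Sum>i\<in>I. cst (f i) :: ('v, 'a::comm_ring_1) mp)"
  by (induction I rule: infinite_finite_induct) (simp_all add: single_add)

definition msc :: "'a::comm_ring_1 \<Rightarrow> ('v::finite, 'a) mp \<Rightarrow> ('v, 'a) mp" where
  "msc c p = cst c * p"

interpretation mpv: vector_space "msc :: 'a::field \<Rightarrow> ('v::finite, 'a) mp \<Rightarrow> ('v, 'a) mp"
  by unfold_locales (simp_all add: msc_def ring_distribs single_add mult_single mult.assoc[symmetric])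

lemma subspace_cst_mult: "mpv.subspace U \<Longrightarrow> p \<in> U \<Longrightarrow> cst c * p \<in> U"
  using mpv.subspace_scale[of U p c] by (simp add: msc_def)

lemma span_cst_mult: "p \<in> mpv.span B \<Longrightarrow> cst c * p \<in> mpv.span B"
  by (rule subspace_cst_mult[OF mpv.subspace_span])

lemma subspace_hmg: "mpv.subspace {p. hmg N p}"
  by (simp add: mpv.subspace_def msc_def hmg_add hmg_cst_mult)

lemma hmg_in_span: "{p :: ('v::finite, 'a::field) mp. hmg N p} \<subseteq> mpv.span ((\<lambda>e. single e 1) ` {e. esz e \<le> N})"
proof
  fix p :: "('v, 'a) mp" assume "p \<in> {p. hmg N p}"
  then have h: "hmg N p" by simp
  have eq: "p = (\<Sum>e\<in>keys p. cst (lookup p e) * single e 1)"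
    by (subst mp_expand[of p]) (simp add: mult_single)
  show "p \<in> mpv.span ((\<lambda>e. single e 1) ` {e. esz e \<le> N})"
    apply (subst eq)
    apply (rule mpv.span_sum)
    apply (rule span_cst_mult)
    apply (rule mpv.span_base)
    using h by (simp add: hmg_def)
qed

lemma hmg_subspace_basis:
  assumes "mpv.subspace U" "U \<subseteq> {p :: ('v::finite, 'a::field) mp. hmg N p}"
  obtains B where "finite B" "mpv.span B = U"
proof -
  obtain B where B: "B \<subseteq> U" "mpv.independent B" "U \<subseteq> mpv.span B"
    by (rule mpv.basis_exists[of U])
  have "B \<subseteq> mpv.span ((\<lambda>e. single e 1) ` {e. esz e \<le> N})"
    using subset_trans[OF B(1) subset_trans[OF assms(2) hmg_in_span]] .
  then have "finite B"
    by (rule mpv.independent_span_bound[OF finite_imageI[OF finite_esz] B(2), THEN conjunct1])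
  moreover have "mpv.span B = U"
    using B(3) mpv.span_minimal[OF B(1) assms(1)] by (rule equalityI[rotated])
  ultimately show ?thesis by (rule that)
qed

definition efact :: "('v::finite \<Rightarrow> nat) \<Rightarrow> rat" where
  "efact e = (\<Prod>v\<in>UNIV. fact (e v))"

lemma efact_pos: "efact e > 0"
  unfolding efact_def by (intro prod_pos) simp

text \<open>The apolar (Fischer) inner product \<open>f(\<partial>) h\<close>.\<close>

definition fis :: "('v::finite, rat) mp \<Rightarrow> ('v, rat) mp \<Rightarrow> rat" where
  "fis f h = (\<Sum>e\<in>keys f. efact e * lookup f e * lookup h e)"

lemma fis_superset: "finite S \<Longrightarrow> keys f \<subseteq> S \<Longrightarrow> fis f h = (\<Sum>e\<in>S. efact e * lookup f e * lookup h e)"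
  unfolding fis_def by (rule sum.mono_neutral_left) (auto simp: in_keys_iff)

lemma fis_commute: "fis f h = fis h f"
proof -
  let ?S = "keys f \<union> keys h"
  show ?thesis by (simp add: fis_superset[of ?S f] fis_superset[of ?S h] mult_ac)
qed

lemma fis_add_right: "fis f (g + h) = fis f g + fis f h"
  by (simp add: fis_def lookup_add ring_distribs sum.distrib)

lemma fis_scale_right: "fis f (cst c * h) = c * fis f h"
  by (simp add: fis_def sum_distrib_left mult.left_commute)

lemma fis_0_right [simp]: "fis f 0 = 0"
  by (simp add: fis_def)

lemma fis_0_left [simp]: "fis 0 f = 0"
  by (simp add: fis_def)

lemma fis_diff_right: "fis f (g - h) = fis f g - fis f h"
  by (simp add: fis_def lookup_minus ring_distribs sum_subtractf)

lemma fis_add_left: "fis (g + h) f = fis g f + fis h f"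
  using fis_add_right[of f g h] by (simp add: fis_commute)

lemma fis_diff_left: "fis (g - h) f = fis g f - fis h f"
  using fis_diff_right[of f g h] by (simp add: fis_commute)

lemma fis_scale_left: "fis (cst c * h) f = c * fis h f"
  using fis_scale_right[of f c h] by (simp add: fis_commute)

text \<open>A sum of squares with the positive weights \<open>efact\<close>. This is the point where
  an ordered coefficient field is essential, hence the reduction to rational coefficients.\<close>

lemma fis_self_eq_0: "fis f f = 0 \<longleftrightarrow> f = 0"
proof
  assume "fis f f = 0"
  then have "(\<Sum>e\<in>keys f. efact e * (lookup f e)\<^sup>2) = 0"
    by (simp add: fis_def power2_eq_square mult.assoc)
  moreover have "0 \<le> efact e * (lookup f e)\<^sup>2" for e
    using efact_pos[of e] by (simp add: less_imp_le)
  ultimately have "\<forall>e\<in>keys f. efact e * (lookup f e)\<^sup>2 = 0"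
    using sum_nonneg_eq_0_iff[of "keys f" "\<lambda>e. efact e * (lookup f e)\<^sup>2"] by auto
  then have "(lookup f e)\<^sup>2 = 0" if "e \<in> keys f" for e
    using efact_pos[of e] that by auto
  then have "e \<notin> keys f" for e by (cases "e \<in> keys f") (auto simp: in_keys_iff)
  then show "f = 0" by (metis keys_eq_empty ex_in_conv)
qed simp

lemma fis_span_right:
  assumes "\<And>b. b \<in> B \<Longrightarrow> fis f b = 0" "h \<in> mpv.span B"
  shows "fis f h = 0"
  using assms(2)
proof (induction rule: mpv.span_induct_alt)
  case (step c x y)
  then show ?case by (simp add: msc_def fis_add_right fis_scale_right assms(1))
qed simp

text \<open>Gram-Schmidt: \<open>c\<close> is the part of \<open>b\<close> orthogonal to the span of
  \<open>B\<close>, and the projection of \<open>h\<close> is corrected along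
  \<open>c\<close>.\<close>

lemma fis_proj_finite:
  assumes "finite B"
  shows "\<exists>u\<in>mpv.span B. \<forall>g\<in>mpv.span B. fis (h - u) g = 0"
  using assms
proof (induction arbitrary: h)
  case empty
  then show ?case by simp
next
  case (insert b B)
  from insert(3)[of b] obtain b' where b': "b' \<in> mpv.span B" "\<And>g. g \<in> mpv.span B \<Longrightarrow> fis (b - b') g = 0" by blast
  from insert(3)[of h] obtain u where u: "u \<in> mpv.span B" "\<And>g. g \<in> mpv.span B \<Longrightarrow> fis (h - u) g = 0" by blast
  define c where "c = b - b'"
  \<comment> \<open>If \<open>b\<close> already lies in the span, \<open>c\<close> may be 0;
    division by zero then gives \<open>t = 0\<close>, which is the right correction.\<close>
  define t where "t = fis (h - u) c / fis c c"
  have c_in: "c \<in> mpv.span (insert b B)"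
    unfolding c_def using b'(1) mpv.span_mono[of B "insert b B"]
    by (intro mpv.span_diff) (auto intro: mpv.span_base)
  have t: "t * fis c c = fis (h - u) c"
    by (cases "c = 0") (auto simp: t_def fis_self_eq_0)
  show ?case
  proof (intro bexI[of _ "u + cst t * c"] ballI)
    show "u + cst t * c \<in> mpv.span (insert b B)"
      using u(1) mpv.span_mono[of B "insert b B"] c_in by (intro mpv.span_add span_cst_mult) auto
    fix g assume g: "g \<in> mpv.span (insert b B)"
    have "fis (h - (u + cst t * c)) b'' = 0" if "b'' \<in> insert b B" for b''
    proof -
      have 1: "fis (h - (u + cst t * c)) k = 0" if "k \<in> mpv.span B" for k
        using u(2)[OF that] b'(2)[OF that]
        by (simp add: c_def[symmetric] fis_diff_left fis_add_left fis_scale_left)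
      have "fis (h - (u + cst t * c)) c = 0"
        using t by (simp add: fis_diff_left fis_add_left fis_scale_left)
      moreover have "b = c + b'" by (simp add: c_def)
      ultimately show ?thesis using that 1 b'(1) by (auto simp: fis_add_right intro: mpv.span_base)
    qed
    then show "fis (h - (u + cst t * c)) g = 0" using g by (rule fis_span_right)
  qed
qed

lemma fis_proj:
  assumes "mpv.subspace U" "U \<subseteq> {p. hmg N p}"
  shows "\<exists>u\<in>U. \<forall>g\<in>U. fis (h - u) g = 0"
proof -
  obtain B where B: "finite B" "mpv.span B = U" by (rule hmg_subspace_basis[OF assms])
  from fis_proj_finite[OF B(1), of h] show ?thesis unfolding B(2) .
qed

definition lform :: "('v::finite \<Rightarrow> rat) \<Rightarrow> ('v, rat) mp" where
  "lform u = (\<Sum>v\<in>UNIV. cst (u v) * Xv v)"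

lemma hmg_lform: "hmg 1 (lform u)"
  unfolding lform_def by (intro hmg_sum hmg_cst_mult hmg_Xv)

lemma lookup_Xv_mult:
  "lookup (Xv v * g) e = (if e v = 0 then 0 else lookup (g :: ('v::finite, 'a::comm_ring_1) mp) (e(v := e v - 1)))"
proof (cases "e v = 0")
  case True
  have "(\<lambda>w. if w = v then 1 else 0) + e' \<noteq> e" for e'
    using True by (auto simp: fun_eq_iff intro!: exI[of _ v])
  then show ?thesis using True by (simp add: Xv_def lookup_single_mult)
next
  case False
  then have "e = (\<lambda>w. if w = v then 1 else 0) + e(v := e v - 1)"
    by (auto simp: fun_eq_iff)
  then show ?thesis using False lookup_single_mult_shift[of "\<lambda>w. if w = v then 1 else 0" 1 g "e(v := e v - 1)"]
    by (simp add: Xv_def)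
qed

text \<open>The multinomial theorem. In the induction every variable contributes
  \<open>of_nat (e v)\<close> times the same term, and these factors add up to the degree.\<close>

lemma lookup_lform_power:
  "esz e = N \<Longrightarrow> lookup (lform u ^ N) e * efact e = fact N * mon u e"
proof (induction N arbitrary: e)
  case 0
  then have e0: "e = 0" by (simp add: esz_def fun_eq_iff)
  have "efact (0 :: 'a \<Rightarrow> nat) = 1" by (simp add: efact_def)
  then show ?case unfolding e0 power_0 by (simp only: lookup_one_zero mon_0 fact_0)
next
  case (Suc N)
  have *: "u v * lookup (Xv v * lform u ^ N) e * efact e = of_nat (e v) * (fact N * mon u e)" for v
  proof (cases "e v = 0")
    case True
    then show ?thesis by (simp add: lookup_Xv_mult)
  next
    case False
    let ?e = "e(v := e v - 1)"
    have e: "e = (\<lambda>w. if w = v then 1 else 0) + ?e"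
      using False by (auto simp: fun_eq_iff)
    have "esz e = 1 + esz ?e" by (subst e) (simp add: esz_def sum.distrib)
    then have sz: "esz ?e = N" using Suc.prems by simp
    have m: "mon u e = u v * mon u ?e" by (subst e) (simp only: mon_add mon_unit)
    have "efact e = fact (e v) * (\<Prod>w\<in>UNIV - {v}. fact (e w))"
      unfolding efact_def by (subst prod.remove[of _ v]) auto
    moreover have "efact ?e = fact (e v - 1) * (\<Prod>w\<in>UNIV - {v}. fact (e w))"
      unfolding efact_def by (subst prod.remove[of _ v]) auto
    moreover have "(fact (e v) :: rat) = of_nat (e v) * fact (e v - 1)"
      using False by (simp add: fact_reduce)
    ultimately have f: "efact e = of_nat (e v) * efact ?e" by simp
    have "u v * lookup (Xv v * lform u ^ N) e * efact e = u v * of_nat (e v) * (lookup (lform u ^ N) ?e * efact ?e)"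
      using False by (simp add: lookup_Xv_mult f)
    also have "\<dots> = of_nat (e v) * (fact N * mon u e)" unfolding Suc.IH[OF sz] m by simp
    finally show ?thesis .
  qed
  have "lookup (lform u ^ Suc N) e * efact e = (\<Sum>v\<in>UNIV. u v * lookup (Xv v * lform u ^ N) e * efact e)"
    by (simp add: lform_def[of u] sum_distrib_right lookup_sum mult.assoc)
  also have "\<dots> = (\<Sum>v\<in>UNIV. of_nat (e v)) * (fact N * mon u e)"
    by (simp add: * sum_distrib_right)
  also have "(\<Sum>v\<in>UNIV. of_nat (e v)) = (of_nat (Suc N) :: rat)"
    using Suc.prems by (simp add: esz_def flip: of_nat_sum)
  finally show ?case by (simp add: mult_ac)
qed

text \<open>Powers of linear forms are the reproducing kernel of the apolar form: orthogonality to
  all of them means vanishing at all points.\<close>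

lemma fis_lform_power:
  assumes "hmg N h"
  shows "fis (lform u ^ N) h = fact N * ev u h"
proof -
  have "fis (lform u ^ N) h = (\<Sum>e\<in>keys h. lookup h e * (lookup (lform u ^ N) e * efact e))"
    by (subst fis_commute) (simp add: fis_def mult_ac)
  also have "\<dots> = (\<Sum>e\<in>keys h. lookup h e * (fact N * mon u e))"
    using assms by (intro sum.cong refl) (simp add: lookup_lform_power hmg_def)
  finally show ?thesis by (simp add: evh_def sum_distrib_left mult_ac)
qed

lemma lsub_lform: "lsub L (lform u) = lform (\<lambda>w. \<Sum>v\<in>UNIV. u v * L v w)"
proof -
  have "lsub L (lform u) = (\<Sum>v\<in>UNIV. \<Sum>w\<in>UNIV. cst (u v * L v w) * Xv w)"
    by (simp add: lform_def ls.hom_sum ls.hom_mult lsub_Xv sum_distrib_left mult_single mult.assoc[symmetric])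
  also have "\<dots> = (\<Sum>w\<in>UNIV. \<Sum>v\<in>UNIV. cst (u v * L v w) * Xv w)" by (rule sum.swap)
  also have "\<dots> = lform (\<lambda>w. \<Sum>v\<in>UNIV. u v * L v w)"
    by (simp add: lform_def cst_sum flip: sum_distrib_right)
  finally show ?thesis .
qed

text \<open>It suffices to test the adjunction on powers of linear forms, which span.\<close>

lemma fis_adjoint:
  assumes "hmg N f" "hmg N h"
  shows "fis (lsub L f) h = fis f (lsub (\<lambda>w v. L v w) h)"
proof -
  let ?U = "mpv.span (range (\<lambda>u. lform u ^ N))"
  have "?U \<subseteq> {p. hmg N p}"
    using subspace_hmg hmg_power[OF hmg_lform] by (intro mpv.span_minimal) auto
  then obtain u where u: "u \<in> ?U" "\<And>g. g \<in> ?U \<Longrightarrow> fis (f - u) g = 0"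
    using fis_proj[OF mpv.subspace_span, of _ N f] by blast
  have "hmg N u" using subsetD[OF \<open>?U \<subseteq> _\<close> u(1)] by simp
  then have hu: "hmg N (f - u)" using assms(1) by (rule hmg_diff[rotated])
  \<comment> \<open>The residue of \<open>f\<close> is orthogonal to every power
    \<open>lform x ^ N\<close>, so it vanishes at every \<open>x\<close>. This is the proof that
    such powers span.\<close>
  have "ev x (f - u) = 0" for x
    using u(2)[of "lform x ^ N"] fis_lform_power[OF hu, of x] 
    by (simp add: mpv.span_base fis_commute[of "f - u"])
  then have "f - u = 0" using mp_nonzero_point[of "f - u"] by metis
  then have "f \<in> ?U" using u by simp
  then show ?thesis
  proof (induction rule: mpv.span_induct_alt)
    case base
    then show ?case by simp
  next
    case (step c x y)
    then obtain z where z: "x = lform z ^ N" by auto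
    have "fis (lsub L x) h = fis x (lsub (\<lambda>w v. L v w) h)"
      unfolding z ls.hom_power lsub_lform
      by (simp add: fis_lform_power assms(2) hmg_lsub ev_lsub mult.commute)
    then show ?case using step by (simp add: msc_def ls.hom_add ls.hom_mult fis_add_left fis_scale_left)
  qed
qed

section \<open>Invariants and invariant cofactors\<close>

definition Inv :: "('v::finite \<Rightarrow> 'v \<Rightarrow> rat) set \<Rightarrow> ('v, rat) mp set" where
  "Inv \<Gamma> = {f. \<forall>L\<in>\<Gamma>. lsub L f = f}"

lemma Inv_add: "f \<in> Inv \<Gamma> \<Longrightarrow> g \<in> Inv \<Gamma> \<Longrightarrow> f + g \<in> Inv \<Gamma>"
  and Inv_diff: "f \<in> Inv \<Gamma> \<Longrightarrow> g \<in> Inv \<Gamma> \<Longrightarrow> f - g \<in> Inv \<Gamma>"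
  and Inv_mult: "f \<in> Inv \<Gamma> \<Longrightarrow> g \<in> Inv \<Gamma> \<Longrightarrow> f * g \<in> Inv \<Gamma>"
  and Inv_cst: "cst c \<in> Inv \<Gamma>"
  and Inv_0: "0 \<in> Inv \<Gamma>" and Inv_1: "1 \<in> Inv \<Gamma>"
  by (auto simp: Inv_def ls.hom_add ls.hom_mult ls.hom_minus)

lemma Inv_sum: "(\<And>i. i \<in> I \<Longrightarrow> f i \<in> Inv \<Gamma>) \<Longrightarrow> sum f I \<in> Inv \<Gamma>"
  by (induction I rule: infinite_finite_induct) (auto simp: Inv_0 Inv_add)

lemma Inv_power: "f \<in> Inv \<Gamma> \<Longrightarrow> f ^ n \<in> Inv \<Gamma>"
  by (induction n) (auto simp: Inv_1 Inv_mult)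

lemma hcomp_lsub: "hcomp N (lsub L p) = lsub L (hcomp N p)"
proof -
  have "hcomp N (lsub L p) = (\<Sum>k\<le>mxd p + N. hcomp N (lsub L (hcomp k p)))"
    using arg_cong[OF hcomp_decomp[of p "mxd p + N"], of "\<lambda>p. hcomp N (lsub L p)"]
    by (simp add: ls.hom_sum hcomp_sum)
  also have "\<dots> = (\<Sum>k\<le>mxd p + N. if k = N then lsub L (hcomp N p) else 0)"
    by (intro sum.cong refl) (simp add: hcomp_hmg[OF hmg_lsub[OF hmg_hcomp]])
  finally show ?thesis by (simp add: sum.delta)
qed

lemma Inv_hcomp: "f \<in> Inv \<Gamma> \<Longrightarrow> hcomp N f \<in> Inv \<Gamma>"
  by (simp add: Inv_def flip: hcomp_lsub)

definition transp :: "('v \<Rightarrow> 'w \<Rightarrow> 'a) \<Rightarrow> 'w \<Rightarrow> 'v \<Rightarrow> 'a" where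
  "transp L = (\<lambda>w v. L v w)"

lemma fis_adjoint': "hmg N f \<Longrightarrow> hmg N h \<Longrightarrow> fis (lsub L f) h = fis f (lsub (transp L) h)"
  unfolding transp_def by (rule fis_adjoint)

text \<open>\<open>D N\<close> is spanned by the differences \<open>lsub L g - g\<close>, and its
  orthogonal complement in degree \<open>N\<close> consists of invariants. Each cofactor is replaced
  by its component orthogonal to \<open>D\<close>. As \<open>D\<close> is stable under
  multiplication by the invariants \<theta> i, the resulting error lies in \<open>D\<close>; being
  also invariant, it is orthogonal to \<open>D\<close> and hence to itself.\<close>

lemma reynolds:
  assumes sym: "\<And>L. L \<in> \<Gamma> \<Longrightarrow> transp L \<in> \<Gamma>"
    and f: "f \<in> Inv \<Gamma>" "hmg N f"
    and th: "\<And>i. i \<in> I \<Longrightarrow> \<theta> i \<in> Inv \<Gamma> \<and> hmg (d i) (\<theta> i)"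
    and eq: "f = (\<Sum>i\<in>I. \<theta> i * h i)"
  shows "\<exists>h'. (\<forall>i. h' i \<in> Inv \<Gamma> \<and> hmg (N - d i) (h' i) \<and> (N < d i \<longrightarrow> h' i = 0)) \<and> f = (\<Sum>i\<in>I. \<theta> i * h' i)"
proof -
  define D where "D N = mpv.span {lsub L g - g | L g. L \<in> \<Gamma> \<and> hmg N g}" for N
  have Dh: "D N \<subseteq> {p. hmg N p}" for N
    unfolding D_def using subspace_hmg by (intro mpv.span_minimal) (auto intro: hmg_diff hmg_lsub)
  have orth: "g \<in> Inv \<Gamma>" if g: "hmg N g" "\<And>x. x \<in> D N \<Longrightarrow> fis g x = 0" for g N
    unfolding Inv_def
  proof safe
    fix L assume L: "L \<in> \<Gamma>"
    define k where "k = lsub L g - g"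
    have hk: "hmg N k" using g(1) by (simp add: k_def hmg_diff hmg_lsub)
    \<comment> \<open>Orthogonality of \<open>g\<close> to this element of \<open>D N\<close>,
      rewritten by adjointness, says that \<open>k\<close> is orthogonal to itself.\<close>
    have "lsub (transp L) k - k \<in> D N"
      unfolding D_def using hk sym[OF L] by (intro mpv.span_base) blast
    from g(2)[OF this] have "fis g (lsub (transp L) k) - fis g k = 0" by (simp add: fis_diff_right)
    then have "fis (lsub L g - g) k = 0"
      by (simp add: fis_diff_left fis_adjoint'[OF g(1) hk])
    then have "k = 0" by (simp add: k_def[symmetric] fis_self_eq_0)
    then show "lsub L g = g" by (simp add: k_def)
  qed
  have Dmult: "\<theta> i * x \<in> D (M + d i)" if "i \<in> I" "x \<in> D M" for i x M
    using that(2) unfolding D_def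
  proof (induction rule: mpv.span_induct_alt)
    case base
    then show ?case by (simp add: mpv.span_zero)
  next
    case (step c x y)
    then obtain L g where Lg: "x = lsub L g - g" "L \<in> \<Gamma>" "hmg M g" by blast
    have "\<theta> i * x = lsub L (\<theta> i * g) - \<theta> i * g"
      using th[OF that(1)] Lg by (simp add: Inv_def ls.hom_mult ring_distribs)
    moreover have "hmg (M + d i) (\<theta> i * g)"
      using hmg_mult[of "d i" "\<theta> i" M g] th[OF that(1)] Lg(3) by (simp add: add.commute)
    ultimately have "\<theta> i * x \<in> mpv.span {lsub L g - g | L g. L \<in> \<Gamma> \<and> hmg (M + d i) g}"
      using Lg(2) by (intro mpv.span_base) blast
    then have "cst c * (\<theta> i * x) + \<theta> i * y \<in> mpv.span {lsub L g - g | L g. L \<in> \<Gamma> \<and> hmg (M + d i) g}"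
      using step.IH by (intro mpv.span_add span_cst_mult)
    moreover have "\<theta> i * (msc c x + y) = cst c * (\<theta> i * x) + \<theta> i * y"
      by (simp add: msc_def ring_distribs mult_ac)
    ultimately show ?case by (simp only:)
  qed
  have "\<exists>g. hmg M g \<and> g \<in> Inv \<Gamma> \<and> k - g \<in> D M" if "hmg M k" for k M
  proof -
    have "mpv.subspace (D M)" unfolding D_def by (rule mpv.subspace_span)
    then obtain u where u: "u \<in> D M" "\<And>g. g \<in> D M \<Longrightarrow> fis (k - u) g = 0"
      using fis_proj[OF _ Dh, of M k] by blast
    have "hmg M u" using subsetD[OF Dh u(1)] by simp
    then have "hmg M (k - u)" using that by (rule hmg_diff[rotated])
    moreover from this have "k - u \<in> Inv \<Gamma>" using u(2) by (rule orth)
    ultimately show ?thesis using u(1) by (intro exI[of _ "k - u"]) simp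
  qed
  then have "\<exists>g. hmg (N - d i) g \<and> g \<in> Inv \<Gamma> \<and> hcomp (N - d i) (h i) - g \<in> D (N - d i)" for i by simp
  then obtain g where g: "\<And>i. hmg (N - d i) (g i)" "\<And>i. g i \<in> Inv \<Gamma>"
    "\<And>i. hcomp (N - d i) (h i) - g i \<in> D (N - d i)" by metis
  \<comment> \<open>The subtraction \<open>N - d i\<close> truncates at 0. Where the cofactor would
    have negative degree it is set to 0.\<close>
  define g' where "g' i = (if N < d i then 0 else g i)" for i
  have hc: "hcomp N (\<theta> i * h i) = (if N < d i then 0 else \<theta> i * hcomp (N - d i) (h i))" if "i \<in> I" for i
  proof (cases "N < d i")
    case False
    then show ?thesis
      using hcomp_mult_hmg[of "d i" "\<theta> i" "N - d i" "h i"] th[OF that] by (simp add: mult.commute)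
  next
    case True
    have "lookup (\<theta> i * h i) e = 0" if "esz e = N" for e
    proof -
      have "e1 + e2 \<noteq> e" if "e1 \<in> keys (\<theta> i)" for e1 e2
        using th[OF \<open>i \<in> I\<close>] that True \<open>esz e = N\<close> by (auto simp: hmg_def)
      then show ?thesis unfolding lookup_mult' by (simp add: sum.neutral)
    qed
    then have "hcomp N (\<theta> i * h i) = 0"
      by (intro poly_mapping_eqI) (simp add: lookup_hcomp)
    then show ?thesis using True by simp
  qed
  define x where "x = f - (\<Sum>i\<in>I. \<theta> i * g' i)"
  have "f = hcomp N f" using f(2) by (simp add: hcomp_hmg)
  also have "\<dots> = (\<Sum>i\<in>I. if N < d i then 0 else \<theta> i * hcomp (N - d i) (h i))"
    by (simp add: eq hcomp_sum hc)
  finally have "x = (\<Sum>i\<in>I. (if N < d i then 0 else \<theta> i * hcomp (N - d i) (h i)) - \<theta> i * g' i)"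
    by (simp add: x_def sum_subtractf)
  also have "\<dots> = (\<Sum>i\<in>I. if N < d i then 0 else \<theta> i * (hcomp (N - d i) (h i) - g i))"
    by (intro sum.cong refl) (simp add: g'_def right_diff_distrib)
  finally have xeq: "x = (\<Sum>i\<in>I. if N < d i then 0 else \<theta> i * (hcomp (N - d i) (h i) - g i))" .
  have "(if N < d i then 0 else \<theta> i * (hcomp (N - d i) (h i) - g i)) \<in> D N" if "i \<in> I" for i
    using Dmult[OF that g(3)[of i]] by (auto simp: D_def mpv.span_zero)
  then have xD: "x \<in> D N"
    unfolding xeq D_def by (intro mpv.span_sum)
  have xI: "x \<in> Inv \<Gamma>"
    unfolding x_def using f(1) th g(2) by (intro Inv_diff Inv_sum Inv_mult) (auto simp: g'_def Inv_0)
  have "fis x y = 0" if "y \<in> {lsub L g - g | L g. L \<in> \<Gamma> \<and> hmg N g}" for y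
  proof -
    from that obtain L g where Lg: "y = lsub L g - g" "L \<in> \<Gamma>" "hmg N g" by blast
    have hx: "hmg N x" using subsetD[OF Dh xD] by simp
    have "fis x (lsub L g) = fis (lsub (transp L) x) g"
      using fis_adjoint'[OF hx Lg(3), of "transp L"] by (simp add: transp_def)
    also have "lsub (transp L) x = x" using xI sym[OF Lg(2)] by (simp add: Inv_def)
    finally show ?thesis by (simp add: Lg(1) fis_diff_right)
  qed
  then have "fis x x = 0" by (rule fis_span_right) (use xD in \<open>simp_all add: D_def\<close>)
  then have "x = 0" by (simp add: fis_self_eq_0)
  then show ?thesis using g by (intro exI[of _ g']) (simp add: x_def g'_def Inv_0)
qed

text \<open>A variable is a pair of a copy and a coordinate: \<open>amp\<close> mixes the copies and \<open>gmp\<close> acts on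
  the coordinates of every copy.\<close>

definition amp :: "('n::finite \<Rightarrow> 'm::finite \<Rightarrow> 'a) \<Rightarrow> 'n \<times> 'c::finite \<Rightarrow> 'm \<times> 'c \<Rightarrow> 'a::comm_ring_1" where
  "amp b = (\<lambda>(k, c) (l, c'). if c = c' then b k l else 0)"

definition gmp :: "('c::finite \<Rightarrow> 'c \<Rightarrow> 'a) \<Rightarrow> 'm::finite \<times> 'c \<Rightarrow> 'm \<times> 'c \<Rightarrow> 'a::comm_ring_1" where
  "gmp g = (\<lambda>(k, c) (l, c'). if k = l then g c c' else 0)"

lemma sum_prod_UNIV: "(\<Sum>w\<in>UNIV. f (w :: 'a::finite \<times> 'b::finite)) = (\<Sum>a\<in>UNIV. \<Sum>b\<in>UNIV. f (a, b))"
  by (simp add: sum.cartesian_product flip: UNIV_Times_UNIV)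

lemma amp_apply: "(\<Sum>w\<in>UNIV. amp b (k, c) w * X w) = (\<Sum>l\<in>UNIV. b k l * X (l, c))"
  by (simp add: sum_prod_UNIV amp_def if_distrib[of "\<lambda>t. t * _"] sum.delta cong: if_cong)

lemma gmp_apply: "(\<Sum>w\<in>UNIV. gmp g (k, c) w * X w) = (\<Sum>c'\<in>UNIV. g c c' * X (k, c'))"
proof -
  have "(\<Sum>w\<in>UNIV. gmp g (k, c) w * X w) = (\<Sum>l\<in>UNIV. \<Sum>c'\<in>UNIV. if k = l then g c c' * X (l, c') else 0)"
    unfolding sum_prod_UNIV gmp_def by (intro sum.cong refl) simp
  also have "\<dots> = (\<Sum>c'\<in>UNIV. \<Sum>l\<in>UNIV. if k = l then g c c' * X (l, c') else 0)"
    by (rule sum.swap)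
  finally show ?thesis by (simp add: sum.delta)
qed

lemma ev_amp: "ev X (lsub (amp b) f) = ev (\<lambda>(k, c). \<Sum>l\<in>UNIV. b k l * X (l, c)) f"
  unfolding ev_lsub by (rule arg_cong[of _ _ "\<lambda>X. ev X f"]) (auto simp: amp_apply)

lemma ev_gmp: "ev X (lsub (gmp g) f) = ev (\<lambda>(k, c). \<Sum>c'\<in>UNIV. g c c' * X (k, c')) f"
  unfolding ev_lsub by (rule arg_cong[of _ _ "\<lambda>X. ev X f"]) (auto simp: gmp_apply)

lemma transp_amp: "transp (amp b) = amp (transp b)"
  by (auto simp: transp_def amp_def fun_eq_iff)

lemma amp_gmp_commute:
  fixes f :: "('n::finite \<times> 'c::finite, rat) mp"
  shows "lsub (gmp g) (lsub (amp (b :: 'n \<Rightarrow> 'm::finite \<Rightarrow> rat)) f) = lsub (amp b) (lsub (gmp g) f)"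
proof (rule mp_eqI)
  fix x :: "'m \<times> 'c \<Rightarrow> nat"
  show "ev (\<lambda>v. of_nat (x v)) (lsub (gmp g) (lsub (amp b) f)) = ev (\<lambda>v. of_nat (x v)) (lsub (amp b) (lsub (gmp g) f))"
    unfolding ev_amp ev_gmp
    by (rule arg_cong[of _ _ "\<lambda>X. ev X f"])
      (auto simp: sum_distrib_left mult_ac fun_eq_iff intro: sum.swap)
qed

lemma Inv_amp: "f \<in> Inv (gmp ` G) \<Longrightarrow> lsub (amp b) f \<in> Inv (gmp ` G)"
  by (auto simp: Inv_def amp_gmp_commute)

text \<open>Weyl's polarization theorem: the component of \<open>f\<close> orthogonal to the polarizations vanishes on all
  tuples.\<close>

lemma weyl:
  fixes f :: "('m::finite \<times> 'c::finite, rat) mp"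
  assumes f: "f \<in> Inv (gmp ` G)" "hmg N f"
  shows "f \<in> mpv.span {lsub (amp b) g | b g. (g :: ('c \<times> 'c, rat) mp) \<in> Inv (gmp ` G) \<and> hmg N g}"
    (is "_ \<in> mpv.span ?W")
proof -
  have "mpv.span ?W \<subseteq> {p. hmg N p}"
    using subspace_hmg by (intro mpv.span_minimal) (auto intro: hmg_lsub)
  then obtain w where w: "w \<in> mpv.span ?W" "\<And>g. g \<in> mpv.span ?W \<Longrightarrow> fis (f - w) g = 0"
    using fis_proj[OF mpv.subspace_span, of ?W N f] by blast
  have "mpv.subspace (Inv (gmp ` G) :: ('m \<times> 'c, rat) mp set)"
    by (simp add: mpv.subspace_def msc_def Inv_0 Inv_add Inv_mult Inv_cst)
  then have "mpv.span ?W \<subseteq> Inv (gmp ` G)"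
    by (intro mpv.span_minimal) (auto intro: Inv_amp)
  then have "w \<in> Inv (gmp ` G)" using w(1) by (rule subsetD)
  moreover have "hmg N w" using subsetD[OF \<open>mpv.span ?W \<subseteq> {p. hmg N p}\<close> w(1)] by simp
  ultimately have r: "f - w \<in> Inv (gmp ` G)" "hmg N (f - w)"
    using f by (auto intro: Inv_diff hmg_diff)
  \<comment> \<open>Pulling the residue back along \<open>c\<close> and the result along
    \<open>transp c\<close> gives a polarization, to which the residue is orthogonal. By adjointness
    the first pullback has norm 0.\<close>
  have z: "lsub (amp c) (f - w) = 0" for c :: "'m \<Rightarrow> 'c \<Rightarrow> rat"
  proof -
    let ?h = "lsub (amp c) (f - w)"
    have "lsub (amp (transp c)) ?h \<in> mpv.span ?W"
      using Inv_amp[OF r(1), of c] hmg_lsub[OF r(2), of "amp c"] by (intro mpv.span_base) blast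
    then have "fis (f - w) (lsub (amp (transp c)) ?h) = 0" by (rule w(2))
    then have "fis ?h ?h = 0"
      using fis_adjoint'[OF r(2) hmg_lsub[OF r(2)], of "amp c" "amp c"] by (simp add: transp_amp)
    then show ?thesis by (simp add: fis_self_eq_0)
  qed
  have "f - w = 0"
  proof (rule mp_eqI)
    fix x :: "'m \<times> 'c \<Rightarrow> nat"
    define X :: "'m \<times> 'c \<Rightarrow> rat" where "X = (\<lambda>v. of_nat (x v))"
    \<comment> \<open>Every tuple of vectors is obtained from the standard basis by mixing copies,
      with the coordinates of the tuple as mixing matrix. Hence as many copies as coordinates
      suffice.\<close>
    have "ev (\<lambda>(k, c'). if k = c' then 1 else 0) (lsub (amp (\<lambda>l c. X (l, c))) (f - w)) = 0"
      by (simp add: z)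
    also have "ev (\<lambda>(k, c'). if k = c' then 1 else 0) (lsub (amp (\<lambda>l c. X (l, c))) (f - w)) = ev X (f - w)"
      unfolding ev_amp by (rule arg_cong[of _ _ "\<lambda>X. ev X (f - w)"])
        (auto simp: fun_eq_iff if_distrib[of "\<lambda>t. _ * t"] sum.delta cong: if_cong)
    finally show "ev (\<lambda>v. of_nat (x v)) (f - w) = ev (\<lambda>v. of_nat (x v)) 0"
      by (simp add: X_def)
  qed
  then show ?thesis using w(1) by simp
qed

section \<open>Noether normalization\<close>

text \<open>The ring as a module over itself: \<open>mpi.span F\<close> is the ideal generated by
  \<open>F\<close>, whereas \<open>mpv.span\<close> is the linear span.\<close>

definition rsc :: "'a::comm_ring_1 \<Rightarrow> 'a \<Rightarrow> 'a" where "rsc a x = a * x"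

interpretation mpi: Modules.module "rsc :: 'a::comm_ring_1 \<Rightarrow> 'a \<Rightarrow> 'a"
  by unfold_locales (simp_all add: rsc_def ring_distribs mult.assoc)

lemma span_mult_left: "x \<in> mpi.span F \<Longrightarrow> y * x \<in> mpi.span F"
  using mpi.span_scale[of x F y] by (simp add: rsc_def)

lemma span_mult_right: "x \<in> mpi.span F \<Longrightarrow> x * y \<in> mpi.span F"
  using span_mult_left[of x F y] by (simp add: mult.commute)

definition inrad :: "'a::comm_ring_1 set \<Rightarrow> 'a \<Rightarrow> bool" where
  "inrad F x \<longleftrightarrow> (\<exists>n. x ^ n \<in> mpi.span F)"

lemma inrad_add:
  assumes "inrad F x" "inrad F y"
  shows "inrad F (x + y)"
proof -
  from assms obtain n m where nm: "x ^ n \<in> mpi.span F" "y ^ m \<in> mpi.span F" by (auto simp: inrad_def)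
  have "of_nat ((n + m) choose k) * x ^ k * y ^ (n + m - k) \<in> mpi.span F" if "k \<le> n + m" for k
  proof (cases "n \<le> k")
    case True
    then have "x ^ k = x ^ n * x ^ (k - n)" by (simp flip: power_add)
    then have "of_nat ((n + m) choose k) * x ^ k * y ^ (n + m - k)
      = x ^ n * (of_nat ((n + m) choose k) * x ^ (k - n) * y ^ (n + m - k))" by (simp add: mult_ac)
    then show ?thesis using span_mult_right[OF nm(1)] by simp
  next
    case False
    then have "n + m - k = m + (n - k)" by simp
    then have "y ^ (n + m - k) = y ^ m * y ^ (n - k)" by (simp only: power_add)
    then have "of_nat ((n + m) choose k) * x ^ k * y ^ (n + m - k)
      = y ^ m * (of_nat ((n + m) choose k) * x ^ k * y ^ (n - k))" by (simp add: mult_ac)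
    then show ?thesis using span_mult_right[OF nm(2)] by simp
  qed
  then have "(x + y) ^ (n + m) \<in> mpi.span F"
    unfolding binomial_ring by (intro mpi.span_sum) simp
  then show ?thesis by (auto simp: inrad_def)
qed

lemma inrad_mult: "inrad F x \<Longrightarrow> inrad F (y * x)"
  unfolding inrad_def power_mult_distrib by (blast intro: span_mult_left)

lemma inrad_span: "x \<in> mpi.span F \<Longrightarrow> inrad F x"
  unfolding inrad_def by (metis power_one_right)

lemma inrad_trans:
  assumes "x \<in> mpi.span F" "\<And>a. a \<in> F \<Longrightarrow> inrad F' a"
  shows "inrad F' x"
  using assms(1)
proof (induction rule: mpi.span_induct_alt)
  case base
  then show ?case using inrad_span mpi.span_zero by blast
next
  case (step c x y)
  then show ?case by (simp add: rsc_def inrad_add inrad_mult assms(2))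
qed

lemma inrad_power: "inrad F (x ^ n) \<Longrightarrow> inrad F x"
  unfolding inrad_def by (metis power_mult)

lemma inrad_trans': "inrad F x \<Longrightarrow> (\<And>a. a \<in> F \<Longrightarrow> inrad F' a) \<Longrightarrow> inrad F' x"
proof -
  assume *: "inrad F x" "\<And>a. a \<in> F \<Longrightarrow> inrad F' a"
  from *(1) obtain n where "x ^ n \<in> mpi.span F" by (auto simp: inrad_def)
  then have "inrad F' (x ^ n)" by (rule inrad_trans) (rule *(2))
  then show "inrad F' x" by (rule inrad_power)
qed

text \<open>Stated for a family since different indices may carry the same polynomial; a repetition
  \<open>f i = f j\<close> gives the relation with coefficients 1 and -1.\<close>

lemma family_dependent:
  fixes f :: "'i \<Rightarrow> ('v::finite, 'a::field) mp"
  assumes A: "finite A" and B: "finite B" "card B < card A" "\<And>i. i \<in> A \<Longrightarrow> f i \<in> mpv.span B"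
  shows "\<exists>c. (\<exists>i\<in>A. c i \<noteq> 0) \<and> (\<Sum>i\<in>A. cst (c i) * f i) = 0"
proof (cases "inj_on f A")
  case True
  have dep: "mpv.dependent (f ` A)"
  proof (rule ccontr)
    assume ind: "mpv.independent (f ` A)"
    have "card (f ` A) \<le> card B"
      by (rule mpv.independent_span_bound[OF B(1) ind, THEN conjunct2]) (use B(3) in blast)
    then show False using B(2) True by (simp add: card_image)
  qed
  obtain u where u: "\<exists>v\<in>f ` A. u v \<noteq> 0" "(\<Sum>v\<in>f ` A. msc (u v) v) = 0"
    using mpv.dependent_finite[THEN iffD1, OF finite_imageI[OF A] dep] by blast
  show ?thesis
  proof (intro exI[of _ "\<lambda>i. u (f i)"] conjI)
    show "\<exists>i\<in>A. u (f i) \<noteq> 0" using u(1) by auto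
    show "(\<Sum>i\<in>A. cst (u (f i)) * f i) = 0"
      using u(2) True by (simp add: sum.reindex msc_def)
  qed
next
  case False
  then obtain i j where ij: "i \<in> A" "j \<in> A" "i \<noteq> j" "f i = f j" by (auto simp: inj_on_def)
  define c :: "'i \<Rightarrow> 'a" where "c k = (if k = i then 1 else if k = j then -1 else 0)" for k
  show ?thesis
  proof (intro exI[of _ c] conjI)
    show "\<exists>i\<in>A. c i \<noteq> 0" using ij by (auto simp: c_def)
    have "(\<Sum>k\<in>A. cst (c k) * f k) = (\<Sum>k\<in>{i, j}. cst (c k) * f k)"
      using ij A by (intro sum.mono_neutral_right) (auto simp: c_def)
    then show "(\<Sum>k\<in>A. cst (c k) * f k) = 0"
      using ij by (simp add: c_def single_uminus)
  qed
qed

lemma card_esz_le: "card {e :: 'v::finite \<Rightarrow> nat. esz e \<le> N} \<le> (N + 1) ^ CARD('v)"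
proof -
  have "{e :: 'v \<Rightarrow> nat. esz e \<le> N} \<subseteq> PiE UNIV (\<lambda>_. {..N})"
    using le_esz le_trans by (fastforce simp: PiE_UNIV_domain)
  then have "card {e :: 'v \<Rightarrow> nat. esz e \<le> N} \<le> card (PiE (UNIV :: 'v set) (\<lambda>_. {..N}))"
    by (intro card_mono finite_PiE) auto
  then show ?thesis by (simp add: card_PiE)
qed

lemma hmg_span_le:
  assumes "hmg k (p :: ('v::finite, 'a::field) mp)" "k \<le> N"
  shows "p \<in> mpv.span ((\<lambda>e. single e 1) ` {e. esz e \<le> N})"
proof -
  have "p \<in> mpv.span ((\<lambda>e. single e 1) ` {e. esz e \<le> k})"
    using subsetD[OF hmg_in_span, of p k] assms(1) by simp
  moreover have "mpv.span ((\<lambda>e. single e 1) ` {e. esz e \<le> k})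
      \<subseteq> mpv.span ((\<lambda>e. single e (1::'a)) ` {e :: 'v \<Rightarrow> nat. esz e \<le> N})"
    by (rule mpv.span_mono) (use assms(2) in auto)
  ultimately show ?thesis by blast
qed

text \<open>Counting: monomials in the forms with all exponents at most \<open>T\<close> outnumber
  the dimension of the polynomials of degree at most \<open>N\<close>, because there is one form
  more than there are variables.\<close>

lemma alg_dependent:
  fixes \<theta> :: "'v::finite option \<Rightarrow> ('v, rat) mp"
  assumes th: "\<And>i. hmg d (\<theta> i)"
  shows "\<exists>P. P \<noteq> 0 \<and> evh cst \<theta> P = 0"
proof -
  let ?n = "CARD('v)"
  \<comment> \<open>Chosen so that \<open>(N + 1) ^ ?n\<close> is at most
    \<open>T * (T + 1) ^ ?n\<close>, just below \<open>(T + 1) ^ (?n + 1)\<close>, the number of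
    monomials.\<close>
  define T where "T = (d * (?n + 1) + 1) ^ ?n"
  define A where "A = PiE (UNIV :: 'v option set) (\<lambda>_. {..T})"
  define N where "N = d * ((?n + 1) * T)"
  have fA: "finite A" unfolding A_def by (intro finite_PiE) auto
  have cA: "card A = (T + 1) ^ (?n + 1)" by (simp add: A_def card_PiE)
  let ?B = "(\<lambda>e :: 'v \<Rightarrow> nat. single e (1::rat)) ` {e. esz e \<le> N}"
  have "card ?B \<le> (N + 1) ^ ?n"
    using card_image_le[OF finite_esz, of "\<lambda>e :: 'v \<Rightarrow> nat. single e (1::rat)" N] card_esz_le[of N, where 'v='v] by linarith
  also have "\<dots> \<le> ((d * (?n + 1) + 1) * (T + 1)) ^ ?n"
    by (intro power_mono) (simp_all add: N_def algebra_simps)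
  also have "\<dots> = T * (T + 1) ^ ?n" by (simp only: T_def power_mult_distrib)
  also have "\<dots> < card A" by (simp add: cA)
  finally have cB: "card ?B < card A" .
  have sp: "mon \<theta> e \<in> mpv.span ?B" if "e \<in> A" for e
  proof (rule hmg_span_le)
    show "hmg (\<Sum>v\<in>UNIV. e v * d) (mon \<theta> e)"
      unfolding mon_def by (intro hmg_prod hmg_power th)
    have "esz e \<le> (\<Sum>v\<in>(UNIV :: 'v option set). T)"
      unfolding esz_def using that by (intro sum_mono) (auto simp: A_def PiE_def Pi_def)
    then have "esz e * d \<le> ((?n + 1) * T) * d" by (intro mult_right_mono) auto
    moreover have "(\<Sum>v\<in>UNIV. e v * d) = esz e * d" by (simp add: esz_def sum_distrib_right)
    ultimately show "(\<Sum>v\<in>UNIV. e v * d) \<le> N" unfolding N_def by (simp only: mult.commute)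
  qed
  have "\<exists>c. (\<exists>i\<in>A. c i \<noteq> 0) \<and> (\<Sum>i\<in>A. cst (c i) * mon \<theta> i) = 0"
    by (rule family_dependent[OF fA finite_imageI[OF finite_esz] cB]) (rule sp)
  then obtain c where c: "\<exists>i\<in>A. c i \<noteq> 0" "(\<Sum>i\<in>A. cst (c i) * mon \<theta> i) = 0"
    by (elim exE conjE)
  define P where "P = (\<Sum>e\<in>A. single e (c e))"
  have lP: "lookup P e = (if e \<in> A then c e else 0)" for e
    unfolding P_def lookup_sum using fA by (simp add: lookup_single when_def sum.delta)
  show ?thesis
  proof (intro exI[of _ P] conjI)
    show "P \<noteq> 0" using c(1) lP by (metis lookup_zero)
    show "evh cst \<theta> P = 0"
      using c(2) by (simp add: P_def evc.hom_sum evh_single)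
  qed
qed

lemma evh_diff_ideal:
  assumes "comm_ring_hom h" "\<And>v. s v - s' v \<in> mpi.span F"
  shows "evh h s p - evh h s' p \<in> mpi.span F"
proof -
  interpret h: comm_ring_hom h by fact
  have mulc: "x * y - x' * y' \<in> mpi.span F" if "x - x' \<in> mpi.span F" "y - y' \<in> mpi.span F" for x y x' y'
  proof -
    have "x * y - x' * y' = (x - x') * y + x' * (y - y')" by (simp add: algebra_simps)
    then show ?thesis using that by (simp add: mpi.span_add span_mult_left span_mult_right)
  qed
  have pw: "x ^ n - x' ^ n \<in> mpi.span F" if "x - x' \<in> mpi.span F" for x x' and n :: nat
    by (induction n) (auto simp: mpi.span_zero that intro: mulc)
  have pr: "prod f A - prod g A \<in> mpi.span F" if "\<And>i. i \<in> A \<Longrightarrow> f i - g i \<in> mpi.span F" for f g and A :: "'c set"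
    using that by (induction A rule: infinite_finite_induct) (auto simp: mpi.span_zero intro: mulc)
  have "h (lookup p e) * mon s e - h (lookup p e) * mon s' e \<in> mpi.span F" for e
    unfolding mon_def using span_mult_left[OF pr[OF pw[OF assms(2)]], of "h (lookup p e)"]
    by (simp add: right_diff_distrib)
  then show ?thesis unfolding evh_def sum_subtractf[symmetric] by (intro mpi.span_sum)
qed

lemma hmg_evc: 
  assumes "hmg t P" "\<And>v. hmg d (s v)"
  shows "hmg (t * d) (evh cst s P)"
  unfolding evh_def
proof (intro hmg_sum hmg_cst_mult)
  fix e assume "e \<in> keys P"
  then have "(\<Sum>v\<in>UNIV. e v * d) = t * d"
    using assms(1) by (simp add: hmg_def esz_def flip: sum_distrib_right)
  moreover have "hmg (\<Sum>v\<in>UNIV. e v * d) (mon s e)"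
    unfolding mon_def by (intro hmg_prod hmg_power assms(2))
  ultimately show "hmg (t * d) (mon s e)" by simp
qed

lemma hcomp_evc:
  assumes "\<And>v. hmg d (s v)" "d > 0"
  shows "hcomp (t * d) (evh cst s P) = evh cst s (hcomp t P)"
proof -
  have "hcomp (t * d) (evh cst s P) = (\<Sum>k\<le>mxd P + t. hcomp (t * d) (evh cst s (hcomp k P)))"
    using arg_cong[OF hcomp_decomp[of P "mxd P + t"], of "\<lambda>P. hcomp (t * d) (evh cst s P)"]
    by (simp add: evc.hom_sum hcomp_sum)
  also have "\<dots> = (\<Sum>k\<le>mxd P + t. if k = t then evh cst s (hcomp t P) else 0)"
    using assms(2) by (intro sum.cong refl) (auto simp: hcomp_hmg[OF hmg_evc[OF hmg_hcomp assms(1)]])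
  finally show ?thesis by (simp add: sum.delta)
qed

text \<open>One more form than there are variables: an algebraic relation makes one of them integral
  over linear combinations of the others.\<close>

lemma noether_step:
  fixes \<theta> :: "'v::finite option \<Rightarrow> ('v, rat) mp"
  assumes th: "\<And>i. hmg d (\<theta> i)" "d > 0" and V: "mpv.subspace V" "\<And>i. \<theta> i \<in> V"
  shows "\<exists>\<theta>' :: 'v \<Rightarrow> ('v, rat) mp. (\<forall>v. \<theta>' v \<in> V) \<and> (\<forall>i. inrad (range \<theta>') (\<theta> i))"
proof -
  obtain P0 where P0: "P0 \<noteq> 0" "evh cst \<theta> P0 = 0"
    using alg_dependent[of d \<theta>, OF th(1)] by (elim exE conjE)
  \<comment> \<open>All forms have the same positive degree, so the homogeneous components of a
    relation are relations.\<close>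
  have "\<exists>t. hcomp t P0 \<noteq> 0"
    using hcomp_decomp[of P0 "mxd P0"] P0(1) by (metis order_refl sum.neutral)
  then obtain t where t: "hcomp t P0 \<noteq> 0" by blast
  define P where "P = hcomp t P0"
  have P: "P \<noteq> 0" "evh cst \<theta> P = 0" "hmg t P"
    using t hcomp_evc[of d \<theta> t P0] th P0(2) by (auto simp: P_def)
  obtain x where x: "ev (\<lambda>v. of_nat (x v)) P \<noteq> 0" using mp_nonzero_point[OF P(1)] by blast
  define a :: "'v option \<Rightarrow> rat" where "a = (\<lambda>v. of_nat (x v))"
  have aP: "ev a P \<noteq> 0" using x by (simp add: a_def)
  \<comment> \<open>If \<open>a\<close> were 0, the relation \<open>P\<close> would be a nonzero
    constant, yet it vanishes at the forms.\<close>
  have "\<exists>j. a j \<noteq> 0"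
  proof (rule ccontr)
    assume "\<not> ?thesis"
    then have "a = (\<lambda>v. 0 * 1)" by (simp add: fun_eq_iff)
    then have "ev (\<lambda>v. 0 * 1) P \<noteq> 0" using aP by simp
    then have "(0::rat) ^ t \<noteq> 0" using hmg_evh[OF P(3) id_hom', of 0 "\<lambda>_. 1"] by auto
    then have "t = 0" by (cases t) auto
    then have "keys P \<subseteq> {0}" using P(3) by (auto simp: hmg_def esz_def fun_eq_iff)
    then have "P = cst (lookup P 0)"
      by (intro poly_mapping_eqI) (auto simp: lookup_single when_def in_keys_iff)
    then have "evh cst \<theta> P = cst (lookup P 0)" by (metis evh_cst_simps(2))
    then have "lookup P 0 = 0" using P(2) by (metis lookup_single_eq lookup_zero)
    then have "P = 0" using \<open>P = cst (lookup P 0)\<close> by (metis single_zero)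
    then show False using P(1) by simp
  qed
  then obtain j where j: "a j \<noteq> 0" by blast
  define b where "b i = a i / a j" for i
  have "card (UNIV - {j}) = CARD('v)" by (simp add: card_Diff_singleton)
  then obtain g where g: "bij_betw g (UNIV :: 'v set) (UNIV - {j})"
    using finite_same_card_bij[of "UNIV :: 'v set" "UNIV - {j}"] by auto
  \<comment> \<open>Modulo these forms \<theta> i is congruent to
    \<open>cst (b i) * \<theta> j\<close> for every \<open>i\<close>. The homogeneous relation
    becomes \<open>\<theta> j ^ t * cst (ev b P)\<close>, and the constant is invertible.\<close>
  define \<theta>' where "\<theta>' v = \<theta> (g v) - cst (b (g v)) * \<theta> j" for v
  let ?I = "mpi.span (range \<theta>')"
  have diff: "\<theta> i - cst (b i) * \<theta> j \<in> ?I" for i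
  proof (cases "i = j")
    case True
    then show ?thesis using j by (simp add: b_def mpi.span_zero)
  next
    case False
    then obtain v where "i = g v" using g by (auto simp: bij_betw_def)
    then show ?thesis by (auto simp: \<theta>'_def intro!: mpi.span_base)
  qed
  have "evh cst \<theta> P - evh cst (\<lambda>i. cst (b i) * \<theta> j) P \<in> ?I"
    by (rule evh_diff_ideal[OF cst_hom diff])
  then have "evh cst (\<lambda>i. \<theta> j * cst (b i)) P \<in> ?I"
    using mpi.span_neg by (fastforce simp: P(2) mult.commute)
  also have "evh cst (\<lambda>i. \<theta> j * cst (b i)) P = \<theta> j ^ t * evh cst (\<lambda>i. cst (b i)) P"
    by (rule hmg_evh[OF P(3) cst_hom])
  also have "evh cst (\<lambda>i. cst (b i)) P = (cst (ev b P) :: ('v, rat) mp)"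
    by (rule hom_evh[OF cst_hom, symmetric])
  finally have "\<theta> j ^ t * cst (ev b P) \<in> ?I" .
  then have "\<theta> j ^ t * cst (ev b P) * cst (inverse (ev b P)) \<in> ?I" by (rule span_mult_right)
  moreover have "ev b P \<noteq> 0"
  proof -
    have "a = (\<lambda>v. a j * b v)" using j by (simp add: b_def)
    then have "ev a P = a j ^ t * ev b P" using hmg_evh[OF P(3) id_hom', of "a j" b] by simp
    then show ?thesis using aP by auto
  qed
  ultimately have "\<theta> j ^ t \<in> ?I" by (simp add: mult.assoc mult_single)
  then have rj: "inrad (range \<theta>') (\<theta> j)" by (auto simp: inrad_def)
  have "inrad (range \<theta>') (\<theta> i)" for i
    using inrad_add[OF inrad_span[OF diff[of i]] inrad_mult[OF rj, of "cst (b i)"]] by simp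
  moreover have "\<theta>' v \<in> V" for v
    unfolding \<theta>'_def using V by (intro mpv.subspace_diff subspace_cst_mult)
  ultimately show ?thesis by blast
qed

text \<open>The induction starts with all forms 0. Each new element of \<open>F\<close> joins the
  current forms as the one in excess, and \<open>noether_step\<close> restores their number;
  membership in radicals is transitive, so the elements treated before are kept.\<close>

lemma noether_normalization:
  assumes "finite F" "mpv.subspace V" "F \<subseteq> V" "V \<subseteq> {p :: ('v::finite, rat) mp. hmg d p}" "d > 0"
  shows "\<exists>\<theta> :: 'v \<Rightarrow> ('v, rat) mp. (\<forall>v. \<theta> v \<in> V) \<and> (\<forall>x\<in>F. inrad (range \<theta>) x)"
  using assms(1,3)
proof induction
  case empty
  then show ?case using mpv.subspace_0[OF assms(2)] by (intro exI[of _ "\<lambda>_. 0"]) simp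
next
  case (insert x F)
  then obtain \<theta> :: "'v \<Rightarrow> ('v, rat) mp" where th: "\<And>v. \<theta> v \<in> V" "\<And>x. x \<in> F \<Longrightarrow> inrad (range \<theta>) x" by auto
  define \<eta> where "\<eta> i = (case i of None \<Rightarrow> x | Some v \<Rightarrow> \<theta> v)" for i
  have e: "\<eta> i \<in> V" for i using insert th by (auto simp: \<eta>_def split: option.splits)
  have "hmg d (\<eta> i)" for i using e[of i] assms(4) by auto
  from noether_step[of d \<eta> V, OF this assms(5,2) e]
  obtain \<theta>' :: "'v \<Rightarrow> ('v, rat) mp" where
    "(\<forall>v. \<theta>' v \<in> V) \<and> (\<forall>i. inrad (range \<theta>') (\<eta> i))" by (rule exE)
  then have th': "\<And>v. \<theta>' v \<in> V" "\<And>i. inrad (range \<theta>') (\<eta> i)" by simp_all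
  have "inrad (range \<theta>') x" using th'(2)[of None] by (simp add: \<eta>_def)
  moreover have "inrad (range \<theta>') y" if "y \<in> F" for y
  proof (rule inrad_trans'[OF th(2)[OF that]])
    fix a assume "a \<in> range \<theta>"
    then obtain v where "a = \<eta> (Some v)" by (auto simp: \<eta>_def)
    then show "inrad (range \<theta>') a" using th'(2) by simp
  qed
  ultimately show ?case using th'(1) by blast
qed

section \<open>Invariants in the ideal of parameters\<close>

lemma ispan_rep:
  assumes "finite A" "h \<in> mpi.span A"
  shows "\<exists>u. h = (\<Sum>a\<in>A. a * u a)"
proof -
  from assms obtain u where "h = (\<Sum>a\<in>A. rsc (u a) a)"
    by (auto simp: mpi.span_finite)
  then show ?thesis by (intro exI[of _ u]) (simp add: rsc_def mult.commute)
qed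

lemma ispan_sumI: "(\<And>a. a \<in> A \<Longrightarrow> g a \<in> B) \<Longrightarrow> (\<Sum>a\<in>A. g a * u a) \<in> mpi.span B"
  by (intro mpi.span_sum span_mult_right mpi.span_base)

text \<open>Modulo the ideal of \<open>A\<close>, an invariant is a multiple of \<open>x\<close>,
  and \<open>reynolds\<close> makes the cofactor an invariant to which the same applies. Repeating
  this \<open>n\<close> times leaves a multiple of \<open>x ^ n\<close>, which is in the ideal. Each
  round costs \<open>dg x\<close> in the degree.\<close>

lemma elim_step:
  assumes sym: "\<And>L. L \<in> \<Gamma> \<Longrightarrow> transp L \<in> \<Gamma>"
    and A: "finite A" "\<And>a. a \<in> insert x A \<Longrightarrow> a \<in> Inv \<Gamma> \<and> hmg (dg a) a"
    and n: "x ^ n \<in> mpi.span A"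
    and M: "\<And>j f. M \<le> j \<Longrightarrow> f \<in> Inv \<Gamma> \<Longrightarrow> hmg j f \<Longrightarrow> f \<in> mpi.span (insert x A)"
  shows "\<exists>M'. \<forall>j\<ge>M'. \<forall>f\<in>Inv \<Gamma>. hmg j f \<longrightarrow> f \<in> mpi.span A"
proof (cases "x \<in> A")
  case True
  then show ?thesis using M by (auto simp: insert_absorb)
next
  case False
  have step: "\<exists>h\<in>Inv \<Gamma>. hmg (j - k * dg x) h \<and> f - x ^ k * h \<in> mpi.span A"
    if "f \<in> Inv \<Gamma>" "hmg j f" "M + k * dg x \<le> j" for f j k
    using that(3)
  proof (induction k)
    case 0
    then show ?case using that by (intro bexI[of _ f]) (auto simp: mpi.span_zero)
  next
    case (Suc k)
    then obtain h where h: "h \<in> Inv \<Gamma>" "hmg (j - k * dg x) h" "f - x ^ k * h \<in> mpi.span A" by auto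
    have "h \<in> mpi.span (insert x A)" using Suc.prems h by (intro M[of "j - k * dg x"]) auto
    then obtain u where u: "h = (\<Sum>a\<in>insert x A. a * u a)" using ispan_rep A(1) by blast
    obtain h' where h': "\<forall>i. h' i \<in> Inv \<Gamma> \<and> hmg (j - k * dg x - dg i) (h' i) \<and> (j - k * dg x < dg i \<longrightarrow> h' i = 0)"
      "h = (\<Sum>a\<in>insert x A. a * h' a)"
      using reynolds[of \<Gamma> h _ "insert x A" "\<lambda>a. a" dg u, OF sym h(1,2) A(2) u] by auto
    have "h = x * h' x + (\<Sum>a\<in>A. a * h' a)" using h'(2) A(1) False by simp
    then have "f - x ^ Suc k * h' x = (f - x ^ k * h) + x ^ k * (\<Sum>a\<in>A. a * h' a)"
      by (simp add: algebra_simps)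
    moreover have "\<dots> \<in> mpi.span A"
      by (intro mpi.span_add h(3) span_mult_left ispan_sumI)
    ultimately have "f - x ^ Suc k * h' x \<in> mpi.span A" by (simp only:)
    moreover have "j - Suc k * dg x = j - k * dg x - dg x" by simp
    ultimately show ?case using h'(1)[rule_format, of x] by (intro bexI[of _ "h' x"]) auto
  qed
  show ?thesis
  proof (intro exI[of _ "M + n * dg x"] allI impI ballI)
    fix j f assume "M + n * dg x \<le> j" "f \<in> Inv \<Gamma>" "hmg j f"
    from step[OF this(2,3,1)] obtain h where "f - x ^ n * h \<in> mpi.span A" by auto
    from mpi.span_add[OF this span_mult_right[OF n, of h]] show "f \<in> mpi.span A" by simp
  qed
qed

text \<open>The elements of \<open>F\<close> are discarded one at a time from the generators
  \<open>range \<theta> \<union> F\<close>, each by \<open>elim_step\<close>, since each lies in the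
  radical of the parameters.\<close>

lemma finite_over_parameters:
  fixes \<theta> :: "'v::finite \<Rightarrow> ('v, rat) mp"
  assumes sym: "\<And>L. L \<in> \<Gamma> \<Longrightarrow> transp L \<in> \<Gamma>"
    and F: "finite F" "\<And>x. x \<in> F \<Longrightarrow> x \<in> Inv \<Gamma> \<and> (\<exists>k. hmg k x)"
    and gen: "\<And>j f. 0 < j \<Longrightarrow> f \<in> Inv \<Gamma> \<Longrightarrow> hmg j f \<Longrightarrow> f \<in> mpi.span F"
    and th: "\<And>v. \<theta> v \<in> Inv \<Gamma> \<and> hmg d (\<theta> v)"
    and rad: "\<And>x. x \<in> F \<Longrightarrow> inrad (range \<theta>) x"
  shows "\<exists>M. \<forall>j\<ge>M. \<forall>f\<in>Inv \<Gamma>. hmg j f \<longrightarrow> f \<in> mpi.span (range \<theta>)"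
proof -
  define dg where "dg a = (SOME k. hmg k a)" for a :: "('v, rat) mp"
  have dg: "hmg (dg a) a" if "\<exists>k. hmg k a" for a unfolding dg_def using that by (rule someI_ex)
  have "\<exists>M. \<forall>j\<ge>M. \<forall>f\<in>Inv \<Gamma>. hmg j f \<longrightarrow> f \<in> mpi.span (range \<theta> \<union> (F - E))" if "finite E" "E \<subseteq> F" for E
    using that
  proof (induction E)
    case empty
    have "f \<in> mpi.span (range \<theta> \<union> F)" if "1 \<le> j" "f \<in> Inv \<Gamma>" "hmg j f" for j f
      using gen[of j f] that mpi.span_mono[of F "range \<theta> \<union> F"] by auto
    then show ?case by (intro exI[of _ 1]) auto
  next
    case (insert x E)
    then obtain M where M: "\<And>j f. M \<le> j \<Longrightarrow> f \<in> Inv \<Gamma> \<Longrightarrow> hmg j f \<Longrightarrow> f \<in> mpi.span (range \<theta> \<union> (F - E))"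
      by auto
    let ?A = "range \<theta> \<union> (F - insert x E)"
    have eq: "range \<theta> \<union> (F - E) = insert x ?A" using insert by auto
    have A: "finite ?A" using F(1) by simp
    have "inrad (range \<theta>) x" using rad insert by auto
    then obtain n where "x ^ n \<in> mpi.span (range \<theta>)" by (auto simp: inrad_def)
    then have n: "x ^ n \<in> mpi.span ?A" using mpi.span_mono[of "range \<theta>" ?A] by auto
    have "a \<in> Inv \<Gamma> \<and> hmg (dg a) a" if "a \<in> insert x ?A" for a
    proof -
      have "a \<in> Inv \<Gamma> \<and> (\<exists>k. hmg k a)" using that F(2) th insert by auto
      then show ?thesis using dg by simp
    qed
    from elim_step[OF sym A this n M[unfolded eq]] show ?case by simp
  qed
  from this[OF F(1) order_refl] show ?thesis by simp
qed

section \<open>Integral combinations and reduction modulo a prime\<close>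

definition zs :: "int \<Rightarrow> ('v::finite, rat) mp \<Rightarrow> ('v, rat) mp" where
  "zs c p = of_int c * p"

interpretation mpz: Modules.module "zs :: int \<Rightarrow> ('v::finite, rat) mp \<Rightarrow> ('v, rat) mp"
  by unfold_locales (simp_all add: zs_def ring_distribs mult.assoc)

lemma zspan_nat_mult: "x \<in> mpz.span S \<Longrightarrow> of_nat n * x \<in> mpz.span S"
  using mpz.span_scale[of x S "int n"] by (simp add: zs_def)

lemma clear_denom:
  assumes "x \<in> mpv.span (S :: ('v::finite, rat) mp set)"
  shows "\<exists>D>0. of_nat D * x \<in> mpz.span S"
  using assms
proof (induction rule: mpv.span_induct_alt)
  case base
  show ?case by (intro exI[of _ 1]) (simp add: mpz.span_zero)
next
  case (step c x y)
  then obtain D where D: "D > 0" "of_nat D * y \<in> mpz.span S" by auto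
  obtain a b where ab: "c = of_int a / of_int b" "b > 0" by (metis Fract_of_int_quotient Rat_cases)
  define n where "n = nat b"
  have n: "n > 0" "of_int b = (of_nat n :: rat)" using ab by (auto simp: n_def)
  have e: "of_nat (n * D) * c = of_int (a * int D)" using n ab(1) by simp
  have "of_nat (n * D) * cst c = cst (of_nat (n * D) * c)"
    unfolding single_of_nat[symmetric] mult_single by simp
  also have "\<dots> = of_int (a * int D)" unfolding e by (rule single_of_int)
  finally have e2: "of_nat (n * D) * (cst c :: ('v, rat) mp) = of_int (a * int D)" .
  have "of_nat (n * D) * (cst c * x) = zs (a * int D) x"
    unfolding zs_def e2[symmetric] by (rule mult.assoc[symmetric])
  then have "of_nat (n * D) * (msc c x + y) = zs (a * int D) x + of_nat n * (of_nat D * y)"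
    by (simp add: msc_def ring_distribs mult.assoc)
  moreover have "zs (a * int D) x + of_nat n * (of_nat D * y) \<in> mpz.span S"
    by (intro mpz.span_add mpz.span_scale mpz.span_base step.hyps zspan_nat_mult D)
  ultimately have "of_nat (n * D) * (msc c x + y) \<in> mpz.span S" by (simp only:)
  then show ?case using n D by (intro exI[of _ "n * D"]) simp
qed

lemma clear_denom_finite:
  assumes "finite X" "\<And>x. x \<in> X \<Longrightarrow> g x \<in> mpv.span (S x :: ('v::finite, rat) mp set)"
  shows "\<exists>D>0. \<forall>x\<in>X. of_nat D * g x \<in> mpz.span (S x)"
  using assms
proof (induction X)
  case empty
  show ?case by (intro exI[of _ 1]) simp
next
  case (insert x X)
  then obtain D where D: "D > 0" "\<And>y. y \<in> X \<Longrightarrow> of_nat D * g y \<in> mpz.span (S y)" by auto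
  obtain D' where D': "D' > 0" "of_nat D' * g x \<in> mpz.span (S x)"
    using clear_denom[of "g x" "S x"] insert.prems[of x] by auto
  have "of_nat (D * D') * g y \<in> mpz.span (S y)" if "y \<in> insert x X" for y
  proof -
    have e: "of_nat (D * D') * g y = of_nat D' * (of_nat D * g y)"
      "of_nat (D * D') * g y = of_nat D * (of_nat D' * g y)"
      by (simp_all add: mult_ac)
    show ?thesis
    proof (cases "y = x")
      case True
      then show ?thesis unfolding e(2) unfolding True by (intro zspan_nat_mult[OF D'(2)])
    next
      case False
      then show ?thesis unfolding e(1) using that by (intro zspan_nat_mult[OF D(2)]) simp
    qed
  qed
  then show ?case using D D' by (intro exI[of _ "D * D'"]) simp
qed

definition intc :: "('v::finite, rat) mp \<Rightarrow> bool" where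
  "intc p \<longleftrightarrow> (\<forall>e. lookup p e \<in> \<int>)"

lemma intc_0 [simp]: "intc 0" by (simp add: intc_def)
lemma intc_single: "c \<in> \<int> \<Longrightarrow> intc (single e c)" by (simp add: intc_def lookup_single when_def)
lemma intc_1 [simp]: "intc 1" using intc_single[of 1 0] by simp
lemma intc_add: "intc p \<Longrightarrow> intc q \<Longrightarrow> intc (p + q)" by (simp add: intc_def lookup_add)
lemma intc_diff: "intc p \<Longrightarrow> intc q \<Longrightarrow> intc (p - q)" by (simp add: intc_def lookup_minus)
lemma intc_mult: "intc p \<Longrightarrow> intc q \<Longrightarrow> intc (p * q)"
  by (auto simp: intc_def lookup_mult' intro!: Ints_sum)
lemma intc_sum: "(\<And>i. i \<in> I \<Longrightarrow> intc (f i)) \<Longrightarrow> intc (sum f I)"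
  by (induction I rule: infinite_finite_induct) (auto intro: intc_add)
lemma intc_prod: "(\<And>i. i \<in> I \<Longrightarrow> intc (f i)) \<Longrightarrow> intc (prod f I)"
  by (induction I rule: infinite_finite_induct) (auto intro: intc_mult)
lemma intc_power: "intc p \<Longrightarrow> intc (p ^ n)"
  by (induction n) (auto intro: intc_mult)
lemma intc_mon: "(\<And>v. intc (s v)) \<Longrightarrow> intc (mon s e)"
  unfolding mon_def by (intro intc_prod intc_power)
lemma intc_of_nat: "intc (of_nat n)"
  by (induction n) (auto intro: intc_add)

lemma lookup_of_nat_mult: "lookup (of_nat n * p) e = of_nat n * lookup (p :: ('v::finite, 'a::comm_ring_1) mp) e"
  using lookup_cst_mult[of "of_nat n" p e] by simp

lemma intc_scale: "\<exists>c>0. intc (of_nat c * p)"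
proof -
  have "\<exists>c>0. \<forall>e\<in>S. of_nat c * lookup p e \<in> \<int>" if "finite S" for S
    using that
  proof induction
    case (insert e S)
    then obtain c where c: "c > 0" "\<And>e. e \<in> S \<Longrightarrow> of_nat c * lookup p e \<in> \<int>" by auto
    obtain a b where ab: "lookup p e = of_int a / of_int b" "b > 0" by (metis Fract_of_int_quotient Rat_cases)
    define n where "n = nat b"
    have n: "n > 0" "of_int b = (of_nat n :: rat)" using ab by (auto simp: n_def)
    have "of_nat (n * c) * lookup p e' \<in> \<int>" if "e' \<in> insert e S" for e'
    proof (cases "e' = e")
      case True
      have "of_nat (n * c) * lookup p e = of_int (int c * a)" using n ab by simp
      then show ?thesis using True by (metis Ints_of_int)
    next
      case False
      then have "of_nat n * (of_nat c * lookup p e') \<in> \<int>" using c(2)[of e'] that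
        by (intro Ints_mult[OF Ints_of_nat, of "of_nat c * lookup p e'"]) auto
      moreover have "of_nat (n * c) * lookup p e' = of_nat n * (of_nat c * lookup p e')" by simp
      ultimately show ?thesis by (simp only:)
    qed
    then show ?case using n c by (intro exI[of _ "n * c"]) simp
  qed (auto intro: exI[of _ 1])
  from this[of "keys p"] obtain c where c: "c > 0" "\<And>e. e \<in> keys p \<Longrightarrow> of_nat c * lookup p e \<in> \<int>" by auto
  have "of_nat c * lookup p e \<in> \<int>" for e
    using c(2)[of e] by (cases "e \<in> keys p") (auto simp: in_keys_iff)
  then have "intc (of_nat c * p)" unfolding intc_def lookup_of_nat_mult by simp
  then show ?thesis using c(1) by (intro exI[of _ c]) simp
qed

lemma intc_nat_mult: "intc p \<Longrightarrow> intc (of_nat n * p)"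
  by (intro intc_mult intc_of_nat)

text \<open>Modulo \<open>p\<close> this agrees with \<open>f ^ p\<close>.\<close>

definition frob :: "nat \<Rightarrow> ('v::finite, rat) mp \<Rightarrow> ('v, rat) mp" where
  "frob p f = evh cst (\<lambda>v. Xv v ^ p) f"

lemma frob_eq: "frob p f = (\<Sum>e\<in>keys f. single (\<lambda>v. p * e v) (lookup f e))"
proof -
  have "mon (\<lambda>v. Xv v ^ p :: ('a, rat) mp) e = single (\<lambda>v. p * e v) 1" for e
  proof -
    have "mon (\<lambda>v. Xv v ^ p :: ('a, rat) mp) e = mon Xv (\<lambda>v. p * e v)"
      by (simp add: mon_def power_mult)
    then show ?thesis using single_eq_mon[of "\<lambda>v. p * e v" "1::rat"] by simp
  qed
  then show ?thesis by (simp add: frob_def evh_def mult_single)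
qed

lemma power_p_add:
  assumes "prime p" "intc x" "intc y"
  shows "\<exists>z. intc z \<and> (x + y) ^ p = x ^ p + y ^ p + of_nat p * z"
proof -
  define z where "z = (\<Sum>k\<in>{1..<p}. of_nat ((p choose k) div p) * x ^ k * y ^ (p - k))"
  have p: "p > 0" using assms(1) by (simp add: prime_gt_0_nat)
  have "(x + y) ^ p = (\<Sum>k\<le>p. of_nat (p choose k) * x ^ k * y ^ (p - k))"
    by (rule binomial_ring)
  also have "{..p} = insert 0 (insert p {1..<p})" using p by auto
  also have "(\<Sum>k\<in>insert 0 (insert p {1..<p}). of_nat (p choose k) * x ^ k * y ^ (p - k))
     = x ^ p + y ^ p + (\<Sum>k\<in>{1..<p}. of_nat (p choose k) * x ^ k * y ^ (p - k))"
    using p by simp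
  also have "(\<Sum>k\<in>{1..<p}. of_nat (p choose k) * x ^ k * y ^ (p - k)) = of_nat p * z"
    unfolding z_def sum_distrib_left
  proof (intro sum.cong refl)
    fix k assume "k \<in> {1..<p}"
    then have "p dvd (p choose k)" using assms(1) by (intro dvd_choose_prime) auto
    then have "(of_nat (p choose k) :: ('a, rat) mp) = of_nat p * of_nat ((p choose k) div p)"
      by (metis dvd_mult_div_cancel of_nat_mult)
    then show "of_nat (p choose k) * x ^ k * y ^ (p - k) = of_nat p * (of_nat ((p choose k) div p) * x ^ k * y ^ (p - k))"
      by (simp add: mult.assoc)
  qed
  finally show ?thesis
    using assms by (intro exI[of _ z]) (auto simp: z_def intro!: intc_sum intc_mult intc_power intc_of_nat)
qed

lemma fermat_rat: "prime p \<Longrightarrow> c \<in> \<int> \<Longrightarrow> \<exists>t\<in>\<int>. (c::rat) ^ p = c + of_nat p * t"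
proof -
  assume p: "prime p" and "c \<in> \<int>"
  then obtain a where a: "c = of_int a" by (auto elim: Ints_cases)
  have pos: "\<exists>t. (int n) ^ p = int n + int p * t" for n
  proof (induction n)
    case 0
    then show ?case using p by (intro exI[of _ 0]) (simp add: prime_gt_0_nat zero_power)
  next
    case (Suc n)
    then obtain t where t: "int n ^ p = int n + int p * t" by auto
    have "int p dvd (int n + 1) ^ p - (int n ^ p + 1)"
    proof -
      have p0: "p > 0" using p by (simp add: prime_gt_0_nat)
      have "(int n + 1) ^ p = (\<Sum>k\<le>p. of_nat (p choose k) * int n ^ k)"
        by (simp add: binomial_ring)
      also have "{..p} = insert 0 (insert p {1..<p})" using p0 by auto
      finally have "(int n + 1) ^ p - (int n ^ p + 1) = (\<Sum>k\<in>{1..<p}. of_nat (p choose k) * int n ^ k)"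
        using p0 by simp
      also have "int p dvd \<dots>"
        using p by (intro dvd_sum dvd_mult2) (auto simp: int_dvd_int_iff intro!: dvd_choose_prime)
      finally show ?thesis .
    qed
    then obtain s where "(int n + 1) ^ p - (int n ^ p + 1) = int p * s" by (auto simp: dvd_def)
    then have "int (Suc n) ^ p = int (Suc n) + int p * (t + s)" by (simp add: t algebra_simps)
    then show ?case by blast
  qed
  have "\<exists>t. a ^ p = a + int p * t"
  proof -
    \<comment> \<open>A multiple of \<open>p\<close> moves \<open>a\<close> into the natural numbers
      without changing its class.\<close>
    obtain n where n: "a = int n - int p * (abs a)"
    proof -
      have "a + int p * abs a \<ge> 0" using p
        by (smt (verit) mult_le_cancel_right1 of_nat_0_less_iff prime_gt_0_nat int_one_le_iff_zero_less)
      then have "a = int (nat (a + int p * abs a)) - int p * abs a" by simp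
      then show ?thesis by (rule that)
    qed
    obtain t where "int n ^ p = int n + int p * t" using pos by blast
    moreover have "int p dvd int n ^ p - a ^ p"
    proof -
      have "int n - a = int p * abs a" using n by simp
      then have "int p dvd int n - a" by simp
      moreover have "int n - a dvd int n ^ p - a ^ p" by (simp add: power_diff_sumr2)
      ultimately show ?thesis by (rule dvd_trans)
    qed
    then obtain s where "int n ^ p - a ^ p = int p * s" by (auto simp: dvd_def)
    ultimately have "a ^ p = a + int p * (t + abs a - s)" using n by (simp add: algebra_simps)
    then show ?thesis by blast
  qed
  then obtain t where "a ^ p = a + int p * t" by blast
  then have "c ^ p = c + of_nat p * of_int t" unfolding a by (metis of_int_add of_int_mult of_int_of_nat_eq of_int_power)
  then show ?thesis by auto
qed

lemma power_p_frob:
  assumes "prime p" "intc f"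
  shows "\<exists>z. intc z \<and> f ^ p = frob p f + of_nat p * z"
proof -
  have sp: "\<exists>z. intc z \<and> single e c ^ p = single (\<lambda>v. p * e v) c + of_nat p * z" if c: "c \<in> \<int>"
    for e :: "'a \<Rightarrow> nat" and c
  proof -
    have pw: "single e c ^ n = single (\<lambda>v. n * e v) (c ^ n)" for n
    proof (induction n)
      case 0
      then show ?case by (simp add: zero_fun_def[symmetric])
    next
      case (Suc n)
      have "e + (\<lambda>v. n * e v) = (\<lambda>v. Suc n * e v)" by (simp add: fun_eq_iff)
      then show ?case using Suc by (simp add: mult_single)
    qed
    obtain t where t: "t \<in> \<int>" "c ^ p = c + of_nat p * t" using fermat_rat[OF assms(1) c] by auto
    have "of_nat p * single (\<lambda>v. p * e v) t = single (\<lambda>v. p * e v) (of_nat p * t)"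
      unfolding single_of_nat[symmetric] mult_single by simp
    then have "single e c ^ p = single (\<lambda>v. p * e v) c + of_nat p * single (\<lambda>v. p * e v) t"
      unfolding pw t(2) by (simp add: single_add)
    then show ?thesis using t(1) by (intro exI[of _ "single (\<lambda>v. p * e v) t"]) (simp add: intc_single)
  qed
  have "\<exists>z. intc z \<and> (\<Sum>e\<in>S. single e (lookup f e)) ^ p = (\<Sum>e\<in>S. single (\<lambda>v. p * e v) (lookup f e)) + of_nat p * z"
    if "finite S" for S
    using that
  proof induction
    case empty
    then show ?case using assms(1) by (intro exI[of _ 0]) (simp add: prime_gt_0_nat zero_power)
  next
    case (insert e S)
    let ?x = "single e (lookup f e)" and ?y = "\<Sum>e\<in>S. single e (lookup f e)"
    have ix: "lookup f e \<in> \<int>" for e using assms(2) by (simp add: intc_def)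
    obtain z1 where z1: "intc z1" "?y ^ p = (\<Sum>e\<in>S. single (\<lambda>v. p * e v) (lookup f e)) + of_nat p * z1"
      using insert by auto
    obtain z2 where z2: "intc z2" "?x ^ p = single (\<lambda>v. p * e v) (lookup f e) + of_nat p * z2"
      using sp[OF ix] by auto
    have "intc ?x" "intc ?y" using ix by (auto intro: intc_sum intc_single)
    from power_p_add[OF assms(1) this] obtain z3 where z3: "intc z3" "(?x + ?y) ^ p = ?x ^ p + ?y ^ p + of_nat p * z3" by auto
    show ?case
      using insert(1,2) z1 z2 z3 by (intro exI[of _ "z1 + z2 + z3"]) (auto simp: algebra_simps intro: intc_add)
  qed
  from this[of "keys f"] show ?thesis
    by (simp add: frob_eq flip: mp_expand)
qed

text \<open>Linear over the \<open>p\<close>-th powers of the variables.\<close>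

definition extr :: "nat \<Rightarrow> ('v::finite \<Rightarrow> nat) \<Rightarrow> ('v, rat) mp \<Rightarrow> ('v, rat) mp" where
  "extr p \<alpha> u = (\<Sum>e\<in>{e\<in>keys u. \<forall>v. e v mod p = \<alpha> v}. single (\<lambda>v. e v div p) (lookup u e))"

lemma lookup_extr:
  assumes "\<And>v. \<alpha> v < p"
  shows "lookup (extr p \<alpha> u) \<beta> = lookup u (\<lambda>v. \<alpha> v + p * \<beta> v)"
proof -
  let ?k = "\<lambda>v. \<alpha> v + p * \<beta> v"
  have "p > 0" using assms[of undefined] by simp
  have *: "(\<lambda>v. e v div p) = \<beta> \<longleftrightarrow> e = ?k" if "\<forall>v. e v mod p = \<alpha> v" for e
  proof
    assume b: "(\<lambda>v. e v div p) = \<beta>"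
    show "e = ?k"
    proof
      fix v show "e v = \<alpha> v + p * \<beta> v"
        using that[rule_format, of v] fun_cong[OF b, of v] mod_mult_div_eq[of "e v" p] by simp
    qed
  qed (use assms \<open>p > 0\<close> in \<open>auto simp: fun_eq_iff\<close>)
  have "lookup (extr p \<alpha> u) \<beta> = (\<Sum>e\<in>{e\<in>keys u. \<forall>v. e v mod p = \<alpha> v}. if e = ?k then lookup u ?k else 0)"
    unfolding extr_def lookup_sum by (intro sum.cong refl) (use * in \<open>auto simp: lookup_single when_def\<close>)
  also have "\<dots> = lookup u ?k"
    using assms by (simp add: sum.delta in_keys_iff)
  finally show ?thesis .
qed

lemma extr_add: "(\<And>v. \<alpha> v < p) \<Longrightarrow> extr p \<alpha> (u + w) = extr p \<alpha> u + extr p \<alpha> w"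
  by (rule poly_mapping_eqI) (simp add: lookup_extr lookup_add)

lemma extr_sum: "(\<And>v. \<alpha> v < p) \<Longrightarrow> extr p \<alpha> (sum f I) = (\<Sum>i\<in>I. extr p \<alpha> (f i))"
  by (rule poly_mapping_eqI) (simp add: lookup_extr lookup_sum)

lemma extr_cst: "(\<And>v. \<alpha> v < p) \<Longrightarrow> extr p \<alpha> (cst c * u) = cst c * extr p \<alpha> u"
  by (rule poly_mapping_eqI) (simp add: lookup_extr)

lemma intc_extr: "(\<And>v. \<alpha> v < p) \<Longrightarrow> intc u \<Longrightarrow> intc (extr p \<alpha> u)"
  by (simp add: intc_def lookup_extr)

lemma lookup_single_mult_0:
  "(\<And>k'. e + k' \<noteq> k) \<Longrightarrow> lookup (single e c * q) k = (0::rat)"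
  by (simp add: lookup_single_mult)

text \<open>All exponents of \<open>frob p f\<close> are divisible by \<open>p\<close>, so
  multiplication by it does not mix the residue classes of exponents modulo \<open>p\<close>.
  Extraction divides these exponents by \<open>p\<close> again and turns \<open>frob p f\<close>
  back into \<open>f\<close>.\<close>

lemma extr_frob:
  assumes a: "\<And>v. \<alpha> v < p"
  shows "extr p \<alpha> (frob p f * u) = f * extr p \<alpha> u"
proof -
  have "p > 0" using a[of undefined] by simp
  have s: "extr p \<alpha> (single (\<lambda>v. p * e v) c * u) = single e c * extr p \<alpha> u" for e c
  proof (rule poly_mapping_eqI)
    fix \<beta>
    let ?k = "\<lambda>v. \<alpha> v + p * \<beta> v"
    show "lookup (extr p \<alpha> (single (\<lambda>v. p * e v) c * u)) \<beta> = lookup (single e c * extr p \<alpha> u) \<beta>"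
    proof (cases "\<forall>v. e v \<le> \<beta> v")
      case True
      define \<gamma> where "\<gamma> v = \<beta> v - e v" for v
      have b: "\<beta> = e + \<gamma>" using True by (auto simp: \<gamma>_def fun_eq_iff)
      have k: "?k = (\<lambda>v. p * e v) + (\<lambda>v. \<alpha> v + p * \<gamma> v)" by (simp add: b fun_eq_iff algebra_simps)
      have "lookup (extr p \<alpha> (single (\<lambda>v. p * e v) c * u)) \<beta> = lookup (single (\<lambda>v. p * e v) c * u) ?k"
        using a by (rule lookup_extr)
      also have "\<dots> = c * lookup u (\<lambda>v. \<alpha> v + p * \<gamma> v)"
        unfolding k by (rule lookup_single_mult_shift)
      also have "\<dots> = c * lookup (extr p \<alpha> u) \<gamma>"
        using lookup_extr[of \<alpha> p u \<gamma>, OF a] by simp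
      also have "\<dots> = lookup (single e c * extr p \<alpha> u) \<beta>"
        unfolding b by (rule lookup_single_mult_shift[symmetric])
      finally show ?thesis .
    next
      case False
      then obtain v where v: "\<beta> v < e v" by (auto simp: not_le)
      have "(\<lambda>v. p * e v) + k' \<noteq> ?k" for k'
      proof
        assume "(\<lambda>v. p * e v) + k' = ?k"
        then have "p * e v + k' v = \<alpha> v + p * \<beta> v" by (auto simp: fun_eq_iff)
        moreover have "p * (\<beta> v + 1) \<le> p * e v" using v by (intro mult_left_mono) auto
        ultimately show False using a[of v] by simp
      qed
      moreover have "e + k' \<noteq> \<beta>" for k' using v by (auto simp: fun_eq_iff intro!: exI[of _ v])
      ultimately show ?thesis using lookup_extr[of \<alpha> p _ \<beta>, OF a] by (simp add: lookup_single_mult_0)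
    qed
  qed
  have "frob p f * u = (\<Sum>e\<in>keys f. single (\<lambda>v. p * e v) (lookup f e) * u)"
    by (simp add: frob_eq sum_distrib_right)
  then have "extr p \<alpha> (frob p f * u) = (\<Sum>e\<in>keys f. single e (lookup f e) * extr p \<alpha> u)"
    using a by (simp add: extr_sum s)
  also have "\<dots> = f * extr p \<alpha> u"
    by (simp add: flip: sum_distrib_right mp_expand)
  finally show ?thesis .
qed

lemma esz_unit1: "esz (\<lambda>w. if w = v then 1 else 0) = 1"
  by (simp add: esz_def)

text \<open>\<open>H\<close> stores each module generator together with its degree, because the
  degree cannot be read off from the zero polynomial.\<close>

definition lat :: "('v::finite \<Rightarrow> ('v, rat) mp) \<Rightarrow> nat \<Rightarrow> (nat \<times> ('v, rat) mp) set \<Rightarrow> nat \<Rightarrow> ('v, rat) mp set" where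
  "lat \<theta> d H j = {mon \<theta> \<alpha> * h | \<alpha> h i. (i, h) \<in> H \<and> d * esz \<alpha> + i = j}"

lemma lat_mult: "x \<in> lat \<theta> d H j \<Longrightarrow> mon \<theta> \<beta> * x \<in> lat \<theta> d H (d * esz \<beta> + j)"
proof -
  assume "x \<in> lat \<theta> d H j"
  then obtain \<alpha> h i where x: "x = mon \<theta> \<alpha> * h" "(i, h) \<in> H" "d * esz \<alpha> + i = j" by (auto simp: lat_def)
  have "mon \<theta> \<beta> * x = mon \<theta> (\<beta> + \<alpha>) * h" by (simp add: x(1) mon_add mult.assoc)
  moreover have "d * esz (\<beta> + \<alpha>) + i = d * esz \<beta> + j" using x(3) by (simp add: algebra_simps)
  ultimately show ?thesis using x(2) by (auto simp: lat_def intro!: exI)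
qed

text \<open>The graded Nakayama argument: in degree at least \<open>M\<close> an invariant is in the
  ideal of the parameters, \<open>reynolds\<close> makes the cofactors invariants of degree
  \<open>j - d\<close>, and induction applies to them.\<close>

lemma lat_span:
  fixes \<theta> :: "'v::finite \<Rightarrow> ('v, rat) mp"
  assumes sym: "\<And>L. L \<in> \<Gamma> \<Longrightarrow> transp L \<in> \<Gamma>"
    and th: "\<And>v. \<theta> v \<in> Inv \<Gamma> \<and> hmg d (\<theta> v)" "0 < d"
    and M: "\<And>j f. M \<le> j \<Longrightarrow> f \<in> Inv \<Gamma> \<Longrightarrow> hmg j f \<Longrightarrow> f \<in> mpi.span (range \<theta>)"
    and H: "\<And>i f. i < M \<Longrightarrow> f \<in> Inv \<Gamma> \<Longrightarrow> hmg i f \<Longrightarrow> f \<in> mpv.span (snd ` {x\<in>H. fst x = i})"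
    and f: "f \<in> Inv \<Gamma>" "hmg j f"
  shows "f \<in> mpv.span (lat \<theta> d H j)"
  using f
proof (induction j arbitrary: f rule: less_induct)
  case (less j)
  show ?case
  proof (cases "j < M")
    case True
    have "snd ` {x\<in>H. fst x = j} \<subseteq> lat \<theta> d H j"
      unfolding lat_def by (force intro: exI[of _ 0])
    then have "mpv.span (snd ` {x\<in>H. fst x = j}) \<subseteq> mpv.span (lat \<theta> d H j)" by (rule mpv.span_mono)
    then show ?thesis using H[OF True less.prems] by (rule subsetD)
  next
    case False
    then have "f \<in> mpi.span (range \<theta>)" by (intro M[OF _ less.prems]) simp
    then obtain u where "f = (\<Sum>a\<in>range \<theta>. a * u a)" using ispan_rep[of "range \<theta>" f] by auto
    from reynolds[of \<Gamma> f j "range \<theta>" "\<lambda>a. a" "\<lambda>_. d" u, OF sym less.prems _ this] th(1)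
    obtain h where h: "\<And>a. h a \<in> Inv \<Gamma> \<and> hmg (j - d) (h a) \<and> (j < d \<longrightarrow> h a = 0)" "f = (\<Sum>a\<in>range \<theta>. a * h a)"
      by auto
    have "a * h a \<in> mpv.span (lat \<theta> d H j)" if ar: "a \<in> range \<theta>" for a
    proof (cases "j < d")
      case True
      then show ?thesis using h(1)[of a] by (simp add: mpv.span_zero)
    next
      case False
      then have "h a \<in> mpv.span (lat \<theta> d H (j - d))" using h(1)[of a] th(2) by (intro less.IH) auto
      then show ?thesis
      proof (induction rule: mpv.span_induct_alt)
        case base
        then show ?case by (simp add: mpv.span_zero)
      next
        case (step c x y)
        obtain v where v: "a = \<theta> v" using ar by auto
        have "mon \<theta> (\<lambda>w. if w = v then 1 else 0) * x \<in> lat \<theta> d H (d * esz (\<lambda>w. if w = v then 1 else 0) + (j - d))"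
          using step.hyps by (rule lat_mult)
        moreover have "d * esz (\<lambda>w. if w = v then 1 else 0) + (j - d) = j" using False esz_unit1[of v] by simp
        ultimately have "a * x \<in> lat \<theta> d H j" by (simp only: mon_unit v)
        then have "msc c (a * x) + a * y \<in> mpv.span (lat \<theta> d H j)"
          using step.IH by (intro mpv.span_add mpv.span_scale) (auto intro: mpv.span_base)
        moreover have "a * (msc c x + y) = msc c (a * x) + a * y"
          by (simp add: msc_def algebra_simps)
        ultimately show ?case by (simp only:)
      qed
    qed
    then show ?thesis unfolding h(2) by (intro mpv.span_sum)
  qed
qed

text \<open>One denominator \<open>D\<close> for the products of \<open>f\<close> with the
  generators serves each further factor \<open>f\<close>. The denominator of the power is a power of
  \<open>D\<close>, so the primes dividing it do not depend on \<open>n\<close>.\<close>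

lemma zspan_power:
  assumes one: "(0, 1) \<in> H"
    and H: "\<And>i h. (i, h) \<in> H \<Longrightarrow> of_nat D * (f * h) \<in> mpz.span (lat \<theta> d H (e + i))"
  shows "(of_nat D * f) ^ n \<in> mpz.span (lat \<theta> d H (n * e))"
proof (induction n)
  case 0
  have "1 \<in> lat \<theta> d H 0" unfolding lat_def
    by (rule CollectI, rule exI[of _ 0], rule exI[of _ 1], rule exI[of _ 0]) (use one in simp)
  then show ?case by (simp add: mpz.span_base)
next
  case (Suc n)
  have mono: "mon \<theta> \<beta> * x \<in> mpz.span (lat \<theta> d H (d * esz \<beta> + j))" if "x \<in> mpz.span (lat \<theta> d H j)" for x j \<beta>
    using that
  proof (induction rule: mpz.span_induct_alt)
    case base
    then show ?case by (simp add: mpz.span_zero)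
  next
    case (step c x y)
    have "zs c (mon \<theta> \<beta> * x) + mon \<theta> \<beta> * y \<in> mpz.span (lat \<theta> d H (d * esz \<beta> + j))"
      by (intro mpz.span_add mpz.span_scale mpz.span_base lat_mult step)
    moreover have "mon \<theta> \<beta> * (zs c x + y) = zs c (mon \<theta> \<beta> * x) + mon \<theta> \<beta> * y"
      by (simp add: zs_def algebra_simps)
    ultimately show ?case by (simp only:)
  qed
  have "of_nat D * f * x \<in> mpz.span (lat \<theta> d H (e + j))" if "x \<in> mpz.span (lat \<theta> d H j)" for x j
    using that
  proof (induction rule: mpz.span_induct_alt)
    case base
    then show ?case by (simp add: mpz.span_zero)
  next
    case (step c x y)
    then obtain \<alpha> h i where x: "x = mon \<theta> \<alpha> * h" "(i, h) \<in> H" "d * esz \<alpha> + i = j" by (auto simp: lat_def)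
    have "mon \<theta> \<alpha> * (of_nat D * (f * h)) \<in> mpz.span (lat \<theta> d H (d * esz \<alpha> + (e + i)))"
      by (intro mono H x)
    moreover have "d * esz \<alpha> + (e + i) = e + j" using x(3) by simp
    moreover have "mon \<theta> \<alpha> * (of_nat D * (f * h)) = of_nat D * f * x" by (simp add: x(1) mult_ac)
    ultimately have 1: "of_nat D * f * x \<in> mpz.span (lat \<theta> d H (e + j))" by (simp only:)
    have "zs c (of_nat D * f * x) + of_nat D * f * y \<in> mpz.span (lat \<theta> d H (e + j))"
      by (intro mpz.span_add mpz.span_scale 1 step)
    moreover have "of_nat D * f * (zs c x + y) = zs c (of_nat D * f * x) + of_nat D * f * y"
      by (simp add: zs_def algebra_simps)
    ultimately show ?case by (simp only:)
  qed
  from this[OF Suc.IH] show ?case by simp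
qed

lemma fis_hcomp: "hmg e g \<Longrightarrow> fis g x = fis g (hcomp e x)"
  by (simp add: fis_def hmg_def lookup_hcomp)

lemma fis_intc: "intc g \<Longrightarrow> intc x \<Longrightarrow> fis g x \<in> \<int>"
proof -
  assume "intc g" "intc x"
  moreover have "efact e \<in> \<int>" for e :: "'a \<Rightarrow> nat"
  proof -
    have "efact e = of_nat (\<Prod>v\<in>UNIV. fact (e v))" by (simp add: efact_def)
    then show ?thesis by (metis Ints_of_nat)
  qed
  ultimately show ?thesis unfolding fis_def intc_def by (intro Ints_sum Ints_mult) auto
qed

lemma common_scale:
  assumes "finite X"
  shows "\<exists>c>0. \<forall>x\<in>X. intc (of_nat c * (g x :: ('v::finite, rat) mp))"
  using assms
proof induction
  case empty
  show ?case by (intro exI[of _ 1]) simp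
next
  case (insert x X)
  then obtain c where c: "c > 0" "\<And>x. x \<in> X \<Longrightarrow> intc (of_nat c * g x)" by auto
  obtain c' where c': "c' > 0" "intc (of_nat c' * g x)" using intc_scale by auto
  have "intc (of_nat (c * c') * g y)" if "y \<in> insert x X" for y
  proof (cases "y = x")
    case True
    have eq: "of_nat (c * c') * g y = of_nat c * (of_nat c' * g x)" by (simp add: True mult_ac)
    show ?thesis unfolding eq by (rule intc_nat_mult[OF c'(2)])
  next
    case False
    have eq: "of_nat (c * c') * g y = of_nat c' * (of_nat c * g y)" by (simp add: mult_ac)
    show ?thesis unfolding eq using False that by (intro intc_nat_mult c(2)) simp
  qed
  then show ?case using c c' by (intro exI[of _ "c * c'"]) simp
qed

text \<open>
  Multiplication by \<open>D * f\<close> preserves the integral combinations of parameter monomials times finitely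
  many invariants. As \<open>f\<close> has degree at least \<open>CARD('v) * d\<close>, its power with exponent \<open>p + k\<close>, scaled by
  an integer, lies in the ideal of the \<open>p\<close>-th powers of the parameters. Modulo \<open>p\<close>, taking \<open>p\<close>-th powers
  is the substitution of the \<open>p\<close>-th powers of the variables, so comparing coefficients puts \<open>f\<close> into the
  ideal modulo \<open>p\<close>. This fails for large \<open>p\<close> by a functional separating \<open>f\<close> from the ideal.
\<close>

lemma briancon_skoda_int:
  fixes \<theta> :: "'v::finite \<Rightarrow> ('v, rat) mp"
  assumes sym: "\<And>L. L \<in> \<Gamma> \<Longrightarrow> transp L \<in> \<Gamma>"
    and th: "\<And>v. \<theta> v \<in> Inv \<Gamma> \<and> hmg d (\<theta> v)" "0 < d"
    and M: "\<And>j f. M \<le> j \<Longrightarrow> f \<in> Inv \<Gamma> \<Longrightarrow> hmg j f \<Longrightarrow> f \<in> mpi.span (range \<theta>)"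
    and f: "f \<in> Inv \<Gamma>" "hmg e f" "CARD('v) * d \<le> e"
    and int: "\<And>v. intc (\<theta> v)" "intc f"
  shows "f \<in> mpi.span (range \<theta>)"
proof (rule ccontr)
  assume notin: "f \<notin> mpi.span (range \<theta>)"
  have e: "0 < e" using f(3) th(2) by (metis mult_pos_pos not_le gr0I le_0_eq zero_less_card_finite)
  have f0: "f \<noteq> 0" using notin mpi.span_zero by metis
  have "\<exists>B. finite B \<and> mpv.span B = {p. p \<in> Inv \<Gamma> \<and> hmg i p}" for i
  proof -
    have ss: "mpv.subspace {p. p \<in> Inv \<Gamma> \<and> hmg i p}"
      by (simp add: mpv.subspace_def msc_def Inv_0 Inv_add Inv_mult Inv_cst hmg_add hmg_cst_mult)
    have sub: "{p. p \<in> Inv \<Gamma> \<and> hmg i p} \<subseteq> {p. hmg i p}" by (simp add: subset_iff)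
    show ?thesis by (rule hmg_subspace_basis[OF ss sub]) (rule exI, rule conjI, assumption+)
  qed
  then obtain B where B: "\<And>i. finite (B i) \<and> mpv.span (B i) = {p. p \<in> Inv \<Gamma> \<and> hmg i p}" by metis
  define H where "H = insert (0, 1) (\<Union>i<M. Pair i ` B i)"
  have fH: "finite H" using B by (simp add: H_def)
  have Hi: "h \<in> Inv \<Gamma> \<and> hmg i h \<and> i \<le> M" if "(i, h) \<in> H" for i h
  proof (cases "(i, h) = (0, 1)")
    case True
    then show ?thesis by (simp add: Inv_1 hmg_1)
  next
    case False
    then have "i < M" "h \<in> B i" using that by (auto simp: H_def)
    then show ?thesis using B[of i] mpv.span_base[of h "B i"] by auto
  qed
  have Hs: "g \<in> mpv.span (snd ` {x\<in>H. fst x = i})" if "i < M" "g \<in> Inv \<Gamma>" "hmg i g" for i g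
  proof -
    have "B i \<subseteq> snd ` {x\<in>H. fst x = i}"
    proof
      fix h assume "h \<in> B i"
      then have "(i, h) \<in> (\<Union>i<M. Pair i ` B i)" using that(1) by (intro UN_I[of i] imageI) simp_all
      then have "(i, h) \<in> {x\<in>H. fst x = i}" by (simp add: H_def)
      then have "snd (i, h) \<in> snd ` {x\<in>H. fst x = i}" by (rule imageI)
      then show "h \<in> snd ` {x\<in>H. fst x = i}" by simp
    qed
    then have "mpv.span (B i) \<subseteq> mpv.span (snd ` {x\<in>H. fst x = i})" by (rule mpv.span_mono)
    moreover have "g \<in> mpv.span (B i)" using that B[of i] by simp
    ultimately show ?thesis by (rule subsetD)
  qed
  have fl: "f * snd x \<in> mpv.span (lat \<theta> d H (e + fst x))" if "x \<in> H" for x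
  proof (rule lat_span[OF sym th M Hs])
    have "snd x \<in> Inv \<Gamma> \<and> hmg (fst x) (snd x)" using Hi[of "fst x" "snd x"] that by simp
    then show "f * snd x \<in> Inv \<Gamma>" "hmg (e + fst x) (f * snd x)"
      using f by (simp_all add: Inv_mult hmg_mult)
  qed
  have "\<exists>D>0. \<forall>x\<in>H. of_nat D * (f * snd x) \<in> mpz.span (lat \<theta> d H (e + fst x))"
    by (rule clear_denom_finite[OF fH]) (rule fl)
  then obtain D where D0: "D > 0" "\<forall>x\<in>H. of_nat D * (f * snd x) \<in> mpz.span (lat \<theta> d H (e + fst x))"
    by (elim exE conjE)
  have D: "D > 0" "\<And>i h. (i, h) \<in> H \<Longrightarrow> of_nat D * (f * h) \<in> mpz.span (lat \<theta> d H (e + i))"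
    using D0(1) D0(2)[rule_format, of "(_, _)"] by simp_all
  obtain C where C: "C > 0" "\<And>x. x \<in> H \<Longrightarrow> intc (of_nat C * snd x)" using common_scale[OF fH, of snd] by auto
  \<comment> \<open>The additional factors \<open>f ^ k\<close> have degree \<open>k * e\<close>, at
    least the degree of any generator in \<open>H\<close>. Degree at least \<open>p * e\<close> is
    left for the parameters.\<close>
  define k where "k = M"
  have kM: "M \<le> k * e" using e by (simp add: k_def)
  \<comment> \<open>Some monomial of \<open>f ^ k\<close>. Its coefficient \<open>b\<close> will be,
    up to powers of the denominators, the constant in front of \<open>f\<close> after
    extraction.\<close>
  obtain \<alpha> where al: "\<alpha> \<in> keys (f ^ k)" using mp_power_nonzero[OF f0, of k] by (metis keys_eq_empty ex_in_conv)
  have hfk: "hmg (k * e) (f ^ k)" using f(2) by (rule hmg_power)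
  \<comment> \<open>a functional vanishing on the ideal but not on \<open>f\<close>\<close>
  define U where "U = {x. x \<in> mpi.span (range \<theta>) \<and> hmg e x}"
  have "mpv.subspace U"
    unfolding U_def mpv.subspace_def msc_def
    by (auto intro: mpi.span_zero mpi.span_add span_mult_left hmg_add hmg_cst_mult)
  then obtain u where u: "u \<in> U" "\<And>g. g \<in> U \<Longrightarrow> fis (f - u) g = 0"
    using fis_proj[of U e f] by (auto simp: U_def)
  define f' where "f' = f - u"
  have hf': "hmg e f'" using u(1) f(2) by (simp add: f'_def U_def hmg_diff)
  have "f' \<noteq> 0" using u(1) notin by (auto simp: f'_def U_def)
  obtain c where c: "c > 0" "intc (of_nat c * f')" using intc_scale by blast
  define \<phi> where "\<phi> x = fis (of_nat c * f') x" for x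
  have \<phi>eq: "\<phi> x = of_nat c * fis f' x" for x
    unfolding \<phi>_def using fis_scale_left[of "of_nat c" f' x] by simp
  have \<phi>f: "\<phi> f \<noteq> 0"
  proof -
    have "fis f' u = 0" using u by (simp add: f'_def)
    moreover have "f = u + f'" by (simp add: f'_def)
    ultimately have "fis f' f = fis f' f'" by (metis fis_add_right add_0)
    then show ?thesis using c(1) \<open>f' \<noteq> 0\<close> by (simp add: \<phi>eq fis_self_eq_0)
  qed
  have \<phi>0: "\<phi> (\<theta> v * w) = 0" for v w
  proof -
    have "d \<le> CARD('v) * d" by simp
    from order_trans[OF this f(3)] have de: "d \<le> e" .
    then have "hcomp e (\<theta> v * w) = hcomp (e - d) w * \<theta> v"
      using hcomp_mult_hmg[of d "\<theta> v" "e - d" w] th(1) by (simp add: mult.commute)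
    moreover have "hcomp (e - d) w * \<theta> v \<in> mpi.span (range \<theta>)"
      by (intro span_mult_left mpi.span_base) simp
    ultimately have "hcomp e (\<theta> v * w) \<in> mpi.span (range \<theta>)" by simp
    then have "hcomp e (\<theta> v * w) \<in> U" by (simp add: U_def)
    then show ?thesis using u(2) fis_hcomp[OF hf', of "\<theta> v * w"] by (simp add: \<phi>eq f'_def)
  qed
  have \<phi>int: "\<phi> x \<in> \<int>" if "intc x" for x unfolding \<phi>_def using c(2) that by (rule fis_intc)
  obtain a where a: "\<phi> f = of_int a" using \<phi>int[OF int(2)] by (auto elim: Ints_cases)
  obtain b where b: "lookup (f ^ k) \<alpha> = of_int b" using intc_power[OF int(2), of k] by (auto simp: intc_def elim: Ints_cases)
  have ab: "a \<noteq> 0" "b \<noteq> 0" using a \<phi>f b al by (auto simp: in_keys_iff)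
  \<comment> \<open>Large enough that \<open>p\<close> divides none of \<open>C\<close>,
    \<open>D\<close>, \<open>a\<close>, \<open>b\<close>, and above \<open>k * e\<close>, the size
    of the exponents in \<open>f ^ k\<close>.\<close>
  obtain p where p: "prime p" "p > C + D + nat \<bar>a\<bar> + nat \<bar>b\<bar> + k * e"
    using bigger_prime by blast
  \<comment> \<open>The ideal of the \<open>p\<close>-th powers of the parameters, with cofactors
    kept integral so that reduction modulo \<open>p\<close> makes sense.\<close>
  define P where "P = {x. \<exists>w. (\<forall>v. intc (w v)) \<and> x = (\<Sum>v\<in>UNIV. \<theta> v ^ p * w v)}"
  have P0: "0 \<in> P" unfolding P_def by (intro CollectI exI[of _ "\<lambda>_. 0"]) simp
  have Padd: "x + y \<in> P" if x: "x \<in> P" and y: "y \<in> P" for x y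
  proof -
    from x obtain w where w: "\<forall>v. intc (w v)" "x = (\<Sum>v\<in>UNIV. \<theta> v ^ p * w v)" by (auto simp: P_def)
    from y obtain w' where w': "\<forall>v. intc (w' v)" "y = (\<Sum>v\<in>UNIV. \<theta> v ^ p * w' v)" by (auto simp: P_def)
    have "x + y = (\<Sum>v\<in>UNIV. \<theta> v ^ p * (w v + w' v))" using w w' by (simp add: ring_distribs sum.distrib)
    then show ?thesis unfolding P_def using w w' by (intro CollectI exI[of _ "\<lambda>v. w v + w' v"]) (simp add: intc_add)
  qed
  have Pmul: "of_int z * x \<in> P" if "x \<in> P" for z x
  proof -
    from that obtain w where w: "\<forall>v. intc (w v)" "x = (\<Sum>v\<in>UNIV. \<theta> v ^ p * w v)" by (auto simp: P_def)
    have iz: "intc (of_int z * w v)" for v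
      using intc_mult[OF intc_single[of "of_int z" 0], of "w v"] w by simp
    have "of_int z * x = (\<Sum>v\<in>UNIV. \<theta> v ^ p * (of_int z * w v))" using w by (simp add: sum_distrib_left mult_ac)
    then show ?thesis unfolding P_def using iz by (intro CollectI exI[of _ "\<lambda>v. of_int z * w v"]) simp
  qed
  have Plat: "of_nat C * x \<in> P" if "x \<in> lat \<theta> d H ((p + k) * e)" for x
  proof -
    from that obtain \<beta> h i where x: "x = mon \<theta> \<beta> * h" "(i, h) \<in> H" "d * esz \<beta> + i = (p + k) * e" by (auto simp: lat_def)
    \<comment> \<open>Pigeonhole: if all exponents were below \<open>p\<close>, the parameters would
      contribute less than \<open>CARD('v) * d * p \<le> e * p\<close>. This is where the hypothesis
      on \<open>e\<close> enters.\<close>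
    have "\<exists>v. p \<le> \<beta> v"
    proof (rule ccontr)
      assume "\<not> ?thesis"
      then have lt: "\<And>v. \<beta> v < p" by (simp add: not_le)
      then have "esz \<beta> < (\<Sum>v\<in>(UNIV :: 'v set). p)" unfolding esz_def by (intro sum_strict_mono) auto
      then have "d * esz \<beta> < d * (CARD('v) * p)" using th(2) by simp
      also have "\<dots> \<le> e * p" using mult_right_mono[OF f(3), of p] by (simp add: mult_ac)
      finally have "d * esz \<beta> < e * p" .
      moreover have "i \<le> k * e" using Hi[OF x(2)] kM by simp
      ultimately show False using x(3) by (simp add: algebra_simps)
    qed
    then obtain v where v: "p \<le> \<beta> v" by blast
    define \<gamma> where "\<gamma> = \<beta>(v := \<beta> v - p)"
    have "\<beta> = (\<lambda>w. if w = v then p else 0) + \<gamma>" using v by (auto simp: \<gamma>_def fun_eq_iff)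
    then have "mon \<theta> \<beta> = mon \<theta> ((\<lambda>w. if w = v then p else 0) + \<gamma>)" by (rule arg_cong)
    also have "\<dots> = mon \<theta> (\<lambda>w. if w = v then p else 0) * mon \<theta> \<gamma>" by (rule mon_add)
    also have "mon \<theta> (\<lambda>w. if w = v then p else 0) = (\<Prod>w\<in>UNIV. if w = v then \<theta> v ^ p else 1)"
      unfolding mon_def by (rule prod.cong) auto
    finally have "mon \<theta> \<beta> = \<theta> v ^ p * mon \<theta> \<gamma>" by simp
    then have eq: "of_nat C * x = \<theta> v ^ p * (mon \<theta> \<gamma> * (of_nat C * h))" by (simp add: x(1) mult_ac)
    have "intc (mon \<theta> \<gamma> * (of_nat C * h))" using C(2)[OF x(2)] int(1) by (intro intc_mult[OF intc_mon]) auto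
    then show ?thesis unfolding eq P_def
      by (intro CollectI exI[of _ "\<lambda>w. if w = v then mon \<theta> \<gamma> * (of_nat C * h) else 0"])
        (simp add: if_distrib[of "\<lambda>t. _ * t"] cong: if_cong)
  qed
  have "of_nat C * x \<in> P" if "x \<in> mpz.span (lat \<theta> d H ((p + k) * e))" for x
    using that
  proof (induction rule: mpz.span_induct_alt)
    case base
    then show ?case using P0 by simp
  next
    case (step z x y)
    have "of_nat C * (zs z x + y) = of_int z * (of_nat C * x) + of_nat C * y" by (simp add: zs_def algebra_simps)
    then show ?case using Padd[OF Pmul[OF Plat[OF step.hyps(1)]] step.IH] by (simp only:)
  qed
  from this[OF zspan_power[of H D f \<theta> d e "p + k"]] D(2)
  have "of_nat C * (of_nat D * f) ^ (p + k) \<in> P" by (simp add: H_def)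
  then obtain w where w: "\<And>v. intc (w v)" "of_nat C * (of_nat D * f) ^ (p + k) = (\<Sum>v\<in>UNIV. \<theta> v ^ p * w v)"
    by (auto simp: P_def)
  obtain z where z: "intc z" "f ^ p = frob p f + of_nat p * z" using power_p_frob[OF p(1) int(2)] by auto
  define y where "y v = (SOME y. intc y \<and> \<theta> v ^ p = frob p (\<theta> v) + of_nat p * y)" for v
  have y: "intc (y v) \<and> \<theta> v ^ p = frob p (\<theta> v) + of_nat p * y v" for v
    unfolding y_def by (rule someI_ex[OF power_p_frob[OF p(1) int(1)]])
  \<comment> \<open>The membership of the power of \<open>f\<close> is rewritten with
    \<open>frob\<close> in place of all \<open>p\<close>-th powers; the errors are collected in the
    integral polynomial \<open>Z\<close>, with a factor \<open>p\<close> in front.\<close>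
  define g where "g = of_nat (C * D ^ (p + k)) * f ^ k"
  define Z where "Z = (\<Sum>v\<in>UNIV. y v * w v) - g * z"
  have ig: "intc g" unfolding g_def by (intro intc_nat_mult intc_power int)
  have iZ: "intc Z" unfolding Z_def using y w ig z by (intro intc_diff intc_sum intc_mult) auto
  have "g * f ^ p = of_nat C * (of_nat D * f) ^ (p + k)"
    by (simp add: g_def power_add power_mult_distrib mult_ac)
  also have "\<dots> = (\<Sum>v\<in>UNIV. (frob p (\<theta> v) + of_nat p * y v) * w v)" using w(2) y by simp
  finally have "g * (frob p f + of_nat p * z) = (\<Sum>v\<in>UNIV. (frob p (\<theta> v) + of_nat p * y v) * w v)"
    by (simp only: z(2))
  then have key: "frob p f * g = (\<Sum>v\<in>UNIV. frob p (\<theta> v) * w v) + of_nat p * Z"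
    by (simp add: Z_def sum.distrib sum_distrib_left algebra_simps)
  have alp: "\<alpha> v < p" for v
  proof -
    have "\<alpha> v \<le> k * e" using le_esz[of \<alpha> v] al hfk by (simp add: hmg_def)
    then show ?thesis using p(2) by simp
  qed
  have pc: "of_nat p * Z = cst (of_nat p) * Z" by simp
  have "f * extr p \<alpha> g = (\<Sum>v\<in>UNIV. \<theta> v * extr p \<alpha> (w v)) + cst (of_nat p) * extr p \<alpha> Z"
    using arg_cong[OF key, of "extr p \<alpha>"] alp unfolding pc
    by (simp only: extr_frob extr_add extr_sum extr_cst)
  \<comment> \<open>The exponents of \<open>g\<close> have size \<open>k * e < p\<close>, so
    \<alpha> is the only one among them of the form \<alpha> plus a multiple of
    \<open>p\<close>.\<close>
  moreover have "extr p \<alpha> g = cst (of_int (int (C * D ^ (p + k)) * b))"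
  proof (rule poly_mapping_eqI)
    fix \<beta>
    show "lookup (extr p \<alpha> g) \<beta> = lookup (cst (of_int (int (C * D ^ (p + k)) * b))) \<beta>"
    proof (cases "\<beta> = 0")
      case True
      have "lookup (extr p \<alpha> g) 0 = lookup g \<alpha>" using lookup_extr[of \<alpha> p g 0, OF alp] by simp
      then show ?thesis using True by (simp add: g_def lookup_of_nat_mult b lookup_single flip: of_nat_mult of_nat_power)
    next
      case False
      then obtain v where v: "\<beta> v \<noteq> 0" by (auto simp: fun_eq_iff)
      have "p * 1 \<le> p * \<beta> v" using v by (intro mult_left_mono) auto
      also have "\<dots> \<le> esz (\<lambda>v. \<alpha> v + p * \<beta> v)" using le_esz[of "\<lambda>v. \<alpha> v + p * \<beta> v" v] by simp
      finally have "esz (\<lambda>v. \<alpha> v + p * \<beta> v) \<noteq> k * e" using p(2) by simp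
      then have "lookup (f ^ k) (\<lambda>v. \<alpha> v + p * \<beta> v) = 0" using hfk by (auto simp: hmg_def in_keys_iff)
      then have "lookup g (\<lambda>v. \<alpha> v + p * \<beta> v) = 0" by (simp only: g_def lookup_of_nat_mult mult_zero_right)
      moreover have "lookup (cst (of_int (int (C * D ^ (p + k)) * b)) :: ('v, rat) mp) \<beta> = 0"
        using False by (simp only: lookup_single_not_eq)
      ultimately show ?thesis using lookup_extr[of \<alpha> p g \<beta>, OF alp] by (simp only:)
    qed
  qed
  ultimately have "cst (of_int (int (C * D ^ (p + k)) * b)) * f
    = (\<Sum>v\<in>UNIV. \<theta> v * extr p \<alpha> (w v)) + cst (of_nat p) * extr p \<alpha> Z" by (simp only: mult.commute[of f])
  \<comment> \<open>\<open>\<phi>\<close> kills the ideal of the parameters and is integral on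
    integral polynomials. What remains is an equation of integers with the factor \<open>p\<close>
    on one side only.\<close>
  then have "\<phi> (cst (of_int (int (C * D ^ (p + k)) * b)) * f)
    = \<phi> ((\<Sum>v\<in>UNIV. \<theta> v * extr p \<alpha> (w v)) + cst (of_nat p) * extr p \<alpha> Z)" by (simp only:)
  also have "\<dots> = (\<Sum>v\<in>UNIV. \<phi> (\<theta> v * extr p \<alpha> (w v))) + of_nat p * \<phi> (extr p \<alpha> Z)"
  proof -
    have "fis q (sum h UNIV) = (\<Sum>v\<in>UNIV. fis q (h v))" for q and h :: "'v \<Rightarrow> ('v, rat) mp"
      unfolding fis_def lookup_sum sum_distrib_left by (rule sum.swap)
    then show ?thesis unfolding \<phi>_def fis_add_right fis_scale_right by simp
  qed
  also have "\<phi> (cst (of_int (int (C * D ^ (p + k)) * b)) * f) = of_int (int (C * D ^ (p + k)) * b) * \<phi> f"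
    unfolding \<phi>_def by (rule fis_scale_right)
  finally have fin: "of_int (int (C * D ^ (p + k)) * b * a) = of_nat p * \<phi> (extr p \<alpha> Z)"
    by (simp add: \<phi>0 a)
  obtain s where s: "\<phi> (extr p \<alpha> Z) = of_int s"
    using \<phi>int[OF intc_extr[of \<alpha> p Z, OF alp iZ]] by (auto elim: Ints_cases)
  have "(of_int (int (C * D ^ (p + k)) * b * a) :: rat) = of_int (int p * s)"
    using fin s by simp
  then have "int (C * D ^ (p + k)) * b * a = int p * s" by (simp only: of_int_eq_iff)
  then have "int p dvd int (C * D ^ (p + k)) * b * a" by simp
  then have "int p dvd int C \<or> int p dvd int D \<or> int p dvd b \<or> int p dvd a"
    
    using prime_dvd_mult_iff[of "int p"] prime_dvd_power[of "int p" "int D" "p + k"] p(1)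
    by auto
  then show False
    using p(2) C(1) D(1) ab zdvd_imp_le[of "int p" "int C"] zdvd_imp_le[of "int p" "int D"]
      dvd_imp_le_int[of a "int p"] dvd_imp_le_int[of b "int p"] by auto
qed

lemma ispan_nat_cancel:
  assumes "of_nat c * x \<in> mpi.span F" "0 < c"
  shows "(x :: ('v::finite, rat) mp) \<in> mpi.span F"
proof -
  have "cst (1 / of_nat c) * (of_nat c * x) = (cst (1 / of_nat c) * of_nat c) * x"
    by (rule mult.assoc[symmetric])
  also have "cst (1 / of_nat c) * of_nat c = (1 :: ('v, rat) mp)"
    unfolding single_of_nat[symmetric] mult_single using assms(2) by simp
  finally have "cst (1 / of_nat c) * (of_nat c * x) = x" by simp
  with span_mult_left[OF assms(1), of "cst (1 / of_nat c)"] show ?thesis by (simp only:)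
qed

lemma briancon_skoda:
  fixes \<theta> :: "'v::finite \<Rightarrow> ('v, rat) mp"
  assumes sym: "\<And>L. L \<in> \<Gamma> \<Longrightarrow> transp L \<in> \<Gamma>"
    and th: "\<And>v. \<theta> v \<in> Inv \<Gamma> \<and> hmg d (\<theta> v)" "0 < d"
    and M: "\<And>j f. M \<le> j \<Longrightarrow> f \<in> Inv \<Gamma> \<Longrightarrow> hmg j f \<Longrightarrow> f \<in> mpi.span (range \<theta>)"
    and f: "f \<in> Inv \<Gamma>" "hmg e f" "CARD('v) * d \<le> e"
  shows "f \<in> mpi.span (range \<theta>)"
proof -
  have "\<exists>c>0. \<forall>x\<in>range \<theta>. intc (of_nat c * x)" by (rule common_scale) simp
  then obtain c where c: "c > 0" "\<And>v. intc (of_nat c * \<theta> v)" by auto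
  obtain b where b: "b > 0" "intc (of_nat b * f)" using intc_scale by blast
  define \<theta>' where "\<theta>' v = of_nat c * \<theta> v" for v
  have n: "of_nat k * x \<in> Inv \<Gamma> \<and> hmg j (of_nat k * x)" if "x \<in> Inv \<Gamma>" "hmg j x" for j k x
    using Inv_mult[OF Inv_cst[of "of_nat k"] that(1)] hmg_cst_mult[OF that(2), of "of_nat k"] by simp
  have 1: "mpi.span (range \<theta>) \<subseteq> mpi.span (range \<theta>')"
  proof (rule mpi.span_minimal[OF _ mpi.subspace_span], rule image_subsetI)
    fix v
    have "of_nat c * \<theta> v \<in> mpi.span (range \<theta>')" by (rule mpi.span_base) (auto simp: \<theta>'_def)
    then show "\<theta> v \<in> mpi.span (range \<theta>')" using c(1) by (rule ispan_nat_cancel)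
  qed
  have 2: "mpi.span (range \<theta>') \<subseteq> mpi.span (range \<theta>)"
  proof (rule mpi.span_minimal[OF _ mpi.subspace_span], rule image_subsetI)
    fix v
    show "\<theta>' v \<in> mpi.span (range \<theta>)" unfolding \<theta>'_def by (intro span_mult_left mpi.span_base) simp
  qed
  have "of_nat b * f \<in> mpi.span (range \<theta>')"
  proof (rule briancon_skoda_int[OF sym _ th(2)])
    fix v show "\<theta>' v \<in> Inv \<Gamma> \<and> hmg d (\<theta>' v)" unfolding \<theta>'_def using th(1)[of v] by (intro n) simp_all
  next
    fix j g assume "M \<le> j" "g \<in> Inv \<Gamma>" "hmg j g"
    from subsetD[OF 1 M[OF this]] show "g \<in> mpi.span (range \<theta>')" .
  next
    show "of_nat b * f \<in> Inv \<Gamma>" "hmg e (of_nat b * f)" using n[OF f(1,2), of b] by simp_all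
    show "CARD('v) * d \<le> e" by fact
    show "intc (\<theta>' v)" for v unfolding \<theta>'_def by (rule c(2))
    show "intc (of_nat b * f)" by (rule b(2))
  qed
  from ispan_nat_cancel[OF subsetD[OF 2 this] b(1)] show ?thesis .
qed

section \<open>The Nullstellensatz\<close>

hide_const (open) Polynomial.order

section \<open>Dickson's lemma and Hilbert's basis theorem\<close>

lemma nat_mono_subseq: "\<exists>r :: nat \<Rightarrow> nat. strict_mono r \<and> mono (\<lambda>n. (s (r n) :: nat))"
proof -
  obtain r where r: "strict_mono r" "monoseq (\<lambda>n. s (r n))" using seq_monosub[of s] by auto
  show ?thesis
  proof (cases "mono (\<lambda>n. s (r n))")
    case True
    then show ?thesis using r by blast
  next
    case False
    then have dec: "\<And>m n. m \<le> n \<Longrightarrow> s (r n) \<le> s (r m)" using r(2) by (auto simp: monoseq_def mono_def)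
    define m where "m = (LEAST x. \<exists>n. x = s (r n))"
    have "\<exists>n. m = s (r n)" unfolding m_def by (rule LeastI_ex) auto
    then obtain N where N: "m = s (r N)" by blast
    have "s (r (n + N)) = m" for n
    proof (rule antisym)
      show "s (r (n + N)) \<le> m" unfolding N by (rule dec) simp
      show "m \<le> s (r (n + N))" unfolding m_def by (rule Least_le) auto
    qed
    then have "mono (\<lambda>n. s (r (n + N)))" by (simp add: mono_def)
    moreover have "strict_mono (\<lambda>n. r (n + N))" using r(1) by (simp add: strict_mono_def)
    ultimately show ?thesis by (intro exI[of _ "\<lambda>n. r (n + N)"]) simp
  qed
qed

lemma fun_mono_subseq:
  fixes s :: "nat \<Rightarrow> 'v::finite \<Rightarrow> nat"
  shows "\<exists>r :: nat \<Rightarrow> nat. strict_mono r \<and> (\<forall>v. mono (\<lambda>n. s (r n) v))"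
proof -
  have "\<exists>r :: nat \<Rightarrow> nat. strict_mono r \<and> (\<forall>v\<in>V. mono (\<lambda>n. s (r n) v))" if "finite V" for V
    using that
  proof induction
    case empty
    then show ?case by (auto intro: exI[of _ id] simp: strict_mono_def)
  next
    case (insert v V)
    then obtain r :: "nat \<Rightarrow> nat" where r: "strict_mono r" "\<And>v. v \<in> V \<Longrightarrow> mono (\<lambda>n. s (r n) v)" by auto
    obtain q :: "nat \<Rightarrow> nat" where q: "strict_mono q" "mono (\<lambda>n. s (r (q n)) v)"
      using nat_mono_subseq[of "\<lambda>n. s (r n) v"] by auto
    have "strict_mono (\<lambda>n. r (q n))" using r(1) q(1) by (simp add: strict_mono_def)
    moreover have "mono (\<lambda>n. s (r (q n)) w)" if "w \<in> insert v V" for w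
    proof (cases "w = v")
      case False
      then have "mono (\<lambda>n. s (r n) w)" using r(2) that by auto
      moreover have "mono q" using q(1) by (rule strict_mono_mono)
      ultimately show ?thesis by (auto simp: mono_def)
    qed (use q(2) in simp)
    ultimately show ?case by (intro exI[of _ "\<lambda>n. r (q n)"]) simp
  qed
  from this[of UNIV] show ?thesis by simp
qed

text \<open>\<open>F\<close> consists of the minimal exponents. Infinitely many of them would
  contain a coordinatewise increasing sequence of distinct ones, against minimality.\<close>

lemma dickson:
  fixes E :: "('v::finite \<Rightarrow> nat) set"
  shows "\<exists>F\<subseteq>E. finite F \<and> (\<forall>e\<in>E. \<exists>f\<in>F. \<exists>h. e = f + h)"
proof -
  define F where "F = {f\<in>E. \<forall>e\<in>E. (\<forall>v. e v \<le> f v) \<longrightarrow> e = f}"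
  have ab: "\<exists>f\<in>F. \<forall>v. f v \<le> e v" if "e \<in> E" for e
    using that
  proof (induction "esz e" arbitrary: e rule: less_induct)
    case less
    show ?case
    proof (cases "e \<in> F")
      case True
      then show ?thesis by auto
    next
      case False
      then obtain e' where e': "e' \<in> E" "\<forall>v. e' v \<le> e v" "e' \<noteq> e" using less.prems by (auto simp: F_def)
      then obtain w where "e' w < e w" by (auto simp: fun_eq_iff order_less_le)
      then have "esz e' < esz e" unfolding esz_def using e'(2) by (intro sum_strict_mono_ex1) auto
      from less.hyps[OF this e'(1)] obtain f where "f \<in> F" "\<forall>v. f v \<le> e' v" by auto
      then show ?thesis using e'(2) by (meson order_trans)
    qed
  qed
  have fin: "finite F"
  proof (rule ccontr)
    assume "infinite F"
    then obtain s :: "nat \<Rightarrow> 'v \<Rightarrow> nat" where s: "inj s" "range s \<subseteq> F" using infinite_countable_subset by blast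
    obtain r :: "nat \<Rightarrow> nat" where r: "strict_mono r" "\<And>v. mono (\<lambda>n. s (r n) v)" using fun_mono_subseq[of s] by auto
    have "\<forall>v. s (r 0) v \<le> s (r 1) v" using r(2) by (auto simp: mono_def)
    moreover have "s (r 0) \<in> E" "s (r 1) \<in> F" using s(2) by (auto simp: F_def)
    ultimately have "s (r 0) = s (r 1)" by (simp add: F_def)
    then have "r 0 = r 1" using s(1) by (simp add: inj_eq)
    moreover have "r 0 < r 1" using r(1) by (simp add: strict_mono_def)
    ultimately show False by simp
  qed
  have sub: "\<exists>h. e = f + h" if "\<forall>v. f v \<le> e v" for e f :: "'v \<Rightarrow> nat"
    using that by (intro exI[of _ "\<lambda>v. e v - f v"]) (auto simp: fun_eq_iff)
  have "\<exists>f\<in>F. \<exists>h. e = f + h" if "e \<in> E" for e using ab[OF that] sub by blast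
  moreover have "F \<subseteq> E" by (simp add: F_def)
  ultimately show ?thesis using fin by (intro exI[of _ F]) simp
qed

definition isld :: "('v::finite, 'a::comm_ring_1) mp \<Rightarrow> ('v \<Rightarrow> nat) \<Rightarrow> bool" where
  "isld p e \<longleftrightarrow> e \<in> keys p \<and> (\<forall>e'\<in>keys p. wt e' \<le> wt e)"

lemma isld_ex: "p \<noteq> 0 \<Longrightarrow> \<exists>e. isld p e"
  using mp_lead[of p] unfolding isld_def by metis

lemma ispan_finite_subset:
  assumes "x \<in> mpi.span G"
  shows "\<exists>F\<subseteq>G. finite F \<and> x \<in> mpi.span F"
  using assms
proof (induction rule: mpi.span_induct_alt)
  case base
  show ?case by (intro exI[of _ "{}"]) (simp add: mpi.span_zero)
next
  case (step c x y)
  then obtain F where F: "F \<subseteq> G" "finite F" "y \<in> mpi.span F" by auto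
  have "rsc c x + y \<in> mpi.span (insert x F)"
  proof (intro mpi.span_add mpi.span_scale)
    show "x \<in> mpi.span (insert x F)" by (rule mpi.span_base) simp
    show "y \<in> mpi.span (insert x F)" using F(3) mpi.span_mono[of F "insert x F"] by auto
  qed
  then show ?case using F step.hyps by (intro exI[of _ "insert x F"]) simp
qed

text \<open>Division by finitely many elements of the ideal whose leading exponents divide all
  others. Those elements need not be in \<open>G\<close>, but each uses finitely many members of
  \<open>G\<close>; taking these keeps the generators inside \<open>G\<close>, so that they remain
  homogeneous invariants in the applications.\<close>

lemma hilbert_basis:
  fixes G :: "('v::finite, 'a::field) mp set"
  shows "\<exists>F\<subseteq>G. finite F \<and> G \<subseteq> mpi.span F"
proof -
  let ?I = "mpi.span G"
  define E where "E = {e. \<exists>p\<in>?I. isld p e}"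
  obtain E0 where E0: "E0 \<subseteq> E" "finite E0" "\<forall>e\<in>E. \<exists>f\<in>E0. \<exists>h. e = f + h" using dickson[of E] by blast
  define g where "g f = (SOME p. p \<in> ?I \<and> isld p f)" for f
  have g: "g f \<in> ?I \<and> isld (g f) f" if "f \<in> E0" for f
    unfolding g_def by (rule someI_ex) (use that E0(1) in \<open>auto simp: E_def\<close>)
  have "\<exists>F. F \<subseteq> G \<and> finite F \<and> g f \<in> mpi.span F" if "f \<in> E0" for f
    using ispan_finite_subset[of "g f" G] g[OF that] by auto
  then obtain \<F> where \<F>: "\<And>f. f \<in> E0 \<Longrightarrow> \<F> f \<subseteq> G \<and> finite (\<F> f) \<and> g f \<in> mpi.span (\<F> f)" by metis
  define F where "F = (\<Union>f\<in>E0. \<F> f)"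
  have gF: "g f \<in> mpi.span F" if "f \<in> E0" for f
  proof -
    have "\<F> f \<subseteq> F" using that by (auto simp: F_def)
    from subsetD[OF mpi.span_mono[OF this]] show ?thesis using \<F>[OF that] by simp
  qed
  have red: "p \<in> mpi.span F" if "p \<in> ?I" "isld p e" for p e
    using that
  proof (induction "wt e" arbitrary: p e rule: less_induct)
    case less
    have "e \<in> E" using less.prems by (auto simp: E_def)
    then obtain f h where f: "f \<in> E0" "e = f + h" using E0(3) by blast
    have lg: "isld (g f) f" using g[OF f(1)] by simp
    then have lg0: "lookup (g f) f \<noteq> 0" by (simp add: isld_def in_keys_iff)
    define c where "c = lookup p e / lookup (g f) f"
    define q where "q = p - single h c * g f"
    have sg: "single h c * g f \<in> mpi.span F" by (intro span_mult_left gF f(1))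
    have "single h c * g f \<in> ?I" using g[OF f(1)] by (intro span_mult_left) simp
    then have qI: "q \<in> ?I" unfolding q_def using less.prems(1) by (intro mpi.span_diff)
    have qe: "lookup q e = 0"
    proof -
      have "lookup (single h c * g f) (h + f) = c * lookup (g f) f" by (rule lookup_single_mult_shift)
      moreover have "h + f = e" using f(2) by (simp add: add.commute)
      ultimately show ?thesis using lg0 by (simp add: q_def lookup_minus c_def)
    qed
    have qlt: "wt e' < wt e" if "e' \<in> keys q" for e'
    proof -
      have "wt e' \<le> wt e"
      proof (cases "e' \<in> keys p")
        case True
        then show ?thesis using less.prems(2) by (simp add: isld_def)
      next
        case False
        then have "lookup (single h c * g f) e' \<noteq> 0" using that by (auto simp: q_def lookup_minus in_keys_iff)
        then obtain e'' where e'': "e'' \<in> keys (g f)" "h + e'' = e'"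
          unfolding lookup_single_mult using sum.not_neutral_contains_not_neutral by force
        have "wt e' = wt h * wt e''" using e''(2) wt_add by metis
        also have "\<dots> \<le> wt h * wt f" using lg e''(1) by (intro mult_left_mono) (auto simp: isld_def)
        also have "\<dots> = wt e" by (simp add: f(2) wt_add mult.commute)
        finally show ?thesis .
      qed
      moreover have "e' \<noteq> e" using that qe by (auto simp: in_keys_iff)
      ultimately show ?thesis using inj_wt[of e' e] by auto
    qed
    have "q \<in> mpi.span F"
    proof (cases "q = 0")
      case True
      then show ?thesis by (simp add: mpi.span_zero)
    next
      case False
      then obtain e' where e': "isld q e'" using isld_ex by blast
      then have "wt e' < wt e" using qlt by (simp add: isld_def)
      from less.hyps[OF this qI e'] show ?thesis .
    qed
    then have "q + single h c * g f \<in> mpi.span F" using sg by (rule mpi.span_add)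
    then show ?case by (simp add: q_def)
  qed
  have "G \<subseteq> mpi.span F"
  proof
    fix p assume "p \<in> G"
    then have pI: "p \<in> ?I" by (rule mpi.span_base)
    show "p \<in> mpi.span F"
    proof (cases "p = 0")
      case True
      then show ?thesis by (simp add: mpi.span_zero)
    next
      case False
      then obtain e where "isld p e" using isld_ex by blast
      then show ?thesis using red pI by blast
    qed
  qed
  moreover have "F \<subseteq> G" "finite F" using \<F> E0(2) by (auto simp: F_def)
  ultimately show ?thesis by (intro exI[of _ F]) simp
qed

lemma mxd_in_span: "mxd p \<le> N \<Longrightarrow> (p :: ('v::finite, 'a::field) mp) \<in> mpv.span ((\<lambda>e. single e 1) ` {e. esz e \<le> N})"
proof -
  assume N: "mxd p \<le> N"
  have "(\<Sum>k\<le>N. hcomp k p) \<in> mpv.span ((\<lambda>e. single e 1) ` {e. esz e \<le> N})"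
    by (intro mpv.span_sum hmg_span_le[OF hmg_hcomp]) simp
  then show ?thesis using hcomp_decomp[OF N] by simp
qed

text \<open>An ideal maximal among those missing the powers of \<open>f\<close> is prime, and since the complex numbers are
  uncountable it contains \<open>Xv v - a\<close> for some \<open>a\<close>: otherwise the inverses of uncountably many
  \<open>Xv v - a\<close> would be linearly independent.\<close>

lemma nullstellensatz_complex:
  fixes f :: "('v::finite, complex) mp"
  assumes "\<not> inrad \<Theta> f"
  shows "\<exists>a. (\<forall>\<theta>\<in>\<Theta>. ev a \<theta> = 0) \<and> ev a f \<noteq> 0"
proof -
  define \<A> where "\<A> = {I. mpi.subspace I \<and> \<Theta> \<subseteq> I \<and> (\<forall>n. f ^ n \<notin> I)}"
  have "mpi.span \<Theta> \<in> \<A>"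
    using assms mpi.subspace_span mpi.span_superset by (auto simp: \<A>_def inrad_def)
  then have ne: "\<A> \<noteq> {}" by blast
  have "\<exists>M\<in>\<A>. \<forall>X\<in>\<A>. M \<subseteq> X \<longrightarrow> X = M"
  proof (rule subset_Zorn_nonempty[OF ne])
    fix \<C> assume C: "\<C> \<noteq> {}" "subset.chain \<A> \<C>"
    have CA: "I \<in> \<A>" if "I \<in> \<C>" for I using C(2) that by (auto simp: subset.chain_def)
    have tot: "I \<subseteq> J \<or> J \<subseteq> I" if "I \<in> \<C>" "J \<in> \<C>" for I J using C(2) that by (auto simp: subset.chain_def)
    have "mpi.subspace (\<Union>\<C>)"
      unfolding mpi.subspace_def
    proof (intro conjI ballI allI)
      show "0 \<in> \<Union>\<C>" using C(1) CA by (auto simp: \<A>_def mpi.subspace_def)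
      fix x y assume "x \<in> \<Union>\<C>" "y \<in> \<Union>\<C>"
      then obtain I J where IJ: "I \<in> \<C>" "J \<in> \<C>" "x \<in> I" "y \<in> J" by auto
      have "\<exists>K\<in>\<C>. x \<in> K \<and> y \<in> K" using tot[OF IJ(1,2)] IJ by auto
      then obtain K where K: "K \<in> \<C>" "x \<in> K" "y \<in> K" by auto
      have "mpi.subspace K" using CA[OF K(1)] by (simp add: \<A>_def)
      then have "x + y \<in> K" using K by (intro mpi.subspace_add)
      then show "x + y \<in> \<Union>\<C>" using K(1) by auto
    next
      fix c x assume "x \<in> \<Union>\<C>"
      then obtain I where I: "I \<in> \<C>" "x \<in> I" by auto
      have "mpi.subspace I" using CA[OF I(1)] by (simp add: \<A>_def)
      then have "rsc c x \<in> I" using I by (intro mpi.subspace_scale)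
      then show "rsc c x \<in> \<Union>\<C>" using I(1) by auto
    qed
    moreover have "\<Theta> \<subseteq> \<Union>\<C>" using C(1) CA by (auto simp: \<A>_def)
    moreover have "f ^ n \<notin> \<Union>\<C>" for n using CA by (auto simp: \<A>_def)
    ultimately show "\<Union>\<C> \<in> \<A>" by (simp add: \<A>_def)
  qed
  then obtain M where M: "M \<in> \<A>" "\<And>X. X \<in> \<A> \<Longrightarrow> M \<subseteq> X \<Longrightarrow> X = M" by auto
  have sM: "mpi.subspace M" and TM: "\<Theta> \<subseteq> M" and fM: "\<And>n. f ^ n \<notin> M" using M(1) by (auto simp: \<A>_def)
  have Mspan: "mpi.span M = M" using sM by (rule mpi.span_eq_iff[THEN iffD2])
  have Mmul: "y * x \<in> M" if "x \<in> M" for x y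
    using span_mult_left[of x M y] that by (simp add: Mspan)
  have Madd: "x + y \<in> M" if "x \<in> M" "y \<in> M" for x y using sM that by (rule mpi.subspace_add)
  have Mneg: "- x \<in> M" if "x \<in> M" for x using Mmul[OF that, of "-1"] by simp
  have Mdiff: "x - y \<in> M" if "x \<in> M" "y \<in> M" for x y using Madd[OF that(1) Mneg[OF that(2)]] by simp
  have inv: "\<exists>n u. f ^ n - u * x \<in> M" if "x \<notin> M" for x
  proof -
    have "mpi.span (insert x M) \<noteq> M" using that mpi.span_base[of x "insert x M"] by auto
    moreover have "M \<subseteq> mpi.span (insert x M)" using mpi.span_superset[of "insert x M"] by auto
    ultimately have "mpi.span (insert x M) \<notin> \<A>" using M(2) by auto
    then obtain n where "f ^ n \<in> mpi.span (insert x M)"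
      using TM \<open>M \<subseteq> mpi.span (insert x M)\<close> by (auto simp: \<A>_def)
    then obtain k where "f ^ n - rsc k x \<in> mpi.span M" by (auto simp: mpi.span_insert)
    then show ?thesis by (auto simp: rsc_def Mspan)
  qed
  have prime: "x \<in> M \<or> y \<in> M" if "x * y \<in> M" for x y
  proof (rule ccontr)
    assume "\<not> ?thesis"
    then obtain n u m w where nu: "f ^ n - u * x \<in> M" "f ^ m - w * y \<in> M" using inv by blast
    have "f ^ (n + m) = f ^ m * (f ^ n - u * x) + u * x * (f ^ m - w * y) + u * w * (x * y)"
      by (simp add: power_add algebra_simps)
    moreover have "\<dots> \<in> M" by (intro Madd Mmul nu that)
    ultimately have "f ^ (n + m) \<in> M" by (simp only:)
    then show False using fM by blast
  qed
  have cstM: "c = 0" if "cst c \<in> M" for c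
  proof (rule ccontr)
    assume "c \<noteq> 0"
    then have "cst (1 / c) * cst c = (1 :: ('v, complex) mp)" unfolding mult_single by simp
    then have "f ^ 0 \<in> M" using Mmul[OF that, of "cst (1 / c)"] by simp
    then show False using fM by blast
  qed
  have root: "\<exists>a. x - cst a \<in> M" for x :: "('v, complex) mp"
  proof (rule ccontr)
    assume "\<not> ?thesis"
    then have nin: "\<And>a. x - cst a \<notin> M" by blast
    define nu where "nu a = (SOME (n, u). f ^ n - u * (x - cst a) \<in> M)" for a
    have nu: "f ^ fst (nu a) - snd (nu a) * (x - cst a) \<in> M" for a
    proof -
      obtain n u where "f ^ n - u * (x - cst a) \<in> M" using inv[OF nin[of a]] by blast
      then have "\<exists>t. case t of (n, u) \<Rightarrow> f ^ n - u * (x - cst a) \<in> M" by (intro exI[of _ "(n, u)"]) simp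
      from someI_ex[OF this] show ?thesis unfolding nu_def by (simp add: case_prod_unfold)
    qed
    \<comment> \<open>Only countably many pairs of an exponent and a degree bound exist, so
      infinitely many \<open>a\<close> share one pair. Their quasi-inverses lie in one
      finite-dimensional space and satisfy a linear relation.\<close>
    define g where "g a = (fst (nu a), mxd (snd (nu a)))" for a
    have "\<exists>k. infinite {a. g a = k}"
    proof (rule ccontr)
      assume "\<not> ?thesis"
      then have "countable (\<Union>k. {a. g a = k})" by (intro countable_UN) (auto intro: countable_finite)
      moreover have "(\<Union>k. {a. g a = k}) = (UNIV :: complex set)" by auto
      ultimately show False using uncountable_UNIV_complex by simp
    qed
    then obtain n D where inf: "infinite {a. g a = (n, D)}" by auto
    let ?B = "(\<lambda>e :: 'v \<Rightarrow> nat. single e (1 :: complex)) ` {e. esz e \<le> D}"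
    obtain A where A: "finite A" "card A = Suc (card ?B)" "A \<subseteq> {a. g a = (n, D)}"
      using infinite_arbitrarily_large[OF inf] by blast
    define u where "u a = snd (nu a)" for a
    have u: "f ^ n - u a * (x - cst a) \<in> M" "mxd (u a) \<le> D" if "a \<in> A" for a
      using A(3) that nu[of a] by (auto simp: g_def u_def)
    have "card ?B < card A" unfolding A(2) by (rule lessI)
    have "\<exists>c. (\<exists>i\<in>A. c i \<noteq> 0) \<and> (\<Sum>i\<in>A. cst (c i) * u i) = 0"
      by (rule family_dependent[OF A(1) finite_imageI[OF finite_esz] \<open>card ?B < card A\<close>])
        (rule mxd_in_span[OF u(2)])
    then obtain c where c: "\<exists>i\<in>A. c i \<noteq> 0" "(\<Sum>i\<in>A. cst (c i) * u i) = 0" by (elim exE conjE)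
    define L where "L a = [:-a, 1:]" for a :: complex
    interpret mc: map_poly_comm_ring_hom "cst :: complex \<Rightarrow> ('v, complex) mp"
      by (simp add: map_poly_comm_ring_hom_def cst_hom)
    define W where "W w = poly (map_poly cst w) x" for w
    have Wmult: "W (p * q) = W p * W q" for p q by (simp add: W_def mc.hom_mult)
    have Wsum: "W (sum h S) = (\<Sum>i\<in>S. W (h i))" for h :: "complex \<Rightarrow> complex poly" and S by (simp add: W_def mc.hom_sum poly_sum)
    have Wprod: "W (prod h S) = (\<Prod>i\<in>S. W (h i))" for h :: "complex \<Rightarrow> complex poly" and S by (simp add: W_def mc.hom_prod poly_prod)
    have "map_poly cst [:t:] = [:cst t :: ('v, complex) mp:]" for t
      by (rule poly_eqI) (simp add: coeff_map_poly coeff_pCons split: nat.split)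
    then have Wc: "W [:t:] = cst t" for t by (simp add: W_def)
    have "map_poly cst (L a) = [:- cst a, 1 :: ('v, complex) mp:]" for a
      by (rule poly_eqI) (simp add: L_def coeff_map_poly coeff_pCons single_uminus split: nat.split)
    then have WL: "W (L a) = x - cst a" for a by (simp add: W_def)
    \<comment> \<open>The numerator of the sum of the fractions \<open>c a / (x - a)\<close>. At
      \<open>a0\<close> only one summand survives, so \<open>w\<close> is not the zero
      polynomial.\<close>
    define w where "w = (\<Sum>a\<in>A. [:c a:] * (\<Prod>b\<in>A - {a}. L b))"
    obtain a0 where a0: "a0 \<in> A" "c a0 \<noteq> 0" using c(1) by blast
    have "poly w a0 = (\<Sum>a\<in>A. c a * (\<Prod>b\<in>A - {a}. a0 - b))" by (simp add: w_def poly_sum poly_prod L_def)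
    also have "\<dots> = c a0 * (\<Prod>b\<in>A - {a0}. a0 - b)"
    proof (subst sum.remove[OF A(1) a0(1)])
      have "c a * (\<Prod>b\<in>A - {a}. a0 - b) = 0" if "a \<in> A - {a0}" for a
        using that A(1) a0(1) by (auto intro!: prod_zero bexI[of _ a0])
      then have "(\<Sum>a\<in>A - {a0}. c a * (\<Prod>b\<in>A - {a}. a0 - b)) = 0" by (intro sum.neutral ballI)
      then show "c a0 * (\<Prod>b\<in>A - {a0}. a0 - b) + (\<Sum>a\<in>A - {a0}. c a * (\<Prod>b\<in>A - {a}. a0 - b)) = c a0 * (\<Prod>b\<in>A - {a0}. a0 - b)"
        by simp
    qed
    also have "\<dots> \<noteq> 0" using A(1) a0(2) by auto
    finally have w0: "w \<noteq> 0" by auto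
    have fW: "f ^ n * W w = (\<Sum>a\<in>A. cst (c a) * (\<Prod>b\<in>A - {a}. x - cst b) * (f ^ n - u a * (x - cst a)))"
    proof -
      have 1: "W w = (\<Sum>a\<in>A. cst (c a) * (\<Prod>b\<in>A - {a}. x - cst b))"
        unfolding w_def Wsum Wmult Wprod Wc WL ..
      have 2: "(\<Prod>b\<in>A - {a}. x - cst b) * (u a * (x - cst a)) = (\<Prod>b\<in>A. x - cst b) * u a" if "a \<in> A" for a
        using prod.remove[OF A(1) that, of "\<lambda>b. x - cst b"] by (simp add: mult_ac)
      have "(\<Sum>a\<in>A. cst (c a) * (\<Prod>b\<in>A - {a}. x - cst b) * (u a * (x - cst a)))
        = (\<Sum>a\<in>A. (\<Prod>b\<in>A. x - cst b) * (cst (c a) * u a))"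
      proof (intro sum.cong refl)
        fix a assume "a \<in> A"
        have "cst (c a) * (\<Prod>b\<in>A - {a}. x - cst b) * (u a * (x - cst a))
          = cst (c a) * ((\<Prod>b\<in>A - {a}. x - cst b) * (u a * (x - cst a)))" by (rule mult.assoc)
        then show "cst (c a) * (\<Prod>b\<in>A - {a}. x - cst b) * (u a * (x - cst a)) = (\<Prod>b\<in>A. x - cst b) * (cst (c a) * u a)"
          unfolding 2[OF \<open>a \<in> A\<close>] by (simp only: mult_ac)
      qed
      also have "\<dots> = 0" by (simp only: sum_distrib_left[symmetric] c(2) mult_zero_right)
      finally have z: "(\<Sum>a\<in>A. cst (c a) * (\<Prod>b\<in>A - {a}. x - cst b) * (u a * (x - cst a))) = 0" .
      show ?thesis
        unfolding 1 right_diff_distrib[of _ "f ^ n"] sum_subtractf z sum_distrib_left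
        by (simp add: mult.commute)
    qed
    have "f ^ n * W w \<in> M" unfolding fW
      using sM by (intro mpi.subspace_sum Mmul u(1))
    then have WM: "W w \<in> M" using prime fM by blast
    \<comment> \<open>A nonzero polynomial splits into linear factors over the complex numbers, and
      the ideal \<open>M\<close> is prime and contains no nonzero constant.\<close>
    have "\<exists>a. x - cst a \<in> M" if "W w \<in> M" "w \<noteq> 0" for w
      using that
    proof (induction "Polynomial.degree w" arbitrary: w)
      case 0
      then obtain t where t: "w = [:t:]" by (metis degree_eq_zeroE)
      then have "t \<noteq> 0" using 0 by auto
      moreover have "cst t \<in> M" using 0(2) by (simp only: t Wc)
      ultimately show ?case using cstM by blast
    next
      case (Suc k)
      then have "\<not> constant (poly w)" by (simp add: constant_degree)
      then obtain r where r: "poly w r = 0" using Fundamental_Theorem_Algebra.fundamental_theorem_of_algebra by blast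
      then obtain q where q: "w = L r * q" unfolding L_def by (auto simp: poly_eq_0_iff_dvd dvd_def)
      have q0: "q \<noteq> 0" using q Suc.prems by auto
      have "Polynomial.degree w = Suc (Polynomial.degree q)"
        unfolding q L_def using q0 by (subst degree_mult_eq) auto
      then have dq: "k = Polynomial.degree q" using Suc.hyps by simp
      have "W (L r) * W q \<in> M" using Suc.prems(1) unfolding q Wmult .
      then show ?case using prime Suc.hyps(1)[OF dq _ q0] unfolding WL by blast
    qed
    from this[OF WM w0] show False using nin by blast
  qed
  define a where "a v = (SOME a. Xv v - cst a \<in> M)" for v :: 'v
  have a: "Xv v - cst (a v) \<in> M" for v unfolding a_def by (rule someI_ex[OF root])
  have evM: "p - cst (ev a p) \<in> M" for p
  proof -
    have "evh cst Xv p - evh cst (\<lambda>v. cst (a v)) p \<in> mpi.span M"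
      by (rule evh_diff_ideal[OF cst_hom]) (simp add: Mspan a)
    then show ?thesis unfolding mp_eq_evh Mspan hom_evh[OF cst_hom, of "\<lambda>c. c" a p] .
  qed
  have "ev a \<theta> = 0" if "\<theta> \<in> \<Theta>" for \<theta>
  proof (rule cstM)
    have "\<theta> - (\<theta> - cst (ev a \<theta>)) \<in> M" using TM that by (intro Mdiff evM) auto
    then show "cst (ev a \<theta>) \<in> M" by simp
  qed
  moreover have "ev a f \<noteq> 0"
  proof
    assume "ev a f = 0"
    then have "f ^ 1 \<in> M" using evM[of f] by simp
    then show False using fM by blast
  qed
  ultimately show ?thesis by blast
qed

section \<open>Degree bounds from the null cone\<close>

definition scm :: "rat \<Rightarrow> 'k::field_char_0 \<Rightarrow> 'k" where "scm c z = of_rat c * z"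

interpretation scv: vector_space "scm :: rat \<Rightarrow> 'k::field_char_0 \<Rightarrow> 'k"
  by unfold_locales (simp_all add: scm_def of_rat_add of_rat_mult ring_distribs)

interpretation rcv: vector_space_pair "scm :: rat \<Rightarrow> rat \<Rightarrow> rat" "scm :: rat \<Rightarrow> 'k::field_char_0 \<Rightarrow> 'k" ..

section \<open>Descent of ideal membership to the rationals\<close>

lemma rat_retraction:
  "\<exists>\<pi> :: 'k::field_char_0 \<Rightarrow> rat. (\<forall>x y. \<pi> (x + y) = \<pi> x + \<pi> y) \<and> (\<forall>c x. \<pi> (of_rat c * x) = c * \<pi> x) \<and> \<pi> 1 = 1"
proof -
  have lin: "Vector_Spaces.linear scm scm (of_rat :: rat \<Rightarrow> 'k)"
    by unfold_locales (simp_all add: scm_def of_rat_add of_rat_mult)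
  have inj: "inj_on (of_rat :: rat \<Rightarrow> 'k) UNIV" by (simp add: inj_on_def)
  from rcv.linear_exists_left_inverse_on[OF lin scv.subspace_UNIV inj]
  obtain g where g: "Vector_Spaces.linear scm scm g" "\<And>v. g (of_rat v :: 'k) = v" by auto
  interpret g: Vector_Spaces.linear scm scm g by (rule g(1))
  have "g (x + y) = g x + g y" for x y by (rule g.add)
  moreover have "g (of_rat c * x) = c * g x" for c x using g.scale[of c x] by (simp add: scm_def)
  moreover have "g 1 = 1" using g(2)[of 1] by simp
  ultimately show ?thesis by (intro exI[of _ g]) simp
qed

definition cx :: "('v::finite, rat) mp \<Rightarrow> ('v, 'k::field_char_0) mp" where
  "cx p = evh (\<lambda>c. cst (of_rat c)) Xv p"

lemma lookup_cx: "lookup (cx p :: ('v::finite, 'k::field_char_0) mp) e = of_rat (lookup p e)"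
proof -
  have "(cx p :: ('v, 'k) mp) = (\<Sum>e\<in>keys p. single e (of_rat (lookup p e)))"
    by (simp add: cx_def evh_def flip: single_eq_mon)
  then have "lookup (cx p :: ('v, 'k) mp) e = (\<Sum>e'\<in>keys p. if e' = e then of_rat (lookup p e) else 0)"
    by (simp add: lookup_sum lookup_single when_def cong: if_cong)
  then show ?thesis by (simp add: in_keys_iff)
qed

lemma cst_of_rat_hom: "comm_ring_hom (\<lambda>c. cst (of_rat c) :: ('v::finite, 'k::field_char_0) mp)"
proof -
  interpret a: comm_ring_hom "cst :: 'k \<Rightarrow> ('v, 'k) mp" by (rule cst_hom)
  show ?thesis by unfold_locales (simp_all add: a.hom_add a.hom_mult of_rat_add of_rat_mult)
qed

interpretation cx: comm_ring_hom "cx :: ('v::finite, rat) mp \<Rightarrow> ('v, 'k::field_char_0) mp"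
  unfolding cx_def by (rule evh_hom[OF cst_of_rat_hom])

lemma ev_cx: "ev X (cx p) = evq X p"
  unfolding cx_def by (subst hom_evh[OF evid.comm_ring_hom_axioms]) simp

definition cmap :: "('a::comm_ring_1 \<Rightarrow> 'b::comm_ring_1) \<Rightarrow> ('v::finite, 'a) mp \<Rightarrow> ('v, 'b) mp" where
  "cmap h p = (\<Sum>e\<in>keys p. single e (h (lookup p e)))"

lemma lookup_cmap: "h 0 = 0 \<Longrightarrow> lookup (cmap h p) e = h (lookup p e)"
proof -
  assume h: "h 0 = 0"
  have "lookup (cmap h p) e = (\<Sum>e'\<in>keys p. if e' = e then h (lookup p e) else 0)"
    unfolding cmap_def by (simp add: lookup_sum lookup_single when_def cong: if_cong)
  then show ?thesis using h by (simp add: in_keys_iff)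
qed

lemma lookup_mult_superset:
  assumes "finite S" "keys p \<subseteq> S" "finite T" "keys q \<subseteq> T"
  shows "lookup (p * q) k = (\<Sum>e\<in>S. \<Sum>e'\<in>T. if e + e' = k then lookup p e * lookup q e' else 0)"
proof -
  have "(\<Sum>e'\<in>keys q. if e + e' = k then lookup p e * lookup q e' else 0)
    = (\<Sum>e'\<in>T. if e + e' = k then lookup p e * lookup q e' else 0)" for e
    using assms by (intro sum.mono_neutral_left) (auto simp: in_keys_iff)
  then have "lookup (p * q) k = (\<Sum>e\<in>keys p. \<Sum>e'\<in>T. if e + e' = k then lookup p e * lookup q e' else 0)"
    by (simp add: lookup_mult')
  also have "\<dots> = (\<Sum>e\<in>S. \<Sum>e'\<in>T. if e + e' = k then lookup p e * lookup q e' else 0)"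
    using assms by (intro sum.mono_neutral_left) (auto simp: in_keys_iff intro!: sum.neutral)
  finally show ?thesis .
qed

text \<open>\<open>\<pi>\<close> is not multiplicative, but it is linear over the rationals. Applied
  to coefficients it is therefore linear over rational polynomials, and it turns a complex
  combination of rational polynomials into a rational one.\<close>

lemma cmap_cx_mult:
  fixes \<pi> :: "'k::field_char_0 \<Rightarrow> rat"
  assumes add: "\<And>x y. \<pi> (x + y) = \<pi> x + \<pi> y" and mul: "\<And>c x. \<pi> (of_rat c * x) = c * \<pi> x"
  shows "cmap \<pi> (cx p * g) = p * cmap \<pi> (g :: ('v::finite, 'k) mp)"
proof (rule poly_mapping_eqI)
  fix k
  have z: "\<pi> 0 = 0" using mul[of 0 0] by simp
  have sum2: "\<pi> (sum f A) = (\<Sum>a\<in>A. \<pi> (f a))" for f :: "('v \<Rightarrow> nat) \<Rightarrow> 'k" and A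
    by (induction A rule: infinite_finite_induct) (simp_all add: add z)
  have kc: "keys (cx p :: ('v, 'k) mp) \<subseteq> keys p" by (auto simp: in_keys_iff lookup_cx)
  have kg: "keys (cmap \<pi> g) \<subseteq> keys g" by (auto simp: in_keys_iff lookup_cmap z)
  have "lookup (cmap \<pi> (cx p * g)) k
    = \<pi> (\<Sum>e\<in>keys p. \<Sum>e'\<in>keys g. if e + e' = k then of_rat (lookup p e) * lookup g e' else 0)"
    using lookup_mult_superset[OF finite_keys kc finite_keys order_refl, of g k]
    by (simp add: lookup_cmap z lookup_cx cong: if_cong)
  also have "\<dots> = (\<Sum>e\<in>keys p. \<Sum>e'\<in>keys g. if e + e' = k then lookup p e * \<pi> (lookup g e') else 0)"
    unfolding sum2 by (intro sum.cong refl) (simp add: mul z cong: if_cong)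
  also have "\<dots> = lookup (p * cmap \<pi> g) k"
    using lookup_mult_superset[OF finite_keys order_refl finite_keys kg, of p k]
    by (simp add: lookup_cmap z cong: if_cong)
  finally show "lookup (cmap \<pi> (cx p * g)) k = lookup (p * cmap \<pi> g) k" .
qed

lemma nullstellensatz_rat:
  fixes f :: "('v::finite, rat) mp"
  assumes "\<And>X :: 'v \<Rightarrow> complex. (\<forall>\<theta>\<in>\<Theta>. evq X \<theta> = 0) \<Longrightarrow> evq X f = 0"
  shows "inrad \<Theta> f"
proof -
  have "inrad (cx ` \<Theta> :: ('v, complex) mp set) (cx f)"
  proof (rule ccontr)
    assume "\<not> ?thesis"
    then obtain a where a: "\<forall>\<theta>\<in>cx ` \<Theta>. ev a (\<theta> :: ('v, complex) mp) = 0" "ev a (cx f) \<noteq> 0"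
      using nullstellensatz_complex by metis
    have "\<forall>\<theta>\<in>\<Theta>. evq a \<theta> = 0"
    proof
      fix \<theta> assume "\<theta> \<in> \<Theta>"
      then have "ev a (cx \<theta>) = 0" using a(1) by auto
      then show "evq a \<theta> = 0" by (simp only: ev_cx)
    qed
    then have "evq a f = 0" by (rule assms)
    then show False using a(2) by (simp only: ev_cx)
  qed
  then obtain n where n: "(cx f :: ('v, complex) mp) ^ n \<in> mpi.span (cx ` \<Theta>)" by (auto simp: inrad_def)
  obtain F where F: "F \<subseteq> cx ` \<Theta>" "finite F" "(cx f :: ('v, complex) mp) ^ n \<in> mpi.span F"
    using ispan_finite_subset[OF n] by auto
  obtain T where T: "T \<subseteq> \<Theta>" "finite T" "F = cx ` T" using finite_subset_image[OF F(2,1)] by auto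
  obtain u where u: "(cx f :: ('v, complex) mp) ^ n = (\<Sum>a\<in>F. a * u a)" using ispan_rep[OF F(2,3)] by auto
  have inj: "inj_on (cx :: ('v, rat) mp \<Rightarrow> ('v, complex) mp) T"
  proof (rule inj_onI)
    fix p q :: "('v, rat) mp" assume "(cx p :: ('v, complex) mp) = cx q"
    then have "of_rat (lookup p e) = (of_rat (lookup q e) :: complex)" for e by (metis lookup_cx)
    then show "p = q" by (intro poly_mapping_eqI) simp
  qed
  have eq: "(cx (f ^ n) :: ('v, complex) mp) = (\<Sum>t\<in>T. cx t * u (cx t))"
    unfolding cx.hom_power u T(3) sum.reindex[OF inj] o_def ..
  obtain \<pi> :: "complex \<Rightarrow> rat" where p: "\<And>x y. \<pi> (x + y) = \<pi> x + \<pi> y" "\<And>c x. \<pi> (of_rat c * x) = c * \<pi> x" "\<pi> 1 = 1"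
    using rat_retraction[where 'k=complex] by auto
  have z: "\<pi> 0 = 0" using p(2)[of 0 0] by simp
  have cadd: "cmap \<pi> (x + y) = cmap \<pi> x + cmap \<pi> y" for x y :: "('v, complex) mp"
    by (rule poly_mapping_eqI) (simp add: lookup_cmap z lookup_add p(1))
  have csum: "cmap \<pi> (sum h A) = (\<Sum>t\<in>A. cmap \<pi> (h t))" for h :: "('v, rat) mp \<Rightarrow> ('v, complex) mp" and A
  proof (induction A rule: infinite_finite_induct)
    case (infinite A)
    then show ?case by (simp add: cmap_def)
  next
    case empty
    then show ?case by (simp add: cmap_def)
  qed (simp add: cadd)
  have "cmap \<pi> (cx (f ^ n) :: ('v, complex) mp) = f ^ n"
  proof (rule poly_mapping_eqI)
    fix k
    have "\<pi> (of_rat c) = c" for c using p(2)[of c 1] p(3) by simp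
    then show "lookup (cmap \<pi> (cx (f ^ n) :: ('v, complex) mp)) k = lookup (f ^ n) k"
      by (simp only: lookup_cmap[of \<pi>, OF z] lookup_cx)
  qed
  then have "f ^ n = (\<Sum>t\<in>T. t * cmap \<pi> (u (cx t)))"
    unfolding eq csum cmap_cx_mult[OF p(1,2)] ..
  then have "f ^ n \<in> mpi.span \<Theta>" using T(1) ispan_sumI[of T "\<lambda>t. t" \<Theta>] by (simp add: subset_iff)
  then show ?thesis by (auto simp: inrad_def)
qed

inductive_set galg :: "('v::finite \<Rightarrow> 'v \<Rightarrow> rat) set \<Rightarrow> nat \<Rightarrow> ('v, rat) mp set" for \<Gamma> D where
  galg_cst: "cst c \<in> galg \<Gamma> D"
| galg_base: "f \<in> Inv \<Gamma> \<Longrightarrow> hmg k f \<Longrightarrow> k \<le> D \<Longrightarrow> f \<in> galg \<Gamma> D"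
| galg_add: "f \<in> galg \<Gamma> D \<Longrightarrow> g \<in> galg \<Gamma> D \<Longrightarrow> f + g \<in> galg \<Gamma> D"
| galg_mult: "f \<in> galg \<Gamma> D \<Longrightarrow> g \<in> galg \<Gamma> D \<Longrightarrow> f * g \<in> galg \<Gamma> D"

lemma galg_sum: "(\<And>i. i \<in> I \<Longrightarrow> f i \<in> galg \<Gamma> D) \<Longrightarrow> sum f I \<in> galg \<Gamma> D"
  using galg_cst[of 0 \<Gamma> D] by (induction I rule: infinite_finite_induct) (auto intro: galg_add)

text \<open>All parameters have degree \<open>d\<close>, so their degrees sum to
  \<open>CARD('v) * d\<close>. Above this bound an invariant is in their ideal with invariant
  cofactors of degree \<open>e - d\<close>, and induction on the degree finishes, the parameters
  themselves being below the bound.\<close>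

theorem degree_bound_from_null_cone:
  fixes \<Gamma> :: "('v::finite \<Rightarrow> 'v \<Rightarrow> rat) set"
  assumes sym: "\<And>L. L \<in> \<Gamma> \<Longrightarrow> transp L \<in> \<Gamma>" and d: "0 < d"
    and nc: "\<And>(X :: 'v \<Rightarrow> complex) f j. f \<in> Inv \<Gamma> \<Longrightarrow> hmg j f \<Longrightarrow> 0 < j \<Longrightarrow> evq X f \<noteq> 0 \<Longrightarrow>
      \<exists>\<theta>\<in>Inv \<Gamma>. hmg d \<theta> \<and> evq X \<theta> \<noteq> 0"
    and f: "f \<in> Inv \<Gamma>" "hmg e f"
  shows "f \<in> galg \<Gamma> (CARD('v) * d)"
proof -
  define Rp where "Rp = {f. f \<in> Inv \<Gamma> \<and> (\<exists>j>0. hmg j f)}"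
  obtain F where F: "F \<subseteq> Rp" "finite F" "Rp \<subseteq> mpi.span F" using hilbert_basis[of Rp] by auto
  define V where "V = {f. f \<in> Inv \<Gamma> \<and> hmg d f}"
  have sV: "mpv.subspace V"
    by (simp add: V_def mpv.subspace_def msc_def Inv_0 Inv_add Inv_mult Inv_cst hmg_add hmg_cst_mult)
  \<comment> \<open>By \<open>nc\<close> the common complex zeros of \<open>V\<close> are zeros of
    every homogeneous invariant of positive degree.\<close>
  have radV: "inrad V x" if xF: "x \<in> F" for x
  proof (rule nullstellensatz_rat)
    fix X :: "'v \<Rightarrow> complex" assume X: "\<forall>\<theta>\<in>V. evq X \<theta> = 0"
    obtain j where "x \<in> Inv \<Gamma>" "0 < j" "hmg j x" using subsetD[OF F(1) xF] by (auto simp: Rp_def)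
    then show "evq X x = 0" using nc[of x j X] X by (auto simp: V_def)
  qed
  obtain G where G: "G \<subseteq> V" "finite G" "V \<subseteq> mpi.span G" using hilbert_basis[of V] by auto
  have "\<exists>\<theta> :: 'v \<Rightarrow> ('v, rat) mp. (\<forall>v. \<theta> v \<in> V) \<and> (\<forall>x\<in>G. inrad (range \<theta>) x)"
    by (rule noether_normalization[OF G(2) sV G(1) _ d]) (auto simp: V_def)
  then obtain \<theta> :: "'v \<Rightarrow> ('v, rat) mp" where th0: "\<forall>v. \<theta> v \<in> V" "\<forall>x\<in>G. inrad (range \<theta>) x"
    by (elim exE conjE)
  then have th: "\<And>v. \<theta> v \<in> V" "\<And>x. x \<in> G \<Longrightarrow> inrad (range \<theta>) x" by simp_all
  have thI: "\<theta> v \<in> Inv \<Gamma> \<and> hmg d (\<theta> v)" for v using th(1)[of v] by (simp add: V_def)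
  have rF: "inrad (range \<theta>) x" if "x \<in> F" for x
  proof (rule inrad_trans'[OF radV[OF that]])
    fix a assume "a \<in> V"
    then have "a \<in> mpi.span G" using G(3) by auto
    then show "inrad (range \<theta>) a" by (rule inrad_trans) (rule th(2))
  qed
  have "\<exists>M. \<forall>j\<ge>M. \<forall>f\<in>Inv \<Gamma>. hmg j f \<longrightarrow> f \<in> mpi.span (range \<theta>)"
  proof (rule finite_over_parameters[OF sym F(2) _ _ thI rF])
    fix x assume "x \<in> F"
    then show "x \<in> Inv \<Gamma> \<and> (\<exists>k. hmg k x)" using F(1) by (auto simp: Rp_def)
  next
    fix j f assume "0 < j" "f \<in> Inv \<Gamma>" "hmg j f"
    then have "f \<in> Rp" by (auto simp: Rp_def)
    then show "f \<in> mpi.span F" using F(3) by auto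
  qed
  then obtain M where M: "\<And>j f. M \<le> j \<Longrightarrow> f \<in> Inv \<Gamma> \<Longrightarrow> hmg j f \<Longrightarrow> f \<in> mpi.span (range \<theta>)" by auto
  have dD: "d \<le> CARD('v) * d" by simp
  show ?thesis using f
  proof (induction e arbitrary: f rule: less_induct)
    case (less e)
    show ?case
    proof (cases "e \<le> CARD('v) * d")
      case True
      then show ?thesis using less.prems by (intro galg_base)
    next
      case False
      then have "f \<in> mpi.span (range \<theta>)"
        using briancon_skoda[of \<Gamma> \<theta> d M f e, OF sym thI d M less.prems] by simp
      then obtain u where "f = (\<Sum>a\<in>range \<theta>. a * u a)" using ispan_rep[of "range \<theta>" f] by auto
      moreover have "a \<in> Inv \<Gamma> \<and> hmg d a" if "a \<in> range \<theta>" for a using that thI by auto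
      ultimately obtain h where h: "\<And>a. h a \<in> Inv \<Gamma> \<and> hmg (e - d) (h a)" "f = (\<Sum>a\<in>range \<theta>. a * h a)"
        using reynolds[of \<Gamma> f e "range \<theta>" "\<lambda>a. a" "\<lambda>_. d" u, OF sym less.prems] by auto
      have "e - d < e" using d dD False by simp
      then have "h a \<in> galg \<Gamma> (CARD('v) * d)" for a using h(1)[of a] by (intro less.IH) auto
      moreover have "a \<in> galg \<Gamma> (CARD('v) * d)" if "a \<in> range \<theta>" for a
      proof (rule galg_base[OF _ _ dD])
        show "a \<in> Inv \<Gamma>" "hmg d a" using that thI by auto
      qed
      ultimately show ?thesis unfolding h(2) by (intro galg_sum galg_mult)
    qed
  qed
qed

section \<open>Determinants\<close>

text \<open>The sizes of minors and blow-ups vary within proofs, so matrices are functions on all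
  pairs of naturals, cut off at \<open>N\<close>.\<close>

definition ndet :: "nat \<Rightarrow> (nat \<Rightarrow> nat \<Rightarrow> 'a::comm_ring_1) \<Rightarrow> 'a" where
  "ndet N M = Determinant.det (Matrix.mat N N (\<lambda>(i, j). M i j))"

abbreviation perms :: "nat \<Rightarrow> (nat \<Rightarrow> nat) set" where
  "perms N \<equiv> {\<pi>. \<pi> permutes {..<N}}"

lemma ndet_leibniz: "ndet N M = (\<Sum>\<pi>\<in>perms N. of_int (sign \<pi>) * (\<Prod>i<N. M i (\<pi> i)))"
proof -
  have "\<pi> permutes {..<N} \<Longrightarrow> i < N \<Longrightarrow> \<pi> i < N" for \<pi> i
    using permutes_in_image[of \<pi> "{..<N}" i] by simp
  then show ?thesis
    unfolding ndet_def by (subst Determinant.det_def'[of _ N]) (auto simp: atLeast0LessThan intro!: sum.cong prod.cong)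
qed

lemma ndet_cong: "(\<And>i j. i < N \<Longrightarrow> j < N \<Longrightarrow> M i j = M' i j) \<Longrightarrow> ndet N M = ndet N M'"
  unfolding ndet_def by (rule arg_cong[of _ _ Determinant.det]) auto

lemma ndet_mult: "ndet N (\<lambda>i j. \<Sum>k<N. A i k * B k j) = ndet N A * ndet N B"
proof -
  have "Matrix.mat N N (\<lambda>(i, j). \<Sum>k<N. A i k * B k j) = Matrix.mat N N (\<lambda>(i, j). A i j) * Matrix.mat N N (\<lambda>(i, j). B i j)"
    by (rule eq_matI) (auto simp: scalar_prod_def atLeast0LessThan)
  then show ?thesis unfolding ndet_def using Determinant.det_mult[of "Matrix.mat N N (\<lambda>(i, j). A i j)" N "Matrix.mat N N (\<lambda>(i, j). B i j)"] by simp
qed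

lemma ndet_hom: "comm_ring_hom h \<Longrightarrow> h (ndet N M) = ndet N (\<lambda>i j. h (M i j))"
proof -
  assume "comm_ring_hom h"
  then interpret comm_ring_hom h .
  show ?thesis unfolding ndet_leibniz by (simp add: hom_sum hom_mult hom_prod)
qed

lemma ndet_row_perm: "\<pi> \<in> perms N \<Longrightarrow> ndet N (\<lambda>i j. M (\<pi> i) j) = of_int (sign \<pi>) * ndet N M"
proof -
  assume "\<pi> \<in> perms N"
  then have p: "\<pi> permutes {0..<N}" by (simp add: atLeast0LessThan)
  have "i < N \<Longrightarrow> \<pi> i < N" for i using permutes_in_image[OF p, of i] by simp
  then have "Matrix.mat N N (\<lambda>(i, j). M (\<pi> i) j) = Matrix.mat N N (\<lambda>(i, j). Matrix.mat N N (\<lambda>(i, j). M i j) $$ (\<pi> i, j))"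
    by (intro eq_matI) auto
  then show ?thesis
    unfolding ndet_def using det_permute_rows[OF _ p, of "Matrix.mat N N (\<lambda>(i, j). M i j)"] by simp
qed

lemma ndet_transpose: "ndet N (\<lambda>i j. M j i) = ndet N M"
proof -
  have "transpose_mat (Matrix.mat N N (\<lambda>(i, j). M i j)) = Matrix.mat N N (\<lambda>(i, j). M j i)"
    by (rule eq_matI) auto
  then show ?thesis unfolding ndet_def using Determinant.det_transpose[of "Matrix.mat N N (\<lambda>(i, j). M i j)" N] by simp
qed

lemma ndet_one: "ndet N (\<lambda>i j. if i = j then 1 else 0) = 1"
proof -
  have "Matrix.mat N N (\<lambda>(i, j). if i = j then 1 else 0) = (1\<^sub>m N :: 'a mat)" by (rule eq_matI) auto
  then show ?thesis unfolding ndet_def by simp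
qed

lemma ndet_rows_sum:
  fixes E :: "nat \<Rightarrow> 'r \<Rightarrow> nat \<Rightarrow> 'a::comm_ring_1"
  assumes "\<And>s. s < N \<Longrightarrow> finite (R s)"
  shows "ndet N (\<lambda>s a. \<Sum>r\<in>R s. Z s r * E s r a)
    = (\<Sum>r\<in>PiE {..<N} R. (\<Prod>s<N. Z s (r s)) * ndet N (\<lambda>s a. E s (r s) a))"
proof -
  have "ndet N (\<lambda>s a. \<Sum>r\<in>R s. Z s r * E s r a)
    = (\<Sum>\<pi>\<in>perms N. of_int (sign \<pi>) * (\<Sum>r\<in>PiE {..<N} R. \<Prod>s<N. Z s (r s) * E s (r s) (\<pi> s)))"
    unfolding ndet_leibniz using assms by (intro sum.cong refl arg_cong2[of _ _ _ _ times] prod_sum_PiE) auto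
  also have "\<dots> = (\<Sum>\<pi>\<in>perms N. \<Sum>r\<in>PiE {..<N} R. (\<Prod>s<N. Z s (r s)) * (of_int (sign \<pi>) * (\<Prod>s<N. E s (r s) (\<pi> s))))"
    by (simp add: sum_distrib_left prod.distrib mult_ac)
  also have "\<dots> = (\<Sum>r\<in>PiE {..<N} R. (\<Prod>s<N. Z s (r s)) * ndet N (\<lambda>s a. E s (r s) a))"
    unfolding ndet_leibniz by (subst sum.swap) (simp add: sum_distrib_left)
  finally show ?thesis .
qed

lemma ndet_scale_rows: "ndet N (\<lambda>s a. z s * E s a) = (\<Prod>s<N. z s) * ndet N E"
  unfolding ndet_leibniz by (simp add: prod.distrib sum_distrib_left mult_ac)

lemma ndet_kron:
  fixes A :: "nat \<Rightarrow> nat \<Rightarrow> 'a::idom"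
  assumes p: "0 < p"
  shows "ndet (p * w) (\<lambda>a b. if a div p = b div p then A (a mod p) (b mod p) else 0) = ndet p A ^ w"
proof (induction w)
  case 0
  show ?case by (simp add: ndet_def)
next
  case (Suc w)
  let ?K = "\<lambda>(a, b). if a div p = b div p then A (a mod p) (b mod p) else 0"
  have "Matrix.mat (p * Suc w) (p * Suc w) ?K
    = four_block_mat (Matrix.mat (p * w) (p * w) ?K) (0\<^sub>m (p * w) p) (0\<^sub>m p (p * w)) (Matrix.mat p p (\<lambda>(i, j). A i j))"
    (is "?L = ?R")
  proof (rule eq_matI)
    fix a b assume "a < dim_row ?R" "b < dim_col ?R"
    then have ab: "a < p * w + p" "b < p * w + p" by auto
    have lt: "a div p < w \<longleftrightarrow> a < p * w" for a using p by (simp add: div_less_iff_less_mult mult.commute)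
    have ge: "a div p = w \<and> a mod p = a - p * w" if "\<not> a < p * w" "a < p * w + p" for a
    proof -
      from that have "a = p * w + (a - p * w)" "a - p * w < p" by auto
      then have "a div p = (p * w + (a - p * w)) div p" "a mod p = (p * w + (a - p * w)) mod p" by simp_all
      then show ?thesis using \<open>a - p * w < p\<close> p by simp
    qed
    have L: "?L $$ (a, b) = ?K (a, b)" using ab by simp
    show "?L $$ (a, b) = ?R $$ (a, b)"
    proof (cases "a < p * w")
      case a: True
      then have "a div p < w" using lt by simp
      then show ?thesis unfolding L using ab a lt[of b] ge[of b] by (cases "b < p * w") auto
    next
      case a: False
      then have a': "a div p = w" "a mod p = a - p * w" using ge ab by simp_all
      show ?thesis unfolding L using ab a a' lt[of b] ge[of b] by (cases "b < p * w") auto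
    qed
  qed auto
  then have "ndet (p * Suc w) (\<lambda>a b. ?K (a, b)) = ndet (p * w) (\<lambda>a b. ?K (a, b)) * ndet p A"
    unfolding ndet_def
    by (subst det_four_block_mat_lower_left_zero[where n = "p * w" and m = p, symmetric]) simp_all
  then show ?case using Suc by simp
qed

section \<open>Enumeration of finite index types\<close>

definition en :: "nat \<Rightarrow> 'p::finite" where
  "en = (SOME f. bij_betw f {..<CARD('p)} UNIV)"

lemma bij_en: "bij_betw (en :: nat \<Rightarrow> 'p::finite) {..<CARD('p)} UNIV"
proof -
  have "\<exists>f :: nat \<Rightarrow> 'p. bij_betw f {..<CARD('p)} UNIV"
    using ex_bij_betw_nat_finite[of "UNIV :: 'p set"] by (simp add: atLeast0LessThan)
  then show ?thesis unfolding en_def by (rule someI_ex)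
qed

definition de :: "'p::finite \<Rightarrow> nat" where
  "de = inv_into {..<CARD('p)} en"

lemma de_lt: "de (i :: 'p::finite) < CARD('p)"
  using bij_en[where 'p='p] unfolding de_def bij_betw_def by (metis inv_into_into lessThan_iff UNIV_I)

lemma en_de [simp]: "en (de i) = i"
  using bij_en[where 'p='a] unfolding de_def bij_betw_def by (metis f_inv_into_f UNIV_I)

lemma de_en: "k < CARD('p::finite) \<Longrightarrow> de (en k :: 'p) = k"
  using bij_en[where 'p='p] unfolding de_def bij_betw_def by (metis inv_into_f_f lessThan_iff)

lemma en_eq_iff: "k < CARD('p::finite) \<Longrightarrow> i = (en k :: 'p) \<longleftrightarrow> de i = k"
  using de_en en_de by metis

lemma det_eq_ndet: "Determinants.det (A :: 'a::comm_ring_1 ^ 'p ^ 'p) = ndet CARD('p::finite) (\<lambda>i j. A $ en i $ en j)"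
proof -
  let ?p = "CARD('p)"
  have inj: "inj_on (en :: nat \<Rightarrow> 'p) {..<?p}" and im: "(en :: nat \<Rightarrow> 'p) ` {..<?p} = UNIV"
    using bij_en[where 'p='p] by (auto simp: bij_betw_def)
  define \<Phi> where "\<Phi> \<sigma> = map_permutation {..<?p} (en :: nat \<Rightarrow> 'p) \<sigma>" for \<sigma>
  define \<Psi> where "\<Psi> \<pi> = (\<lambda>k. if k < ?p then de (\<pi> (en k :: 'p)) else k)" for \<pi> :: "'p \<Rightarrow> 'p"
  have \<Phi>: "\<Phi> \<sigma> i = en (\<sigma> (de i))" for \<sigma> i
    unfolding \<Phi>_def map_permutation_def im de_def by simp
  have \<Psi>p: "\<Psi> \<pi> permutes {..<?p}" if "\<pi> permutes UNIV" for \<pi>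
  proof -
    have bp: "bij \<pi>" using that by (rule permutes_bij)
    have "bij_betw (\<Psi> \<pi>) {..<?p} {..<?p}"
    proof (rule bij_betw_byWitness[where f' = "\<lambda>k. de (inv_into UNIV \<pi> (en k))"])
      show "\<forall>a\<in>{..<?p}. de (inv_into UNIV \<pi> (en (\<Psi> \<pi> a))) = a"
        using bp by (auto simp: \<Psi>_def bij_is_inj de_en)
      show "\<forall>a\<in>{..<?p}. \<Psi> \<pi> (de (inv_into UNIV \<pi> (en a))) = a"
        using bp by (auto simp: \<Psi>_def de_lt bij_is_surj surj_f_inv_f de_en)
    qed (auto simp: \<Psi>_def de_lt)
    then show ?thesis by (rule bij_imp_permutes) (simp add: \<Psi>_def)
  qed
  have "Determinants.det A = (\<Sum>\<pi>\<in>{\<pi>. \<pi> permutes (UNIV :: 'p set)}. of_int (sign \<pi>) * (\<Prod>i\<in>UNIV. A $ i $ \<pi> i))"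
    by (simp add: Determinants.det_def)
  also have "\<dots> = (\<Sum>\<sigma>\<in>perms ?p. of_int (sign \<sigma>) * (\<Prod>k<?p. A $ en k $ en (\<sigma> k)))"
  proof (rule sum.reindex_bij_witness[where i = \<Phi> and j = \<Psi>])
    fix \<pi> assume "\<pi> \<in> {\<pi>. \<pi> permutes (UNIV :: 'p set)}"
    then have p: "\<pi> permutes UNIV" by simp
    show "\<Phi> (\<Psi> \<pi>) = \<pi>" by (auto simp: fun_eq_iff \<Phi> \<Psi>_def de_lt)
    show "\<Psi> \<pi> \<in> perms ?p" using \<Psi>p[OF p] by simp
    have "sign (\<Phi> (\<Psi> \<pi>)) = sign (\<Psi> \<pi>)"
      unfolding \<Phi>_def by (rule sign_map_permutation[OF inj \<Psi>p[OF p]]) simp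
    moreover have "(\<Prod>i\<in>UNIV. A $ i $ \<pi> i) = (\<Prod>k<?p. A $ en k $ \<pi> (en k))"
      using prod.reindex[OF inj, of "\<lambda>i. A $ i $ \<pi> i"] im by simp
    ultimately show "of_int (sign (\<Psi> \<pi>)) * (\<Prod>k<?p. A $ en k $ en (\<Psi> \<pi> k)) = of_int (sign \<pi>) * (\<Prod>i\<in>UNIV. A $ i $ \<pi> i)"
      using \<open>\<Phi> (\<Psi> \<pi>) = \<pi>\<close> by (simp add: \<Psi>_def)
  next
    fix \<sigma> assume "\<sigma> \<in> perms ?p"
    then have s: "\<sigma> permutes {..<?p}" by simp
    have "\<sigma> k < ?p" if "k < ?p" for k using permutes_in_image[OF s, of k] that by simp
    moreover have "\<sigma> k = k" if "\<not> k < ?p" for k using s that by (auto simp: permutes_def)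
    ultimately show "\<Psi> (\<Phi> \<sigma>) = \<sigma>" by (auto simp: fun_eq_iff \<Phi> \<Psi>_def de_en)
    show "\<Phi> \<sigma> \<in> {\<pi>. \<pi> permutes (UNIV :: 'p set)}"
      unfolding \<Phi>_def using map_permutation_permutes[OF bij_en[where 'p='p] s] by simp
  qed
  finally show ?thesis by (simp add: ndet_leibniz)
qed

section \<open>Regularity of blow-ups\<close>

definition skip :: "nat \<Rightarrow> nat \<Rightarrow> nat" where
  "skip k i = (if i < k then i else Suc i)"

lemma ndet_laplace_column:
  assumes "j < Suc R"
  shows "ndet (Suc R) M = (\<Sum>i<Suc R. M i j * ((-1) ^ (i + j) * ndet R (\<lambda>a b. M (skip i a) (skip j b))))"
proof -
  let ?A = "Matrix.mat (Suc R) (Suc R) (\<lambda>(i, j). M i j)"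
  have del: "mat_delete ?A i j = Matrix.mat R R (\<lambda>(a, b). M (skip i a) (skip j b))" if "i < Suc R" for i
    unfolding mat_delete_def by (rule eq_matI) (use that assms in \<open>auto simp: skip_def\<close>)
  have "ndet (Suc R) M = (\<Sum>i<Suc R. ?A $$ (i, j) * cofactor ?A i j)"
    unfolding ndet_def by (rule laplace_expansion_column) (use assms in auto)
  also have "\<dots> = (\<Sum>i<Suc R. M i j * ((-1) ^ (i + j) * ndet R (\<lambda>a b. M (skip i a) (skip j b))))"
    using assms by (intro sum.cong refl) (auto simp: cofactor_def del ndet_def)
  finally show ?thesis .
qed

lemma ndet_drop_column:
  assumes "ndet (Suc R) M \<noteq> 0" "j < Suc R"
  shows "\<exists>i. i < Suc R \<and> ndet R (\<lambda>a b. M (skip i a) (skip j b)) \<noteq> 0"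
proof (rule ccontr)
  assume "\<not> ?thesis"
  then have "M i j * ((-1) ^ (i + j) * ndet R (\<lambda>a b. M (skip i a) (skip j b))) = 0" if "i < Suc R" for i
    using that by simp
  then have "ndet (Suc R) M = 0" unfolding ndet_laplace_column[OF assms(2), of M] by (intro sum.neutral) auto
  with assms(1) show False by simp
qed

lemma skip_lt: "i < Suc R \<Longrightarrow> a < R \<Longrightarrow> skip i a < Suc R"
  by (simp add: skip_def)

text \<open>Discarding the columns outside \<open>J\<close> one at a time costs one row each.\<close>

lemma drop_columns:
  assumes "ndet R (\<lambda>i j. M (a i) (b j)) \<noteq> 0"
  shows "\<exists>R' a' b'. R' \<le> R \<and> R \<le> R' + card {j. j < R \<and> b j \<notin> J} \<and> a' ` {..<R'} \<subseteq> a ` {..<R} \<and>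
    b' ` {..<R'} \<subseteq> b ` {..<R} \<inter> J \<and> ndet R' (\<lambda>i j. M (a' i) (b' j)) \<noteq> 0"
  using assms
proof (induction R arbitrary: a b)
  case 0
  then show ?case by (intro exI[of _ 0]) auto
next
  case (Suc R)
  show ?case
  proof (cases "\<exists>j. j < Suc R \<and> b j \<notin> J")
    case False
    then show ?thesis using Suc.prems by (intro exI[of _ "Suc R"] exI[of _ a] exI[of _ b]) auto
  next
    case True
    then obtain j where j: "j < Suc R" "b j \<notin> J" by blast
    obtain i where i: "i < Suc R" "ndet R (\<lambda>x y. M (a (skip i x)) (b (skip j y))) \<noteq> 0"
      using ndet_drop_column[OF Suc.prems j(1)] by blast
    obtain R' a' b' where *: "R' \<le> R" "R \<le> R' + card {y. y < R \<and> b (skip j y) \<notin> J}"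
      "a' ` {..<R'} \<subseteq> (\<lambda>x. a (skip i x)) ` {..<R}" "b' ` {..<R'} \<subseteq> (\<lambda>y. b (skip j y)) ` {..<R} \<inter> J"
      "ndet R' (\<lambda>i j. M (a' i) (b' j)) \<noteq> 0"
      using Suc.IH[of "\<lambda>x. a (skip i x)" "\<lambda>y. b (skip j y)", OF i(2)] by (elim exE conjE)
    have "skip j ` {y. y < R \<and> b (skip j y) \<notin> J} \<subseteq> {y. y < Suc R \<and> b y \<notin> J} - {j}"
      by (auto simp: skip_def)
    then have "card (skip j ` {y. y < R \<and> b (skip j y) \<notin> J}) \<le> card ({y. y < Suc R \<and> b y \<notin> J} - {j})"
      by (intro card_mono) auto
    moreover have "inj (skip j)" by (auto simp: inj_def skip_def split: if_splits)
    moreover have "card ({y. y < Suc R \<and> b y \<notin> J} - {j}) < card {y. y < Suc R \<and> b y \<notin> J}"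
      using j by (intro psubset_card_mono) auto
    ultimately have c: "card {y. y < R \<and> b (skip j y) \<notin> J} < card {y. y < Suc R \<and> b y \<notin> J}"
      using card_image[OF inj_on_subset[OF \<open>inj (skip j)\<close>], of "{y. y < R \<and> b (skip j y) \<notin> J}"] by simp
    have sub: "(\<lambda>x. a (skip i x)) ` {..<R} \<subseteq> a ` {..<Suc R}" "(\<lambda>y. b (skip j y)) ` {..<R} \<subseteq> b ` {..<Suc R}"
      using skip_lt[OF i(1)] skip_lt[OF j(1)] by auto
    have "a' ` {..<R'} \<subseteq> a ` {..<Suc R}" by (rule subset_trans[OF *(3) sub(1)])
    moreover have "b' ` {..<R'} \<subseteq> b ` {..<Suc R} \<inter> J" by (rule subset_trans[OF *(4) Int_mono[OF sub(2) order_refl]])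
    ultimately have "a' ` {..<R'} \<subseteq> a ` {..<Suc R}" "b' ` {..<R'} \<subseteq> b ` {..<Suc R} \<inter> J" .
    then show ?thesis using * c by (intro exI[of _ R'] exI[of _ a'] exI[of _ b']) auto
  qed
qed

lemma drop_rows:
  assumes "ndet R (\<lambda>i j. M (a i) (b j)) \<noteq> 0"
  shows "\<exists>R' a' b'. R' \<le> R \<and> R \<le> R' + card {i. i < R \<and> a i \<notin> I} \<and> a' ` {..<R'} \<subseteq> a ` {..<R} \<inter> I \<and>
    b' ` {..<R'} \<subseteq> b ` {..<R} \<and> ndet R' (\<lambda>i j. M (a' i) (b' j)) \<noteq> 0"
proof -
  have "ndet R (\<lambda>i j. M (a j) (b i)) \<noteq> 0"
    using assms ndet_transpose[of R "\<lambda>i j. M (a i) (b j)"] by simp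
  from drop_columns[of R "\<lambda>i j. M j i" b a I, OF this]
  obtain R' a' b' where *: "R' \<le> R" "R \<le> R' + card {i. i < R \<and> a i \<notin> I}" "b' ` {..<R'} \<subseteq> b ` {..<R}"
    "a' ` {..<R'} \<subseteq> a ` {..<R} \<inter> I" "ndet R' (\<lambda>i j. M (a' j) (b' i)) \<noteq> 0"
    by (elim exE conjE)
  then show ?thesis using ndet_transpose[of R' "\<lambda>i j. M (a' i) (b' j)"]
    by (intro exI[of _ R'] exI[of _ a'] exI[of _ b']) auto
qed

lemma ndet_inj_rows:
  fixes M :: "nat \<Rightarrow> nat \<Rightarrow> 'a::comm_ring_1"
  assumes "ndet R (\<lambda>i j. M (a i) j) \<noteq> 0"
  shows "inj_on a {..<R}"
proof (rule inj_onI, rule ccontr)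
  fix x y assume "x \<in> {..<R}" "y \<in> {..<R}" "a x = a y" "x \<noteq> y"
  then have "ndet R (\<lambda>i j. M (a i) j) = 0"
    unfolding ndet_def by (intro Determinant.det_identical_rows[of _ R x y]) auto
  with assms show False by simp
qed

lemma ndet_inj_columns:
  fixes M :: "nat \<Rightarrow> nat \<Rightarrow> 'a::comm_ring_1"
  assumes "ndet R (\<lambda>i j. M i (b j)) \<noteq> 0"
  shows "inj_on b {..<R}"
  using assms ndet_inj_rows[of R "\<lambda>i j. M j i" b] ndet_transpose[of R "\<lambda>i j. M i (b j)"] by simp

text \<open>
  A nonzero \<open>R\<close>-minor makes every row a combination of its \<open>R\<close> rows once the \<open>R + 1\<close>-minors
  vanish: expand the bordered minor along its last column.
\<close>

lemma minors_rank_one: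
  fixes M :: "nat \<Rightarrow> nat \<Rightarrow> 'a::idom"
  assumes D: "ndet R (\<lambda>i j. M (r i) (c j)) \<noteq> 0"
    and van: "\<And>a b. a ` {..<Suc R} \<subseteq> I \<Longrightarrow> b ` {..<Suc R} \<subseteq> J \<Longrightarrow> ndet (Suc R) (\<lambda>i j. M (a i) (b j)) = 0"
    and I: "r ` {..<R} \<subseteq> I" "r' ` {..<R} \<subseteq> I" and J: "c ` {..<R} \<subseteq> J" "c' ` {..<R} \<subseteq> J"
  shows "ndet R (\<lambda>i j. M (r i) (c j)) * ndet R (\<lambda>i j. M (r' i) (c' j))
    = ndet R (\<lambda>i j. M (r i) (c' j)) * ndet R (\<lambda>i j. M (r' i) (c j))"
proof -
  let ?D = "ndet R (\<lambda>i j. M (r i) (c j))"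
  define \<mu> where "\<mu> a i = - ((-1) ^ (i + R) * ndet R (\<lambda>x y. M (if skip i x < R then r (skip i x) else a) (c y)))" for a i
  have row: "?D * M a b = (\<Sum>i<R. \<mu> a i * M (r i) b)" if "a \<in> I" "b \<in> J" for a b
  proof -
    let ?a = "\<lambda>i. if i < R then r i else a" and ?b = "\<lambda>j. if j < R then c j else b"
    have "ndet (Suc R) (\<lambda>i j. M (?a i) (?b j)) = 0"
      by (rule van) (use I J that in auto)
    moreover have "ndet R (\<lambda>x y. M (?a (skip i x)) (?b (skip R y)))
        = ndet R (\<lambda>x y. M (if skip i x < R then r (skip i x) else a) (c y))" for i
      by (rule ndet_cong) (simp add: skip_def)
    moreover have "ndet R (\<lambda>x y. M (if skip R x < R then r (skip R x) else a) (c y)) = ?D"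
      by (rule ndet_cong) (simp add: skip_def)
    ultimately have "0 = (\<Sum>i<R. M (r i) b * (- \<mu> a i)) + M a b * ((-1) ^ (R + R) * ?D)"
      unfolding ndet_laplace_column[of R R, simplified] lessThan_Suc by (simp add: \<mu>_def)
    moreover have "(-1 :: 'a) ^ (R + R) = 1" by (simp add: power_add flip: power_mult_distrib)
    ultimately show ?thesis by (simp add: sum_negf algebra_simps)
  qed
  \<comment> \<open>The matrix of the \<mu> does not depend on the columns \<open>k\<close>. Using
    this for \<open>c\<close> and for \<open>c'\<close> makes the minors in the rows
    \<open>r'\<close> proportional to those in the rows \<open>r\<close>, with one common
    factor.\<close>
  have col: "?D ^ R * ndet R (\<lambda>i j. M (r' i) (k j)) = ndet R (\<lambda>i j. \<mu> (r' i) j) * ndet R (\<lambda>i j. M (r i) (k j))"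
    if "k ` {..<R} \<subseteq> J" for k
  proof -
    have "?D ^ R * ndet R (\<lambda>i j. M (r' i) (k j)) = ndet R (\<lambda>i j. ?D * M (r' i) (k j))"
      by (subst ndet_scale_rows) simp
    also have "\<dots> = ndet R (\<lambda>i j. \<Sum>l<R. \<mu> (r' i) l * M (r l) (k j))"
      by (rule ndet_cong) (use that I in \<open>auto intro!: row\<close>)
    finally show ?thesis by (simp only: ndet_mult)
  qed
  have "?D ^ R * (?D * ndet R (\<lambda>i j. M (r' i) (c' j))) = ?D * (?D ^ R * ndet R (\<lambda>i j. M (r' i) (c' j)))"
    by (simp only: mult_ac)
  also have "\<dots> = (ndet R (\<lambda>i j. \<mu> (r' i) j) * ?D) * ndet R (\<lambda>i j. M (r i) (c' j))"
    unfolding col[OF J(2)] by (simp only: mult_ac)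
  also have "\<dots> = ?D ^ R * (ndet R (\<lambda>i j. M (r i) (c' j)) * ndet R (\<lambda>i j. M (r' i) (c j)))"
    unfolding col[OF J(1), symmetric] by (simp only: mult_ac)
  finally show ?thesis using D by simp
qed

lemma line_polynomial:
  fixes A B :: "nat \<Rightarrow> nat \<Rightarrow> 'a::idom"
  shows "\<exists>q. \<forall>z. poly q z = (\<Sum>\<pi>\<in>P. s \<pi> * (\<Prod>i<R. A i (\<pi> i) + z * (B i (\<pi> i) - A i (\<pi> i))))"
  by (rule exI[of _ "\<Sum>\<pi>\<in>P. [:s \<pi>:] * (\<Prod>i<R. [:A i (\<pi> i), B i (\<pi> i) - A i (\<pi> i):])"])
    (simp add: poly_sum poly_prod)

definition blk :: "nat \<Rightarrow> (nat \<Rightarrow> nat) \<Rightarrow> nat \<Rightarrow> nat" where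
  "blk L g a = g (a div L) * L + a mod L"

text \<open>What the rank argument needs of the set of all blow-ups of one tuple.
  \<open>line\<close> permits generic choices, \<open>scale\<close> weights blocks by independent
  scalars, and \<open>reindex\<close> moves, repeats or omits block rows and block columns.\<close>

locale block_space =
  fixes L :: nat and \<M> :: "(nat \<Rightarrow> nat \<Rightarrow> complex) set"
  assumes L: "0 < L"
    and line: "M \<in> \<M> \<Longrightarrow> M' \<in> \<M> \<Longrightarrow> (\<lambda>a b. M a b + z * (M' a b - M a b)) \<in> \<M>"
    and scale: "M \<in> \<M> \<Longrightarrow> (\<lambda>a b. y (a div L) (b div L) * M a b) \<in> \<M>"
    and reindex: "M \<in> \<M> \<Longrightarrow> (\<lambda>a b. M (blk L g a) (blk L h b)) \<in> \<M>"
begin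

definition ex :: "nat \<Rightarrow> nat \<Rightarrow> nat \<Rightarrow> nat" where
  "ex d a b = nat ((int (a div L) - int (b div L)) mod int d)"

definition ym :: "nat \<Rightarrow> (nat \<Rightarrow> nat \<Rightarrow> complex) \<Rightarrow> nat \<Rightarrow> nat \<Rightarrow> complex poly" where
  "ym d M a b = monom (M a b) (ex d a b)"

text \<open>Shows each coefficient as a polynomial in the entries of \<open>M\<close>. On a line of
  matrices it is then a polynomial in the line parameter.\<close>

lemma coeff_ym: "poly.coeff (ndet R (\<lambda>i j. ym d M (r i) (c j))) K
  = (\<Sum>\<pi>\<in>perms R. (if (\<Sum>i<R. ex d (r i) (c (\<pi> i))) = K then of_int (sign \<pi>) else 0) * (\<Prod>i<R. M (r i) (c (\<pi> i))))"
proof -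
  have p: "(\<Prod>i<R. ym d M (r i) (c (\<pi> i))) = monom (\<Prod>i<R. M (r i) (c (\<pi> i))) (\<Sum>i<R. ex d (r i) (c (\<pi> i)))" for \<pi>
    unfolding ym_def by (induction R) (simp_all add: mult_monom)
  show ?thesis
    unfolding ndet_leibniz p coeff_sum
    by (intro sum.cong refl) (simp add: of_int_poly)
qed

lemma degree_ym:
  assumes "0 < d"
  shows "Polynomial.degree (ndet R (\<lambda>i j. ym d M (r i) (c j))) \<le> R * d"
proof (rule degree_le, intro allI impI)
  fix K assume K: "R * d < K"
  have "ex d a b \<le> d" for a b
    using pos_mod_bound[of "int d" "int (a div L) - int (b div L)"] assms by (simp add: ex_def nat_le_iff less_imp_le)
  then have le: "(\<Sum>i<R. ex d (r i) (c (\<pi> i))) \<le> R * d" for \<pi>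
    using sum_bounded_above[of "{..<R}" "\<lambda>i. ex d (r i) (c (\<pi> i))" d] by simp
  have "(\<Sum>i<R. ex d (r i) (c (\<pi> i))) \<noteq> K" for \<pi> using le[of \<pi>] K by linarith
  then show "poly.coeff (ndet R (\<lambda>i j. ym d M (r i) (c j))) K = 0" unfolding coeff_ym by simp
qed

text \<open>Modulo \<open>d\<close> the exponent of a term is a difference of sums of block indices,
  and a permutation of the columns does not change such a sum.\<close>

lemma coeff_ym_cong:
  assumes d: "0 < d" and nz: "poly.coeff (ndet R (\<lambda>i j. ym d M (r i) (c j))) K \<noteq> 0"
  shows "[int K = (\<Sum>i<R. int (r i div L)) - (\<Sum>i<R. int (c i div L))] (mod int d)"
proof -
  obtain \<pi> where pi: "\<pi> \<in> perms R" "(\<Sum>i<R. ex d (r i) (c (\<pi> i))) = K"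
  proof (rule ccontr)
    assume *: "\<not> thesis"
    have "poly.coeff (ndet R (\<lambda>i j. ym d M (r i) (c j))) K = 0"
      unfolding coeff_ym by (intro sum.neutral ballI) (use * that in auto)
    with nz show False by simp
  qed
  have "[int (ex d a b) = int (a div L) - int (b div L)] (mod int d)" for a b
    using d by (simp add: ex_def cong_def)
  then have "[(\<Sum>i<R. int (ex d (r i) (c (\<pi> i)))) = (\<Sum>i<R. int (r i div L) - int (c (\<pi> i) div L))] (mod int d)"
    by (rule cong_sum)
  moreover have "(\<Sum>i<R. int (c (\<pi> i) div L)) = (\<Sum>i<R. int (c i div L))"
    using pi(1) sum.permute[of \<pi> "{..<R}" "\<lambda>i. int (c i div L)"] by (simp add: o_def)
  ultimately show ?thesis using pi(2) by (simp add: sum_subtractf flip: of_nat_sum)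
qed

definition cyc :: "nat \<Rightarrow> nat \<Rightarrow> nat" where
  "cyc d = blk L (\<lambda>k. (k + 1) mod d)"

lemma blk_div: "blk L g a div L = g (a div L)"
  using L by (simp add: blk_def)

lemma blk_blk: "blk L g (blk L h a) = blk L (g \<circ> h) a"
  using L by (simp add: blk_def)

lemma blk_lt: "blk L g a < L * d" if "g (a div L) < d"
proof -
  have "blk L g a < Suc (g (a div L)) * L" using L by (simp add: blk_def)
  also have "\<dots> \<le> d * L" using that by (intro mult_right_mono) auto
  finally show ?thesis by (simp add: mult.commute)
qed

lemma div_lt: "a div L < d \<longleftrightarrow> a < L * d"
  using L by (simp add: div_less_iff_less_mult mult.commute)

lemma blk_id: "g (a div L) = a div L \<Longrightarrow> blk L g a = a"
  by (simp add: blk_def)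

lemma ex_cyc: "0 < d \<Longrightarrow> ex d (cyc d a) (cyc d b) = ex d a b"
  by (simp add: ex_def cyc_def blk_div of_nat_mod mod_diff_eq)

definition good :: "nat \<Rightarrow> nat \<Rightarrow> (nat \<Rightarrow> nat \<Rightarrow> complex) \<times> (nat \<Rightarrow> nat) \<times> (nat \<Rightarrow> nat) \<Rightarrow> bool" where
  "good d R = (\<lambda>(M, r, c). M \<in> \<M> \<and> r ` {..<R} \<subseteq> {..<L * d} \<and> c ` {..<R} \<subseteq> {..<L * d})"

text \<open>
  Weighting block \<open>(\<kappa>, \<kappa>')\<close> by \<open>y ^ ((\<kappa> - \<kappa>') mod d)\<close> makes the minors of maximal size polynomials
  in \<open>y\<close> whose exponents are determined modulo \<open>d\<close> by the chosen rows and columns. Since minors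
  of maximal size form a matrix of rank one, the rows of a minor of top degree can be combined
  with its cyclically shifted columns, and comparing exponents gives \<open>d dvd R\<close>.
\<close>

lemma regularity:
  assumes d: "0 < d"
    and ex: "\<exists>x. good d R x \<and> (case x of (M, r, c) \<Rightarrow> ndet R (\<lambda>i j. M (r i) (c j))) \<noteq> 0"
    and max: "\<And>M r c. good d (Suc R) (M, r, c) \<Longrightarrow> ndet (Suc R) (\<lambda>i j. M (r i) (c j)) = 0"
  shows "d dvd R"
proof -
  define m where "m M r c = ndet R (\<lambda>i j. ym d M (r i) (c j))" for M r c
  define Q where "Q K \<longleftrightarrow> (\<exists>M r c. good d R (M, r, c) \<and> poly.coeff (m M r c) K \<noteq> 0)" for K
  have yev: "poly (m M r c) y = ndet R (\<lambda>i j. y ^ ex d (r i) (c j) * M (r i) (c j))" for M r c y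
    unfolding m_def ndet_leibniz by (simp add: poly_sum poly_prod ym_def poly_monom mult_ac)
  obtain M0 r0 c0 where 0: "good d R (M0, r0, c0)" "ndet R (\<lambda>i j. M0 (r0 i) (c0 j)) \<noteq> 0"
    using ex by auto
  have "m M0 r0 c0 \<noteq> 0" using 0(2) yev[of M0 r0 c0 1] by auto
  then have Q0: "Q (Polynomial.degree (m M0 r0 c0))" unfolding Q_def using 0(1) leading_coeff_0_iff by blast
  have bnd: "K \<le> R * d" if "Q K" for K
  proof -
    from that obtain M r c where "poly.coeff (m M r c) K \<noteq> 0" unfolding Q_def by blast
    then have "K \<le> Polynomial.degree (m M r c)" by (rule le_degree)
    then show ?thesis using degree_ym[OF d, of R M r c] unfolding m_def by simp
  qed
  \<comment> \<open>The largest exponent occurring in any \<open>R\<close>-minor of any member of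
    the space, so that every degree below is bounded by it.\<close>
  define K where "K = (GREATEST K. Q K)"
  have QK: "Q K" unfolding K_def by (rule GreatestI_nat[of Q, OF Q0]) (use bnd in auto)
  have Kmax: "K' \<le> K" if "Q K'" for K' unfolding K_def by (rule Greatest_le_nat[of Q, OF that]) (use bnd in auto)
  obtain M1 r c where 1: "good d R (M1, r, c)" "poly.coeff (m M1 r c) K \<noteq> 0" using QK unfolding Q_def by blast
  have rc: "r ` {..<R} \<subseteq> {..<L * d}" "c ` {..<R} \<subseteq> {..<L * d}" and M1: "M1 \<in> \<M>" using 1(1) by (auto simp: good_def)
  define r' where "r' = cyc d \<circ> r"
  define c' where "c' = cyc d \<circ> c"
  have cyc_lt: "cyc d a < L * d" for a unfolding cyc_def using blk_lt d by simp
  have rc': "r' ` {..<R} \<subseteq> {..<L * d}" "c' ` {..<R} \<subseteq> {..<L * d}" using cyc_lt by (auto simp: r'_def c'_def)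
  \<comment> \<open>\<open>d - 1\<close> is the inverse shift modulo \<open>d\<close>: the shifted
    rows and columns see in \<open>M2\<close> what \<open>r\<close> and \<open>c\<close> see in
    \<open>M1\<close>.\<close>
  define M2 where "M2 = (\<lambda>a b. M1 (blk L (\<lambda>k. (k + (d - 1)) mod d) a) (blk L (\<lambda>k. (k + (d - 1)) mod d) b))"
  have M2: "M2 \<in> \<M>" unfolding M2_def by (rule reindex[OF M1])
  have unshift: "blk L (\<lambda>k. (k + (d - 1)) mod d) (cyc d a) = a" if "a < L * d" for a
  proof -
    have "((a div L + 1) mod d + (d - 1)) mod d = (a div L + d) mod d"
      using d mod_add_left_eq[of "a div L + 1" d "d - 1"] by simp
    also have "\<dots> = a div L" using that div_lt by simp
    finally show ?thesis unfolding cyc_def blk_blk by (intro blk_id) (simp add: o_def)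
  qed
  have "m M2 r' c' = m M1 r c"
    unfolding m_def
  proof (rule ndet_cong)
    fix i j assume ij: "i < R" "j < R"
    then have "r i < L * d" "c j < L * d" using rc by auto
    then show "ym d M2 (r' i) (c' j) = ym d M1 (r i) (c j)"
      using unshift d by (simp add: ym_def r'_def c'_def ex_cyc M2_def)
  qed
  then have 2: "poly.coeff (m M2 r' c') K \<noteq> 0" using 1(2) by simp
  \<comment> \<open>On the line through \<open>M1\<close> and \<open>M2\<close> both coefficients at
    \<open>K\<close> are polynomials that are not identically 0, so some member has both
    nonzero.\<close>
  define N where "N z = (\<lambda>a b. M1 a b + z * (M2 a b - M1 a b))" for z
  have N: "N z \<in> \<M>" for z unfolding N_def by (rule line[OF M1 M2])
  have pol: "\<exists>q. \<forall>z. poly q z = poly.coeff (m (N z) r c) K" for r c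
    unfolding m_def coeff_ym N_def by (rule line_polynomial)
  obtain q1 where q1: "\<And>z. poly q1 z = poly.coeff (m (N z) r c) K" using pol[of r c] by blast
  obtain q2 where q2: "\<And>z. poly q2 z = poly.coeff (m (N z) r' c') K" using pol[of r' c'] by blast
  have "N 0 = M1" "N 1 = M2" by (auto simp: N_def fun_eq_iff)
  then have "q1 \<noteq> 0" "q2 \<noteq> 0" using q1[of 0] q2[of 1] 1(2) 2 by auto
  then have "finite {z. poly (q1 * q2) z = 0}" by (intro poly_roots_finite) simp
  then obtain z where "poly (q1 * q2) z \<noteq> 0" using infinite_UNIV_char_0[where 'a=complex]
    by (metis (mono_tags, lifting) UNIV_I finite_subset mem_Collect_eq subsetI)
  then have z: "poly.coeff (m (N z) r c) K \<noteq> 0" "poly.coeff (m (N z) r' c') K \<noteq> 0"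
    using q1[of z] q2[of z] by auto
  have gd: "good d R (N z, a, b)" if "a ` {..<R} \<subseteq> {..<L * d}" "b ` {..<R} \<subseteq> {..<L * d}" for a b
    using N that by (simp add: good_def)
  have deg: "Polynomial.degree (m (N z) a b) \<le> K" if "a ` {..<R} \<subseteq> {..<L * d}" "b ` {..<R} \<subseteq> {..<L * d}" for a b
  proof (cases "m (N z) a b = 0")
    case False
    then have "poly.coeff (m (N z) a b) (Polynomial.degree (m (N z) a b)) \<noteq> 0" by simp
    then have "Q (Polynomial.degree (m (N z) a b))" unfolding Q_def using gd[OF that] by blast
    then show ?thesis by (rule Kmax)
  qed simp
  have eqK: "Polynomial.degree (m (N z) a b) = K \<and> m (N z) a b \<noteq> 0" if "poly.coeff (m (N z) a b) K \<noteq> 0"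
    "a ` {..<R} \<subseteq> {..<L * d}" "b ` {..<R} \<subseteq> {..<L * d}" for a b
    using le_degree[OF that(1)] deg[OF that(2,3)] that(1) by auto
  \<comment> \<open>For each value of \<open>y\<close> the weighted matrix is again in the space by
    \<open>scale\<close>, so its minors of size \<open>Suc R\<close> vanish; a polynomial with all
    values 0 is 0.\<close>
  have van: "ndet (Suc R) (\<lambda>i j. ym d (N z) (a i) (b j)) = 0"
    if "a ` {..<Suc R} \<subseteq> {..<L * d}" "b ` {..<Suc R} \<subseteq> {..<L * d}" for a b
  proof -
    have "poly (ndet (Suc R) (\<lambda>i j. ym d (N z) (a i) (b j))) y = 0" for y
    proof -
      have "(\<lambda>a b. y ^ nat ((int (a div L) - int (b div L)) mod int d) * N z a b) \<in> \<M>"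
        by (rule scale[OF N, of "\<lambda>k k'. y ^ nat ((int k - int k') mod int d)"])
      then have "good d (Suc R) (\<lambda>a b. y ^ ex d a b * N z a b, a, b)"
        using that by (simp add: good_def ex_def)
      from max[OF this] show ?thesis
        unfolding ndet_leibniz by (simp only: poly_sum poly_prod ym_def poly_monom mult_ac poly_mult poly_of_int)
    qed
    then show ?thesis using poly_all_0_iff_0 by blast
  qed
  have "m (N z) r c * m (N z) r' c' = m (N z) r c' * m (N z) r' c"
    unfolding m_def
    by (rule minors_rank_one[where I = "{..<L * d}" and J = "{..<L * d}"])
      (use van rc rc' eqK[OF z(1) rc] in \<open>auto simp: m_def\<close>)
  \<comment> \<open>Each mixed minor has degree at most \<open>K\<close>, and their product has
    degree \<open>2 * K\<close>; so both attain \<open>K\<close>.\<close>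
  then have "Polynomial.degree (m (N z) r c' * m (N z) r' c) = 2 * K" "m (N z) r c' * m (N z) r' c \<noteq> 0"
    using eqK[OF z(1) rc] eqK[OF z(2) rc'] degree_mult_eq[of "m (N z) r c" "m (N z) r' c'"] by auto
  then have "Polynomial.degree (m (N z) r c') + Polynomial.degree (m (N z) r' c) = 2 * K" "m (N z) r c' \<noteq> 0"
    using degree_mult_eq[of "m (N z) r c'" "m (N z) r' c"] by auto
  then have "Polynomial.degree (m (N z) r c') = K" using deg[OF rc(1) rc'(2)] deg[OF rc'(1) rc(2)] by simp
  then have "poly.coeff (m (N z) r c') K \<noteq> 0" using \<open>m (N z) r c' \<noteq> 0\<close> by (metis leading_coeff_0_iff)
  then have "[int K = (\<Sum>i<R. int (r i div L)) - (\<Sum>i<R. int (c' i div L))] (mod int d)"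
    unfolding m_def by (rule coeff_ym_cong[OF d])
  moreover have "[int K = (\<Sum>i<R. int (r i div L)) - (\<Sum>i<R. int (c i div L))] (mod int d)"
    using z(1) unfolding m_def by (rule coeff_ym_cong[OF d])
  ultimately have k: "[(\<Sum>i<R. int (r i div L)) - (\<Sum>i<R. int (c i div L))
      = (\<Sum>i<R. int (r i div L)) - (\<Sum>i<R. int (c' i div L))] (mod int d)"
    using cong_sym cong_trans by blast
  \<comment> \<open>The shift adds 1 modulo \<open>d\<close> to the block index of each of the
    \<open>R\<close> columns. As \<open>c\<close> and \<open>c'\<close> give the same exponent,
    \<open>d\<close> divides \<open>R\<close>.\<close>
  have "[(\<Sum>i<R. int (c' i div L)) = (\<Sum>i<R. int (c i div L) + 1)] (mod int d)"
    by (rule cong_sum) (simp add: c'_def cyc_def blk_div cong_def of_nat_mod add.commute)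
  then have "[(\<Sum>i<R. int (c' i div L)) = (\<Sum>i<R. int (c i div L)) + int R] (mod int d)"
    by (simp add: sum.distrib)
  from cong_trans[OF k cong_diff[OF cong_refl this]]
  have "[(\<Sum>i<R. int (r i div L)) - (\<Sum>i<R. int (c i div L))
      = (\<Sum>i<R. int (r i div L)) - ((\<Sum>i<R. int (c i div L)) + int R)] (mod int d)" .
  then have "int d dvd int R" by (simp add: cong_iff_dvd_diff)
  then show ?thesis by simp
qed

text \<open>A nonzero minor has distinct rows and distinct columns, so here both index maps are
  permutations and contribute only signs.\<close>

lemma full_minor:
  assumes "ndet N (\<lambda>i j. M (r i) (c j)) \<noteq> 0" "r ` {..<N} \<subseteq> {..<N}" "c ` {..<N} \<subseteq> {..<N}"
  shows "ndet N M \<noteq> 0"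
proof -
  have perm: "(\<lambda>i. if i < N then f i else i) \<in> perms N" if "inj_on f {..<N}" "f ` {..<N} \<subseteq> {..<N}" for f
  proof -
    have "bij_betw f {..<N} {..<N}" using that by (simp add: bij_betw_def endo_inj_surj)
    then have "bij_betw (\<lambda>i. if i < N then f i else i) {..<N} {..<N}" by (subst bij_betw_cong[of _ _ f]) auto
    then show ?thesis by (intro CollectI bij_imp_permutes) auto
  qed
  let ?r = "\<lambda>i. if i < N then r i else i" and ?c = "\<lambda>i. if i < N then c i else i"
  have "inj_on r {..<N}" "inj_on c {..<N}"
    using assms(1) by (rule ndet_inj_rows[where M = "\<lambda>i j. M i (c j)"], rule ndet_inj_columns[where M = "\<lambda>i j. M (r i) j"])
  then have c: "?c \<in> perms N" and "?r \<in> perms N" using perm assms(2,3) by simp_all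
  moreover have "ndet N (\<lambda>i j. M (r i) (c j)) = ndet N (\<lambda>i j. M (?r i) (?c j))"
    by (rule ndet_cong) simp
  ultimately have "ndet N (\<lambda>i j. M (r i) (c j)) = of_int (sign ?r) * ndet N (\<lambda>i j. M j (?c i))"
    using ndet_row_perm[of ?r N "\<lambda>i j. M i (?c j)"] ndet_transpose[of N "\<lambda>i j. M i (?c j)"] by simp
  moreover have "ndet N (\<lambda>i j. M j (?c i)) = of_int (sign ?c) * ndet N M"
    using ndet_row_perm[OF c, of "\<lambda>i j. M j i"] ndet_transpose[of N M] by simp
  ultimately show ?thesis using assms(1) by auto
qed

text \<open>The maximal rank is a multiple of \<open>d\<close> above \<open>(L - 1) * d\<close> and
  at most \<open>L * d\<close>.\<close>

lemma full_rank:
  assumes d: "0 < d" and R0: "(L - 1) * d < R0"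
    and g: "good d R0 (M, r, c)" and nz: "ndet R0 (\<lambda>i j. M (r i) (c j)) \<noteq> 0"
  shows "\<exists>M\<in>\<M>. ndet (L * d) M \<noteq> 0"
proof -
  define Q where "Q R \<longleftrightarrow> (\<exists>M r c. good d R (M, r, c) \<and> ndet R (\<lambda>i j. M (r i) (c j)) \<noteq> 0)" for R
  have Q0: "Q R0" unfolding Q_def using g nz by blast
  have bnd: "R \<le> L * d" if "Q R" for R
  proof -
    from that obtain M r c where *: "good d R (M, r, c)" "ndet R (\<lambda>i j. M (r i) (c j)) \<noteq> 0"
      unfolding Q_def by blast
    have "inj_on r {..<R}" using *(2) by (rule ndet_inj_rows)
    then show ?thesis using *(1) card_inj_on_le[of r "{..<R}" "{..<L * d}"] by (simp add: good_def)
  qed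
  define R where "R = (GREATEST R. Q R)"
  have QR: "Q R" unfolding R_def by (rule GreatestI_nat[of Q, OF Q0]) (use bnd in auto)
  have max: "R' \<le> R" if "Q R'" for R' unfolding R_def by (rule Greatest_le_nat[of Q, OF that]) (use bnd in auto)
  have "d dvd R"
  proof (rule regularity[OF d])
    show "\<exists>x. good d R x \<and> (case x of (M, r, c) \<Rightarrow> ndet R (\<lambda>i j. M (r i) (c j))) \<noteq> 0"
      using QR unfolding Q_def by auto
    show "ndet (Suc R) (\<lambda>i j. M (r i) (c j)) = 0" if "good d (Suc R) (M, r, c)" for M r c
    proof (rule ccontr)
      assume "ndet (Suc R) (\<lambda>i j. M (r i) (c j)) \<noteq> 0"
      with that have "Q (Suc R)" unfolding Q_def by blast
      from max[OF this] show False by simp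
    qed
  qed
  then obtain t where t: "R = d * t" by (elim dvdE)
  have "(L - 1) * d < t * d" using less_le_trans[OF R0 max[OF Q0]] unfolding t mult.commute[of d t] .
  moreover have "t * d \<le> L * d" using bnd[OF QR] unfolding t mult.commute[of d t] .
  ultimately have "L - 1 < t" "t \<le> L" using d by simp_all
  then have "t = L" using d by simp
  then have R: "R = L * d" using t by simp
  obtain M r c where *: "good d R (M, r, c)" "ndet R (\<lambda>i j. M (r i) (c j)) \<noteq> 0"
    using QR unfolding Q_def by blast
  have "ndet R M \<noteq> 0" using *(2) by (rule full_minor) (use *(1) R in \<open>simp_all add: good_def\<close>)
  then show ?thesis using *(1) R by (auto simp: good_def)
qed

text \<open>Without the last block row the rank is still \<open>L * k\<close>. A block column
  containing a column outside the chosen minor meets that minor in at most \<open>L - 1\<close>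
  columns, so its removal leaves rank at least \<open>L * k - (L - 1)\<close>, above
  \<open>(L - 1) * k\<close> as \<open>L \<le> k\<close>.\<close>

lemma descent:
  assumes M: "M \<in> \<M>" and nz: "ndet (L * Suc k) M \<noteq> 0" and k: "L \<le> k"
  shows "\<exists>M\<in>\<M>. ndet (L * k) M \<noteq> 0"
proof -
  obtain R1 a1 b1 where 1: "L * Suc k \<le> R1 + card {i. i < L * Suc k \<and> i \<notin> {..<L * k}}"
    "a1 ` {..<R1} \<subseteq> {..<L * Suc k} \<inter> {..<L * k}" "b1 ` {..<R1} \<subseteq> {..<L * Suc k}"
    "ndet R1 (\<lambda>i j. M (a1 i) (b1 j)) \<noteq> 0"
    using drop_rows[of "L * Suc k" M "\<lambda>i. i" "\<lambda>j. j" "{..<L * k}", OF nz] by (elim exE conjE) simp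
  have "{i. i < L * Suc k \<and> i \<notin> {..<L * k}} = {L * k..<L * k + L}" by auto
  then have "L * k \<le> R1" using 1(1) by simp
  moreover have "inj_on a1 {..<R1}" using 1(4) by (rule ndet_inj_rows)
  then have "R1 \<le> L * k" using 1(2) card_inj_on_le[of a1 "{..<R1}" "{..<L * k}"] by simp
  ultimately have R1: "R1 = L * k" by simp
  have inj: "inj_on b1 {..<R1}" using 1(4) by (rule ndet_inj_columns)
  have "card (b1 ` {..<R1}) < card {..<L * Suc k}" using card_image[OF inj] R1 L by simp
  then have "b1 ` {..<R1} \<noteq> {..<L * Suc k}" by auto
  \<comment> \<open>A column the minor does not use; its block \<beta> is the one to remove.\<close>
  then obtain b0 where b0: "b0 < L * Suc k" "b0 \<notin> b1 ` {..<R1}" using 1(3) by auto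
  define \<beta> where "\<beta> = b0 div L"
  have \<beta>: "\<beta> < Suc k" unfolding \<beta>_def using b0(1) div_lt by blast
  obtain R2 a2 b2 where 2: "R1 \<le> R2 + card {j. j < R1 \<and> b1 j \<notin> {b. b div L \<noteq> \<beta>}}"
    "a2 ` {..<R2} \<subseteq> a1 ` {..<R1}" "b2 ` {..<R2} \<subseteq> b1 ` {..<R1} \<inter> {b. b div L \<noteq> \<beta>}"
    "ndet R2 (\<lambda>i j. M (a2 i) (b2 j)) \<noteq> 0"
    using drop_columns[of R1 M a1 b1 "{b. b div L \<noteq> \<beta>}", OF 1(4)] by (elim exE conjE) simp
  have sub: "b1 ` {j. j < R1 \<and> b1 j \<notin> {b. b div L \<noteq> \<beta>}} \<subseteq> {\<beta> * L..<\<beta> * L + L} - {b0}"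
  proof (rule image_subsetI)
    fix j assume j: "j \<in> {j. j < R1 \<and> b1 j \<notin> {b. b div L \<noteq> \<beta>}}"
    then have "b1 j = \<beta> * L + b1 j mod L" "b1 j mod L < L" using L div_mult_mod_eq[of "b1 j" L] by auto
    then have "b1 j \<in> {\<beta> * L..<\<beta> * L + L}" by (metis atLeastLessThan_iff le_add1 nat_add_left_cancel_less)
    moreover have "b1 j \<noteq> b0" using j b0(2) by auto
    ultimately show "b1 j \<in> {\<beta> * L..<\<beta> * L + L} - {b0}" by blast
  qed
  have "b0 = \<beta> * L + b0 mod L" "b0 mod L < L" using L by (simp_all add: \<beta>_def)
  then have "b0 \<in> {\<beta> * L..<\<beta> * L + L}" by (metis atLeastLessThan_iff le_add1 nat_add_left_cancel_less)
  then have "card ({\<beta> * L..<\<beta> * L + L} - {b0}) = L - 1" by simp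
  then have "card {j. j < R1 \<and> b1 j \<notin> {b. b div L \<noteq> \<beta>}} \<le> L - 1"
    using card_inj_on_le[OF inj_on_subset[OF inj] sub] by (metis (no_types, lifting) finite_Diff finite_atLeastLessThan lessThan_iff mem_Collect_eq subsetI)
  then have R2: "L * k \<le> R2 + (L - 1)" using 2(1) R1 by simp
  have "(L - 1) * k + k = L * k" using L by (simp add: algebra_simps)
  then have big: "(L - 1) * k < R2" using R2 k L by linarith
  \<comment> \<open>\<open>h\<close> leaves a gap at \<beta> and \<open>h'\<close> closes it; they
    translate between the remaining block columns and the indices below \<open>k\<close>.\<close>
  define h where "h \<kappa> = (if \<kappa> < \<beta> then \<kappa> else \<kappa> + 1)" for \<kappa>
  define h' where "h' \<kappa> = (if \<kappa> < \<beta> then \<kappa> else \<kappa> - 1)" for \<kappa>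
  have b2: "b2 j < L * Suc k" "b2 j div L \<noteq> \<beta>" if "j < R2" for j
  proof -
    have "b2 j \<in> b1 ` {..<R1} \<inter> {b. b div L \<noteq> \<beta>}" by (rule subsetD[OF 2(3) imageI]) (simp add: that)
    then show "b2 j < L * Suc k" "b2 j div L \<noteq> \<beta>" using subsetD[OF 1(3), of "b2 j"] by simp_all
  qed
  define b3 where "b3 j = blk L h' (b2 j)" for j
  have hb: "blk L h (b3 j) = b2 j" if "j < R2" for j
    unfolding b3_def blk_blk using b2(2)[OF that] by (intro blk_id) (auto simp: h_def h'_def)
  have b3: "b3 j < L * k" if "j < R2" for j
  proof -
    have "b2 j div L < Suc k" using b2(1)[OF that] div_lt by blast
    then have "h' (b2 j div L) < k" using \<beta> b2(2)[OF that] by (auto simp: h'_def)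
    then show ?thesis unfolding b3_def by (rule blk_lt)
  qed
  have "(\<lambda>a b. M (blk L (\<lambda>\<kappa>. \<kappa>) a) (blk L h b)) \<in> \<M>" by (rule reindex[OF M])
  then have M': "(\<lambda>a b. M a (blk L h b)) \<in> \<M>" by (simp add: blk_def)
  show ?thesis
  proof (rule full_rank[OF _ big])
    show "0 < k" using k L by simp
    have "a2 ` {..<R2} \<subseteq> {..<L * k}" by (rule subset_trans[OF 2(2) subset_trans[OF 1(2) Int_lower2]])
    then show "good k R2 (\<lambda>a b. M a (blk L h b), a2, b3)"
      using M' b3 by (auto simp: good_def)
    have "ndet R2 (\<lambda>i j. M (a2 i) (blk L h (b3 j))) = ndet R2 (\<lambda>i j. M (a2 i) (b2 j))"
      by (rule ndet_cong) (simp add: hb)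
    then show "ndet R2 (\<lambda>i j. M (a2 i) (blk L h (b3 j))) \<noteq> 0" using 2(4) by simp
  qed
qed

lemma square_blocks:
  assumes "M \<in> \<M>" "ndet (L * k) M \<noteq> 0" "L \<le> k"
  shows "\<exists>M\<in>\<M>. ndet (L * L) M \<noteq> 0"
  using assms(3,1,2)
proof (induction k arbitrary: M rule: dec_induct)
  case base
  then show ?case by blast
next
  case (step k)
  from descent[OF step.prems step.hyps(1)] step.IH show ?case by blast
qed

end

section \<open>Pairing with powers of the determinant\<close>

definition fdet :: "('p::finite \<Rightarrow> 'p \<Rightarrow> 'a::comm_ring_1) \<Rightarrow> 'a" where
  "fdet A = ndet CARD('p) (\<lambda>i j. A (en i) (en j))"

abbreviation words :: "nat \<Rightarrow> (nat \<Rightarrow> 'v) set" where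
  "words N \<equiv> PiE {..<N} (\<lambda>_. UNIV)"

lemma finite_words [simp]: "finite (words N :: (nat \<Rightarrow> 'v::finite) set)"
  by (intro finite_PiE) auto

text \<open>Words are ordered monomials, and the content is the exponent of the commutative
  monomial. Words of equal content differ by a permutation of positions.\<close>

definition wcont :: "nat \<Rightarrow> (nat \<Rightarrow> 'v) \<Rightarrow> 'v \<Rightarrow> nat" where
  "wcont N z v = card {s. s < N \<and> z s = v}"

lemma wcont_Suc: "wcont (Suc N) z = wcont N z + (\<lambda>v. if v = z N then 1 else 0)"
proof
  fix v
  have "{s. s < Suc N \<and> z s = v} = (if v = z N then insert N {s. s < N \<and> z s = v} else {s. s < N \<and> z s = v})"
    by (auto simp: less_Suc_eq)
  then show "wcont (Suc N) z v = (wcont N z + (\<lambda>v. if v = z N then 1 else 0)) v"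
    by (simp add: wcont_def)
qed

lemma prod_Xv: "(\<Prod>s<N. Xv (z s)) = (single (wcont N z) 1 :: ('v, 'a::comm_ring_1) mp)"
proof (induction N)
  case 0
  have "wcont 0 z = 0" by (simp add: wcont_def fun_eq_iff)
  then show ?case by simp
next
  case (Suc N)
  have "(\<Prod>s<Suc N. Xv (z s)) = single (wcont N z) 1 * (Xv (z N) :: ('v, 'a) mp)" by (simp add: Suc)
  also have "\<dots> = single (wcont (Suc N) z) 1" unfolding wcont_Suc Xv_def mult_single by simp
  finally show ?case .
qed

lemma wcont_permutes:
  assumes "wcont N z = wcont N z'"
  shows "\<exists>\<tau>\<in>perms N. \<forall>s<N. z s = z' (\<tau> s)"
proof -
  have "count (image_mset z (mset_set {..<N})) v = wcont N z v" for z :: "nat \<Rightarrow> 'a" and v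
  proof -
    have "{s \<in> {..<N}. v = z s} = {s. s < N \<and> z s = v}" by auto
    then show ?thesis unfolding wcont_def by (simp add: count_image_mset_eq_card_vimage)
  qed
  then have "image_mset z (mset_set {..<N}) = image_mset z' (mset_set {..<N})"
    using assms by (intro multiset_eqI) simp
  from image_mset_eq_implies_permutes[OF finite_lessThan this]
  obtain \<tau> where "\<tau> permutes {..<N}" "\<forall>x\<in>{..<N}. z x = z' (\<tau> x)" by blast
  then show ?thesis by (intro bexI[of _ \<tau>]) auto
qed

lemma word_of_exponent:
  "esz e = N \<Longrightarrow> \<exists>z. wcont N z = (e :: 'v::finite \<Rightarrow> nat)"
proof (induction N arbitrary: e)
  case 0
  then have "e = 0" by (simp add: esz_def fun_eq_iff)
  then show ?case by (simp add: wcont_def fun_eq_iff)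
next
  case (Suc N)
  then obtain v where v: "0 < e v" unfolding esz_def by (metis bot_nat_0.not_eq_extremum nat.distinct(1) sum.neutral)
  let ?u = "\<lambda>w. if w = v then 1 else 0 :: nat"
  have e: "e = (\<lambda>w. e w - ?u w) + ?u" using v by (auto simp: fun_eq_iff)
  have "esz ?u = 1" by (simp add: esz_def)
  then have "esz (\<lambda>w. e w - ?u w) = N" using Suc.prems arg_cong[OF e, of esz] by simp
  from Suc.IH[OF this] obtain z where z: "wcont N z = (\<lambda>w. e w - ?u w)" by blast
  have "wcont N (z(N := v)) = wcont N z" unfolding wcont_def by (intro ext arg_cong[of _ _ card]) auto
  then have "wcont (Suc N) (z(N := v)) = e" unfolding wcont_Suc using z e by simp
  then show ?case by blast
qed

lemma mon_wcont: "mon X (wcont N z) = (\<Prod>s<N. X (z s))"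
proof (induction N)
  case 0
  have "wcont 0 z = 0" by (simp add: wcont_def fun_eq_iff)
  then show ?case by simp
next
  case (Suc N)
  then show ?case unfolding wcont_Suc mon_add mon_unit by simp
qed

definition word_pairing :: "nat \<Rightarrow> ((nat \<Rightarrow> 'v) \<Rightarrow> 'a) \<Rightarrow> ('v \<Rightarrow> nat) set \<Rightarrow> ('v, 'a::comm_ring_1) mp \<Rightarrow> 'a" where
  "word_pairing N \<delta> E p = (\<Sum>e\<in>E. lookup p e * \<delta> (SOME z. wcont N z = e))"

lemma word_pairing_sum:
  fixes \<delta> :: "(nat \<Rightarrow> 'v::finite) \<Rightarrow> 'a::comm_ring_1"
  assumes inv: "\<And>z z'. wcont N z = wcont N z' \<Longrightarrow> \<delta> z = \<delta> z'"
    and E: "finite E" "\<And>j. j \<in> J \<Longrightarrow> wcont N (z j) \<in> E"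
  shows "word_pairing N \<delta> E (\<Sum>j\<in>J. cst (\<gamma> j) * (\<Prod>s<N. Xv (z j s))) = (\<Sum>j\<in>J. \<gamma> j * \<delta> (z j))"
proof -
  have \<delta>: "\<delta> (SOME z'. wcont N z' = wcont N z) = \<delta> z" for z
    by (rule inv) (rule someI[of _ z], simp)
  have "word_pairing N \<delta> E (\<Sum>j\<in>J. cst (\<gamma> j) * (\<Prod>s<N. Xv (z j s)))
    = (\<Sum>e\<in>E. \<Sum>j\<in>J. (if wcont N (z j) = e then \<gamma> j else 0) * \<delta> (SOME z. wcont N z = e))"
    unfolding word_pairing_def prod_Xv lookup_sum sum_distrib_right by (simp add: mult_single lookup_single when_def)
  also have "\<dots> = (\<Sum>j\<in>J. \<Sum>e\<in>E. if wcont N (z j) = e then \<gamma> j * \<delta> (z j) else 0)"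
    by (subst sum.swap) (auto intro!: sum.cong simp: \<delta>)
  also have "\<dots> = (\<Sum>j\<in>J. \<gamma> j * \<delta> (z j))"
    by (rule sum.cong) (use E in auto)
  finally show ?thesis .
qed

text \<open>A function of words that depends only on the content is a linear functional on forms of
  degree \<open>N\<close>. It can thus be applied to both sides of an identity, however the
  monomials are ordered.\<close>

lemma word_functional:
  fixes \<delta> :: "(nat \<Rightarrow> 'v::finite) \<Rightarrow> 'a::comm_ring_1"
  assumes inv: "\<And>z z'. wcont N z = wcont N z' \<Longrightarrow> \<delta> z = \<delta> z'"
    and fin: "finite J" "finite J'"
    and eq: "(\<Sum>j\<in>J. cst (\<gamma> j) * (\<Prod>s<N. Xv (z j s))) = (\<Sum>j\<in>J'. cst (\<gamma>' j) * (\<Prod>s<N. Xv (z' j s)))"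
  shows "(\<Sum>j\<in>J. \<gamma> j * \<delta> (z j)) = (\<Sum>j\<in>J'. \<gamma>' j * \<delta> (z' j))"
proof -
  define E where "E = (\<lambda>j. wcont N (z j)) ` J \<union> (\<lambda>j. wcont N (z' j)) ` J'"
  have E: "finite E" using fin by (simp add: E_def)
  have "word_pairing N \<delta> E (\<Sum>j\<in>J. cst (\<gamma> j) * (\<Prod>s<N. Xv (z j s))) = (\<Sum>j\<in>J. \<gamma> j * \<delta> (z j))"
    "word_pairing N \<delta> E (\<Sum>j\<in>J'. cst (\<gamma>' j) * (\<Prod>s<N. Xv (z' j s))) = (\<Sum>j\<in>J'. \<gamma>' j * \<delta> (z' j))"
    by (rule word_pairing_sum[OF inv E]; simp add: E_def)+
  then show ?thesis using eq by simp
qed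

text \<open>
  \<open>fdet A ^ w\<close> is the determinant of \<open>w\<close> diagonal copies of \<open>A\<close>, and \<open>u\<close> assigns the letters of a word
  to the copies. Up to a scalar, \<open>dd N w i r\<close> below is the apolar pairing of \<open>fdet A ^ w\<close> with
  \<open>\<Prod>s<N. A (i s) (r s)\<close>.
\<close>

definition eps :: "nat \<Rightarrow> (nat \<Rightarrow> 'p::finite) \<Rightarrow> (nat \<Rightarrow> nat) \<Rightarrow> int" where
  "eps N i u = ndet N (\<lambda>s a. if i s = en (a mod CARD('p)) \<and> u s = a div CARD('p) then 1 else 0)"

lemma of_int_hom': "comm_ring_hom (of_int :: int \<Rightarrow> 'a::comm_ring_1)"
  by unfold_locales auto

lemma of_int_eps: "of_int (eps N i u)
  = (ndet N (\<lambda>s a. if i s = en (a mod CARD('p)) \<and> u s = a div CARD('p) then 1 else 0) :: 'a::comm_ring_1)"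
  for i :: "nat \<Rightarrow> 'p::finite"
  unfolding eps_def by (subst ndet_hom[OF of_int_hom']) (auto intro!: ndet_cong)

lemma eps_contract:
  fixes Z :: "nat \<Rightarrow> 'p::finite \<Rightarrow> 'a::comm_ring_1"
  shows "(\<Sum>r\<in>words N. (\<Prod>s<N. Z s (r s)) * of_int (eps N r u))
    = ndet N (\<lambda>s a. if u s = a div CARD('p) then Z s (en (a mod CARD('p))) else 0)"
proof -
  have "(\<Sum>r\<in>words N. (\<Prod>s<N. Z s (r s)) * of_int (eps N r u))
    = ndet N (\<lambda>s a. \<Sum>r\<in>UNIV. Z s r * (if r = en (a mod CARD('p)) \<and> u s = a div CARD('p) then 1 else 0))"
    unfolding of_int_eps by (rule ndet_rows_sum[symmetric]) simp
  also have "\<dots> = ndet N (\<lambda>s a. if u s = a div CARD('p) then Z s (en (a mod CARD('p))) else 0)"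
    by (rule ndet_cong) (auto simp: if_distrib[of "\<lambda>x. _ * x"] cong: if_cong)
  finally show ?thesis .
qed

text \<open>The sum is the determinant of the selection matrix of \<open>i\<close> and
  \<open>u\<close> multiplied by \<open>w\<close> diagonal copies of \<open>A\<close>.\<close>

lemma eps_transform:
  fixes A :: "'p::finite \<Rightarrow> 'p \<Rightarrow> 'a::idom"
  assumes N: "N = CARD('p) * w"
  shows "(\<Sum>r\<in>words N. (\<Prod>s<N. A (i s) (r s)) * of_int (eps N r u)) = of_int (eps N i u) * fdet A ^ w"
proof -
  let ?p = "CARD('p)"
  let ?K = "\<lambda>b a. if b div ?p = a div ?p then A (en (b mod ?p)) (en (a mod ?p)) else 0"
  let ?E = "\<lambda>s a. if i s = en (a mod ?p) \<and> u s = a div ?p then 1 else (0 :: 'a)"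
  have "(\<Sum>b<N. ?E s b * ?K b a) = (if u s = a div ?p then A (i s) (en (a mod ?p)) else 0)"
    if a: "a < N" for s a
  proof (cases "u s = a div ?p")
    case True
    define b0 where "b0 = ?p * u s + de (i s)"
    have "u s < w" using True a N by (simp add: div_less_iff_less_mult mult.commute)
    then have "?p * Suc (u s) \<le> ?p * w" by (intro mult_left_mono) auto
    then have b0: "b0 < N" using de_lt[of "i s"] N by (simp add: b0_def)
    have d: "b0 div ?p = u s" "b0 mod ?p = de (i s)" using de_lt[of "i s"] by (simp_all add: b0_def)
    have eq: "i s = en (b mod ?p) \<and> u s = b div ?p \<longleftrightarrow> b = b0" for b
    proof
      assume *: "i s = en (b mod ?p) \<and> u s = b div ?p"
      then have "de (i s) = b mod ?p" by (simp add: de_en)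
      then show "b = b0" using * mult_div_mod_eq[of ?p b] by (simp add: b0_def)
    qed (simp add: d)
    have "(\<Sum>b<N. ?E s b * ?K b a) = (\<Sum>b<N. if b = b0 then A (i s) (en (a mod ?p)) else 0)"
      unfolding eq by (rule sum.cong) (auto simp: d True)
    then show ?thesis using b0 True by simp
  next
    case False
    then have "?E s b * ?K b a = 0" for b by auto
    then show ?thesis using False by (simp add: sum.neutral)
  qed
  then have "ndet N (\<lambda>s a. if u s = a div ?p then A (i s) (en (a mod ?p)) else 0)
    = ndet N (\<lambda>s a. \<Sum>b<N. ?E s b * ?K b a)"
    by (intro ndet_cong) simp
  also have "\<dots> = of_int (eps N i u) * ndet N ?K"
    unfolding ndet_mult of_int_eps ..
  also have "ndet N ?K = fdet A ^ w"
    unfolding N fdet_def using ndet_kron[of ?p w "\<lambda>i j. A (en i) (en j)"] by simp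
  finally show ?thesis by (subst eps_contract)
qed

definition dd :: "nat \<Rightarrow> nat \<Rightarrow> (nat \<Rightarrow> 'p::finite) \<Rightarrow> (nat \<Rightarrow> 'p) \<Rightarrow> int" where
  "dd N w i r = (\<Sum>u\<in>PiE {..<N} (\<lambda>_. {..<w}). eps N i u * eps N r u)"

lemma eps_perm: "\<tau> \<in> perms N \<Longrightarrow> eps N (i \<circ> \<tau>) (u \<circ> \<tau>) = of_int (sign \<tau>) * eps N i u"
  unfolding eps_def o_def
  by (rule ndet_row_perm[of \<tau> N "\<lambda>s a. if i s = en (a mod CARD('a)) \<and> u s = a div CARD('a) then 1 else 0"])

lemma eps_cong: "(\<And>s. s < N \<Longrightarrow> i s = i' s) \<Longrightarrow> eps N i u = eps N i' u"
  unfolding eps_def by (rule ndet_cong) simp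

lemma dd_cong: "(\<And>s. s < N \<Longrightarrow> i s = i' s) \<Longrightarrow> (\<And>s. s < N \<Longrightarrow> r s = r' s) \<Longrightarrow> dd N w i r = dd N w i' r'"
  unfolding dd_def using eps_cong[of N i i'] eps_cong[of N r r'] by simp

text \<open>Reordering positions changes both factors \<open>eps\<close> by the same sign.\<close>

lemma dd_perm:
  assumes \<tau>: "\<tau> \<in> perms N"
  shows "dd N w (i \<circ> \<tau>) (r \<circ> \<tau>) = dd N w i r"
proof -
  have t: "\<tau> permutes {..<N}" using \<tau> by simp
  let ?U = "PiE {..<N} (\<lambda>_. {..<w}) :: (nat \<Rightarrow> nat) set"
  let ?i = "inv_into UNIV \<tau>"
  have ti: "?i permutes {..<N}" by (rule permutes_inv[OF t])
  have mem: "u \<circ> \<rho> \<in> ?U" if "u \<in> ?U" "\<rho> permutes {..<N}" for u \<rho>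
    using that permutes_in_image[OF that(2)] permutes_not_in[OF that(2)]
    by (auto simp: PiE_iff extensional_def)
  have s1: "of_int (sign \<tau>) * of_int (sign \<tau>) = (1 :: int)" by (simp add: sign_def)
  show ?thesis
    unfolding dd_def
  proof (rule sum.reindex_bij_witness[where i = "\<lambda>u. u \<circ> \<tau>" and j = "\<lambda>u. u \<circ> ?i"])
    fix u assume u: "u \<in> ?U"
    show eq: "u \<circ> ?i \<circ> \<tau> = u" using permutes_inv_o(2)[OF t] by (simp add: o_assoc[symmetric])
    show "u \<circ> ?i \<in> ?U" by (rule mem[OF u ti])
    show "eps N i (u \<circ> ?i) * eps N r (u \<circ> ?i) = eps N (i \<circ> \<tau>) u * eps N (r \<circ> \<tau>) u"
      using eps_perm[OF \<tau>, of i "u \<circ> ?i"] eps_perm[OF \<tau>, of r "u \<circ> ?i"] s1 unfolding eq by (simp add: mult_ac)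
  next
    fix u assume u: "u \<in> ?U"
    show "u \<circ> \<tau> \<circ> ?i = u" using permutes_inv_o(1)[OF t] by (simp add: o_assoc[symmetric])
    show "u \<circ> \<tau> \<in> ?U" by (rule mem[OF u t])
  qed
qed

lemma dd_wcont:
  assumes "wcont N z = wcont N z'"
  shows "dd N w (\<lambda>s. fst (z s)) (\<lambda>s. snd (z s)) = dd N w (\<lambda>s. fst (z' s)) (\<lambda>s. snd (z' s))"
proof -
  obtain \<tau> where \<tau>: "\<tau> \<in> perms N" "\<forall>s<N. z s = z' (\<tau> s)" using wcont_permutes[OF assms] by blast
  have "dd N w (\<lambda>s. fst (z s)) (\<lambda>s. snd (z s)) = dd N w ((\<lambda>s. fst (z' s)) \<circ> \<tau>) ((\<lambda>s. snd (z' s)) \<circ> \<tau>)"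
    by (rule dd_cong) (use \<tau> in auto)
  then show ?thesis unfolding dd_perm[OF \<tau>(1)] .
qed

text \<open>By \<open>total\<close> the numbers \<open>dd\<close> are the coefficients of
  \<open>of_int S * fdet A ^ w\<close> over pairs of words. Pairing the hypothesis with
  \<open>dd\<close> thus gives \<open>g\<close> times \<open>T\<close>, the pairing of
  \<open>dd\<close> with itself. \<open>S\<close> and \<open>T\<close> are positive as sums of
  squares, and \<kappa> is their quotient, independent of the given family.\<close>

lemma det_pairing:
  assumes N: "N = CARD('p::finite) * w"
  shows "\<exists>\<kappa> :: 'a::field_char_0. \<kappa> \<noteq> 0 \<and> (\<forall>(J :: 'j set) \<gamma> x y g. finite J \<longrightarrow>
    (\<forall>A :: 'p \<Rightarrow> 'p \<Rightarrow> 'a. (\<Sum>j\<in>J. \<gamma> j * (\<Prod>s<N. A (x j s) (y j s))) = g * fdet A ^ w) \<longrightarrow>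
    (\<Sum>j\<in>J. \<gamma> j * of_int (dd N w (x j) (y j))) = \<kappa> * g)"
proof -
  let ?p = "CARD('p)"
  let ?W = "words N :: (nat \<Rightarrow> 'p) set" and ?U = "PiE {..<N} (\<lambda>_. {..<w}) :: (nat \<Rightarrow> nat) set"
  define S where "S = (\<Sum>u\<in>?U. \<Sum>i\<in>?W. (eps N i u)\<^sup>2)"
  define T where "T = (\<Sum>(i, r)\<in>?W \<times> ?W. (dd N w i r)\<^sup>2)"
  have finU: "finite ?U" by (intro finite_PiE) auto
  \<comment> \<open>With the letters and copies listed in their natural order the selection matrix
    is the identity; this keeps \<open>S\<close> and \<open>T\<close> away from 0.\<close>
  define i0 where "i0 = restrict (\<lambda>s. en (s mod ?p) :: 'p) {..<N}"
  define u0 where "u0 = restrict (\<lambda>s. s div ?p) {..<N}"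
  have i0: "i0 \<in> ?W" by (simp add: i0_def)
  have u0: "u0 \<in> ?U" using N by (simp add: u0_def div_less_iff_less_mult mult.commute)
  have "eps N i0 u0 = ndet N (\<lambda>s a. if s = a then 1 else 0)"
    unfolding eps_def
  proof (rule ndet_cong)
    fix s a assume sa: "s < N" "a < N"
    have "en (s mod ?p) = (en (a mod ?p) :: 'p) \<longleftrightarrow> s mod ?p = a mod ?p"
      by (subst en_eq_iff) (simp_all add: de_en)
    then have "i0 s = en (a mod ?p) \<and> u0 s = a div ?p \<longleftrightarrow> s = a"
      using sa by (simp add: i0_def u0_def) (metis mult_div_mod_eq)
    then show "(if i0 s = en (a mod ?p) \<and> u0 s = a div ?p then 1 else 0) = (if s = a then 1 else (0 :: int))" by simp
  qed
  then have e0: "eps N i0 u0 = 1" by (simp add: ndet_one)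
  have pos: "(\<Sum>i\<in>?W. (eps N i u0)\<^sup>2) > 0"
    by (rule sum_pos2[OF finite_words i0]) (simp_all add: e0)
  have S: "S > 0"
    unfolding S_def
  proof (rule sum_pos2[OF finU u0])
    show "0 < (\<Sum>i\<in>?W. (eps N i u0)\<^sup>2)" by (fact pos)
  qed (simp add: sum_nonneg)
  have "dd N w i0 i0 > 0"
    unfolding dd_def by (rule sum_pos2[OF finU u0]) (simp_all add: e0)
  then have T: "T > 0"
    unfolding T_def by (intro sum_pos2[of "?W \<times> ?W" "(i0, i0)"] finite_cartesian_product finite_words) (simp_all add: i0 case_prod_unfold)
  have total: "(\<Sum>(i, r)\<in>?W \<times> ?W. of_int (dd N w i r) * (\<Prod>s<N. A (i s) (r s))) = of_int S * fdet A ^ w"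
    for A :: "'p \<Rightarrow> 'p \<Rightarrow> 'a"
  proof -
    have "(\<Sum>(i, r)\<in>?W \<times> ?W. of_int (dd N w i r) * (\<Prod>s<N. A (i s) (r s)))
      = (\<Sum>i\<in>?W. \<Sum>r\<in>?W. \<Sum>u\<in>?U. of_int (eps N i u) * ((\<Prod>s<N. A (i s) (r s)) * of_int (eps N r u)))"
      unfolding sum.cartesian_product[symmetric] dd_def of_int_sum of_int_mult sum_distrib_right
      by (intro sum.cong refl) (simp only: mult_ac)
    also have "\<dots> = (\<Sum>i\<in>?W. \<Sum>u\<in>?U. \<Sum>r\<in>?W. of_int (eps N i u) * ((\<Prod>s<N. A (i s) (r s)) * of_int (eps N r u)))"
      by (rule sum.cong[OF refl], rule sum.swap)
    also have "\<dots> = (\<Sum>u\<in>?U. \<Sum>i\<in>?W. \<Sum>r\<in>?W. of_int (eps N i u) * ((\<Prod>s<N. A (i s) (r s)) * of_int (eps N r u)))"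
      by (rule sum.swap)
    also have "\<dots> = (\<Sum>u\<in>?U. \<Sum>i\<in>?W. of_int (eps N i u) * (of_int (eps N i u) * fdet A ^ w))"
      unfolding sum_distrib_left[symmetric] eps_transform[OF N] ..
    also have "\<dots> = of_int S * fdet A ^ w"
      unfolding S_def of_int_sum sum_distrib_right by (simp add: power2_eq_square mult.assoc)
    finally show ?thesis .
  qed
  have main: "of_int S * (\<Sum>j\<in>J. \<gamma> j * of_int (dd N w (x j) (y j))) = of_int T * g"
    if fin: "finite J" and H: "\<And>A. (\<Sum>j\<in>J. \<gamma> j * (\<Prod>s<N. A (x j s) (y j s))) = g * fdet A ^ w"
    for J :: "'j set" and \<gamma> and x y :: "'j \<Rightarrow> nat \<Rightarrow> 'p" and g :: 'a
  proof -
    have "(\<Sum>j\<in>J. cst (of_int S * \<gamma> j) * (\<Prod>s<N. Xv (x j s, y j s)))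
      = (\<Sum>z\<in>?W \<times> ?W. cst (g * of_int (dd N w (fst z) (snd z))) * (\<Prod>s<N. Xv (fst z s, snd z s)))"
      (is "?P = ?Q")
    proof (rule mp_eqI)
      fix a :: "'p \<times> 'p \<Rightarrow> nat"
      let ?A = "\<lambda>i j. of_nat (a (i, j)) :: 'a"
      have "ev (\<lambda>v. of_nat (a v)) ?P = (\<Sum>j\<in>J. of_int S * \<gamma> j * (\<Prod>s<N. ?A (x j s) (y j s)))"
        by (simp add: evid.hom_sum evid.hom_mult evid.hom_prod evh_cst[OF id_hom'] evh_Xv[OF id_hom'])
      also have "\<dots> = of_int S * (g * fdet ?A ^ w)"
        unfolding H[of ?A, symmetric] by (simp add: sum_distrib_left mult.assoc)
      also have "\<dots> = g * (\<Sum>(i, r)\<in>?W \<times> ?W. of_int (dd N w i r) * (\<Prod>s<N. ?A (i s) (r s)))"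
        by (subst total[of ?A]) (simp add: mult_ac)
      also have "\<dots> = ev (\<lambda>v. of_nat (a v)) ?Q"
        by (simp add: evid.hom_sum evid.hom_mult evid.hom_prod evh_cst[OF id_hom'] evh_Xv[OF id_hom']
            sum_distrib_left case_prod_unfold mult.assoc)
      finally show "ev (\<lambda>v. of_nat (a v)) ?P = ev (\<lambda>v. of_nat (a v)) ?Q" .
    qed
    then have "(\<Sum>j\<in>J. of_int S * \<gamma> j * of_int (dd N w (\<lambda>s. fst (x j s, y j s)) (\<lambda>s. snd (x j s, y j s))))
      = (\<Sum>z\<in>?W \<times> ?W. g * of_int (dd N w (fst z) (snd z)) * of_int (dd N w (\<lambda>s. fst (fst z s, snd z s)) (\<lambda>s. snd (fst z s, snd z s))))"
      by (rule word_functional[where \<delta> = "\<lambda>z. of_int (dd N w (\<lambda>s. fst (z s)) (\<lambda>s. snd (z s)))", rotated 3])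
        (use fin dd_wcont in auto)
    then show ?thesis
      unfolding T_def by (simp add: sum_distrib_left sum_distrib_right case_prod_unfold power2_eq_square mult_ac)
  qed
  show ?thesis
  proof (intro exI[of _ "of_int T / of_int S"] conjI allI impI)
    show "of_int T / of_int S \<noteq> (0 :: 'a)" using S T by simp
    fix J :: "'j set" and \<gamma> and x y :: "'j \<Rightarrow> nat \<Rightarrow> 'p" and g :: 'a
    assume "finite J" "\<forall>A. (\<Sum>j\<in>J. \<gamma> j * (\<Prod>s<N. A (x j s) (y j s))) = g * fdet A ^ w"
    then have "of_int S * (\<Sum>j\<in>J. \<gamma> j * of_int (dd N w (x j) (y j))) = of_int T * g" by (intro main) simp_all
    then show "(\<Sum>j\<in>J. \<gamma> j * of_int (dd N w (x j) (y j))) = of_int T / of_int S * g"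
      using S by (simp add: field_simps)
  qed
qed

text \<open>
  The double sum is the coefficient of \<open>\<Prod>s<N. t s\<close> in the determinant; it is isolated by
  letting \<open>t\<close> run through the indicator functions of subsets.
\<close>

lemma polarized_determinant:
  fixes Y :: "nat \<Rightarrow> nat \<Rightarrow> nat \<Rightarrow> 'a::comm_ring_1"
  assumes nz: "(\<Sum>\<pi>\<in>perms N. \<Sum>\<sigma>\<in>perms N. of_int (sign \<pi>) * of_int (sign \<sigma>) * (\<Prod>s<N. Y s (\<pi> s) (\<sigma> s))) \<noteq> 0"
  shows "\<exists>t. ndet N (\<lambda>a b. \<Sum>s<N. t s * Y s a b) \<noteq> 0"
proof (rule ccontr)
  assume neg: "\<not> ?thesis"
  \<comment> \<open>\<open>G S\<close> collects the terms of the expanded determinant that use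
    exactly the matrices with index in \<open>S\<close>. The indicator of \<open>S\<close> makes the
    sum of \<open>G\<close> over all subsets of \<open>S\<close> vanish, and induction on
    \<open>S\<close> isolates \<open>G S\<close>.\<close>
  define G where "G S = (\<Sum>h | h \<in> PiE {..<N} (\<lambda>_. {..<N}) \<and> h ` {..<N} = S. ndet N (\<lambda>a b. Y (h a) a b))" for S
  have fin: "finite (PiE {..<N} (\<lambda>_. {..<N}) :: (nat \<Rightarrow> nat) set)" by (intro finite_PiE) auto
  have sub: "(\<Sum>S'\<in>Pow S. G S') = 0" if S: "S \<subseteq> {..<N}" for S
  proof -
    have fS: "finite S" using S finite_subset by blast
    have "0 = ndet N (\<lambda>a b. \<Sum>s<N. (if s \<in> S then 1 else 0) * Y s a b)" using neg by auto
    also have "\<dots> = ndet N (\<lambda>a b. \<Sum>s\<in>S. 1 * Y s a b)"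
    proof (rule ndet_cong)
      fix a b
      have "(\<Sum>s\<in>S. 1 * Y s a b) = (\<Sum>s\<in>S. (if s \<in> S then 1 else 0) * Y s a b)" by (rule sum.cong) auto
      also have "\<dots> = (\<Sum>s<N. (if s \<in> S then 1 else 0) * Y s a b)"
        by (rule sum.mono_neutral_left) (use S in auto)
      finally show "(\<Sum>s<N. (if s \<in> S then 1 else 0) * Y s a b) = (\<Sum>s\<in>S. 1 * Y s a b)" ..
    qed
    also have "\<dots> = (\<Sum>h\<in>PiE {..<N} (\<lambda>_. S). ndet N (\<lambda>a b. Y (h a) a b))"
      by (subst ndet_rows_sum[of N "\<lambda>_. S" "\<lambda>_ _. 1" "\<lambda>a s b. Y s a b"]) (simp_all add: fS)
    also have "PiE {..<N} (\<lambda>_. S) = (\<Union>S'\<in>Pow S. {h. h \<in> PiE {..<N} (\<lambda>_. {..<N}) \<and> h ` {..<N} = S'})"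
    proof (intro subset_antisym subsetI)
      fix h assume h: "h \<in> PiE {..<N} (\<lambda>_. S)"
      then have "h \<in> PiE {..<N} (\<lambda>_. {..<N})" using S by (intro subsetD[OF PiE_mono h]) auto
      moreover have "h ` {..<N} \<in> Pow S" using h by (auto simp: PiE_iff)
      ultimately show "h \<in> (\<Union>S'\<in>Pow S. {h. h \<in> PiE {..<N} (\<lambda>_. {..<N}) \<and> h ` {..<N} = S'})" by blast
    next
      fix h assume "h \<in> (\<Union>S'\<in>Pow S. {h. h \<in> PiE {..<N} (\<lambda>_. {..<N}) \<and> h ` {..<N} = S'})"
      then have "h ` {..<N} \<subseteq> S" "h \<in> extensional {..<N}" by (auto simp: PiE_iff)
      then show "h \<in> PiE {..<N} (\<lambda>_. S)" unfolding PiE_iff by blast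
    qed
    also have "(\<Sum>h\<in>\<dots>. ndet N (\<lambda>a b. Y (h a) a b)) = (\<Sum>S'\<in>Pow S. G S')"
      unfolding G_def by (rule sum.UNION_disjoint) (use fS fin in auto)
    finally show ?thesis by simp
  qed
  have G0: "G S = 0" if "S \<subseteq> {..<N}" for S
    using finite_subset[OF that finite_lessThan] that
  proof (induction S rule: finite_psubset_induct)
    case (psubset S)
    have "(\<Sum>S'\<in>Pow S. G S') = G S + (\<Sum>S'\<in>Pow S - {S}. G S')"
      using psubset.hyps by (intro sum.remove) auto
    moreover have "(\<Sum>S'\<in>Pow S - {S}. G S') = 0"
    proof (rule sum.neutral, rule ballI)
      fix S' assume "S' \<in> Pow S - {S}"
      then have "S' \<subset> S" by auto
      then show "G S' = 0" using psubset.IH[of S'] psubset.prems by auto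
    qed
    ultimately show ?case using sub[OF psubset.prems] by simp
  qed
  have "(\<Sum>\<pi>\<in>perms N. \<Sum>\<sigma>\<in>perms N. of_int (sign \<pi>) * of_int (sign \<sigma>) * (\<Prod>s<N. Y s (\<pi> s) (\<sigma> s)))
    = (\<Sum>\<pi>\<in>perms N. ndet N (\<lambda>a b. Y (inv_into UNIV \<pi> a) a b))"
  proof (rule sum.cong[OF refl])
    fix \<pi> assume "\<pi> \<in> perms N"
    then have p: "\<pi> permutes {..<N}" by simp
    have "(\<Sum>\<sigma>\<in>perms N. of_int (sign \<pi>) * of_int (sign \<sigma>) * (\<Prod>s<N. Y s (\<pi> s) (\<sigma> s)))
      = (\<Sum>\<sigma>\<in>perms N. of_int (sign \<pi>) * of_int (sign (\<sigma> \<circ> \<pi>)) * (\<Prod>s<N. Y s (\<pi> s) ((\<sigma> \<circ> \<pi>) s)))"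
      by (rule sum_permutations_compose_right[OF p])
    also have "\<dots> = (\<Sum>\<sigma>\<in>perms N. of_int (sign \<sigma>) * (\<Prod>a<N. Y (inv_into UNIV \<pi> a) a (\<sigma> a)))"
    proof (rule sum.cong[OF refl])
      fix \<sigma> assume "\<sigma> \<in> perms N"
      then have s: "\<sigma> permutes {..<N}" by simp
      have "sign (\<sigma> \<circ> \<pi>) = sign \<sigma> * sign \<pi>"
        using p s by (intro sign_compose) (auto simp: permutation_permutes)
      then have sgn: "of_int (sign \<pi>) * of_int (sign (\<sigma> \<circ> \<pi>)) = (of_int (sign \<sigma>) :: 'a)"
        by (simp add: sign_def)
      have prd: "(\<Prod>a<N. Y (inv_into UNIV \<pi> a) a (\<sigma> a)) = (\<Prod>s<N. Y s (\<pi> s) ((\<sigma> \<circ> \<pi>) s))"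
        using prod.permute[OF p, of "\<lambda>a. Y (inv_into UNIV \<pi> a) a (\<sigma> a)"]
        by (simp add: permutes_inverses(2)[OF p] o_def)
      show "of_int (sign \<pi>) * of_int (sign (\<sigma> \<circ> \<pi>)) * (\<Prod>s<N. Y s (\<pi> s) ((\<sigma> \<circ> \<pi>) s))
        = of_int (sign \<sigma>) * (\<Prod>a<N. Y (inv_into UNIV \<pi> a) a (\<sigma> a))"
        unfolding sgn prd ..
    qed
    finally show "(\<Sum>\<sigma>\<in>perms N. of_int (sign \<pi>) * of_int (sign \<sigma>) * (\<Prod>s<N. Y s (\<pi> s) (\<sigma> s)))
      = ndet N (\<lambda>a b. Y (inv_into UNIV \<pi> a) a b)"
      unfolding ndet_leibniz .
  qed
  also have "\<dots> = (\<Sum>\<pi>\<in>perms N. ndet N (\<lambda>a b. Y (\<pi> a) a b))"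
    using sum_permutations_inverse[of "\<lambda>\<pi>. ndet N (\<lambda>a b. Y (\<pi> a) a b)" "{..<N}"] by simp
  \<comment> \<open>Maps onto the full index set are the permutations.\<close>
  also have "\<dots> = G {..<N}"
    unfolding G_def
  proof (rule sum.reindex_bij_witness[where i = "\<lambda>h a. if a < N then h a else a" and j = "\<lambda>\<pi>. restrict \<pi> {..<N}"])
    fix \<pi> assume "\<pi> \<in> perms N"
    then have p: "\<pi> permutes {..<N}" by simp
    show "(\<lambda>a. if a < N then restrict \<pi> {..<N} a else a) = \<pi>"
      using permutes_not_in[OF p] by (auto simp: fun_eq_iff)
    show "restrict \<pi> {..<N} \<in> {h. h \<in> PiE {..<N} (\<lambda>_. {..<N}) \<and> h ` {..<N} = {..<N}}"
      using permutes_image[OF p] by (auto simp: PiE_iff)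
    show "ndet N (\<lambda>a b. Y (restrict \<pi> {..<N} a) a b) = ndet N (\<lambda>a b. Y (\<pi> a) a b)"
      by (rule ndet_cong) simp
  next
    fix h assume "h \<in> {h. h \<in> PiE {..<N} (\<lambda>_. {..<N}) \<and> h ` {..<N} = {..<N}}"
    then have h: "h \<in> extensional {..<N}" "h ` {..<N} = {..<N}" by (auto simp: PiE_iff)
    show "restrict (\<lambda>a. if a < N then h a else a) {..<N} = h"
      using h(1) by (auto simp: fun_eq_iff extensional_def)
    have "inj_on h {..<N}" using h(2) by (intro eq_card_imp_inj_on) auto
    then have "bij_betw h {..<N} {..<N}" using h(2) by (simp add: bij_betw_def)
    then have "bij_betw (\<lambda>a. if a < N then h a else a) {..<N} {..<N}" by (subst bij_betw_cong[of _ _ h]) auto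
    then show "(\<lambda>a. if a < N then h a else a) \<in> perms N" by (intro CollectI bij_imp_permutes) auto
  qed
  finally show False using nz G0[of "{..<N}"] by simp
qed

section \<open>Blow-ups and determinantal invariants\<close>

text \<open>\<open>B\<close> multiplies from the right without an inverse, so that the result is
  polynomial in the entries of both factors.\<close>

definition act :: "('p \<Rightarrow> 'p \<Rightarrow> 'a) \<Rightarrow> ('q \<Rightarrow> 'q \<Rightarrow> 'a) \<Rightarrow> ('m \<times> ('p::finite \<times> 'q::finite) \<Rightarrow> 'a::comm_ring_1) \<Rightarrow> 'm \<times> ('p \<times> 'q) \<Rightarrow> 'a" where
  "act A B X = (\<lambda>(l, (r, c)). \<Sum>r'\<in>UNIV. \<Sum>c'\<in>UNIV. A r r' * X (l, (r', c')) * B c' c)"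

text \<open>The matrix \<open>\<Sum>l. X l \<otimes> T l\<close>, with the factors arranged so that \<open>T\<close> indexes the blocks.\<close>

definition blow :: "('m::finite \<times> ('p::finite \<times> 'q::finite) \<Rightarrow> 'a::comm_ring_1) \<Rightarrow> ('m \<Rightarrow> nat \<Rightarrow> nat \<Rightarrow> 'a) \<Rightarrow> nat \<Rightarrow> nat \<Rightarrow> 'a" where
  "blow X T a b = (\<Sum>l\<in>UNIV. X (l, (en (a mod CARD('p)), en (b mod CARD('q)))) * T l (a div CARD('p)) (b div CARD('q)))"

lemma evq_words:
  fixes f :: "('v::finite, rat) mp"
  assumes "hmg N f"
  shows "\<exists>z. \<forall>X :: 'v \<Rightarrow> 'a::field_char_0. evq X f = (\<Sum>e\<in>keys f. of_rat (lookup f e) * (\<Prod>s<N. X (z e s)))"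
proof -
  define z where "z e = (SOME z. wcont N z = e)" for e :: "'v \<Rightarrow> nat"
  have "wcont N (z e) = e" if "e \<in> keys f" for e
  proof -
    have "esz e = N" using assms that by (auto simp: hmg_def)
    from someI_ex[OF word_of_exponent[OF this]] show ?thesis unfolding z_def .
  qed
  then have "evq X f = (\<Sum>e\<in>keys f. of_rat (lookup f e) * (\<Prod>s<N. X (z e s)))" for X :: "'v \<Rightarrow> 'a"
    unfolding evh_def mon_wcont[symmetric] by (intro sum.cong refl) simp
  then show ?thesis by blast
qed

lemma sum_double: "(\<Sum>j\<in>A \<times> B. g (fst j) (snd j)) = (\<Sum>a\<in>A. \<Sum>b\<in>B. g a b)"
  by (simp add: sum.cartesian_product case_prod_unfold)

lemma sum_triple: "(\<Sum>j\<in>(A \<times> B) \<times> C. g (fst (fst j)) (snd (fst j)) (snd j)) = (\<Sum>a\<in>A. \<Sum>b\<in>B. \<Sum>c\<in>C. g a b c)"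
  using sum_double[of "\<lambda>j c. g (fst j) (snd j) c" "A \<times> B" C] sum_double[of "\<lambda>a b. \<Sum>c\<in>C. g a b c" A B] by simp

lemma sum_swap4: "(\<Sum>a\<in>A. \<Sum>b\<in>B. \<Sum>c\<in>C. \<Sum>d\<in>D. F a b c d) = (\<Sum>d\<in>D. \<Sum>c\<in>C. \<Sum>a\<in>A. \<Sum>b\<in>B. F a b c d)"
proof -
  have "(\<Sum>b\<in>B. \<Sum>c\<in>C. \<Sum>d\<in>D. F a b c d) = (\<Sum>d\<in>D. \<Sum>c\<in>C. \<Sum>b\<in>B. F a b c d)" for a
  proof -
    have "(\<Sum>b\<in>B. \<Sum>c\<in>C. \<Sum>d\<in>D. F a b c d) = (\<Sum>b\<in>B. \<Sum>d\<in>D. \<Sum>c\<in>C. F a b c d)" by (intro sum.cong refl sum.swap)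
    also have "\<dots> = (\<Sum>d\<in>D. \<Sum>b\<in>B. \<Sum>c\<in>C. F a b c d)" by (rule sum.swap)
    also have "\<dots> = (\<Sum>d\<in>D. \<Sum>c\<in>C. \<Sum>b\<in>B. F a b c d)" by (intro sum.cong refl sum.swap)
    finally show ?thesis .
  qed
  then have "(\<Sum>a\<in>A. \<Sum>b\<in>B. \<Sum>c\<in>C. \<Sum>d\<in>D. F a b c d) = (\<Sum>a\<in>A. \<Sum>d\<in>D. \<Sum>c\<in>C. \<Sum>b\<in>B. F a b c d)" by simp
  also have "\<dots> = (\<Sum>d\<in>D. \<Sum>a\<in>A. \<Sum>c\<in>C. \<Sum>b\<in>B. F a b c d)" by (rule sum.swap)
  also have "\<dots> = (\<Sum>d\<in>D. \<Sum>c\<in>C. \<Sum>a\<in>A. \<Sum>b\<in>B. F a b c d)" by (intro sum.cong refl sum.swap)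
  finally show ?thesis .
qed

lemma sum_nonzero: "sum g A \<noteq> 0 \<Longrightarrow> \<exists>a\<in>A. g a \<noteq> 0"
  by (metis sum.neutral)

text \<open>
  First fundamental theorem: pairing the semi-invariance of \<open>f\<close> with powers of the determinant in
  both group variables expresses \<open>f\<close> through polarized determinants of blow-ups.
\<close>

lemma semi_invariant_blow:
  fixes f :: "('m::finite \<times> ('p::finite \<times> 'q::finite), rat) mp" and X :: "'m \<times> ('p \<times> 'q) \<Rightarrow> 'a::field_char_0"
  assumes f: "hmg N f" and N: "N = CARD('p) * w" "N = CARD('q) * w'"
    and semi: "\<And>A B. evq (act A B X) f = fdet A ^ w * fdet B ^ w' * evq X f"
    and nz: "evq X f \<noteq> 0"
  shows "\<exists>T. ndet N (blow X T) \<noteq> 0"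
proof -
  let ?Wp = "words N :: (nat \<Rightarrow> 'p) set" and ?Wq = "words N :: (nat \<Rightarrow> 'q) set"
  obtain z where z: "\<And>X :: 'm \<times> ('p \<times> 'q) \<Rightarrow> 'a. evq X f = (\<Sum>e\<in>keys f. of_rat (lookup f e) * (\<Prod>s<N. X (z e s)))"
    using evq_words[OF f] by blast
  define l where "l e s = fst (z e s)" for e s
  define r where "r e s = fst (snd (z e s))" for e s
  define c where "c e s = snd (snd (z e s))" for e s
  have zz: "z e s = (l e s, (r e s, c e s))" for e s by (simp add: l_def r_def c_def)
  define x where "x e \<rho> \<xi> = (\<Prod>s<N. X (l e s, (\<rho> s, \<xi> s)))" for e \<rho> \<xi>
  \<comment> \<open>For fixed \<open>B\<close> this is an identity in \<open>A\<close> of the form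
    that \<open>det_pairing\<close> accepts; everything depending on \<open>B\<close> is in the
    coefficients.\<close>
  have expand: "(\<Sum>j\<in>keys f \<times> ?Wp. (of_rat (lookup f (fst j)) * (\<Sum>\<xi>\<in>?Wq. x (fst j) (snd j) \<xi> * (\<Prod>s<N. B (\<xi> s) (c (fst j) s)))) * (\<Prod>s<N. A (r (fst j) s) (snd j s)))
     = (fdet B ^ w' * evq X f) * fdet A ^ w" for A B
  proof -
    have *: "(\<Prod>s<N. act A B X (z e s))
      = (\<Sum>\<rho>\<in>?Wp. (\<Sum>\<xi>\<in>?Wq. x e \<rho> \<xi> * (\<Prod>s<N. B (\<xi> s) (c e s))) * (\<Prod>s<N. A (r e s) (\<rho> s)))" for e
    proof -
      have "(\<Prod>s<N. act A B X (z e s)) = (\<Prod>s<N. \<Sum>r'\<in>UNIV. \<Sum>c'\<in>UNIV. A (r e s) r' * X (l e s, (r', c')) * B c' (c e s))"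
        unfolding zz by (simp add: act_def)
      also have "\<dots> = (\<Sum>\<rho>\<in>?Wp. \<Prod>s<N. \<Sum>c'\<in>UNIV. A (r e s) (\<rho> s) * X (l e s, (\<rho> s, c')) * B c' (c e s))"
        by (rule prod_sum_PiE) auto
      also have "\<dots> = (\<Sum>\<rho>\<in>?Wp. \<Sum>\<xi>\<in>?Wq. \<Prod>s<N. A (r e s) (\<rho> s) * X (l e s, (\<rho> s, \<xi> s)) * B (\<xi> s) (c e s))"
        by (intro sum.cong refl prod_sum_PiE) auto
      also have "\<dots> = (\<Sum>\<rho>\<in>?Wp. (\<Sum>\<xi>\<in>?Wq. x e \<rho> \<xi> * (\<Prod>s<N. B (\<xi> s) (c e s))) * (\<Prod>s<N. A (r e s) (\<rho> s)))"
        unfolding x_def sum_distrib_right by (intro sum.cong refl) (simp add: prod.distrib mult_ac)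
      finally show ?thesis .
    qed
    have "evq (act A B X) f = (\<Sum>e\<in>keys f. \<Sum>\<rho>\<in>?Wp. (of_rat (lookup f e) * (\<Sum>\<xi>\<in>?Wq. x e \<rho> \<xi> * (\<Prod>s<N. B (\<xi> s) (c e s)))) * (\<Prod>s<N. A (r e s) (\<rho> s)))"
      unfolding z *
      by (rule sum.cong[OF refl], subst sum_distrib_left, rule sum.cong[OF refl], rule mult.assoc[symmetric])
    then show ?thesis unfolding semi by (simp add: sum.cartesian_product case_prod_unfold mult_ac)
  qed
  obtain \<kappa> :: 'a where \<kappa>: "\<kappa> \<noteq> 0" "\<forall>(J :: (('m \<times> 'p \<times> 'q \<Rightarrow> nat) \<times> (nat \<Rightarrow> 'p)) set) \<gamma> x y g. finite J \<longrightarrow>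
    (\<forall>A :: 'p \<Rightarrow> 'p \<Rightarrow> 'a. (\<Sum>j\<in>J. \<gamma> j * (\<Prod>s<N. A (x j s) (y j s))) = g * fdet A ^ w) \<longrightarrow>
    (\<Sum>j\<in>J. \<gamma> j * of_int (dd N w (x j) (y j))) = \<kappa> * g"
    using det_pairing[OF N(1), where 'a='a and 'j="('m \<times> 'p \<times> 'q \<Rightarrow> nat) \<times> (nat \<Rightarrow> 'p)"] by (elim exE conjE) (rule that)
  obtain \<kappa>' :: 'a where \<kappa>': "\<kappa>' \<noteq> 0" "\<forall>(J :: ((('m \<times> 'p \<times> 'q \<Rightarrow> nat) \<times> (nat \<Rightarrow> 'p)) \<times> (nat \<Rightarrow> 'q)) set) \<gamma> x y g. finite J \<longrightarrow>
    (\<forall>A :: 'q \<Rightarrow> 'q \<Rightarrow> 'a. (\<Sum>j\<in>J. \<gamma> j * (\<Prod>s<N. A (x j s) (y j s))) = g * fdet A ^ w') \<longrightarrow>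
    (\<Sum>j\<in>J. \<gamma> j * of_int (dd N w' (x j) (y j))) = \<kappa>' * g"
    using det_pairing[OF N(2), where 'a='a and 'j="(('m \<times> 'p \<times> 'q \<Rightarrow> nat) \<times> (nat \<Rightarrow> 'p)) \<times> (nat \<Rightarrow> 'q)"] by (elim exE conjE) (rule that)
  have fin: "finite (keys f \<times> ?Wp)" by simp
  define \<gamma> where "\<gamma> j = of_rat (lookup f (fst (fst j))) * x (fst (fst j)) (snd (fst j)) (snd j) * of_int (dd N w (r (fst (fst j))) (snd (fst j)))"
    for j :: "(('m \<times> 'p \<times> 'q \<Rightarrow> nat) \<times> (nat \<Rightarrow> 'p)) \<times> (nat \<Rightarrow> 'q)"
  have step: "(\<Sum>j\<in>(keys f \<times> ?Wp) \<times> ?Wq. \<gamma> j * (\<Prod>s<N. B (snd j s) (c (fst (fst j)) s))) = (\<kappa> * evq X f) * fdet B ^ w'" for B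
  proof -
    have "(\<Sum>j\<in>(keys f \<times> ?Wp) \<times> ?Wq. \<gamma> j * (\<Prod>s<N. B (snd j s) (c (fst (fst j)) s)))
      = (\<Sum>j\<in>keys f \<times> ?Wp. \<Sum>\<xi>\<in>?Wq. \<gamma> (j, \<xi>) * (\<Prod>s<N. B (\<xi> s) (c (fst j) s)))"
      by (simp add: sum.cartesian_product case_prod_unfold)
    also have "\<dots> = (\<Sum>j\<in>keys f \<times> ?Wp. (of_rat (lookup f (fst j)) * (\<Sum>\<xi>\<in>?Wq. x (fst j) (snd j) \<xi> * (\<Prod>s<N. B (\<xi> s) (c (fst j) s)))) * of_int (dd N w (r (fst j)) (snd j)))"
      unfolding \<gamma>_def sum_distrib_left sum_distrib_right by (intro sum.cong refl) (simp add: mult_ac)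
    also have "\<dots> = \<kappa> * (fdet B ^ w' * evq X f)"
      by (rule \<kappa>(2)[rule_format, OF fin], rule expand)
    finally show ?thesis by (simp add: mult_ac)
  qed
  have "(\<Sum>j\<in>(keys f \<times> ?Wp) \<times> ?Wq. \<gamma> j * of_int (dd N w' (snd j) (c (fst (fst j))))) = \<kappa>' * (\<kappa> * evq X f)"
    by (rule \<kappa>'(2)[rule_format, OF _ step]) simp
  then have "(\<Sum>j\<in>(keys f \<times> ?Wp) \<times> ?Wq. \<gamma> j * of_int (dd N w' (snd j) (c (fst (fst j))))) \<noteq> 0"
    using \<kappa>(1) \<kappa>'(1) nz by simp
  moreover have "(\<Sum>j\<in>(keys f \<times> ?Wp) \<times> ?Wq. \<gamma> j * of_int (dd N w' (snd j) (c (fst (fst j)))))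
    = (\<Sum>e\<in>keys f. \<Sum>\<rho>\<in>?Wp. \<Sum>\<xi>\<in>?Wq. of_rat (lookup f e) * (x e \<rho> \<xi> * of_int (dd N w (r e) \<rho>) * of_int (dd N w' \<xi> (c e))))"
    unfolding \<gamma>_def sum_triple[of "\<lambda>e \<rho> \<xi>. of_rat (lookup f e) * x e \<rho> \<xi> * of_int (dd N w (r e) \<rho>) * of_int (dd N w' \<xi> (c e))"]
    by (simp only: mult.assoc)
  ultimately have "\<exists>e\<in>keys f. of_rat (lookup f e) * (\<Sum>\<rho>\<in>?Wp. \<Sum>\<xi>\<in>?Wq. x e \<rho> \<xi> * of_int (dd N w (r e) \<rho>) * of_int (dd N w' \<xi> (c e))) \<noteq> 0"
    unfolding sum_distrib_left[symmetric] by (intro sum_nonzero) simp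
  then obtain e where e: "(\<Sum>\<rho>\<in>?Wp. \<Sum>\<xi>\<in>?Wq. x e \<rho> \<xi> * of_int (dd N w (r e) \<rho>) * of_int (dd N w' \<xi> (c e))) \<noteq> 0"
    by auto
  let ?U = "PiE {..<N} (\<lambda>_. {..<w}) :: (nat \<Rightarrow> nat) set" and ?V = "PiE {..<N} (\<lambda>_. {..<w'}) :: (nat \<Rightarrow> nat) set"
  define D where "D u v = (\<Sum>\<rho>\<in>?Wp. (\<Sum>\<xi>\<in>?Wq. x e \<rho> \<xi> * of_int (eps N \<xi> v)) * of_int (eps N \<rho> u))" for u v
  have "(\<Sum>\<rho>\<in>?Wp. \<Sum>\<xi>\<in>?Wq. x e \<rho> \<xi> * of_int (dd N w (r e) \<rho>) * of_int (dd N w' \<xi> (c e)))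
    = (\<Sum>u\<in>?U. \<Sum>v\<in>?V. of_int (eps N (r e) u) * of_int (eps N (c e) v) * D u v)"
  proof -
    have "(\<Sum>\<rho>\<in>?Wp. \<Sum>\<xi>\<in>?Wq. x e \<rho> \<xi> * of_int (dd N w (r e) \<rho>) * of_int (dd N w' \<xi> (c e)))
      = (\<Sum>\<rho>\<in>?Wp. \<Sum>\<xi>\<in>?Wq. \<Sum>v\<in>?V. \<Sum>u\<in>?U. x e \<rho> \<xi> * of_int (eps N (r e) u) * of_int (eps N \<rho> u) * of_int (eps N \<xi> v) * of_int (eps N (c e) v))"
      unfolding dd_def of_int_sum of_int_mult sum_distrib_left sum_distrib_right by (simp only: mult_ac)
    also have "\<dots> = (\<Sum>u\<in>?U. \<Sum>v\<in>?V. \<Sum>\<rho>\<in>?Wp. \<Sum>\<xi>\<in>?Wq. x e \<rho> \<xi> * of_int (eps N (r e) u) * of_int (eps N \<rho> u) * of_int (eps N \<xi> v) * of_int (eps N (c e) v))"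
      by (rule sum_swap4)
    also have "\<dots> = (\<Sum>u\<in>?U. \<Sum>v\<in>?V. of_int (eps N (r e) u) * of_int (eps N (c e) v) * D u v)"
      unfolding D_def sum_distrib_left sum_distrib_right by (simp only: mult_ac)
    finally show ?thesis .
  qed
  then have "(\<Sum>u\<in>?U. \<Sum>v\<in>?V. of_int (eps N (r e) u) * of_int (eps N (c e) v) * D u v) \<noteq> 0" using e by simp
  \<comment> \<open>A single assignment of letters to copies on each side suffices; \<open>u\<close>
    and \<open>v\<close> become the block positions.\<close>
  from sum_nonzero[OF this] obtain u where "(\<Sum>v\<in>?V. of_int (eps N (r e) u) * of_int (eps N (c e) v) * D u v) \<noteq> 0" ..
  from sum_nonzero[OF this] obtain v where D: "D u v \<noteq> 0" by auto
  let ?p = "CARD('p)" and ?q = "CARD('q)"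
  define Y where "Y s a b = (if u s = a div ?p then if v s = b div ?q then X (l e s, (en (a mod ?p), en (b mod ?q))) else 0 else 0)" for s a b
  define Y' where "Y' s \<rho> b = (if v s = b div ?q then X (l e s, (\<rho>, en (b mod ?q))) else 0)" for s \<rho> b
  have "D u v = (\<Sum>\<rho>\<in>?Wp. ndet N (\<lambda>s b. Y' s (\<rho> s) b) * of_int (eps N \<rho> u))"
    unfolding D_def x_def Y'_def eps_contract[where Z = "\<lambda>s \<xi>. X (l e s, (\<rho> s, \<xi>))" for \<rho>] ..
  also have "\<dots> = (\<Sum>\<rho>\<in>?Wp. \<Sum>\<sigma>\<in>perms N. of_int (sign \<sigma>) * ((\<Prod>s<N. Y' s (\<rho> s) (\<sigma> s)) * of_int (eps N \<rho> u)))"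
    unfolding ndet_leibniz sum_distrib_right mult.assoc ..
  also have "\<dots> = (\<Sum>\<sigma>\<in>perms N. of_int (sign \<sigma>) * (\<Sum>\<rho>\<in>?Wp. (\<Prod>s<N. Y' s (\<rho> s) (\<sigma> s)) * of_int (eps N \<rho> u)))"
    unfolding sum_distrib_left by (rule sum.swap)
  also have "\<dots> = (\<Sum>\<sigma>\<in>perms N. of_int (sign \<sigma>) * ndet N (\<lambda>s a. Y s a (\<sigma> s)))"
    unfolding Y_def Y'_def eps_contract[where Z = "\<lambda>s \<rho>. if v s = \<sigma> s div ?q then X (l e s, (\<rho>, en (\<sigma> s mod ?q))) else 0" for \<sigma>] ..
  also have "\<dots> = (\<Sum>\<sigma>\<in>perms N. \<Sum>\<pi>\<in>perms N. of_int (sign \<pi>) * of_int (sign \<sigma>) * (\<Prod>s<N. Y s (\<pi> s) (\<sigma> s)))"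
    unfolding ndet_leibniz sum_distrib_left by (intro sum.cong refl) (simp add: mult_ac)
  also have "\<dots> = (\<Sum>\<pi>\<in>perms N. \<Sum>\<sigma>\<in>perms N. of_int (sign \<pi>) * of_int (sign \<sigma>) * (\<Prod>s<N. Y s (\<pi> s) (\<sigma> s)))"
    by (rule sum.swap)
  finally have "(\<Sum>\<pi>\<in>perms N. \<Sum>\<sigma>\<in>perms N. of_int (sign \<pi>) * of_int (sign \<sigma>) * (\<Prod>s<N. Y s (\<pi> s) (\<sigma> s))) \<noteq> 0"
    using D by simp
  from polarized_determinant[OF this] obtain t where t: "ndet N (\<lambda>a b. \<Sum>s<N. t s * Y s a b) \<noteq> 0" by blast
  \<comment> \<open>The scalar \<open>t s\<close> is put at block \<open>(u s, v s)\<close> of the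
    matrix that belongs to the copy \<open>l e s\<close> of the letter.\<close>
  define T where "T k i j = (\<Sum>s<N. if l e s = k \<and> u s = i \<and> v s = j then t s else 0)" for k i j
  have "blow X T a b = (\<Sum>s<N. t s * Y s a b)" for a b
  proof -
    have "blow X T a b = (\<Sum>s<N. \<Sum>k\<in>UNIV. X (k, (en (a mod ?p), en (b mod ?q))) * (if l e s = k \<and> u s = a div ?p \<and> v s = b div ?q then t s else 0))"
      unfolding blow_def T_def sum_distrib_left by (rule sum.swap)
    also have "\<dots> = (\<Sum>s<N. \<Sum>k\<in>UNIV. if k = l e s then t s * Y s a b else 0)"
      unfolding Y_def by (intro sum.cong refl) auto
    finally show ?thesis by simp
  qed
  then have "blow X T = (\<lambda>a b. \<Sum>s<N. t s * Y s a b)" by (intro ext)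
  then show ?thesis using t by (intro exI[of _ T]) simp
qed

definition blow_space :: "('m::finite \<times> ('p::finite \<times> 'q::finite) \<Rightarrow> complex) \<Rightarrow> (nat \<Rightarrow> nat \<Rightarrow> complex) set" where
  "blow_space X = range (blow X)"

lemma blow_line:
  "blow X T a b + z * (blow X T' a b - blow X T a b) = blow X (\<lambda>l j k. T l j k + z * (T' l j k - T l j k)) a b"
  unfolding blow_def by (simp add: sum_distrib_left sum_subtractf[symmetric] sum.distrib[symmetric] algebra_simps)

lemma blk_mod: "p dvd L \<Longrightarrow> blk L g a mod p = a mod p"
  unfolding blk_def by (metis dvd_mult2 mod_mult_self3 mod_mod_cancel mult.commute dvd_def mod_add_left_eq mod_add_right_eq add_0 mod_mult_self2_is_0 mod_mod_trivial)

lemma blk_div_word: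
  assumes "L = p * L'" "0 < p"
  shows "blk L g a div p = blk L' g (a div p)"
proof -
  have "blk L g a div p = (p * (g (a div L) * L') + a mod L) div p"
    by (simp add: blk_def assms(1) mult_ac)
  also have "\<dots> = g (a div L) * L' + (a mod L) div p" using assms(2) by simp
  also have "(a mod L) div p = (a div p) mod L'" using assms by (simp add: mod_mult2_eq)
  also have "a div L = a div p div L'" using assms by (simp add: div_mult2_eq)
  finally show ?thesis by (simp add: blk_def)
qed

text \<open>Both \<open>CARD('p)\<close> and \<open>CARD('q)\<close> divide \<open>L\<close>, so the
  blocks of size \<open>L\<close> are made of whole copies of the matrices in \<open>X\<close>.
  Every operation on these blocks is then an operation on \<open>T\<close>.\<close>

lemma blow_block_space:
  fixes X :: "'m::finite \<times> ('p::finite \<times> 'q::finite) \<Rightarrow> complex"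
  assumes L: "0 < L" and p: "L = CARD('p) * L1" and q: "L = CARD('q) * L2"
  shows "block_space L (blow_space X)"
proof
  show "0 < L" by fact
next
  fix M M' and z :: complex assume "M \<in> blow_space X" "M' \<in> blow_space X"
  then obtain T T' where "M = blow X T" "M' = blow X T'" by (auto simp: blow_space_def)
  then show "(\<lambda>a b. M a b + z * (M' a b - M a b)) \<in> blow_space X"
    by (simp add: blow_line blow_space_def)
next
  fix M and y :: "nat \<Rightarrow> nat \<Rightarrow> complex" assume "M \<in> blow_space X"
  then obtain T where M: "M = blow X T" by (auto simp: blow_space_def)
  have d1: "a div L = a div CARD('p) div L1" for a unfolding p by (rule div_mult2_eq)
  have d2: "a div L = a div CARD('q) div L2" for a unfolding q by (rule div_mult2_eq)
  have "y (a div L) (b div L) = y (a div CARD('p) div L1) (b div CARD('q) div L2)" for a b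
    using d1[of a] d2[of b] by (rule arg_cong2)
  then have "y (a div L) (b div L) * M a b = blow X (\<lambda>l j k. y (j div L1) (k div L2) * T l j k) a b" for a b
    unfolding M blow_def sum_distrib_left by (intro sum.cong refl) (simp add: mult_ac)
  then have "(\<lambda>a b. y (a div L) (b div L) * M a b) = blow X (\<lambda>l j k. y (j div L1) (k div L2) * T l j k)" by (intro ext)
  then show "(\<lambda>a b. y (a div L) (b div L) * M a b) \<in> blow_space X" by (simp add: blow_space_def)
next
  fix M and g h :: "nat \<Rightarrow> nat" assume "M \<in> blow_space X"
  then obtain T where M: "M = blow X T" by (auto simp: blow_space_def)
  have "(\<lambda>a b. M (blk L g a) (blk L h b)) = blow X (\<lambda>l j k. T l (blk L1 g j) (blk L2 h k))"
  proof (intro ext)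
    fix a b
    have "CARD('p) dvd L" unfolding p by simp
    moreover have "CARD('q) dvd L" unfolding q by simp
    ultimately show "M (blk L g a) (blk L h b) = blow X (\<lambda>l j k. T l (blk L1 g j) (blk L2 h k)) a b"
      unfolding M blow_def by (simp add: blk_mod blk_div_word[OF p] blk_div_word[OF q])
  qed
  then show "(\<lambda>a b. M (blk L g a) (blk L h b)) \<in> blow_space X" by (simp add: blow_space_def)
qed

lemma ndet_blow_hom:
  assumes "comm_ring_hom h"
  shows "h (ndet n (blow X T)) = ndet n (blow (\<lambda>v. h (X v)) (\<lambda>l j k. h (T l j k)))"
proof -
  interpret comm_ring_hom h by fact
  show ?thesis unfolding ndet_hom[OF assms] by (rule ndet_cong) (simp add: blow_def hom_sum hom_mult)
qed

text \<open>The entries of \<open>T\<close> are made natural numbers one at a time.\<close>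

lemma blow_nat:
  fixes X :: "'m::finite \<times> ('p::finite \<times> 'q::finite) \<Rightarrow> complex"
  assumes nz: "ndet n (blow X T) \<noteq> 0"
  shows "\<exists>T :: 'm \<Rightarrow> nat \<Rightarrow> nat \<Rightarrow> nat. ndet n (blow X (\<lambda>l j k. of_nat (T l j k))) \<noteq> 0"
proof -
  define B where "B t = blow X (\<lambda>l j k. t (l, j, k))" for t
  have step: "\<exists>t. (\<forall>v\<in>F. t v \<in> \<nat>) \<and> ndet n (B t) \<noteq> 0" if "finite F" for F
    using that
  proof (induction F rule: finite_induct)
    case empty
    show ?case using nz by (intro exI[of _ "\<lambda>(l, j, k). T l j k"]) (simp add: B_def)
  next
    case (insert v F)
    then obtain t where t: "\<forall>v\<in>F. t v \<in> \<nat>" "ndet n (B t) \<noteq> 0" by blast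
    define u where "u z = t(v := z)" for z
    have line: "B (u z) a b = B (u 0) a b + z * (B (u 1) a b - B (u 0) a b)" for z a b
      unfolding B_def blow_line by (rule arg_cong[of _ _ "\<lambda>T. blow X T a b"]) (auto simp: u_def fun_eq_iff)
    have "\<exists>q. \<forall>z. poly q z = (\<Sum>\<pi>\<in>perms n. of_int (sign \<pi>) * (\<Prod>i<n. B (u 0) i (\<pi> i) + z * (B (u 1) i (\<pi> i) - B (u 0) i (\<pi> i))))"
      by (rule line_polynomial)
    then obtain q where q: "\<And>z. poly q z = ndet n (B (u z))"
      unfolding line[symmetric] ndet_leibniz by blast
    have "u (t v) = t" by (simp add: u_def)
    then have "q \<noteq> 0" using q[of "t v"] t(2) by auto
    then have "finite {z. poly q z = 0}" by (rule poly_roots_finite)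
    moreover have "infinite (\<nat> :: complex set)"
      unfolding Nats_def by (rule range_inj_infinite) (simp add: inj_of_nat)
    ultimately obtain z where z: "z \<in> \<nat>" "poly q z \<noteq> 0" using finite_subset[of \<nat> "{z. poly q z = 0}"] by blast
    have "\<forall>v'\<in>insert v F. u z v' \<in> \<nat>" using t(1) z(1) by (simp add: u_def)
    moreover have "ndet n (B (u z)) \<noteq> 0" using z(2) q[of z] by simp
    ultimately show ?case by blast
  qed
  let ?F = "UNIV \<times> {..n} \<times> {..n} :: ('m \<times> nat \<times> nat) set"
  obtain t where t: "\<forall>v\<in>?F. t v \<in> \<nat>" "ndet n (B t) \<noteq> 0" using step[of ?F] by auto
  define T' where "T' l j k = (SOME i. t (l, j, k) = of_nat i)" for l j k
  have T': "of_nat (T' l j k) = t (l, j, k)" if "j \<le> n" "k \<le> n" for l j k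
  proof -
    have "t (l, j, k) \<in> \<nat>" using t(1) that by auto
    then have "\<exists>i. t (l, j, k) = of_nat i" by (auto simp: Nats_def)
    from someI_ex[OF this] show ?thesis unfolding T'_def by simp
  qed
  have "ndet n (blow X (\<lambda>l j k. of_nat (T' l j k))) = ndet n (B t)"
  proof (rule ndet_cong)
    fix a b assume "a < n" "b < n"
    then have "a div CARD('p) \<le> n" "b div CARD('q) \<le> n" by (meson div_le_dividend le_trans less_imp_le)+
    then show "blow X (\<lambda>l j k. of_nat (T' l j k)) a b = B t a b" by (simp add: B_def blow_def T')
  qed
  then show ?thesis using t(2) by (intro exI[of _ T']) simp
qed

lemma block_sum:
  fixes F :: "'p::finite \<Rightarrow> 'a::comm_monoid_add"
  assumes "n = CARD('p) * w" "a < n"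
  shows "(\<Sum>a'<n. if a div CARD('p) = a' div CARD('p) then F (en (a' mod CARD('p))) else 0) = (\<Sum>r\<in>UNIV. F r)"
proof -
  let ?p = "CARD('p)"
  let ?S = "{a'. a' < n \<and> a div ?p = a' div ?p}"
  have "(\<Sum>a'<n. if a div ?p = a' div ?p then F (en (a' mod ?p)) else 0) = (\<Sum>a'\<in>?S. F (en (a' mod ?p)))"
    by (rule sum.mono_neutral_cong_right) auto
  also have "\<dots> = (\<Sum>r\<in>UNIV. F r)"
  proof (rule sum.reindex_bij_witness[where i = "\<lambda>r. ?p * (a div ?p) + de r" and j = "\<lambda>a'. en (a' mod ?p)"])
    fix a' assume "a' \<in> ?S"
    then show "?p * (a div ?p) + de (en (a' mod ?p) :: 'p) = a'" by (simp add: de_en)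
  next
    fix r :: 'p
    have "a div ?p < w" using assms by (simp add: div_less_iff_less_mult mult.commute)
    then have "?p * Suc (a div ?p) \<le> ?p * w" by (intro mult_left_mono) auto
    then show "?p * (a div ?p) + de r \<in> ?S" using de_lt[of r] assms(1) by simp
    show "en ((?p * (a div ?p) + de r) mod ?p) = r" using de_lt[of r] by simp
  qed auto
  finally show ?thesis .
qed

text \<open>Acting on \<open>X\<close> multiplies the blow-up by block diagonal matrices with
  \<open>w\<close> copies of \<open>A\<close> on the left and \<open>w'\<close> copies of
  \<open>B\<close> on the right.\<close>

lemma ndet_blow_act:
  fixes X :: "'m::finite \<times> ('p::finite \<times> 'q::finite) \<Rightarrow> 'a::idom"
  assumes n: "n = CARD('p) * w" "n = CARD('q) * w'"
  shows "ndet n (blow (act A B X) T) = fdet A ^ w * fdet B ^ w' * ndet n (blow X T)"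
proof -
  let ?p = "CARD('p)" and ?q = "CARD('q)"
  let ?A = "\<lambda>a a'. if a div ?p = a' div ?p then A (en (a mod ?p)) (en (a' mod ?p)) else 0"
  let ?B = "\<lambda>b' b. if b' div ?q = b div ?q then B (en (b' mod ?q)) (en (b mod ?q)) else 0"
  have "ndet n (blow (act A B X) T) = ndet n (\<lambda>a b. \<Sum>a'<n. ?A a a' * (\<Sum>b'<n. blow X T a' b' * ?B b' b))"
  proof (rule ndet_cong)
    fix a b assume ab: "a < n" "b < n"
    have inner: "(\<Sum>b'<n. blow X T a' b' * ?B b' b)
      = (\<Sum>c'\<in>UNIV. (\<Sum>l\<in>UNIV. X (l, (en (a' mod ?p), c')) * T l (a' div ?p) (b div ?q)) * B c' (en (b mod ?q)))" for a'
    proof -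
      have "(\<Sum>b'<n. blow X T a' b' * ?B b' b) = (\<Sum>b'<n. if b div ?q = b' div ?q then
        (\<Sum>l\<in>UNIV. X (l, (en (a' mod ?p), en (b' mod ?q))) * T l (a' div ?p) (b div ?q)) * B (en (b' mod ?q)) (en (b mod ?q)) else 0)"
        by (rule sum.cong) (auto simp: blow_def)
      also have "\<dots> = (\<Sum>c'\<in>UNIV. (\<Sum>l\<in>UNIV. X (l, (en (a' mod ?p), c')) * T l (a' div ?p) (b div ?q)) * B c' (en (b mod ?q)))"
        by (rule block_sum[OF n(2) ab(2)])
      finally show ?thesis .
    qed
    have "(\<Sum>a'<n. ?A a a' * (\<Sum>b'<n. blow X T a' b' * ?B b' b)) = (\<Sum>a'<n. if a div ?p = a' div ?p then
      A (en (a mod ?p)) (en (a' mod ?p)) * (\<Sum>c'\<in>UNIV. (\<Sum>l\<in>UNIV. X (l, (en (a' mod ?p), c')) * T l (a div ?p) (b div ?q)) * B c' (en (b mod ?q))) else 0)"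
      unfolding inner by (rule sum.cong) auto
    also have "\<dots> = (\<Sum>r'\<in>UNIV. A (en (a mod ?p)) r' * (\<Sum>c'\<in>UNIV. (\<Sum>l\<in>UNIV. X (l, (r', c')) * T l (a div ?p) (b div ?q)) * B c' (en (b mod ?q))))"
      by (rule block_sum[OF n(1) ab(1)])
    also have "\<dots> = (\<Sum>r'\<in>UNIV. \<Sum>c'\<in>UNIV. \<Sum>l\<in>UNIV. A (en (a mod ?p)) r' * X (l, (r', c')) * B c' (en (b mod ?q)) * T l (a div ?p) (b div ?q))"
      unfolding sum_distrib_left sum_distrib_right by (intro sum.cong refl) (simp add: mult_ac)
    also have "\<dots> = (\<Sum>r'\<in>UNIV. \<Sum>l\<in>UNIV. \<Sum>c'\<in>UNIV. A (en (a mod ?p)) r' * X (l, (r', c')) * B c' (en (b mod ?q)) * T l (a div ?p) (b div ?q))"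
      by (intro sum.cong refl sum.swap)
    also have "\<dots> = (\<Sum>l\<in>UNIV. \<Sum>r'\<in>UNIV. \<Sum>c'\<in>UNIV. A (en (a mod ?p)) r' * X (l, (r', c')) * B c' (en (b mod ?q)) * T l (a div ?p) (b div ?q))"
      by (rule sum.swap)
    also have "\<dots> = blow (act A B X) T a b"
      unfolding blow_def act_def by (simp add: sum_distrib_right)
    finally show "blow (act A B X) T a b = (\<Sum>a'<n. ?A a a' * (\<Sum>b'<n. blow X T a' b' * ?B b' b))" ..
  qed
  also have "\<dots> = ndet n ?A * (ndet n (blow X T) * ndet n ?B)" unfolding ndet_mult ..
  also have "ndet n ?A = fdet A ^ w"
    unfolding n(1) fdet_def using ndet_kron[of ?p w "\<lambda>i j. A (en i) (en j)"] by simp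
  also have "ndet n ?B = fdet B ^ w'"
    unfolding n(2) fdet_def using ndet_kron[of ?q w' "\<lambda>i j. B (en i) (en j)"] by simp
  finally show ?thesis by (simp add: mult_ac)
qed

section \<open>Rational group elements and invariants with rational coefficients\<close>

definition gk :: "('p \<Rightarrow> 'p \<Rightarrow> 'a) \<Rightarrow> ('q \<Rightarrow> 'q \<Rightarrow> 'a) \<Rightarrow> 'p \<times> 'q \<Rightarrow> 'p \<times> 'q \<Rightarrow> 'a::comm_ring_1" where
  "gk A B = (\<lambda>(r, c) (r', c'). A r r' * B c' c)"

text \<open>Only rational points of the group; invariance over larger fields is recovered from
  \<open>semi_invariance\<close>.\<close>

definition SLG :: "('p::finite \<times> 'q::finite \<Rightarrow> 'p \<times> 'q \<Rightarrow> rat) set" where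
  "SLG = {gk A B | A B. fdet A = 1 \<and> fdet B = 1}"

lemma ev_gk: "ev X (lsub (gmp (gk A B)) f) = ev (act A B X) f"
proof -
  have "(\<lambda>(k, c). \<Sum>c'\<in>UNIV. gk A B c c' * X (k, c')) = act A B X"
    by (auto simp: fun_eq_iff act_def gk_def sum_prod_UNIV intro!: sum.cong)
  then show ?thesis unfolding ev_gmp by simp
qed

lemma fdet_transpose: "fdet (\<lambda>i j. A j i) = fdet A"
  unfolding fdet_def by (rule ndet_transpose[of _ "\<lambda>i j. A (en i) (en j)"])

lemma SLG_transp: "L \<in> gmp ` SLG \<Longrightarrow> transp L \<in> gmp ` (SLG :: ('p::finite \<times> 'q::finite \<Rightarrow> _) set)"
proof -
  assume "L \<in> gmp ` (SLG :: ('p \<times> 'q \<Rightarrow> _) set)"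
  then obtain A :: "'p \<Rightarrow> 'p \<Rightarrow> rat" and B :: "'q \<Rightarrow> 'q \<Rightarrow> rat" where *: "L = gmp (gk A B)" "fdet A = 1" "fdet B = 1"
    by (auto simp: SLG_def)
  have "transp L = gmp (gk (\<lambda>i j. A j i) (\<lambda>i j. B j i))"
    unfolding *(1) by (auto simp: transp_def gmp_def gk_def fun_eq_iff)
  moreover have "gk (\<lambda>i j. A j i) (\<lambda>i j. B j i) \<in> SLG"
    unfolding SLG_def
    by (intro CollectI exI conjI, rule refl, rule trans[OF fdet_transpose *(2)], rule trans[OF fdet_transpose *(3)])
  ultimately show ?thesis by simp
qed

lemma fdet_hom: "comm_ring_hom h \<Longrightarrow> h (fdet A) = fdet (\<lambda>i j. h (A i j))"
  unfolding fdet_def by (rule ndet_hom)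

text \<open>Natural entries of \<open>T\<close> keep the coefficients of the determinant
  rational.\<close>

definition theta :: "nat \<Rightarrow> ('m \<Rightarrow> nat \<Rightarrow> nat \<Rightarrow> nat) \<Rightarrow> ('m::finite \<times> ('p::finite \<times> 'q::finite), rat) mp" where
  "theta n T = ndet n (blow Xv (\<lambda>l j k. cst (of_nat (T l j k))))"

lemma evq_theta: "evq X (theta n T) = ndet n (blow X (\<lambda>l j k. of_nat (T l j k)))"
  unfolding theta_def ndet_blow_hom[OF evr.comm_ring_hom_axioms] by (simp add: evr.hom_of_nat)

lemma ev_theta: "ev X (theta n T) = ndet n (blow X (\<lambda>l j k. of_nat (T l j k)))"
  unfolding theta_def ndet_blow_hom[OF evid.comm_ring_hom_axioms] by (simp add: evid.hom_of_nat)

lemma hmg_theta: "hmg n (theta n T :: ('a::finite \<times> ('b::finite \<times> 'c::finite), rat) mp)"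
proof -
  have m: "hmg 1 (Xv v * cst c)" for v :: "'a \<times> ('b \<times> 'c)" and c :: rat
    using hmg_mult[OF hmg_Xv hmg_cst, of v c] unfolding add_0_right .
  have 1: "hmg 1 (blow Xv (\<lambda>l j k. cst (of_nat (T l j k))) a b :: ('a \<times> ('b \<times> 'c), rat) mp)" for a b
    unfolding blow_def by (intro hmg_sum m)
  have "hmg n (\<Prod>i<n. blow Xv (\<lambda>l j k. cst (of_nat (T l j k))) i (\<pi> i) :: ('a \<times> ('b \<times> 'c), rat) mp)" for \<pi>
    using hmg_prod[of "{..<n}" "\<lambda>_. 1", OF 1]
    by (simp only: sum_constant card_lessThan mult_1_right of_nat_id)
  then have "hmg n (cst (of_int (sign \<pi>)) * (\<Prod>i<n. blow Xv (\<lambda>l j k. cst (of_nat (T l j k))) i (\<pi> i)) :: ('a \<times> ('b \<times> 'c), rat) mp)" for \<pi>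
    by (rule hmg_cst_mult)
  then have "hmg n (of_int (sign \<pi>) * (\<Prod>i<n. blow Xv (\<lambda>l j k. cst (of_nat (T l j k))) i (\<pi> i)) :: ('a \<times> ('b \<times> 'c), rat) mp)" for \<pi>
    by simp
  then show ?thesis unfolding theta_def ndet_leibniz by (rule hmg_sum)
qed

lemma theta_Inv:
  assumes n: "n = CARD('p) * w" "n = CARD('q) * w'"
  shows "(theta n T :: ('m::finite \<times> ('p::finite \<times> 'q::finite), rat) mp) \<in> Inv (gmp ` SLG)"
proof -
  have "lsub (gmp (gk A B)) (theta n T) = (theta n T :: ('m \<times> ('p \<times> 'q), rat) mp)"
    if "fdet A = 1" "fdet B = 1" for A B
    by (rule mp_eqI) (simp add: ev_gk ev_theta ndet_blow_act[OF n] that)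
  then show ?thesis by (auto simp: Inv_def SLG_def)
qed

section \<open>Semi-invariance\<close>

lemma fdet_one: "fdet (\<lambda>i j. if i = j then 1 else 0) = 1"
proof -
  have "ndet CARD('p::finite) (\<lambda>i j. if (en i :: 'p) = en j then 1 else 0) = ndet CARD('p) (\<lambda>i j. if i = j then 1 else 0)"
    by (rule ndet_cong) (metis de_en)
  then show ?thesis unfolding fdet_def ndet_one .
qed

lemma fdet_scale_rows:
  fixes A :: "'p::finite \<Rightarrow> 'p \<Rightarrow> 'a::comm_ring_1"
  shows "fdet (\<lambda>i j. s i * A i j) = (\<Prod>i\<in>UNIV. s i) * fdet A"
proof -
  have "(\<Prod>i<CARD('p). s (en i)) = (\<Prod>i\<in>UNIV. s i)"
    by (rule prod.reindex_bij_betw[OF bij_en])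
  then show ?thesis unfolding fdet_def by (simp add: ndet_scale_rows)
qed

lemma fdet_scale_columns: "fdet (\<lambda>i j. s j * A i j) = (\<Prod>i\<in>UNIV. s i) * fdet A"
proof -
  have "fdet (\<lambda>i j. s j * A i j) = fdet (\<lambda>i j. s i * A j i)"
    using fdet_transpose[of "\<lambda>i j. s i * A j i"] .
  also have "\<dots> = (\<Prod>i\<in>UNIV. s i) * fdet (\<lambda>i j. A j i)" by (rule fdet_scale_rows)
  finally show ?thesis unfolding fdet_transpose[of A] .
qed

lemma evq_lsub: "evq X (lsub L p) = evq (\<lambda>v. \<Sum>w\<in>UNIV. of_rat (L v w) * X w) p"
  unfolding lsub_def by (subst hom_evh[OF evr.comm_ring_hom_axioms]) (simp add: evr.hom_sum evr.hom_mult)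

lemma evq_gk:
  fixes X :: "'m::finite \<times> ('p::finite \<times> 'q::finite) \<Rightarrow> 'a::field_char_0"
  shows "evq X (lsub (gmp (gk A B)) f) = evq (act (\<lambda>i j. of_rat (A i j)) (\<lambda>i j. of_rat (B i j)) X) f"
proof -
  have "(\<lambda>v. \<Sum>w\<in>UNIV. of_rat (gmp (gk A B) v w) * X w) = act (\<lambda>i j. of_rat (A i j)) (\<lambda>i j. of_rat (B i j)) X"
  proof
    fix v :: "'m \<times> ('p \<times> 'q)"
    obtain l r c where v: "v = (l, (r, c))" by (cases v) auto
    have "(\<Sum>w\<in>UNIV. of_rat (gmp (gk A B) v w) * X w)
      = (\<Sum>k\<in>UNIV. if k = l then \<Sum>r'\<in>UNIV. \<Sum>c'\<in>UNIV. of_rat (A r r') * X (l, (r', c')) * of_rat (B c' c) else 0)"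
      unfolding v sum_prod_UNIV gmp_def gk_def by (intro sum.cong refl) (auto simp: of_rat_mult mult_ac)
    then show "(\<Sum>w\<in>UNIV. of_rat (gmp (gk A B) v w) * X w) = act (\<lambda>i j. of_rat (A i j)) (\<lambda>i j. of_rat (B i j)) X v"
      by (simp add: v act_def)
  qed
  then show ?thesis unfolding evq_lsub by simp
qed

lemma Inv_act:
  assumes "f \<in> Inv (gmp ` SLG)" "fdet A = 1" "fdet B = 1"
  shows "evq (act (\<lambda>i j. of_rat (A i j)) (\<lambda>i j. of_rat (B i j)) X) f = evq X f"
proof -
  have "gk A B \<in> SLG" unfolding SLG_def using assms(2,3) by blast
  then have "lsub (gmp (gk A B)) f = f" using assms(1) unfolding Inv_def by blast
  then show ?thesis unfolding evq_gk[symmetric] by simp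
qed

section \<open>Row and column degrees of the monomials of an invariant\<close>

definition rdeg :: "'p \<Rightarrow> ('m::finite \<times> ('p::finite \<times> 'q::finite) \<Rightarrow> nat) \<Rightarrow> nat" where
  "rdeg r e = (\<Sum>l\<in>UNIV. \<Sum>c\<in>UNIV. e (l, (r, c)))"

definition cdeg :: "'q \<Rightarrow> ('m::finite \<times> ('p::finite \<times> 'q::finite) \<Rightarrow> nat) \<Rightarrow> nat" where
  "cdeg c e = (\<Sum>l\<in>UNIV. \<Sum>r\<in>UNIV. e (l, (r, c)))"

lemma sum_rdeg: "(\<Sum>r\<in>UNIV. rdeg r e) = esz e"
  unfolding rdeg_def esz_def sum_prod_UNIV by (rule sum.swap)

lemma sum_cdeg: "(\<Sum>c\<in>UNIV. cdeg c e) = esz e"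
proof -
  have "(\<Sum>c\<in>UNIV. cdeg c e) = (\<Sum>l\<in>UNIV. \<Sum>c\<in>UNIV. \<Sum>r\<in>UNIV. e (l, (r, c)))"
    unfolding cdeg_def by (rule sum.swap)
  also have "\<dots> = esz e" unfolding esz_def sum_prod_UNIV by (intro sum.cong refl sum.swap)
  finally show ?thesis .
qed

lemma prod_prod_UNIV: "(\<Prod>w\<in>UNIV. f (w :: 'a::finite \<times> 'b::finite)) = (\<Prod>a\<in>UNIV. \<Prod>b\<in>UNIV. f (a, b))"
  by (simp add: prod.cartesian_product flip: UNIV_Times_UNIV)

lemma mon_torus: "mon (\<lambda>(l, (r, c)). a r * b c) e = (\<Prod>r\<in>UNIV. a r ^ rdeg r e) * (\<Prod>c\<in>UNIV. b c ^ cdeg c e)"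
proof -
  have "mon (\<lambda>(l, (r, c)). a r * b c) e = (\<Prod>l\<in>UNIV. \<Prod>r\<in>UNIV. \<Prod>c\<in>UNIV. a r ^ e (l, (r, c))) * (\<Prod>l\<in>UNIV. \<Prod>r\<in>UNIV. \<Prod>c\<in>UNIV. b c ^ e (l, (r, c)))"
    unfolding mon_def prod_prod_UNIV by (simp add: power_mult_distrib prod.distrib)
  also have "(\<Prod>l\<in>UNIV. \<Prod>r\<in>UNIV. \<Prod>c\<in>UNIV. a r ^ e (l, (r, c))) = (\<Prod>r\<in>UNIV. \<Prod>l\<in>UNIV. \<Prod>c\<in>UNIV. a r ^ e (l, (r, c)))"
    by (rule prod.swap)
  also have "\<dots> = (\<Prod>r\<in>UNIV. a r ^ rdeg r e)" unfolding rdeg_def power_sum ..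
  also have "(\<Prod>l\<in>UNIV. \<Prod>r\<in>UNIV. \<Prod>c\<in>UNIV. b c ^ e (l, (r, c))) = (\<Prod>l\<in>UNIV. \<Prod>c\<in>UNIV. \<Prod>r\<in>UNIV. b c ^ e (l, (r, c)))"
    by (intro prod.cong refl prod.swap)
  also have "\<dots> = (\<Prod>c\<in>UNIV. \<Prod>l\<in>UNIV. \<Prod>r\<in>UNIV. b c ^ e (l, (r, c)))" by (rule prod.swap)
  also have "\<dots> = (\<Prod>c\<in>UNIV. b c ^ cdeg c e)" unfolding cdeg_def power_sum ..
  finally show ?thesis .
qed

lemma evh_scale: "evh h (\<lambda>v. t v * X v) f = (\<Sum>e\<in>keys f. h (lookup f e) * (mon t e * mon X e))"
  unfolding evh_def mon_def by (simp add: power_mult_distrib prod.distrib)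

lemma act_diag:
  fixes X :: "'m::finite \<times> ('p::finite \<times> 'q::finite) \<Rightarrow> 'a::comm_ring_1"
  shows "act (\<lambda>i j. if i = j then a i else 0) (\<lambda>i j. if i = j then b i else 0) X = (\<lambda>v. (case v of (l, (r, c)) \<Rightarrow> a r * b c) * X v)"
proof (rule ext)
  fix v :: "'m \<times> ('p \<times> 'q)"
  obtain l r c where v: "v = (l, (r, c))" by (cases v) auto
  have "act (\<lambda>i j. if i = j then a i else 0) (\<lambda>i j. if i = j then b i else 0) X v
    = (\<Sum>r'\<in>UNIV. if r' = r then \<Sum>c'\<in>UNIV. if c' = c then a r * X (l, (r, c)) * b c else 0 else 0)"
    unfolding v act_def prod.case
    by (rule sum.cong[OF refl]) (simp add: if_distrib[of "\<lambda>x. _ * x"] cong: if_cong)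
  then show "act (\<lambda>i j. if i = j then a i else 0) (\<lambda>i j. if i = j then b i else 0) X v = (case v of (l, (r, c)) \<Rightarrow> a r * b c) * X v"
    by (simp add: v mult_ac)
qed

lemma fdet_diag: "fdet (\<lambda>i j. if i = j then a i else 0) = (\<Prod>i\<in>UNIV. a i)"
  using fdet_scale_rows[of a "\<lambda>i j. if i = j then 1 else 0"] by (simp add: fdet_one if_distrib cong: if_cong)

text \<open>Diagonal matrices rescale each monomial separately, so invariance under them holds
  monomial by monomial.\<close>

lemma Inv_torus:
  fixes f :: "('m::finite \<times> ('p::finite \<times> 'q::finite), rat) mp"
    and a :: "'p \<Rightarrow> rat" and b :: "'q \<Rightarrow> rat"
  assumes f: "f \<in> Inv (gmp ` SLG)" and a: "(\<Prod>i\<in>UNIV. a i) = 1" and b: "(\<Prod>i\<in>UNIV. b i) = 1" and e: "e \<in> keys f"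
  shows "(\<Prod>r\<in>UNIV. a r ^ rdeg r e) * (\<Prod>c\<in>UNIV. b c ^ cdeg c e) = 1"
proof -
  let ?t = "\<lambda>(l :: 'm, (r, c)). a r * b c"
  let ?g = "gk (\<lambda>i j. if i = j then a i else 0) (\<lambda>i j. if i = j then b i else 0)"
  have "?g \<in> SLG" unfolding SLG_def using a b fdet_diag[of a] fdet_diag[of b] by auto
  then have fix_f: "lsub (gmp ?g) f = f" using f unfolding Inv_def by blast
  have "f = (\<Sum>e\<in>keys f. single e (lookup f e * mon ?t e))"
  proof (rule mp_eqI)
    fix x :: "'m \<times> ('p \<times> 'q) \<Rightarrow> nat"
    let ?X = "\<lambda>v. of_nat (x v) :: rat"
    have "ev ?X f = ev ?X (lsub (gmp ?g) f)" by (simp only: fix_f)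
    also have "\<dots> = (\<Sum>e\<in>keys f. lookup f e * (mon ?t e * mon ?X e))"
      unfolding ev_gk act_diag evh_scale ..
    also have "\<dots> = ev ?X (\<Sum>e\<in>keys f. single e (lookup f e * mon ?t e))"
      by (simp add: evid.hom_sum evh_single mult.assoc)
    finally show "ev ?X f = ev ?X (\<Sum>e\<in>keys f. single e (lookup f e * mon ?t e))" .
  qed
  then have "lookup f e = lookup (\<Sum>e\<in>keys f. single e (lookup f e * mon ?t e)) e" by (rule arg_cong)
  also have "\<dots> = lookup f e * mon ?t e" using e by (simp add: lookup_sum lookup_single when_def)
  finally have "mon ?t e = 1" using e by (simp add: in_keys_iff)
  then show ?thesis unfolding mon_torus .
qed

lemma prod_two: "finite A \<Longrightarrow> x \<in> A \<Longrightarrow> y \<in> A \<Longrightarrow> x \<noteq> y \<Longrightarrow>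
  (\<Prod>i\<in>A. if i = x then u else if i = y then v else 1) = u * (v :: 'a::comm_monoid_mult)"
proof -
  assume A: "finite A" "x \<in> A" "y \<in> A" "x \<noteq> y"
  then have "(\<Prod>i\<in>A. if i = x then u else if i = y then v else 1) = u * (\<Prod>i\<in>A - {x}. if i = x then u else if i = y then v else 1)"
    by (subst prod.remove[of A x]) auto
  also have "(\<Prod>i\<in>A - {x}. if i = x then u else if i = y then v else 1) = (\<Prod>i\<in>A - {x}. if i = y then v else 1)"
    by (rule prod.cong) auto
  also have "\<dots> = v" using A by simp
  finally show ?thesis .
qed

text \<open>Tested on the diagonal matrix with 2 and 1/2 at \<open>x\<close> and \<open>y\<close>:
  the two powers of 2 must cancel.\<close>

lemma Inv_rdeg:
  fixes f :: "('m::finite \<times> ('p::finite \<times> 'q::finite), rat) mp"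
  assumes f: "f \<in> Inv (gmp ` SLG)" and e: "e \<in> keys f"
  shows "rdeg x e = rdeg y e"
proof (cases "x = y")
  case False
  let ?a = "\<lambda>i. if i = x then 2 else if i = y then 1 / 2 else (1 :: rat)"
  have "(\<Prod>r\<in>UNIV. ?a r ^ rdeg r e) * (\<Prod>c\<in>UNIV. 1 ^ cdeg c e) = 1"
    by (rule Inv_torus[OF f _ _ e]) (use False prod_two[of UNIV x y 2 "1 / 2 :: rat"] in auto)
  moreover have "(\<Prod>r\<in>UNIV. ?a r ^ rdeg r e) = (\<Prod>r\<in>UNIV. if r = x then 2 ^ rdeg x e else if r = y then (1 / 2) ^ rdeg y e else 1)"
    by (rule prod.cong) auto
  moreover have "\<dots> = 2 ^ rdeg x e * (1 / 2) ^ rdeg y e" using False by (intro prod_two) auto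
  ultimately have "(2 :: rat) ^ rdeg x e * (1 / 2) ^ rdeg y e = 1" by simp
  then have "(2 :: rat) ^ rdeg x e = 2 ^ rdeg y e" by (simp add: power_divide)
  then show ?thesis by simp
qed simp

lemma Inv_cdeg:
  fixes f :: "('m::finite \<times> ('p::finite \<times> 'q::finite), rat) mp"
  assumes f: "f \<in> Inv (gmp ` SLG)" and e: "e \<in> keys f"
  shows "cdeg x e = cdeg y e"
proof (cases "x = y")
  case False
  let ?a = "\<lambda>i. if i = x then 2 else if i = y then 1 / 2 else (1 :: rat)"
  have "(\<Prod>r\<in>UNIV. 1 ^ rdeg r e) * (\<Prod>c\<in>UNIV. ?a c ^ cdeg c e) = 1"
    by (rule Inv_torus[OF f _ _ e]) (use False prod_two[of UNIV x y 2 "1 / 2 :: rat"] in auto)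
  moreover have "(\<Prod>r\<in>UNIV. ?a r ^ cdeg r e) = (\<Prod>r\<in>UNIV. if r = x then 2 ^ cdeg x e else if r = y then (1 / 2) ^ cdeg y e else 1)"
    by (rule prod.cong) auto
  moreover have "\<dots> = 2 ^ cdeg x e * (1 / 2) ^ cdeg y e" using False by (intro prod_two) auto
  ultimately have "(2 :: rat) ^ cdeg x e * (1 / 2) ^ cdeg y e = 1" by simp
  then have "(2 :: rat) ^ cdeg x e = 2 ^ cdeg y e" by (simp add: power_divide)
  then show ?thesis by simp
qed simp

text \<open>A diagonal factor carrying the determinant in one place is split off from
  \<open>A\<close> and from \<open>B\<close>. The remaining factors have determinant 1, and the
  diagonal ones scale all monomials alike because the row and column degrees are constant.\<close>

lemma rat_semi_invariance:
  fixes f :: "('m::finite \<times> ('p::finite \<times> 'q::finite), rat) mp" and X :: "'m \<times> ('p \<times> 'q) \<Rightarrow> 'a::field_char_0"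
  assumes f: "f \<in> Inv (gmp ` SLG)"
    and deg: "\<And>e r. e \<in> keys f \<Longrightarrow> rdeg r e = w" "\<And>e c. e \<in> keys f \<Longrightarrow> cdeg c e = w'"
    and A: "fdet A \<noteq> 0" and B: "fdet B \<noteq> 0"
  shows "evq (act (\<lambda>i j. of_rat (A i j)) (\<lambda>i j. of_rat (B i j)) X) f = of_rat (fdet A) ^ w * of_rat (fdet B) ^ w' * evq X f"
proof -
  define a where "a r = (if r = en 0 then fdet A else 1)" for r :: 'p
  define b where "b c = (if c = en 0 then fdet B else 1)" for c :: 'q
  define A' where "A' i j = inverse (a i) * A i j" for i j
  define B' where "B' i j = inverse (b j) * B i j" for i j
  have pa: "(\<Prod>r\<in>UNIV. a r ^ k) = fdet A ^ k" for k by (simp add: a_def if_distrib[of "\<lambda>x. x ^ k"] cong: if_cong)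
  have pb: "(\<Prod>c\<in>UNIV. b c ^ k) = fdet B ^ k" for k by (simp add: b_def if_distrib[of "\<lambda>x. x ^ k"] cong: if_cong)
  have a0: "a r \<noteq> 0" for r using A by (simp add: a_def)
  have b0: "b c \<noteq> 0" for c using B by (simp add: b_def)
  have "fdet A' = (\<Prod>i\<in>UNIV. inverse (a i)) * fdet A" unfolding A'_def by (rule fdet_scale_rows)
  then have A': "fdet A' = 1" using pa[of 1] A prod_inversef[of a UNIV] by (simp add: o_def)
  have "fdet B' = (\<Prod>i\<in>UNIV. inverse (b i)) * fdet B" unfolding B'_def by (rule fdet_scale_columns)
  then have B': "fdet B' = 1" using pb[of 1] B prod_inversef[of b UNIV] by (simp add: o_def)
  let ?Y = "act (\<lambda>i j. of_rat (A' i j)) (\<lambda>i j. of_rat (B' i j)) X"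
  let ?t = "\<lambda>(l :: 'm, (r, c)). of_rat (a r) * of_rat (b c) :: 'a"
  have "act (\<lambda>i j. of_rat (A i j)) (\<lambda>i j. of_rat (B i j)) X = (\<lambda>v. ?t v * ?Y v)"
  proof
    fix v :: "'m \<times> ('p \<times> 'q)"
    obtain l r c where v: "v = (l, (r, c))" by (cases v) auto
    have "A r i = a r * A' r i" "B j c = b c * B' j c" for i j
      using a0[of r] b0[of c] by (simp_all add: A'_def B'_def)
    then show "act (\<lambda>i j. of_rat (A i j)) (\<lambda>i j. of_rat (B i j)) X v = ?t v * ?Y v"
      unfolding v act_def prod.case sum_distrib_left by (simp add: of_rat_mult mult_ac)
  qed
  then have "evq (act (\<lambda>i j. of_rat (A i j)) (\<lambda>i j. of_rat (B i j)) X) f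
    = (\<Sum>e\<in>keys f. of_rat (lookup f e) * (mon ?t e * mon ?Y e))"
    by (simp only: evh_scale)
  also have "\<dots> = (\<Sum>e\<in>keys f. of_rat (lookup f e) * (of_rat (fdet A) ^ w * of_rat (fdet B) ^ w' * mon ?Y e))"
  proof (rule sum.cong[OF refl])
    fix e assume e: "e \<in> keys f"
    have "mon ?t e = of_rat ((\<Prod>r\<in>UNIV. a r ^ w) * (\<Prod>c\<in>UNIV. b c ^ w'))"
      unfolding mon_torus[of "\<lambda>r. of_rat (a r)" "\<lambda>c. of_rat (b c)"] using deg e
      by (simp add: of_rat_mult of_rat_prod of_rat_power)
    then have "mon ?t e = of_rat (fdet A) ^ w * of_rat (fdet B) ^ w'" unfolding pa pb by (simp add: of_rat_mult of_rat_power)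
    then show "of_rat (lookup f e) * (mon ?t e * mon ?Y e) = of_rat (lookup f e) * (of_rat (fdet A) ^ w * of_rat (fdet B) ^ w' * mon ?Y e)"
      by (simp only:)
  qed
  also have "\<dots> = of_rat (fdet A) ^ w * of_rat (fdet B) ^ w' * evq ?Y f"
    unfolding evh_def sum_distrib_left by (intro sum.cong refl) (simp add: mult_ac)
  also have "evq ?Y f = evq X f" by (rule Inv_act[OF f A' B'])
  finally show ?thesis .
qed

text \<open>
  The invariance under rational matrices of determinant one is a polynomial identity after
  clearing denominators, so it persists over every field of characteristic zero.
\<close>

lemma semi_invariance:
  fixes f :: "('m::finite \<times> ('p::finite \<times> 'q::finite), rat) mp"
  assumes f: "f \<in> Inv (gmp ` SLG)" and N: "hmg N f"
  shows "\<exists>w w'. (f \<noteq> 0 \<longrightarrow> N = CARD('p) * w \<and> N = CARD('q) * w') \<and>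
    (\<forall>A B (X :: 'm \<times> ('p \<times> 'q) \<Rightarrow> 'a::field_char_0). evq (act A B X) f = fdet A ^ w * fdet B ^ w' * evq X f)"
proof (cases "f = 0")
  case True
  then show ?thesis by simp
next
  case False
  then obtain e0 where e0: "e0 \<in> keys f" by (metis keys_eq_empty ex_in_conv)
  define w where "w = rdeg (en 0) e0"
  define w' where "w' = cdeg (en 0) e0"
  have cr: "CARD('p) * rdeg r e = N" if "e \<in> keys f" for e r
  proof -
    have "esz e = (\<Sum>r'\<in>(UNIV :: 'p set). rdeg r e)"
      unfolding sum_rdeg[symmetric] by (intro sum.cong refl Inv_rdeg[OF f that])
    then show ?thesis using N that by (auto simp: hmg_def)
  qed
  have cc: "CARD('q) * cdeg c e = N" if "e \<in> keys f" for e c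
  proof -
    have "esz e = (\<Sum>c'\<in>(UNIV :: 'q set). cdeg c e)"
      unfolding sum_cdeg[symmetric] by (intro sum.cong refl Inv_cdeg[OF f that])
    then show ?thesis using N that by (auto simp: hmg_def)
  qed
  have deg: "rdeg r e = w" "cdeg c e = w'" if "e \<in> keys f" for e r c
  proof -
    have "CARD('p) * rdeg r e = CARD('p) * w" "CARD('q) * cdeg c e = CARD('q) * w'"
      unfolding w_def w'_def cr[OF that] cr[OF e0] cc[OF that] cc[OF e0] by (rule refl)+
    then show "rdeg r e = w" "cdeg c e = w'" by simp_all
  qed
  have "evq (act A B X) f = fdet A ^ w * fdet B ^ w' * evq X f"
    for A B and X :: "'m \<times> ('p \<times> 'q) \<Rightarrow> 'a"
  proof -
    let ?c = "\<lambda>c. cst c :: (('p \<times> 'p) + ('q \<times> 'q), 'a) mp"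
    define GA where "GA = (\<lambda>i j. Xv (Inl (i, j)) :: (('p \<times> 'p) + ('q \<times> 'q), 'a) mp)"
    define GB where "GB = (\<lambda>i j. Xv (Inr (i, j)) :: (('p \<times> 'p) + ('q \<times> 'q), 'a) mp)"
    define P where "P = evh (\<lambda>c. ?c (of_rat c)) (act GA GB (\<lambda>v. ?c (X v))) f"
    define Q where "Q = fdet GA ^ w * fdet GB ^ w' * ?c (evq X f)"
    have GA: "ev Z (fdet GA) = fdet (\<lambda>i j. Z (Inl (i, j)))" for Z
      unfolding GA_def fdet_hom[OF evid.comm_ring_hom_axioms] by simp
    have GB: "ev Z (fdet GB) = fdet (\<lambda>i j. Z (Inr (i, j)))" for Z
      unfolding GB_def fdet_hom[OF evid.comm_ring_hom_axioms] by simp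
    have P: "ev Z P = evq (act (\<lambda>i j. Z (Inl (i, j))) (\<lambda>i j. Z (Inr (i, j))) X) f" for Z
    proof -
      have "ev Z (act GA GB (\<lambda>v. ?c (X v)) v) = act (\<lambda>i j. Z (Inl (i, j))) (\<lambda>i j. Z (Inr (i, j))) X v" for v
        by (cases v) (simp add: act_def GA_def GB_def evid.hom_sum evid.hom_mult)
      then show ?thesis unfolding P_def by (subst hom_evh[OF evid.comm_ring_hom_axioms]) simp
    qed
    have Q: "ev Z Q = fdet (\<lambda>i j. Z (Inl (i, j))) ^ w * fdet (\<lambda>i j. Z (Inr (i, j))) ^ w' * evq X f" for Z
      unfolding Q_def by (simp add: evid.hom_mult evid.hom_power GA GB)
    \<comment> \<open>At natural points with a vanishing determinant nothing is known about
      \<open>P\<close> and \<open>Q\<close>; the factor in front covers these points, and it can be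
      cancelled because the generic determinants are nonzero.\<close>
    have "fdet GA * fdet GB * (P - Q) = 0"
    proof (rule mp_eqI)
      fix x :: "('p \<times> 'p) + ('q \<times> 'q) \<Rightarrow> nat"
      let ?Z = "\<lambda>v. of_nat (x v) :: 'a"
      let ?A = "\<lambda>i j. of_nat (x (Inl (i, j))) :: rat" and ?B = "\<lambda>i j. of_nat (x (Inr (i, j))) :: rat"
      have A: "fdet (\<lambda>i j. ?Z (Inl (i, j))) = of_rat (fdet ?A)" unfolding fdet_hom[OF of_rat_hom'] by simp
      have B: "fdet (\<lambda>i j. ?Z (Inr (i, j))) = of_rat (fdet ?B)" unfolding fdet_hom[OF of_rat_hom'] by simp
      have "ev ?Z P = ev ?Z Q" if "fdet ?A \<noteq> 0" "fdet ?B \<noteq> 0"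
        unfolding P Q A B using rat_semi_invariance[OF f deg that, of X] by simp
      then have "ev ?Z (fdet GA) = 0 \<or> ev ?Z (fdet GB) = 0 \<or> ev ?Z P = ev ?Z Q"
        unfolding GA GB A B of_rat_eq_0_iff by blast
      then have "ev ?Z (fdet GA) * ev ?Z (fdet GB) * (ev ?Z P - ev ?Z Q) = 0" by (elim disjE) simp_all
      then show "ev ?Z (fdet GA * fdet GB * (P - Q)) = ev ?Z 0"
        by (simp only: evid.hom_mult evid.hom_minus evid.hom_zero)
    qed
    moreover have "fdet GA \<noteq> 0"
      using GA[of "case_sum (\<lambda>(i, j). if i = j then 1 else 0) (\<lambda>_. 0)"] by (auto simp: fdet_one)
    moreover have "fdet GB \<noteq> 0"
      using GB[of "case_sum (\<lambda>_. 0) (\<lambda>(i, j). if i = j then 1 else 0)"] by (auto simp: fdet_one)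
    ultimately have "P - Q = 0" by (metis mp_mult_nonzero)
    then show ?thesis
      using P[of "case_sum (\<lambda>(i, j). A i j) (\<lambda>(i, j). B i j)"] Q[of "case_sum (\<lambda>(i, j). A i j) (\<lambda>(i, j). B i j)"] by simp
  qed
  then show ?thesis using cr[OF e0, of "en 0"] cc[OF e0, of "en 0"] unfolding w_def w'_def by metis
qed

section \<open>The degree bound\<close>

lemma null_cone:
  fixes f :: "('m::finite \<times> ('p::finite \<times> 'q::finite), rat) mp" and X :: "'m \<times> ('p \<times> 'q) \<Rightarrow> complex"
  assumes f: "f \<in> Inv (gmp ` SLG)" "hmg j f" "0 < j" and X: "evq X f \<noteq> 0"
  shows "\<exists>\<theta>\<in>Inv (gmp ` SLG). hmg ((lcm CARD('p) CARD('q))\<^sup>2) (\<theta> :: ('m \<times> ('p \<times> 'q), rat) mp) \<and> evq X \<theta> \<noteq> 0"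
proof -
  define L where "L = lcm CARD('p) CARD('q)"
  have L: "0 < L" unfolding L_def by (simp add: lcm_pos_nat)
  obtain L1 where L1: "L = CARD('p) * L1" unfolding L_def by (metis dvd_lcm1 dvdE)
  obtain L2 where L2: "L = CARD('q) * L2" unfolding L_def by (metis dvd_lcm2 dvdE)
  \<comment> \<open>The power makes the degree \<open>L * (L * j)\<close>, a blow-up with
    \<open>L * j\<close> blocks. There are at least \<open>L\<close> of them, as the descent
    requires.\<close>
  define g where "g = f ^ (L * L)"
  have g: "g \<in> Inv (gmp ` SLG)" "hmg (L * L * j) g" unfolding g_def by (rule Inv_power[OF f(1)], rule hmg_power[OF f(2)])
  have gX: "evq X g \<noteq> 0" using X by (simp add: g_def evr.hom_power)
  then have g0: "g \<noteq> 0" by auto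
  obtain w w' where w: "g \<noteq> 0 \<longrightarrow> L * L * j = CARD('p) * w \<and> L * L * j = CARD('q) * w'"
    "\<forall>A B (X :: 'm \<times> ('p \<times> 'q) \<Rightarrow> complex). evq (act A B X) g = fdet A ^ w * fdet B ^ w' * evq X g"
    using semi_invariance[OF g] by (elim exE conjE)
  have "\<exists>T. ndet (L * L * j) (blow X T) \<noteq> 0"
    by (rule semi_invariant_blow[OF g(2) _ _ _ gX]) (use w g0 in auto)
  then obtain T where T: "ndet (L * (L * j)) (blow X T) \<noteq> 0" unfolding mult.assoc by blast
  interpret block_space L "blow_space X" by (rule blow_block_space[OF L L1 L2])
  have "\<exists>M\<in>blow_space X. ndet (L * L) M \<noteq> 0"
    by (rule square_blocks[OF _ T]) (use f(3) in \<open>simp_all add: blow_space_def\<close>)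
  then obtain T' where "ndet (L * L) (blow X T') \<noteq> 0" unfolding blow_space_def by blast
  from blow_nat[OF this] obtain T'' where T'': "ndet (L * L) (blow X (\<lambda>l j k. of_nat (T'' l j k))) \<noteq> 0" by blast
  have "(theta (L * L) T'' :: ('m \<times> ('p \<times> 'q), rat) mp) \<in> Inv (gmp ` SLG)"
    by (rule theta_Inv[of _ "L1 * L" "L2 * L"]) (simp add: L1 mult.assoc[symmetric], simp add: L2 mult.assoc[symmetric])
  then show ?thesis
    using T'' hmg_theta[of "L * L" T''] unfolding L_def[symmetric] power2_eq_square
    by (intro bexI[of _ "theta (L * L) T''"]) (simp_all add: evq_theta)
qed

lemma galg_lsub_amp:
  assumes "g \<in> galg (gmp ` G) D"
  shows "lsub (amp b) (g :: ('n::finite \<times> 'c::finite, rat) mp) \<in> galg (gmp ` G :: ('m::finite \<times> 'c \<Rightarrow> _) set) D"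
  using assms
proof induction
  case (galg_cst c)
  show ?case by (simp add: galg.galg_cst)
next
  case (galg_base f k)
  show ?case by (rule galg.galg_base[OF Inv_amp[OF galg_base(1)] hmg_lsub[OF galg_base(2)] galg_base(3)])
next
  case (galg_add f g)
  then show ?case by (simp add: ls.hom_add galg.galg_add)
next
  case (galg_mult f g)
  then show ?case by (simp add: ls.hom_mult galg.galg_mult)
qed

text \<open>By Weyl's theorem it suffices to bound the degrees for \<open>CARD('p) * CARD('q)\<close> matrices.\<close>

lemma rational_degree_bound:
  fixes f :: "('m::finite \<times> ('p::finite \<times> 'q::finite), rat) mp"
  assumes f: "f \<in> Inv (gmp ` SLG)"
  shows "f \<in> galg (gmp ` SLG) ((CARD('p) * CARD('q) * lcm CARD('p) CARD('q))\<^sup>2)"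
proof -
  let ?L = "lcm CARD('p) CARD('q)"
  let ?D = "(CARD('p) * CARD('q) * ?L)\<^sup>2"
  \<comment> \<open>\<open>CARD('p) * CARD('q)\<close> copies with as many coordinates each are the
    variables, and the parameters have degree \<open>?L\<^sup>2\<close>.\<close>
  have D: "CARD(('p \<times> 'q) \<times> ('p \<times> 'q)) * ?L\<^sup>2 = ?D" by (simp add: power2_eq_square mult_ac)
  have *: "g \<in> galg (gmp ` SLG) ?D" if "g \<in> Inv (gmp ` SLG)" "hmg N g"
    for N and g :: "(('p \<times> 'q) \<times> ('p \<times> 'q), rat) mp"
    unfolding D[symmetric]
  proof (rule degree_bound_from_null_cone[OF _ _ _ that])
    show "transp L \<in> gmp ` SLG" if "L \<in> gmp ` (SLG :: ('p \<times> 'q \<Rightarrow> _) set)" for L :: "('p \<times> 'q) \<times> ('p \<times> 'q) \<Rightarrow> _"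
      by (rule SLG_transp[OF that])
    show "0 < ?L\<^sup>2" by (simp add: lcm_pos_nat)
  qed (rule null_cone)
  have hom: "f \<in> galg (gmp ` SLG) ?D" if fi: "f \<in> Inv (gmp ` SLG)" "hmg N f"
    for N and f :: "('m \<times> ('p \<times> 'q), rat) mp"
  proof -
    have "{lsub (amp b) g | b g. (g :: (('p \<times> 'q) \<times> ('p \<times> 'q), rat) mp) \<in> Inv (gmp ` SLG) \<and> hmg N g}
      \<subseteq> galg (gmp ` SLG :: ('m \<times> ('p \<times> 'q) \<Rightarrow> _) set) ?D"
    proof (rule subsetI)
      fix h :: "('m \<times> ('p \<times> 'q), rat) mp"
      assume "h \<in> {lsub (amp b) g | b g. (g :: (('p \<times> 'q) \<times> ('p \<times> 'q), rat) mp) \<in> Inv (gmp ` SLG) \<and> hmg N g}"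
      then obtain b and g :: "(('p \<times> 'q) \<times> ('p \<times> 'q), rat) mp" where
        h: "h = lsub (amp b) g" "g \<in> Inv (gmp ` SLG)" "hmg N g" by auto
      show "h \<in> galg (gmp ` SLG) ?D" unfolding h(1) by (rule galg_lsub_amp[OF *[OF h(2,3)]])
    qed
    moreover have "mpv.subspace (galg (gmp ` SLG :: ('m \<times> ('p \<times> 'q) \<Rightarrow> _) set) ?D)"
      unfolding mpv.subspace_def msc_def using galg_cst[of 0] by (auto intro: galg_add galg_mult galg_cst)
    ultimately have "mpv.span {lsub (amp b) g | b g. (g :: (('p \<times> 'q) \<times> ('p \<times> 'q), rat) mp) \<in> Inv (gmp ` SLG) \<and> hmg N g}
      \<subseteq> galg (gmp ` SLG :: ('m \<times> ('p \<times> 'q) \<Rightarrow> _) set) ?D" by (rule mpv.span_minimal)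
    then show ?thesis by (rule subsetD) (rule weyl[OF fi])
  qed
  have "f = (\<Sum>N\<le>mxd f. hcomp N f)" by (rule hcomp_decomp[OF order_refl])
  moreover have "(\<Sum>N\<le>mxd f. hcomp N f) \<in> galg (gmp ` SLG) ?D"
    by (intro galg_sum hom[OF Inv_hcomp[OF f] hmg_hcomp])
  ultimately show ?thesis by (simp only:)
qed

section \<open>Translation to polynomial functions on tuples of matrices\<close>

definition coord :: "'k ^ 'q ^ 'p ^ 'm \<Rightarrow> 'm::finite \<times> ('p::finite \<times> 'q::finite) \<Rightarrow> 'k" where
  "coord X = (\<lambda>(l, (i, j)). X $ l $ i $ j)"

lemma monomial_fun_eq_mon: "monomial_fun e X = mon (coord X) e"
  unfolding monomial_fun_def mon_def coord_def by (rule prod.cong) (auto split: prod.splits)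

lemma poly_fun_iff:
  fixes f :: "'k::field ^ 'q::finite ^ 'p::finite ^ 'm::finite \<Rightarrow> 'k"
  shows "poly_fun f \<longleftrightarrow> (\<exists>F. f = (\<lambda>X. ev (coord X) F))"
proof
  assume "poly_fun f"
  then obtain E c where E: "finite E" "f = (\<lambda>X. \<Sum>e\<in>E. c e * monomial_fun e X)"
    unfolding poly_fun_def poly_fun_le_def by blast
  then have "f = (\<lambda>X. ev (coord X) (\<Sum>e\<in>E. single e (c e)))"
    by (simp add: evid.hom_sum evh_single monomial_fun_eq_mon)
  then show "\<exists>F. f = (\<lambda>X. ev (coord X) F)" by blast
next
  assume "\<exists>F. f = (\<lambda>X. ev (coord X) F)"
  then obtain F where F: "f = (\<lambda>X. ev (coord X) F)" by blast
  have "poly_fun_le (\<Sum>e\<in>keys F. esz e) f"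
    unfolding poly_fun_le_def
  proof (intro exI conjI)
    show "finite (keys F)" by simp
    show "\<forall>e\<in>keys F. sum e UNIV \<le> (\<Sum>e\<in>keys F. esz e)"
      unfolding esz_def[symmetric] by (intro ballI member_le_sum) auto
    show "f = (\<lambda>X. \<Sum>e\<in>keys F. lookup F e * monomial_fun e X)" unfolding F evh_def monomial_fun_eq_mon ..
  qed
  then show "poly_fun f" unfolding poly_fun_def by blast
qed

lemma poly_fun_degree_hmg:
  fixes g :: "('m::finite \<times> ('p::finite \<times> 'q::finite), rat) mp"
  assumes "hmg k g"
  shows "poly_fun_degree (\<lambda>X :: 'k::field_char_0 ^ 'q ^ 'p ^ 'm. evq (coord X) g) \<le> k"
  unfolding poly_fun_degree_def
proof (rule Least_le, unfold poly_fun_le_def, intro exI conjI)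
  show "finite (keys g)" by simp
  show "\<forall>e\<in>keys g. sum e UNIV \<le> k" using assms by (auto simp: hmg_def esz_def)
  show "(\<lambda>X :: 'k ^ 'q ^ 'p ^ 'm. evq (coord X) g) = (\<lambda>X. \<Sum>e\<in>keys g. of_rat (lookup g e) * monomial_fun e X)"
    unfolding evh_def monomial_fun_eq_mon ..
qed

lemma fdet_eq_det: "fdet (\<lambda>i j. A $ i $ j) = Determinants.det A"
  unfolding fdet_def det_eq_ndet ..

lemma matrix_inv_both:
  fixes B :: "'k::field ^ 'n ^ 'n"
  assumes "Determinants.det B = 1"
  shows "B ** matrix_inv B = Finite_Cartesian_Product.mat 1" "matrix_inv B ** B = Finite_Cartesian_Product.mat 1"
proof -
  have "invertible B" using assms by (simp add: invertible_det_nz)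
  then have "\<exists>C. B ** C = Finite_Cartesian_Product.mat 1 \<and> C ** B = Finite_Cartesian_Product.mat 1" unfolding invertible_def .
  from someI_ex[OF this] show "B ** matrix_inv B = Finite_Cartesian_Product.mat 1" "matrix_inv B ** B = Finite_Cartesian_Product.mat 1"
    unfolding matrix_inv_def by auto
qed

lemma det_matrix_inv:
  fixes B :: "'k::field ^ 'n ^ 'n"
  assumes "Determinants.det B = 1"
  shows "Determinants.det (matrix_inv B) = 1"
  using arg_cong[OF matrix_inv_both(1)[OF assms], of Determinants.det] assms by (simp add: Determinants.det_mul)

lemma matrix_inv_inv:
  fixes B :: "'k::field ^ 'n ^ 'n"
  assumes "Determinants.det B = 1"
  shows "matrix_inv (matrix_inv B) = B"
proof -
  let ?C = "matrix_inv B"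
  have "B = B ** (?C ** matrix_inv ?C)" by (simp add: matrix_inv_both(1)[OF det_matrix_inv[OF assms]])
  also have "\<dots> = matrix_inv ?C" by (simp add: matrix_mul_assoc matrix_inv_both(1)[OF assms])
  finally show ?thesis ..
qed

lemma coord_action:
  fixes X :: "'k::field ^ 'q::finite ^ 'p::finite ^ 'm::finite"
  shows "coord (left_right_action A B X) = act (\<lambda>i j. A $ i $ j) (\<lambda>i j. matrix_inv B $ i $ j) (coord X)"
proof
  fix v :: "'m \<times> ('p \<times> 'q)"
  obtain l r c where v: "v = (l, (r, c))" by (cases v) auto
  have "(\<Sum>c'\<in>UNIV. (\<Sum>r'\<in>UNIV. A $ r $ r' * X $ l $ r' $ c') * matrix_inv B $ c' $ c)
    = (\<Sum>r'\<in>UNIV. \<Sum>c'\<in>UNIV. A $ r $ r' * X $ l $ r' $ c' * matrix_inv B $ c' $ c)"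
    unfolding sum_distrib_right by (rule sum.swap)
  then show "coord (left_right_action A B X) v = act (\<lambda>i j. A $ i $ j) (\<lambda>i j. matrix_inv B $ i $ j) (coord X) v"
    unfolding v by (simp add: coord_def left_right_action_def act_def matrix_matrix_mult_def)
qed

text \<open>Rational group elements do not exhaust the group over \<open>'k\<close>;
  \<open>semi_invariance\<close> holds for all matrices over \<open>'k\<close>, and its determinant
  factors are 1 here.\<close>

lemma Inv_invariant_ring:
  fixes g :: "('m::finite \<times> ('p::finite \<times> 'q::finite), rat) mp"
  assumes g: "g \<in> Inv (gmp ` SLG)" "hmg k g"
  shows "(\<lambda>X :: 'k::field_char_0 ^ 'q ^ 'p ^ 'm. evq (coord X) g) \<in> invariant_ring"
  unfolding invariant_ring_def
proof (intro CollectI conjI ballI allI)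
  show "poly_fun (\<lambda>X :: 'k ^ 'q ^ 'p ^ 'm. evq (coord X) g)"
    unfolding poly_fun_iff ev_cx[symmetric] by blast
  fix A :: "'k ^ 'p ^ 'p" and B :: "'k ^ 'q ^ 'q" and X :: "'k ^ 'q ^ 'p ^ 'm"
  assume AB: "A \<in> special_linear" "B \<in> special_linear"
  then have "fdet (\<lambda>i j. A $ i $ j) = 1" "fdet (\<lambda>i j. matrix_inv B $ i $ j) = 1"
    unfolding fdet_eq_det special_linear_def using det_matrix_inv[of B] by simp_all
  moreover obtain w w' where "\<forall>A B (X :: 'm \<times> ('p \<times> 'q) \<Rightarrow> 'k). evq (act A B X) g = fdet A ^ w * fdet B ^ w' * evq X g"
    using semi_invariance[OF g] by (elim exE conjE)
  ultimately show "evq (coord (left_right_action A B X)) g = evq (coord X) g"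
    unfolding coord_action by simp
qed

lemma fun_subalgebra_invariant_ring:
  "fun_subalgebra (invariant_ring :: ('k::field ^ 'q::finite ^ 'p::finite ^ 'm::finite \<Rightarrow> 'k) set)"
proof -
  let ?R = "invariant_ring :: ('k ^ 'q ^ 'p ^ 'm \<Rightarrow> 'k) set"
  have c: "(\<lambda>X. c) \<in> ?R" for c
  proof -
    have "(\<lambda>X :: 'k ^ 'q ^ 'p ^ 'm. c) = (\<lambda>X. ev (coord X) (cst c))" by simp
    then show ?thesis unfolding invariant_ring_def poly_fun_iff by blast
  qed
  have "(\<lambda>X. f X + g X) \<in> ?R \<and> (\<lambda>X. f X * g X) \<in> ?R" if fg: "f \<in> ?R" "g \<in> ?R" for f g
  proof -
    obtain F where F: "f = (\<lambda>X. ev (coord X) F)" using fg(1) unfolding invariant_ring_def poly_fun_iff by blast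
    obtain G where G: "g = (\<lambda>X. ev (coord X) G)" using fg(2) unfolding invariant_ring_def poly_fun_iff by blast
    have "(\<lambda>X. f X + g X) = (\<lambda>X. ev (coord X) (F + G))" "(\<lambda>X. f X * g X) = (\<lambda>X. ev (coord X) (F * G))"
      unfolding F G evid.hom_add evid.hom_mult by (rule refl)+
    then have "poly_fun (\<lambda>X. f X + g X)" "poly_fun (\<lambda>X. f X * g X)" unfolding poly_fun_iff by blast+
    then show ?thesis using fg unfolding invariant_ring_def by simp
  qed
  with c show ?thesis unfolding fun_subalgebra_def by blast
qed

text \<open>
  Expanding the coefficients of an invariant in a basis of the field over the rationals reduces
  the statement to rational coefficients.
\<close>

lemma rational_components:
  fixes F :: "('m::finite \<times> ('p::finite \<times> 'q::finite), 'k::field_char_0) mp"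
  assumes inv: "(\<lambda>X. ev (coord X) F) \<in> invariant_ring"
  shows "\<exists>B G. finite (B :: 'k set) \<and> (\<forall>b\<in>B. G b \<in> Inv (gmp ` SLG)) \<and> (\<forall>Z. ev Z F = (\<Sum>b\<in>B. b * evq Z (G b)))"
proof -
  define C where "C = lookup F ` keys F"
  have "finite C" by (simp add: C_def)
  \<comment> \<open>A rational basis of the span of the coefficients, chosen among them and
    therefore finite.\<close>
  obtain B where B: "B \<subseteq> C" "scv.independent B" "C \<subseteq> scv.span B"
    using scv.maximal_independent_subset[of C] by blast
  have fB: "finite B" using B(1) \<open>finite C\<close> by (rule finite_subset)
  define G where "G b = (\<Sum>e\<in>keys F. single e (scv.representation B (lookup F e) b))" for b
  have expand: "ev Z F = (\<Sum>b\<in>B. b * evq Z (G b))" for Z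
  proof -
    have "ev Z F = (\<Sum>e\<in>keys F. (\<Sum>b\<in>B. of_rat (scv.representation B (lookup F e) b) * b) * mon Z e)"
      unfolding evh_def
    proof (rule sum.cong[OF refl])
      fix e assume "e \<in> keys F"
      then have "lookup F e \<in> scv.span B" using B(3) by (auto simp: C_def)
      from scv.sum_representation_eq[OF B(2) this fB order_refl]
      show "lookup F e * mon Z e = (\<Sum>b\<in>B. of_rat (scv.representation B (lookup F e) b) * b) * mon Z e"
        by (simp only: scm_def)
    qed
    also have "\<dots> = (\<Sum>e\<in>keys F. \<Sum>b\<in>B. b * (of_rat (scv.representation B (lookup F e) b) * mon Z e))"
      unfolding sum_distrib_right by (intro sum.cong refl) (simp only: mult_ac)
    also have "\<dots> = (\<Sum>b\<in>B. \<Sum>e\<in>keys F. b * (of_rat (scv.representation B (lookup F e) b) * mon Z e))"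
      by (rule sum.swap)
    also have "\<dots> = (\<Sum>b\<in>B. b * evq Z (G b))"
      unfolding G_def evr.hom_sum sum_distrib_left by (simp add: evh_single)
    finally show ?thesis .
  qed
  have "lsub (gmp (gk a b')) (G b) = G b" if ab: "fdet a = 1" "fdet b' = 1" and b: "b \<in> B"
    for a :: "'p \<Rightarrow> 'p \<Rightarrow> rat" and b' :: "'q \<Rightarrow> 'q \<Rightarrow> rat" and b
  proof (rule mp_eqI)
    fix x :: "'m \<times> ('p \<times> 'q) \<Rightarrow> nat"
    let ?x = "\<lambda>v. of_nat (x v) :: rat" and ?Z = "\<lambda>v. of_nat (x v) :: 'k"
    define A :: "'k ^ 'p ^ 'p" where "A = (\<chi> i j. of_rat (a i j))"
    define B' :: "'k ^ 'q ^ 'q" where "B' = (\<chi> i j. of_rat (b' i j))"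
    define X :: "'k ^ 'q ^ 'p ^ 'm" where "X = (\<chi> l i j. ?Z (l, (i, j)))"
    have X: "coord X = ?Z" by (auto simp: coord_def X_def fun_eq_iff)
    have entries: "(\<lambda>i j. A $ i $ j) = (\<lambda>i j. of_rat (a i j))" "(\<lambda>i j. B' $ i $ j) = (\<lambda>i j. of_rat (b' i j))"
      by (simp_all add: A_def B'_def fun_eq_iff)
    have "Determinants.det A = of_rat (fdet a)" "Determinants.det B' = of_rat (fdet b')"
      unfolding fdet_eq_det[symmetric] fdet_hom[OF of_rat_hom'] entries by (rule refl)+
    then have det: "Determinants.det A = 1" "Determinants.det B' = 1" by (simp_all add: ab)
    \<comment> \<open>\<open>left_right_action\<close> inverts its second matrix, so the inverse of
      \<open>B'\<close> is inserted to make \<open>B'\<close> itself act.\<close>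
    have "A \<in> special_linear" "matrix_inv B' \<in> special_linear"
      using det det_matrix_inv[OF det(2)] by (simp_all add: special_linear_def)
    then have "ev (coord (left_right_action A (matrix_inv B') X)) F = ev (coord X) F"
      using inv unfolding invariant_ring_def by blast
    then have "ev (act (\<lambda>i j. of_rat (a i j)) (\<lambda>i j. of_rat (b' i j)) ?Z) F = ev ?Z F"
      unfolding coord_action matrix_inv_inv[OF det(2)] X entries .
    then have "(\<Sum>b\<in>B. b * evq ?Z (lsub (gmp (gk a b')) (G b))) = (\<Sum>b\<in>B. b * evq ?Z (G b))"
      unfolding expand evq_gk .
    moreover have "evq ?Z p = of_rat (ev ?x p)" for p
      using evq_of_rat[of ?x p] by simp
    \<comment> \<open>At a natural point all components take rational values, so linear independence
      of \<open>B\<close> over the rationals separates them.\<close>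
    ultimately have "(\<Sum>b\<in>B. scm (ev ?x (lsub (gmp (gk a b')) (G b)) - ev ?x (G b)) b) = 0"
      by (simp add: scm_def of_rat_diff algebra_simps sum_subtractf)
    from scv.independentD[OF B(2) fB order_refl this b]
    show "ev ?x (lsub (gmp (gk a b')) (G b)) = ev ?x (G b)" by simp
  qed
  then have "\<forall>b\<in>B. G b \<in> Inv (gmp ` SLG)" unfolding Inv_def SLG_def by auto
  then show ?thesis using fB expand by blast
qed

theorem theorem1p11:
  "(invariant_ring :: ('k::field_char_0 ^ 'q::finite ^ 'p::finite ^ 'm::finite \<Rightarrow> 'k) set) =
    generated_algebra {f \<in> invariant_ring.
      poly_fun_degree f \<le> (CARD('p) * CARD('q) * lcm CARD('p) CARD('q))\<^sup>2}"
proof -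
  let ?R = "invariant_ring :: ('k ^ 'q ^ 'p ^ 'm \<Rightarrow> 'k) set"
  let ?D = "(CARD('p) * CARD('q) * lcm CARD('p) CARD('q))\<^sup>2"
  let ?S = "{f \<in> ?R. poly_fun_degree f \<le> ?D}"
  have "fun_subalgebra (\<Inter>{t. fun_subalgebra t \<and> ?S \<subseteq> t})"
    unfolding fun_subalgebra_def by blast
  then have alg: "fun_subalgebra (generated_algebra ?S)" unfolding generated_algebra_def hull_def .
  then have c: "(\<lambda>x. c) \<in> generated_algebra ?S"
    and add: "f \<in> generated_algebra ?S \<Longrightarrow> g \<in> generated_algebra ?S \<Longrightarrow> (\<lambda>x. f x + g x) \<in> generated_algebra ?S"
    and mult: "f \<in> generated_algebra ?S \<Longrightarrow> g \<in> generated_algebra ?S \<Longrightarrow> (\<lambda>x. f x * g x) \<in> generated_algebra ?S"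
    for c f g unfolding fun_subalgebra_def by blast+
  have base: "?S \<subseteq> generated_algebra ?S" unfolding generated_algebra_def by (rule hull_subset)
  have rat: "(\<lambda>X :: 'k ^ 'q ^ 'p ^ 'm. evq (coord X) g) \<in> generated_algebra ?S" if "g \<in> galg (gmp ` SLG) ?D" for g
    using that
  proof induction
    case (galg_cst a)
    show ?case using c[of "of_rat a"] by simp
  next
    case (galg_base f k)
    have "poly_fun_degree (\<lambda>X :: 'k ^ 'q ^ 'p ^ 'm. evq (coord X) f) \<le> ?D"
      using poly_fun_degree_hmg[OF galg_base(2), where 'k='k] galg_base(3) by linarith
    then have "(\<lambda>X :: 'k ^ 'q ^ 'p ^ 'm. evq (coord X) f) \<in> ?S"
      using Inv_invariant_ring[OF galg_base(1,2), where 'k='k] by simp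
    then show ?case by (rule subsetD[OF base])
  next
    case (galg_add f g)
    show ?case unfolding evr.hom_add by (rule add[OF galg_add(3,4)])
  next
    case (galg_mult f g)
    show ?case unfolding evr.hom_mult by (rule mult[OF galg_mult(3,4)])
  qed
  have "?R \<subseteq> generated_algebra ?S"
  proof (rule subsetI)
    fix f assume f: "f \<in> ?R"
    obtain F where F: "f = (\<lambda>X. ev (coord X) F)" using f unfolding invariant_ring_def poly_fun_iff by blast
    obtain B G where B: "finite B" "\<forall>b\<in>B. G b \<in> Inv (gmp ` SLG)" "\<forall>Z. ev Z F = (\<Sum>b\<in>B. b * evq Z (G b))"
      using rational_components[OF f[unfolded F]] by (elim exE conjE)
    have "(\<lambda>X. \<Sum>b\<in>B'. b * evq (coord X) (G b)) \<in> generated_algebra ?S" if "B' \<subseteq> B" for B'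
      using finite_subset[OF that B(1)] that
    proof (induction B' rule: finite_induct)
      case empty
      show ?case using c[of 0] by simp
    next
      case (insert b B')
      have "(\<lambda>X :: 'k ^ 'q ^ 'p ^ 'm. evq (coord X) (G b)) \<in> generated_algebra ?S"
        by (rule rat[OF rational_degree_bound]) (use B(2) insert.prems in simp)
      from add[OF mult[OF c[of b] this] insert.IH] show ?case using insert.hyps insert.prems by simp
    qed
    then show "f \<in> generated_algebra ?S" unfolding F using B(3) by simp
  qed
  moreover have "generated_algebra ?S \<subseteq> ?R"
    unfolding generated_algebra_def by (rule hull_minimal) (auto intro: fun_subalgebra_invariant_ring)
  ultimately show ?thesis by (rule subset_antisym)
qed

end
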